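(* Let $S_0\in\Gamma_0$ be time-independent, put $\Xi_0=\Xi[S_0^{-1}]$, and let $(U(t),\widehat\Phi(t))$ be one of the three pairs $(U_M,\widehat\Phi_M)$, $(U_J,\widehat\Phi_J)$, $(U_{MR},\widehat\Phi_{MR})$ (maximal, Jacobian, Manin–Radul SKP hierarchy). Let $S(t)\in\widehat\Gamma_0$ be the solution of the Grassmann equation $(S(t)U(t)S_0^{-1})_-=0$, and let $$w(x,\xi,t;\zeta)=S(t)U(t)e^{xz+\xi\theta},\qquad \widetilde w(x,\xi,t;\zeta)=S^\star(t)U^\star(t)e^{-(xz+\xi\theta)}$$ be its super-wave function and dual super-wave function. Then, with $$\tau(x,\xi,t)=\langle(1,0)|\,e^{x j^t_1+\xi\sigma}\,\widehat\Phi(t)\,|\Xi_{0<}\rangle ,$$ one has the field-theoretic expressions in terms of the B-C system $$w(x,\xi,t;\zeta)=\frac1{\tau(x,\xi,t)}\,\langle(0,0)|\,e^{x j^t_1+\xi\sigma}\,\widehat\Phi(t)\,C(\zeta)\,|\Xi_{0<}\rangle,$$ $$\widetilde w(x,\xi,t;\zeta)=\frac1{\tau(x,\xi,t)}\,\langle(1,0)|\,\gamma_{\frac12}\,e^{x j^t_1+\xi\sigma}\,\widehat\Phi(t)\,B(\zeta)\,|\Xi_{0<}\rangle .$$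
   Context: Operators. $\mathcal A$ is a supercommutative $\mathbf C$-superalgebra, $R=\mathcal A\otimes\mathbf C[[x,\xi]]$ ($x$ even, $\xi$ odd, $\xi^2=0$), $D=\partial_\xi+\xi\partial_x$, $D^2=\partial_x$, $D^{-1}=\partial_x^{-1}D$. $\mathcal E$ is the algebra of super-pseudodifferential operators $\sum_{j<\infty}p_jD^j$, $p_j\in R$, with $D^mf=\sum_{r\ge0}{m\brack r}(-1)^{|f|(m-r)}f^{[r]}D^{m-r}$ ($f^{[r]}=D^r(f)$; ${m\brack r}=0$ if $r(m-r)$ is odd and $\binom{\lfloor m/2\rfloor}{\lfloor r/2\rfloor}$ otherwise). $\Gamma_0$: operators $1+\sum_{j\ge1}s_{-j}D^{-j}$ with $s_{-j}$ of parity $j$ mod 2. Time variables $t^\pm_n$ (resp. $t_n$), $n\ge1$, are even for even index, odd for odd index, with weight $n$. $\widehat{\mathcal E}$: formal sums $\sum_{n\in\mathbf Z}p_nD^n$, $p_n\in R[[t]]$, such that for some $C$ all monomials in the $t$'s occurring in $p_n$ have weight $\ge n-C$ for all $n$. $(\cdot)_-$ is the part with negative powers of $D$. $\widehat\Gamma_0$: as $\Gamma_0$ but with $s_{-j}\in R[[t]]$. Adjoint: $D^*=-D$, $f^*=f$ for $f\in R[[t]]$, $(P_1P_2)^*=(-1)^{|P_1||P_2|}P_2^*P_1^*$; $P^\star=(P^{-1})^*$. Evolution operators. $U_M=e^{H_{(1)}}e^{H_{(0)}}$, $H_{(1)}=\sum_{n\ge0}(t^+_{2n+1}\partial_\xi\partial_x^n+t^-_{2n+1}\xi\partial_x^{n+1})$,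 $H_{(0)}=\sum_{n\ge1}(t^+_{2n}\partial_\xi\xi\partial_x^n+t^-_{2n}\xi\partial_\xi\partial_x^n)$; $U_J=\exp\sum_{n\ge0}(t_{2(n+1)}\partial_x^{n+1}+t_{2n+1}\partial_x^n\partial_\xi)$; $U_{MR}=\exp\sum_{n\ge1}t_nD^n$. Spectral variables. $z$ even, $\theta$ odd, $\zeta^{2m}=z^m$, $\zeta^{2m+1}=z^m\theta$. Operators act on $e^{\pm(xz+\xi\theta)}$ in the $x,\xi$ variables, with $\partial_x^{k}e^{\pm xz}=(\pm z)^ke^{\pm xz}$ for all $k\in\mathbf Z$; the result is a two-sided series in $\zeta^m$, $m\in\mathbf Z$, with coefficients in $\mathcal A[[x,\xi,t]]$. The matrix $\Xi[P]$, $P\in\mathcal E$: define $\psi[P]\in Mat(\mathbf Z\times\mathbf Z,R)$ by $D^jP=\sum_k\psi[P]_{jk}D^k$; then $\Xi[P]=\psi[P]|_{x=\xi=0}$. For $P\in\Gamma_0$, $\Xi[P]_{jk}=\delta_{jk}$ for $j\le k$. B-C system. Generators $B_j,C_j$ ($j\in\mathbf Z$), $C_{2j}=c_j$, $B_{2j}=b_j$ odd, $C_{2j+1}=\gamma_{j+\frac12}$, $B_{2j+1}=\beta_{j+\frac12}$ even, with $C_mB_n-(-1)^{(m+1)(n+1)}B_nC_m=\delta_{m+n,0}$ and all $C$–$C$ and $B$–$B$ supercommutators zero (i.e. $\{c_m,b_n\}=\delta_{m+n,0}$, $[\gamma_r,\beta_s]=\delta_{r+s,0}$, all other supercommutators vanish).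 Fields: $C(\zeta)=\sum_jC_j\zeta^{-j}=c(z)+\gamma(z)\theta$, $B(\zeta)=\sum_j\zeta^{-j-1}B_j=\beta(z)+\theta b(z)$. The Fock space is generated from the even vacuum $|(0,0)\rangle$ with $C_m|(0,0)\rangle=0$ for $m>0$, $B_m|(0,0)\rangle=0$ for $m\ge0$; grade it by giving $C_{-k}$ and $B_{-k}$ degree $k$ and complete it with respect to this degree (direct product of graded pieces), with coefficients extended to $\mathcal A[[x,\xi,t]]$ (elements of the coefficient ring supercommute with $B_j,C_j$ and commute with $|(0,0)\rangle$). Bra vectors are the right-linear functionals: $\langle(1,0)|v$ is the coefficient of $|(0,0)\rangle$ in $v$ and $\langle(0,0)|v$ the coefficient of $c_0|(0,0)\rangle$ in $v$ (in the basis of ordered monomials in creation operators, coefficients written on the right); thus $\langle(1,0)|=\langle(0,0)|c_0$, $\langle(1,0)|(0,0)\rangle=1$; $\langle(1,0)|$ is even and $\langle(0,0)|$ is odd. Currents (for $n>0$, resp. $n\ge0$ for $\psi^\pm$): $j^+_n=\sum_l c_lb_{n-l}$, $j^-_n=-\sum_r\gamma_r\beta_{n-r}$, $j^t_n=j^+_n+j^-_n$, $\psi^+_{n+\frac12}=\sum_lc_l\beta_{n+\frac12-l}$, $\psi^-_{n+\frac12}=\sum_l\gamma_{l+\frac12}b_{n-l}$, $\sigma=\psi^+_{\frac12}+\psi^-_{\frac12}$. Then $\widehat\Phi_M=\exp\big(\sum_{n\ge0}(t^+_{2n+1}\psi^+_{n+\frac12}-t^-_{2n+1}\psi^-_{n+\frac12})\big)\exp\big(\sum_{n\ge1}(t^+_{2n}j^+_n+t^-_{2n}j^-_n)\big)$,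 $\widehat\Phi_J=\exp\big(\sum_{n\ge0}t_{2n+1}\psi^+_{n+\frac12}+\sum_{n\ge1}t_{2n}j^t_n\big)$, $\widehat\Phi_{MR}=\exp\big(\sum_{n\ge0}t_{2n+1}(\psi^+_{n+\frac12}-\psi^-_{n+\frac12})+\sum_{n\ge1}t_{2n}j^t_n\big)$. The state $|\Xi_{0<}\rangle$ (formally the semi-infinite product $\prod_{j\ge1}\tilde c(\Xi_0)_j\prod_{s>0}\delta(\tilde\gamma(\Xi_0)_s)$): the unique vector in the completed Fock space over $\mathcal A$ which is a combination of monomials with equally many $C$'s and $B$'s applied to $|(0,0)\rangle$, is annihilated by $\sum_{k\in\mathbf Z}C_k(\Xi_0)_{-k,-j}$ for every $j>0$, and satisfies $\langle(1,0)|\Xi_{0<}\rangle=1$. *)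

theory Defs
  imports Complex_Main "HOL-Library.Multiset" "HOL-Library.Countable"
begin

section \<open>Supercommutative algebras\<close>

text \<open>The \<open>\<int>/2\<close>-grading is given by the projection onto the even part.\<close>

class supercomm_algebra = ring_1 +
  fixes cscale :: "complex \<Rightarrow> 'a \<Rightarrow> 'a"
    and even_part :: "'a \<Rightarrow> 'a"
  assumes cscale_add_right: "cscale c (a + b) = cscale c a + cscale c b"
    and cscale_add_left: "cscale (c + d) a = cscale c a + cscale d a"
    and cscale_cscale: "cscale c (cscale d a) = cscale (c * d) a"
    and cscale_one: "cscale 1 a = a"
    and mult_cscale_left: "cscale c a * b = cscale c (a * b)"
    and mult_cscale_right: "a * cscale c b = cscale c (a * b)"
    and even_part_add: "even_part (a + b) = even_part a + even_part b"
    and even_part_cscale: "even_part (cscale c a) = cscale c (even_part a)"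
    and even_part_idem: "even_part (even_part a) = even_part a"
    and even_part_mult: "even_part (a * b) =
      even_part a * even_part b + (a - even_part a) * (b - even_part b)"
    and even_commute: "even_part a * b = b * even_part a"
    and odd_anticommute:
      "(a - even_part a) * (b - even_part b) = - ((b - even_part b) * (a - even_part a))"
begin

definition odd_part :: "'a \<Rightarrow> 'a"
  where "odd_part a = a - even_part a"

definition is_even :: "'a \<Rightarrow> bool"
  where "is_even a \<longleftrightarrow> even_part a = a"

definition is_odd :: "'a \<Rightarrow> bool"
  where "is_odd a \<longleftrightarrow> odd_part a = a"

text \<open>\<open>sign_twist n a\<close> is \<open>(-1)\<^bsup>n |a|\<^esup> a\<close>, extended additively to inhomogeneous \<open>a\<close>.\<close>

definition sign_twist :: "int \<Rightarrow> 'a \<Rightarrow> 'a"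
  where "sign_twist n a = (if even n then a else even_part a - odd_part a)"

lemma even_part_0 [simp]: "even_part 0 = 0"
  using even_part_add[of 0 0] by simp

lemma even_part_minus: "even_part (- a) = - even_part a"
  using even_part_add[of a "- a"] by (simp add: eq_neg_iff_add_eq_0 add.commute)

lemma even_part_diff: "even_part (a - b) = even_part a - even_part b"
  using even_part_add[of a "- b"] by (simp add: even_part_minus)

lemma even_part_sum: "even_part (sum f I) = (\<Sum>i\<in>I. even_part (f i))"
  by (induction I rule: infinite_finite_induct) (auto simp: even_part_add)

lemma even_part_odd_part [simp]: "even_part (odd_part a) = 0"
  by (simp add: odd_part_def even_part_diff even_part_idem)

lemma odd_part_even_part [simp]: "odd_part (even_part a) = 0"
  by (simp add: odd_part_def even_part_idem)

lemma odd_part_odd_part [simp]: "odd_part (odd_part a) = odd_part a"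
  by (simp add: odd_part_def even_part_diff even_part_idem)

lemma parts_sum: "even_part a + odd_part a = a"
  unfolding odd_part_def by (metis add.commute diff_add_cancel)

lemma odd_part_add: "odd_part (a + b) = odd_part a + odd_part b"
  by (simp add: odd_part_def even_part_add algebra_simps)

lemma odd_part_minus: "odd_part (- a) = - odd_part a"
  by (simp add: odd_part_def even_part_minus)

lemma odd_part_diff: "odd_part (a - b) = odd_part a - odd_part b"
  by (simp add: odd_part_def even_part_diff algebra_simps)

lemma odd_part_0 [simp]: "odd_part 0 = 0"
  by (simp add: odd_part_def)

lemma even_part_mult': "even_part (a * b) = even_part a * even_part b + odd_part a * odd_part b"
  by (simp add: odd_part_def even_part_mult)

lemma odd_part_mult': "odd_part (a * b) = even_part a * odd_part b + odd_part a * even_part b"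
  unfolding odd_part_def even_part_mult by (simp add: algebra_simps)

lemma even_commute': "b * even_part a = even_part a * b"
  by (rule even_commute[symmetric])

lemma odd_anticommute': "odd_part a * odd_part b = - (odd_part b * odd_part a)"
  unfolding odd_part_def by (rule odd_anticommute)

lemma even_part_1 [simp]: "even_part 1 = 1"
proof -
  have e: "even_part a = even_part a * even_part 1" for a
    using even_part_mult'[of "even_part a" 1] by (simp add: even_part_idem)
  have o: "odd_part a = odd_part a * even_part 1" for a
    using odd_part_mult'[of "odd_part a" 1] by simp
  have "a = a * even_part 1" for a
    by (metis e o parts_sum distrib_right)
  from this[of 1] show ?thesis by simp
qed

lemma odd_part_1 [simp]: "odd_part 1 = 0"
  by (simp add: odd_part_def)

lemma cscale_0 [simp]: "cscale c 0 = 0"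
  using cscale_add_right[of c 0 0] by simp

lemma sign_twist_0 [simp]: "sign_twist n 0 = 0"
  by (simp add: sign_twist_def)

lemma sign_twist_even: "even n \<Longrightarrow> sign_twist n a = a"
  by (simp add: sign_twist_def)

lemma sign_twist_add: "sign_twist n (a + b) = sign_twist n a + sign_twist n b"
  by (simp add: sign_twist_def even_part_add odd_part_add algebra_simps)

lemma sign_twist_minus: "sign_twist n (- a) = - sign_twist n a"
  by (simp add: sign_twist_def even_part_minus odd_part_minus algebra_simps)

lemma sign_twist_sum: "sign_twist n (sum f I) = (\<Sum>i\<in>I. sign_twist n (f i))"
  by (induction I rule: infinite_finite_induct) (auto simp: sign_twist_add)

lemma sign_twist_mult: "sign_twist n (a * b) = sign_twist n a * sign_twist n b"
  by (auto simp: sign_twist_def even_part_mult' odd_part_mult' algebra_simps)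

lemma sign_twist_twist: "sign_twist n (sign_twist k a) = sign_twist (n + k) a"
  by (auto simp: sign_twist_def even_part_diff odd_part_diff even_part_idem parts_sum)

lemma cscale_sum: "cscale c (sum f I) = (\<Sum>i\<in>I. cscale c (f i))"
  by (induction I rule: infinite_finite_induct) (auto simp: cscale_add_right)

lemma cscale_minus: "cscale c (- a) = - cscale c a"
  using cscale_add_right[of c a "- a"] by (simp add: eq_neg_iff_add_eq_0 add.commute)

lemma odd_part_cscale: "odd_part (cscale c a) = cscale c (odd_part a)"
proof -
  have "cscale c a = cscale c (even_part a) + cscale c (odd_part a)"
    by (simp add: cscale_add_right[symmetric] parts_sum)
  then show ?thesis unfolding odd_part_def[of "cscale c a"] even_part_cscale
    by (simp add: algebra_simps)
qed

lemma odd_part_sum: "odd_part (sum f I) = (\<Sum>i\<in>I. odd_part (f i))"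
  by (induction I rule: infinite_finite_induct) (auto simp: odd_part_add)

lemma cscale_diff: "cscale c (a - b) = cscale c a - cscale c b"
  using cscale_add_right[of c a "- b"] by (simp add: cscale_minus)

lemma sign_twist_cscale: "sign_twist n (cscale c a) = cscale c (sign_twist n a)"
  by (auto simp: sign_twist_def even_part_cscale odd_part_cscale cscale_diff)

lemma sign_twist_parts: "sign_twist n (even_part a) = even_part a"
  "sign_twist n (odd_part a) = (if even n then odd_part a else - odd_part a)"
  by (auto simp: sign_twist_def even_part_idem)

lemma sign_twist_1 [simp]: "sign_twist n 1 = 1"
  by (simp add: sign_twist_def)

end

section \<open>Formal power series in even and odd variables\<close>

text \<open>All variables that occur: \<open>x\<close>, \<open>\<xi>\<close>, the odd spectral variable \<open>\<theta>\<close>, the times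
  \<open>t\<^sup>+\<^sub>n\<close>, \<open>t\<^sup>-\<^sub>n\<close> of the maximal and \<open>t\<^sub>n\<close> of the other two hierarchies (only \<open>n \<ge> 1\<close> is used), and
  the creation operators \<open>C\<^sub>-\<^sub>k\<close> (\<open>k \<ge> 0\<close>) and \<open>B\<^sub>-\<^sub>k\<close> (only \<open>k \<ge> 1\<close> is used).
  The creation operators mutually supercommute, and they supercommute with the coefficient ring. So
  the completed Fock space with coefficients \<open>\<A>[[x,\<xi>,t]]\<close>, being the set of all formal sums of
  ordered monomials in creation operators, is identified with power series over \<open>\<A>\<close>
  in the variables \<open>x, \<xi>, t\<close> and in the creation operators.\<close>

datatype svar = Vx | Vxi | Vtheta | Vtp nat | Vtm nat | Vt nat | Vc nat | Vb nat

instance svar :: countable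
  by countable_datatype

fun odd_var :: "svar \<Rightarrow> bool" where
  "odd_var Vx = False"
| "odd_var Vxi = True"
| "odd_var Vtheta = True"
| "odd_var (Vtp n) = odd n"
| "odd_var (Vtm n) = odd n"
| "odd_var (Vt n) = odd n"
| "odd_var (Vc k) = even k"
| "odd_var (Vb k) = even k"

text \<open>A monomial is the multiset of its factors, to be multiplied in the order given by
  \<^const>\<open>to_nat\<close> (any other linear order would do); odd variables have square zero.\<close>

definition valid_mono :: "svar multiset \<Rightarrow> bool"
  where "valid_mono m \<longleftrightarrow> (\<forall>v. odd_var v \<longrightarrow> count m v \<le> 1)"

definition mono_deg :: "svar multiset \<Rightarrow> int"
  where "mono_deg m = int (size (filter_mset odd_var m))"

text \<open>Number of transpositions of odd variables that sort the concatenation of \<open>p\<close> and \<open>q\<close>.\<close>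

definition inversions :: "svar multiset \<Rightarrow> svar multiset \<Rightarrow> nat"
  where "inversions p q =
    (\<Sum>u\<in>#p. \<Sum>v\<in>#q. if odd_var u \<and> odd_var v \<and> to_nat v < to_nat u then 1 else 0)"

definition mono_sign :: "svar multiset \<Rightarrow> svar multiset \<Rightarrow> 'a::ring_1"
  where "mono_sign p q = (-1) ^ inversions p q"

definition mono_splits :: "svar multiset \<Rightarrow> (svar multiset \<times> svar multiset) set"
  where "mono_splits m = {(p, q). p + q = m}"

text \<open>The series \<open>f\<close> stands for \<open>\<Sum>\<^sub>m coeff f m \<cdot> m\<close>, with coefficients on the left.\<close>

typedef (overloaded) 'a sser = "{f :: svar multiset \<Rightarrow> 'a::zero. \<forall>m. \<not> valid_mono m \<longrightarrow> f m = 0}"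
  morphisms coeff Abs_sser
  by (rule exI[of _ "\<lambda>_. 0"]) simp

setup_lifting type_definition_sser

lemma sser_eqI: "(\<And>m. coeff f m = coeff g m) \<Longrightarrow> f = g"
  by (metis coeff_inverse ext)

lemma coeff_invalid: "\<not> valid_mono m \<Longrightarrow> coeff f m = 0"
  using coeff[of f] by simp

lemma finite_mono_splits [simp]: "finite (mono_splits m)"
proof -
  have "finite {p. p \<subseteq># m}"
  proof (induction m)
    case (add x m)
    have "{p. p \<subseteq># add_mset x m} \<subseteq> {p. p \<subseteq># m} \<union> add_mset x ` {p. p \<subseteq># m}"
    proof
      fix p assume p: "p \<in> {p. p \<subseteq># add_mset x m}"
      show "p \<in> {p. p \<subseteq># m} \<union> add_mset x ` {p. p \<subseteq># m}"
      proof (cases "x \<in># p")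
        case True
        then obtain p' where "p = add_mset x p'" by (meson multi_member_split)
        with p show ?thesis by auto
      next
        case False
        then have "p \<subseteq># m" using p
          by (metis diff_single_trivial insert_DiffM2 mem_Collect_eq subset_eq_diff_conv add_mset_add_single)
        then show ?thesis by simp
      qed
    qed
    then show ?case using add by (meson finite_UnI finite_imageI finite_subset)
  qed auto
  moreover have "mono_splits m \<subseteq> (\<lambda>p. (p, m - p)) ` {p. p \<subseteq># m}"
    by (auto simp: mono_splits_def)
  ultimately show ?thesis by (meson finite_imageI finite_subset)
qed

lemma valid_mono_empty [simp]: "valid_mono {#}"
  by (simp add: valid_mono_def)

lemma valid_mono_add: "valid_mono (p + q) \<Longrightarrow> valid_mono p \<and> valid_mono q"
  by (auto simp: valid_mono_def)

lemma valid_splits: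
  assumes "(p, q) \<in> mono_splits m" "valid_mono m"
  shows "valid_mono p" "valid_mono q"
  using assms valid_mono_add[of p q] by (auto simp: mono_splits_def)

lemma mono_deg_add: "mono_deg (p + q) = mono_deg p + mono_deg q"
  by (simp add: mono_deg_def)

lemma mono_deg_empty [simp]: "mono_deg {#} = 0"
  by (simp add: mono_deg_def)

lemma inversions_empty [simp]: "inversions {#} q = 0" "inversions p {#} = 0"
  by (simp_all add: inversions_def)

lemma inversions_add:
  "inversions (p + p') q = inversions p q + inversions p' q"
  "inversions p (q + q') = inversions p q + inversions p q'"
  by (simp_all add: inversions_def sum_mset.distrib)

lemma mono_sign_empty [simp]: "mono_sign {#} q = 1" "mono_sign p {#} = 1"
  by (simp_all add: mono_sign_def)

lemma mono_sign_add:
  "mono_sign (p + p') q = mono_sign p q * mono_sign p' q"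
  "mono_sign p (q + q') = mono_sign p q * mono_sign p q'"
  by (simp_all add: mono_sign_def inversions_add power_add)

lemma sign_twist_mono_sign: "sign_twist n (mono_sign p q * a) = mono_sign p q * sign_twist n a"
  unfolding mono_sign_def by (cases "even (inversions p q)") (auto simp: sign_twist_minus)

lemma even_part_mono_sign: "even_part (mono_sign p q * a) = mono_sign p q * even_part a"
  unfolding mono_sign_def by (cases "even (inversions p q)") (auto simp: even_part_minus)

lemma odd_part_mono_sign: "odd_part (mono_sign p q * a) = mono_sign p q * odd_part a"
  unfolding mono_sign_def by (cases "even (inversions p q)") (auto simp: odd_part_minus)

lemma cscale_mono_sign: "mono_sign p q * cscale c a = cscale c (mono_sign p q * a)"
  by (simp add: mult_cscale_right)

lemma inversions_swap:
  assumes "\<And>v. odd_var v \<Longrightarrow> v \<in># p \<Longrightarrow> v \<notin># q"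
  shows "int (inversions p q + inversions q p) = mono_deg p * mono_deg q"
  using assms
proof (induction p)
  case (add u p)
  have single: "int (inversions {#u#} q + inversions q {#u#}) = mono_deg {#u#} * mono_deg q"
    if "odd_var u \<longrightarrow> u \<notin># q" for u q
    using that
  proof (induction q)
    case (add v q)
    have "to_nat u < to_nat v \<or> to_nat v < to_nat u" if "u \<noteq> v"
      using that by (metis inj_to_nat injD linorder_neqE_nat)
    with add show ?case
      by (auto simp: inversions_def mono_deg_def algebra_simps)
  qed simp
  have "int (inversions ({#u#} + p) q + inversions q ({#u#} + p)) =
      mono_deg ({#u#} + p) * mono_deg q"
    unfolding inversions_add mono_deg_add using single[of u q] add
    by (simp add: algebra_simps)
  then show ?case by simp
qed simp

lemma mono_sign_swap:
  assumes "valid_mono (p + q)"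
  shows "mono_sign q p =
    (if odd (mono_deg p) \<and> odd (mono_deg q) then - mono_sign p q else (mono_sign p q :: 'a::ring_1))"
proof -
  have "v \<notin># q" if "odd_var v" "v \<in># p" for v
  proof -
    have "count p v + count q v \<le> 1" using assms that by (auto simp: valid_mono_def)
    moreover have "count p v > 0" using that by (simp only: count_greater_zero_iff)
    ultimately have "count q v = 0" by linarith
    then show ?thesis by (simp only: not_in_iff)
  qed
  then have "int (inversions p q + inversions q p) = mono_deg p * mono_deg q"
    using inversions_swap by blast
  then have "even (inversions p q + inversions q p) \<longleftrightarrow> even (mono_deg p * mono_deg q)"
    by (metis even_of_nat)
  then show ?thesis
    unfolding mono_sign_def
    by (cases "even (inversions p q)"; cases "even (inversions q p)") auto
qed

lemma even_swap:
  fixes a b :: "'a::supercomm_algebra"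
  assumes "(p, q) \<in> mono_splits m" "valid_mono m"
  shows "mono_sign p q * ((if even (mono_deg p) then even_part a else odd_part a) *
      sign_twist (mono_deg p) b) =
    mono_sign q p * (b * sign_twist (mono_deg q)
      (if even (mono_deg p) then even_part a else odd_part a))"
proof -
  have sw: "mono_sign q p = (if odd (mono_deg p) \<and> odd (mono_deg q) then - mono_sign p q
      else (mono_sign p q :: 'a))"
    by (rule mono_sign_swap) (use assms in \<open>simp add: mono_splits_def\<close>)
  have "b * odd_part a = even_part b * odd_part a + odd_part b * odd_part a"
    by (metis parts_sum distrib_right)
  also have "\<dots> = odd_part a * even_part b - odd_part a * odd_part b"
    unfolding even_commute[of b] odd_anticommute'[of b] by simp
  also have "\<dots> = odd_part a * (even_part b - odd_part b)"
    by (simp only: right_diff_distrib)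
  finally have o: "odd_part a * sign_twist n b = b * odd_part a" if "odd n" for n
    using that by (simp add: sign_twist_def)
  show ?thesis
    by (cases "even (mono_deg p)"; cases "even (mono_deg q)")
      (simp_all add: sw o sign_twist_parts sign_twist_even even_commute[of a b])
qed

lemma odd_swap:
  fixes a b :: "'a::supercomm_algebra"
  assumes "(p, q) \<in> mono_splits m" "valid_mono m"
  shows "mono_sign p q * ((if even (mono_deg p + 1) then even_part a else odd_part a) *
      sign_twist (mono_deg p) (if even (mono_deg q + 1) then even_part b else odd_part b)) =
    - (mono_sign q p * ((if even (mono_deg q + 1) then even_part b else odd_part b) *
      sign_twist (mono_deg q) (if even (mono_deg p + 1) then even_part a else odd_part a)))"
proof -
  have sw: "mono_sign q p = (if odd (mono_deg p) \<and> odd (mono_deg q) then - mono_sign p q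
      else (mono_sign p q :: 'a))"
    by (rule mono_sign_swap) (use assms in \<open>simp add: mono_splits_def\<close>)
  show ?thesis
    by (cases "even (mono_deg p)"; cases "even (mono_deg q)")
      (simp_all add: sw sign_twist_parts even_commute[of b "odd_part a"]
        even_commute[of a "odd_part b"] even_commute[of a "even_part b"] odd_anticommute'[of a b])
qed

instantiation sser :: (supercomm_algebra) supercomm_algebra
begin

lift_definition zero_sser :: "'a sser" is "\<lambda>_. 0" by simp

lift_definition one_sser :: "'a sser" is "\<lambda>m. if m = {#} then 1 else 0"
  by auto

lift_definition plus_sser :: "'a sser \<Rightarrow> 'a sser \<Rightarrow> 'a sser" is "\<lambda>f g m. f m + g m" by simp

lift_definition minus_sser :: "'a sser \<Rightarrow> 'a sser \<Rightarrow> 'a sser" is "\<lambda>f g m. f m - g m" by simp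

lift_definition uminus_sser :: "'a sser \<Rightarrow> 'a sser" is "\<lambda>f m. - f m" by simp

text \<open>\<open>(a p) (b q) = (-1)\<^bsup>|p| |b|\<^esup> a b p q\<close>.\<close>

lift_definition times_sser :: "'a sser \<Rightarrow> 'a sser \<Rightarrow> 'a sser" is
  "\<lambda>f g m. if valid_mono m
     then \<Sum>(p, q)\<in>mono_splits m. mono_sign p q * (f p * sign_twist (mono_deg p) (g q)) else 0"
  by simp

lift_definition cscale_sser :: "complex \<Rightarrow> 'a sser \<Rightarrow> 'a sser" is "\<lambda>c f m. cscale c (f m)" by simp

lift_definition even_part_sser :: "'a sser \<Rightarrow> 'a sser" is
  "\<lambda>f m. if even (mono_deg m) then even_part (f m) else odd_part (f m)" by simp

lemmas coeff_simps = zero_sser.rep_eq one_sser.rep_eq plus_sser.rep_eq minus_sser.rep_eq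
  uminus_sser.rep_eq cscale_sser.rep_eq

lemma coeff_mult: "valid_mono m \<Longrightarrow> coeff (f * g) m =
    (\<Sum>(p, q)\<in>mono_splits m. mono_sign p q * (coeff f p * sign_twist (mono_deg p) (coeff g q)))"
  by (simp add: times_sser.rep_eq)

lemma sser_mult_assoc: "(f * g) * h = f * (g * (h :: 'a sser))"
proof (rule sser_eqI)
  fix m
  show "coeff ((f * g) * h) m = coeff (f * (g * h)) m"
  proof (cases "valid_mono m")
    case True
    define F where "F p q r = mono_sign p q * mono_sign p r * mono_sign q r *
      (coeff f p * sign_twist (mono_deg p) (coeff g q) *
        sign_twist (mono_deg p + mono_deg q) (coeff h r))" for p q r
    have "coeff ((f * g) * h) m = (\<Sum>(s, r)\<in>mono_splits m. \<Sum>(p, q)\<in>mono_splits s. F p q r)"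
      unfolding coeff_mult[OF True]
    proof (intro sum.cong refl, clarsimp)
      fix s r assume sr: "(s, r) \<in> mono_splits m"
      have v: "valid_mono s" by (rule valid_splits(1)[OF sr True])
      show "mono_sign s r * (coeff (f * g) s * sign_twist (mono_deg s) (coeff h r)) =
        (\<Sum>(p, q)\<in>mono_splits s. F p q r)"
        unfolding coeff_mult[OF v] sum_distrib_left sum_distrib_right
      proof (intro sum.cong refl, clarsimp)
        fix p q assume "(p, q) \<in> mono_splits s"
        then have s: "s = p + q" by (auto simp: mono_splits_def)
        show "mono_sign s r * (mono_sign p q * (coeff f p * sign_twist (mono_deg p) (coeff g q)) *
           sign_twist (mono_deg s) (coeff h r)) = F p q r"
          unfolding s F_def mono_sign_add mono_deg_add unfolding mono_sign_def
          by (cases "even (inversions p q)"; cases "even (inversions p r)";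
              cases "even (inversions q r)") (simp_all add: mult.assoc)
      qed
    qed
    also have "\<dots> = (\<Sum>((s, r), (p, q))\<in>(SIGMA x:mono_splits m. mono_splits (fst x)). F p q r)"
      by (simp add: sum.Sigma split_def)
    also have "\<dots> = (\<Sum>((p, s), (q, r))\<in>(SIGMA x:mono_splits m. mono_splits (snd x)). F p q r)"
      by (rule sum.reindex_bij_witness[where
            i = "\<lambda>((p, s), (q, r)). ((p + q, r), (p, q))" and
            j = "\<lambda>((s, r), (p, q)). ((p, q + r), (q, r))"])
        (auto simp: mono_splits_def add.assoc)
    also have "\<dots> = (\<Sum>(p, s)\<in>mono_splits m. \<Sum>(q, r)\<in>mono_splits s. F p q r)"
      by (simp add: sum.Sigma split_def)
    also have "\<dots> = coeff (f * (g * h)) m"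
      unfolding coeff_mult[OF True]
    proof (intro sum.cong refl, clarsimp)
      fix p s assume ps: "(p, s) \<in> mono_splits m"
      have v: "valid_mono s" by (rule valid_splits(2)[OF ps True])
      show "(\<Sum>(q, r)\<in>mono_splits s. F p q r) =
        mono_sign p s * (coeff f p * sign_twist (mono_deg p) (coeff (g * h) s))"
        unfolding coeff_mult[OF v] sign_twist_sum sum_distrib_left
      proof (intro sum.cong refl, clarsimp)
        fix q r assume "(q, r) \<in> mono_splits s"
        then have s: "s = q + r" by (auto simp: mono_splits_def)
        show "F p q r = mono_sign p s * (coeff f p * sign_twist (mono_deg p)
           (mono_sign q r * (coeff g q * sign_twist (mono_deg q) (coeff h r))))"
          unfolding s F_def mono_sign_add sign_twist_mono_sign
          unfolding sign_twist_mult sign_twist_twist mono_sign_def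
          by (cases "even (inversions p q)"; cases "even (inversions p r)";
              cases "even (inversions q r)") (simp_all add: mult.assoc)
      qed
    qed
    finally show ?thesis .
  qed (simp add: coeff_invalid)
qed

lemma sser_mult_one: "1 * f = f" "f * 1 = (f :: 'a sser)"
proof -
  have l: "coeff (1 * f) m = coeff f m" if v: "valid_mono m" for m
  proof -
    have "coeff (1 * f) m = (\<Sum>x\<in>mono_splits m. if x = ({#}, m) then coeff f m else 0)"
      unfolding coeff_mult[OF v]
      by (intro sum.cong refl)
        (auto simp: mono_splits_def one_sser.rep_eq sign_twist_even split: if_split_asm)
    moreover have "({#}, m) \<in> mono_splits m" by (simp add: mono_splits_def)
    ultimately show ?thesis by (simp add: sum.delta)
  qed
  have r: "coeff (f * 1) m = coeff f m" if v: "valid_mono m" for m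
  proof -
    have "coeff (f * 1) m = (\<Sum>x\<in>mono_splits m. if x = (m, {#}) then coeff f m else 0)"
      unfolding coeff_mult[OF v]
      by (intro sum.cong refl) (auto simp: mono_splits_def one_sser.rep_eq split: if_split_asm)
    moreover have "(m, {#}) \<in> mono_splits m" by (simp add: mono_splits_def)
    ultimately show ?thesis by (simp add: sum.delta)
  qed
  show "1 * f = f" "f * 1 = f"
    using l r by (metis coeff_invalid sser_eqI)+
qed

lemma sser_sum_reindex:
  "(\<Sum>(p, q)\<in>mono_splits m. G p q) = (\<Sum>(p, q)\<in>mono_splits m. (G q p :: 'b::comm_monoid_add))"
  by (rule sum.reindex_bij_witness[where i = "\<lambda>(p, q). (q, p)" and j = "\<lambda>(p, q). (q, p)"])
    (auto simp: mono_splits_def add.commute)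

instance
proof
  fix a b c :: "'a sser" and k l :: complex
  show "a * b * c = a * (b * c)" by (rule sser_mult_assoc)
  show "1 * a = a" "a * 1 = a" by (rule sser_mult_one)+
  show "a + b + c = a + (b + c)" "a + b = b + a" "0 + a = a" "- a + a = 0" "a - b = a + - b"
    by (auto intro!: sser_eqI simp: coeff_simps algebra_simps)
  show "(a + b) * c = a * c + b * c"
    by (auto intro!: sser_eqI simp: coeff_simps times_sser.rep_eq sum.distrib[symmetric] algebra_simps split_def)
  show "a * (b + c) = a * b + a * c"
    by (auto intro!: sser_eqI
        simp: coeff_simps times_sser.rep_eq sum.distrib[symmetric] sign_twist_add algebra_simps split_def)
  have "coeff 0 {#} \<noteq> coeff (1 :: 'a sser) {#}" by (simp add: coeff_simps)
  then show "0 \<noteq> (1 :: 'a sser)" by metis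
  show "cscale k (a + b) = cscale k a + cscale k b" "cscale (k + l) a = cscale k a + cscale l a"
    "cscale k (cscale l a) = cscale (k * l) a" "cscale 1 a = a"
    by (auto intro!: sser_eqI
        simp: coeff_simps cscale_add_right cscale_add_left cscale_cscale cscale_one)
  show "cscale k a * b = cscale k (a * b)" "a * cscale k b = cscale k (a * b)"
    by (auto intro!: sser_eqI sum.cong simp: coeff_simps times_sser.rep_eq cscale_sum
        cscale_mono_sign sign_twist_cscale mult_cscale_left mult_cscale_right split_def)
  show "even_part (a + b) = even_part a + even_part b"
    by (auto intro!: sser_eqI simp: coeff_simps even_part_sser.rep_eq even_part_add odd_part_add)
  show "even_part (cscale k a) = cscale k (even_part a)"
    by (auto intro!: sser_eqI simp: coeff_simps even_part_sser.rep_eq even_part_cscale odd_part_cscale)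
  show "even_part (even_part a) = even_part a"
    by (auto intro!: sser_eqI simp: even_part_sser.rep_eq even_part_idem)
  define E where "E n x = (if even n then even_part x else odd_part x)" for n :: int and x :: 'a
  have ev: "coeff (even_part f) m = E (mono_deg m) (coeff f m)" for f m
    by (simp add: E_def even_part_sser.rep_eq)
  have od: "coeff (f - even_part f) m = E (mono_deg m + 1) (coeff f m)" for f m
    by (simp add: E_def even_part_sser.rep_eq coeff_simps odd_part_def)
  have E_sum: "E n (sum f I) = (\<Sum>i\<in>I. E n (f i))" for n I and f :: "_ \<Rightarrow> 'a"
    by (simp add: E_def even_part_sum odd_part_sum)
  have E_sign: "E n (mono_sign p q * x) = mono_sign p q * E n x" for n p q x
    by (simp add: E_def even_part_mono_sign odd_part_mono_sign)
  have E_mult: "E (i + j) (x * sign_twist i y) =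
      E i x * sign_twist i (E j y) + E (i + 1) x * sign_twist i (E (j + 1) y)" for i j x y
    by (auto simp: E_def sign_twist_def even_part_mult' odd_part_mult' even_part_diff odd_part_diff
        even_part_idem algebra_simps)
  show "even_part (a * b) = even_part a * even_part b + (a - even_part a) * (b - even_part b)"
  proof (rule sser_eqI)
    fix m
    show "coeff (even_part (a * b)) m =
      coeff (even_part a * even_part b + (a - even_part a) * (b - even_part b)) m"
    proof (cases "valid_mono m")
      case True
      show ?thesis
        unfolding ev plus_sser.rep_eq coeff_mult[OF True] od E_sum sum.distrib[symmetric]
      proof (intro sum.cong refl, clarsimp)
        fix p q assume "(p, q) \<in> mono_splits m"
        then have "mono_deg m = mono_deg p + mono_deg q" by (auto simp: mono_splits_def mono_deg_add)
        then show "E (mono_deg m) (mono_sign p q * (coeff a p * sign_twist (mono_deg p) (coeff b q))) =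
          mono_sign p q * (E (mono_deg p) (coeff a p) *
            sign_twist (mono_deg p) (E (mono_deg q) (coeff b q))) +
          mono_sign p q * (E (mono_deg p + 1) (coeff a p) *
            sign_twist (mono_deg p) (E (mono_deg q + 1) (coeff b q)))"
          unfolding E_sign by (simp add: E_mult distrib_left)
      qed
    qed (simp add: coeff_invalid)
  qed
  show "even_part a * b = b * even_part a"
  proof (rule sser_eqI)
    fix m
    show "coeff (even_part a * b) m = coeff (b * even_part a) m"
    proof (cases "valid_mono m")
      case True
      show ?thesis
        unfolding coeff_mult[OF True] ev
      proof (subst (2) sser_sum_reindex, intro sum.cong refl, clarsimp)
        fix p q assume pq: "(p, q) \<in> mono_splits m"
        show "mono_sign p q * (E (mono_deg p) (coeff a p) * sign_twist (mono_deg p) (coeff b q)) =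
          mono_sign q p * (coeff b q * sign_twist (mono_deg q) (E (mono_deg p) (coeff a p)))"
          unfolding E_def by (rule even_swap[OF pq True])
      qed
    qed (simp add: coeff_invalid)
  qed
  show "(a - even_part a) * (b - even_part b) = - ((b - even_part b) * (a - even_part a))"
  proof (rule sser_eqI)
    fix m
    show "coeff ((a - even_part a) * (b - even_part b)) m =
      coeff (- ((b - even_part b) * (a - even_part a))) m"
    proof (cases "valid_mono m")
      case True
      show ?thesis
        unfolding uminus_sser.rep_eq coeff_mult[OF True] od
      proof (subst (2) sser_sum_reindex, unfold sum_negf[symmetric], intro sum.cong refl, clarsimp)
        fix p q assume pq: "(p, q) \<in> mono_splits m"
        show "mono_sign p q * (E (mono_deg p + 1) (coeff a p) *
            sign_twist (mono_deg p) (E (mono_deg q + 1) (coeff b q))) =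
          - (mono_sign q p * (E (mono_deg q + 1) (coeff b q) *
            sign_twist (mono_deg q) (E (mono_deg p + 1) (coeff a p))))"
          unfolding E_def by (rule odd_swap[OF pq True])
      qed
    qed (simp add: coeff_invalid)
  qed
qed

end

lift_definition const :: "'a::supercomm_algebra \<Rightarrow> 'a sser" is "\<lambda>a m. if m = {#} then a else 0"
  by auto

lift_definition var :: "svar \<Rightarrow> 'a::supercomm_algebra sser" is "\<lambda>v m. if m = {#v#} then 1 else 0"
  by (auto simp: valid_mono_def split: if_split_asm)

text \<open>Infinite sums are taken coefficientwise. The value is only meaningful for families in which
  every monomial occurs finitely often, as is the case in all uses below.\<close>

lift_definition fsum :: "'i set \<Rightarrow> ('i \<Rightarrow> 'a::supercomm_algebra sser) \<Rightarrow> 'a sser" is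
  "\<lambda>I f m. \<Sum>i\<in>{i\<in>I. f i m \<noteq> 0}. f i m"
  by simp

text \<open>Left partial derivative, a derivation of the parity of the variable:
  \<open>\<partial>\<^sub>v (a v m) = (-1)\<^bsup>|v| |a|\<^esup> a \<partial>\<^sub>v(v m)\<close>.\<close>

lift_definition dvar :: "svar \<Rightarrow> 'a::supercomm_algebra sser \<Rightarrow> 'a sser" is
  "\<lambda>v f m. if valid_mono m
     then of_nat (count m v + 1) *
       (mono_sign {#v#} m * sign_twist (mono_deg {#v#}) (f (add_mset v m))) else 0"
  by simp

definition swap_sign :: "svar \<Rightarrow> svar \<Rightarrow> 'a::ring_1"
  where "swap_sign u v = (if odd_var u \<and> odd_var v then - 1 else 1)"

lemma mono_deg_single: "even (mono_deg {#v#}) \<longleftrightarrow> \<not> odd_var v"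
  by (simp add: mono_deg_def)

lemma inversions_even_var:
  "\<not> odd_var v \<Longrightarrow> inversions {#v#} p = 0" "\<not> odd_var v \<Longrightarrow> inversions p {#v#} = 0"
  by (simp_all add: inversions_def)

lemma mono_sign_self: "mono_sign {#v#} {#v#} = 1"
  by (simp add: mono_sign_def inversions_def)

lemma mono_sign_square: "mono_sign p q * (mono_sign p q * a) = (a::'a::ring_1)"
  unfolding mono_sign_def by (cases "even (inversions p q)") auto

lemma mono_sign_square': "mono_sign p q * mono_sign p q = (1::'a::ring_1)"
  unfolding mono_sign_def by (cases "even (inversions p q)") auto

lemma mono_sign_var_swap:
  assumes "u \<noteq> v"
  shows "mono_sign {#u#} {#v#} = (swap_sign u v * mono_sign {#v#} {#u#} :: 'a::ring_1)"
proof -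
  have "valid_mono ({#v#} + {#u#})" using assms by (simp add: valid_mono_def)
  from mono_sign_swap[OF this, where 'a='a] show ?thesis
    by (simp add: swap_sign_def mono_deg_single conj_commute)
qed

lemma coeff_var_mult:
  "coeff (var v * f) (add_mset v m) = (if valid_mono (add_mset v m)
    then mono_sign {#v#} m * sign_twist (mono_deg {#v#}) (coeff f m) else 0)"
proof (cases "valid_mono (add_mset v m)")
  case True
  have "coeff (var v * f) (add_mset v m) =
    (\<Sum>x\<in>mono_splits (add_mset v m). if x = ({#v#}, m)
      then mono_sign {#v#} m * sign_twist (mono_deg {#v#}) (coeff f m) else 0)"
    unfolding coeff_mult[OF True]
    by (intro sum.cong refl) (auto simp: mono_splits_def var.rep_eq split: if_split_asm)
  moreover have "({#v#}, m) \<in> mono_splits (add_mset v m)" by (simp add: mono_splits_def)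
  ultimately show ?thesis using True by (simp add: sum.delta)
qed (simp add: coeff_invalid)

lemma coeff_var_mult_0:
  assumes "v \<notin># m" shows "coeff (var v * f) m = 0"
proof (cases "valid_mono m")
  case True
  show ?thesis unfolding coeff_mult[OF True]
    using assms by (intro sum.neutral) (auto simp: mono_splits_def var.rep_eq)
qed (simp add: coeff_invalid)

lemma valid_add_mset_iff:
  "valid_mono (add_mset v m) \<longleftrightarrow> valid_mono m \<and> (odd_var v \<longrightarrow> v \<notin># m)"
proof
  assume "valid_mono (add_mset v m)"
  then have c: "count (add_mset v m) u \<le> 1" if "odd_var u" for u
    using that unfolding valid_mono_def by blast
  have "count m u \<le> 1" if "odd_var u" for u
    using c[OF that] by (auto split: if_split_asm)
  moreover have "count m v = 0" if "odd_var v" using c[OF that] by simp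
  ultimately show "valid_mono m \<and> (odd_var v \<longrightarrow> v \<notin># m)"
    by (simp add: valid_mono_def not_in_iff)
qed (auto simp: valid_mono_def not_in_iff)

lemma coeff_swap_sign: "coeff (swap_sign u v * g) m = swap_sign u v * coeff g m"
  by (simp add: swap_sign_def coeff_simps)

lemma sign_twist_of_nat: "sign_twist k (of_nat n * a) = of_nat n * sign_twist k a"
  by (induction n) (auto simp: algebra_simps sign_twist_add)

lemma dvar_var_mult:
  fixes f :: "'a::supercomm_algebra sser"
  shows "dvar u (var v * f) = (if u = v then f else 0) + swap_sign u v * (var v * dvar u f)"
proof (rule sser_eqI)
  fix m
  show "coeff (dvar u (var v * f)) m =
    coeff ((if u = v then f else 0) + swap_sign u v * (var v * dvar u f)) m"
  proof (cases "valid_mono m")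
    case valid: True
    note sw = coeff_swap_sign[of u v _ m]
    show ?thesis
    proof (cases "v \<in># m")
      case True
      then obtain m' where m: "m = add_mset v m'" by (meson multi_member_split)
      show ?thesis
      proof (cases "u = v")
        case uv: True
        show ?thesis
        proof (cases "odd_var v")
          case True
          have "v \<notin># m'" using valid True unfolding m valid_add_mset_iff by blast
          then show ?thesis using valid True uv unfolding m
            by (simp add: coeff_simps sw[unfolded m] dvar.rep_eq coeff_var_mult valid_add_mset_iff
                not_in_iff swap_sign_def sign_twist_mono_sign sign_twist_twist sign_twist_even
                mono_sign_square mono_sign_square' flip: mult.assoc)
        next
          case False
          then have "valid_mono (add_mset v (add_mset v m'))" "valid_mono m'"
            using valid unfolding m valid_add_mset_iff by auto
          moreover have "even (mono_deg {#v#})" using False by (simp add: mono_deg_single)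
          ultimately show ?thesis using valid False uv unfolding m
            by (simp add: coeff_simps dvar.rep_eq coeff_var_mult swap_sign_def sign_twist_even
                mono_deg_single mono_sign_def inversions_even_var algebra_simps)
        qed
      next
        case uv: False
        show ?thesis
        proof (cases "odd_var u \<and> u \<in># m'")
          case True
          then have "\<not> valid_mono (add_mset u m)" "\<not> valid_mono (add_mset u m')"
            by (auto simp: valid_add_mset_iff m)
          then show ?thesis using valid uv unfolding m
            by (simp add: coeff_simps sw[unfolded m] dvar.rep_eq coeff_var_mult coeff_invalid)
        next
          case False
          have v1: "valid_mono (add_mset v (add_mset u m'))" "valid_mono m'"
            using valid False uv unfolding m valid_add_mset_iff by auto
          have e1: "mono_sign {#u#} (add_mset v m') = (mono_sign {#u#} {#v#} * mono_sign {#u#} m' :: 'a)"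
            using mono_sign_add(2)[of "{#u#}" "{#v#}" m'] by simp
          have e2: "mono_sign {#v#} (add_mset u m') = (mono_sign {#v#} {#u#} * mono_sign {#v#} m' :: 'a)"
            using mono_sign_add(2)[of "{#v#}" "{#u#}" m'] by simp
          have L: "coeff (dvar u (var v * f)) m = of_nat (count m' u + 1) * (mono_sign {#u#} (add_mset v m') *
              (mono_sign {#v#} (add_mset u m') * 
                sign_twist (mono_deg {#u#} + mono_deg {#v#}) (coeff f (add_mset u m'))))"
            using valid uv v1 unfolding m
            by (simp add: dvar.rep_eq coeff_var_mult sign_twist_mono_sign sign_twist_twist
                add_mset_commute[of u v])
          have R: "coeff (var v * dvar u f) m = of_nat (count m' u + 1) * (mono_sign {#v#} m' *
              (mono_sign {#u#} m' * 
                sign_twist (mono_deg {#u#} + mono_deg {#v#}) (coeff f (add_mset u m'))))"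
            using valid uv v1 unfolding m coeff_var_mult dvar.rep_eq
            by (simp only: if_True sign_twist_of_nat sign_twist_mono_sign sign_twist_twist add.commute
                mono_sign_def)
              (cases "even (inversions {#v#} m')"; cases "even (inversions {#u#} m')";
                simp add: add.commute sign_twist_twist sign_twist_minus)
          show ?thesis
            unfolding plus_sser.rep_eq sw L R e1 e2 mono_sign_var_swap[OF uv]
            using uv unfolding mono_sign_def swap_sign_def
            by (cases "even (inversions {#v#} m')"; cases "even (inversions {#u#} m')";
                cases "even (inversions {#v#} {#u#})")
              (auto simp: coeff_simps mult.assoc)
        qed
      qed
    next
      case False
      show ?thesis
      proof (cases "u = v")
        case True
        then show ?thesis using valid False
          by (simp add: coeff_simps coeff_swap_sign coeff_var_mult_0 dvar.rep_eq coeff_var_mult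
              valid_add_mset_iff not_in_iff[THEN iffD1, OF False] sign_twist_mono_sign sign_twist_twist sign_twist_even
              mono_sign_square)
      next
        case uv: False
        then have "v \<notin># add_mset u m" using False by simp
        then show ?thesis using valid False uv
          by (simp add: coeff_simps sw coeff_var_mult_0 dvar.rep_eq)
      qed
    qed
  qed (simp add: coeff_invalid)
qed

lemma dvar_dvar:
  fixes f :: "'a::supercomm_algebra sser"
  shows "dvar u (dvar v f) = swap_sign u v * dvar v (dvar u f)"
proof (cases "u = v")
  case True
  show ?thesis
  proof (cases "odd_var v")
    case odd: True
    have "coeff (dvar v (dvar v f)) m = 0" for m
    proof -
      have "\<not> valid_mono (add_mset v (add_mset v m))" using odd by (simp add: valid_add_mset_iff)
      then show ?thesis by (simp add: dvar.rep_eq coeff_invalid)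
    qed
    then have "dvar v (dvar v f) = 0" by (intro sser_eqI) (simp add: coeff_simps)
    then show ?thesis using True by simp
  qed (simp add: True swap_sign_def)
next
  case uv: False
  have d: "coeff (dvar u (dvar v f)) m = of_nat (count m u + 1) * (of_nat (count m v + 1) *
      (mono_sign {#u#} m * (mono_sign {#v#} {#u#} * (mono_sign {#v#} m *
        sign_twist (mono_deg {#u#} + mono_deg {#v#}) (coeff f (add_mset u (add_mset v m)))))))"
    if m: "valid_mono m" and uv: "u \<noteq> v" for u v m
  proof (cases "valid_mono (add_mset u m)")
    case True
    have e: "mono_sign {#v#} (add_mset u m) = (mono_sign {#v#} {#u#} * mono_sign {#v#} m :: 'a)"
      using mono_sign_add(2)[of "{#v#}" "{#u#}" m] by simp
    have c: "mono_sign p q * (of_nat n * a) = of_nat n * (mono_sign p q * a)" for p q n and a :: 'a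
      unfolding mono_sign_def by (cases "even (inversions p q)") auto
    have "coeff (dvar u (dvar v f)) m = of_nat (count m u + 1) * (mono_sign {#u#} m *
      (of_nat (count m v + 1) * (mono_sign {#v#} (add_mset u m) *
        sign_twist (mono_deg {#u#} + mono_deg {#v#}) (coeff f (add_mset u (add_mset v m))))))"
      unfolding dvar.rep_eq using m True uv
      by (simp only: if_True sign_twist_of_nat sign_twist_mono_sign sign_twist_twist
          add_mset_commute[of v u] count_add_mset if_False)
    then show ?thesis unfolding e c mult.assoc .
  next
    case False
    then have "\<not> valid_mono (add_mset u (add_mset v m))"
      using m by (auto simp: valid_add_mset_iff)
    then show ?thesis using False by (simp add: dvar.rep_eq coeff_invalid)
  qed
  show ?thesis
  proof (rule sser_eqI)
    fix m
    show "coeff (dvar u (dvar v f)) m = coeff (swap_sign u v * dvar v (dvar u f)) m"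
    proof (cases "valid_mono m")
      case True
      have c: "of_nat k * (of_nat l * a) = of_nat l * (of_nat k * a)" for k l and a :: 'a
        by (metis mult.assoc mult_of_nat_commute)
      show ?thesis
        unfolding coeff_swap_sign d[OF True uv] d[OF True uv[symmetric]] mono_sign_var_swap[OF uv]
          c[of "count m u + 1"] add.commute[of "mono_deg {#u#}"] add_mset_commute[of u]
        unfolding mono_sign_def swap_sign_def
        by (cases "even (inversions {#v#} m)"; cases "even (inversions {#u#} m)";
            cases "even (inversions {#v#} {#u#})") auto
    qed (simp add: coeff_invalid)
  qed
qed

lemma even_part_var: "even_part (var v) = (if odd_var v then 0 else var v)"
proof (rule sser_eqI)
  fix m show "coeff (even_part (var v)) m = coeff (if odd_var v then 0 else var v) m"
    by (auto simp: even_part_sser.rep_eq var.rep_eq coeff_simps mono_deg_single)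
qed

lemma var_var:
  "var u * (var v * f) = swap_sign u v * (var v * (var u * (f :: 'a::supercomm_algebra sser)))"
proof -
  have "var u * var v = swap_sign u v * (var v * var u :: 'a sser)"
  proof (cases "odd_var u \<and> odd_var v")
    case True
    then show ?thesis
      using odd_anticommute'[of "var u :: 'a sser" "var v"]
      by (simp add: odd_part_def even_part_var swap_sign_def)
  next
    case False
    then show ?thesis
      using even_commute[of "var u :: 'a sser" "var v"] even_commute[of "var v :: 'a sser" "var u"]
      by (auto simp: even_part_var swap_sign_def split: if_split_asm)
  qed
  then show ?thesis by (metis mult.assoc)
qed

lemma dvar_minus: "dvar v (- f) = - dvar v (f :: 'a::supercomm_algebra sser)"
  by (rule sser_eqI) (simp add: dvar.rep_eq coeff_simps sign_twist_minus)

definition in_vars :: "svar set \<Rightarrow> 'a::supercomm_algebra sser \<Rightarrow> bool"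
  where "in_vars V f \<longleftrightarrow> (\<forall>m. coeff f m \<noteq> 0 \<longrightarrow> set_mset m \<subseteq> V)"

definition sinverse :: "'a::supercomm_algebra sser \<Rightarrow> 'a sser"
  where "sinverse f = (THE g. f * g = 1 \<and> g * f = 1)"

fun var_weight :: "svar \<Rightarrow> nat" where
  "var_weight (Vtp n) = n"
| "var_weight (Vtm n) = n"
| "var_weight (Vt n) = n"
| "var_weight _ = 0"

definition weight :: "svar multiset \<Rightarrow> nat"
  where "weight m = (\<Sum>v\<in>#m. var_weight v)"

section \<open>Super-pseudodifferential operators\<close>

text \<open>\<open>\<Sum>\<^sub>n p\<^sub>n D\<^sup>n\<close> is represented by the family \<open>p\<close>.\<close>

type_synonym 'a sdop = "int \<Rightarrow> 'a sser"

definition D_ser :: "'a::supercomm_algebra sser \<Rightarrow> 'a sser"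
  where "D_ser f = dvar Vxi f + var Vxi * dvar Vx f"

text \<open>The set \<open>\<E>^\<close> of operators whose coefficients depend on \<open>x, \<xi>\<close> and the times in \<open>T\<close>.
  Without times all weights are \<open>0\<close>, so that \<open>Ehat {}\<close> is \<open>\<E>\<close>.\<close>

definition Ehat :: "svar set \<Rightarrow> 'a::supercomm_algebra sdop set"
  where "Ehat T = {P. (\<forall>n. in_vars ({Vx, Vxi} \<union> T) (P n)) \<and>
    (\<exists>C::int. \<forall>n m. coeff (P n) m \<noteq> 0 \<longrightarrow> int (weight m) \<ge> n - C)}"

definition Gamma :: "svar set \<Rightarrow> 'a::supercomm_algebra sdop set"
  where "Gamma T = {S. S 0 = 1 \<and> (\<forall>n>0. S n = 0) \<and>
    (\<forall>n<0. in_vars ({Vx, Vxi} \<union> T) (S n) \<and> (if even n then is_even (S n) else is_odd (S n)))}"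

definition super_binom :: "int \<Rightarrow> nat \<Rightarrow> complex"
  where "super_binom m r =
    (if odd (int r * (m - int r)) then 0 else of_int (m div 2) gchoose (r div 2))"

text \<open>Coefficient of \<open>D\<^bsup>m-r\<^esup>\<close> in \<open>D\<^sup>m f\<close>.\<close>

definition leibniz :: "int \<Rightarrow> nat \<Rightarrow> 'a::supercomm_algebra sser \<Rightarrow> 'a sser"
  where "leibniz m r f = cscale (super_binom m r) ((D_ser ^^ r) (sign_twist (m - int r) f))"

definition op_mult :: "'a::supercomm_algebra sdop \<Rightarrow> 'a sdop \<Rightarrow> 'a sdop"  (infixl "\<odot>" 70)
  where "(P \<odot> Q) k = fsum {(m, n). m + n \<ge> k} (\<lambda>(m, n). P m * leibniz m (nat (m + n - k)) (Q n))"

definition D_pow :: "int \<Rightarrow> 'a::supercomm_algebra sdop"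
  where "D_pow n = (\<lambda>k. if k = n then 1 else 0)"

definition coeff_op :: "'a::supercomm_algebra sser \<Rightarrow> 'a sdop"
  where "coeff_op f = (\<lambda>k. if k = 0 then f else 0)"

definition op_inv :: "svar set \<Rightarrow> 'a::supercomm_algebra sdop \<Rightarrow> 'a sdop"
  where "op_inv T P = (THE Q. Q \<in> Ehat T \<and> P \<odot> Q = D_pow 0 \<and> Q \<odot> P = D_pow 0)"

text \<open>From \<open>D\<^sup>* = - D\<close> and \<open>(P\<^sub>1 P\<^sub>2)\<^sup>* = (-1)\<^bsup>|P\<^sub>1| |P\<^sub>2|\<^esup> P\<^sub>2\<^sup>* P\<^sub>1\<^sup>*\<close> one gets
  \<open>(D\<^sup>n)\<^sup>* = (-1)\<^bsup>n(n+1)/2\<^esup> D\<^sup>n\<close> for all integers \<open>n\<close>, hence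
  \<open>(f D\<^sup>n)\<^sup>* = (-1)\<^bsup>n(n+1)/2\<^esup> D\<^sup>n (-1)\<^bsup>n |f|\<^esup> f\<close>.\<close>

definition op_adj :: "'a::supercomm_algebra sdop \<Rightarrow> 'a sdop"
  where "op_adj P k = fsum UNIV (\<lambda>n. (if even (n * (n + 1) div 2) then 1 else - 1) *
    (D_pow n \<odot> coeff_op (sign_twist n (P n))) k)"

definition op_star :: "svar set \<Rightarrow> 'a::supercomm_algebra sdop \<Rightarrow> 'a sdop"
  where "op_star T P = op_adj (op_inv T P)"

primrec op_pow :: "'a::supercomm_algebra sdop \<Rightarrow> nat \<Rightarrow> 'a sdop" where
  "op_pow P 0 = D_pow 0"
| "op_pow P (Suc j) = P \<odot> op_pow P j"

definition op_exp :: "'a::supercomm_algebra sdop \<Rightarrow> 'a sdop"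
  where "op_exp P k = fsum UNIV (\<lambda>j. cscale (1 / fact j) (op_pow P j k))"

definition Xi_matrix :: "'a::supercomm_algebra sdop \<Rightarrow> int \<Rightarrow> int \<Rightarrow> 'a"
  where "Xi_matrix P j k = coeff ((D_pow j \<odot> P) k) {#}"

section \<open>The three hierarchies\<close>

datatype hierarchy = Maximal | Jacobian | Manin_Radul

definition xi_op :: "'a::supercomm_algebra sdop"
  where "xi_op = coeff_op (var Vxi)"

text \<open>\<open>\<partial>\<^sub>\<xi> = D - \<xi> D\<^sup>2\<close>.\<close>

definition d_xi :: "'a::supercomm_algebra sdop"
  where "d_xi k = D_pow 1 k - (xi_op \<odot> D_pow 2) k"

definition dx_pow :: "nat \<Rightarrow> 'a::supercomm_algebra sdop"
  where "dx_pow n = D_pow (2 * int n)"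

definition H_odd :: "'a::supercomm_algebra sdop"
  where "H_odd k = fsum UNIV (\<lambda>n.
    var (Vtp (2 * n + 1)) * (d_xi \<odot> dx_pow n) k +
    var (Vtm (2 * n + 1)) * (xi_op \<odot> dx_pow (n + 1)) k)"

definition H_even :: "'a::supercomm_algebra sdop"
  where "H_even k = fsum {1..} (\<lambda>n.
    var (Vtp (2 * n)) * (d_xi \<odot> xi_op \<odot> dx_pow n) k +
    var (Vtm (2 * n)) * (xi_op \<odot> d_xi \<odot> dx_pow n) k)"

definition H_Jac :: "'a::supercomm_algebra sdop"
  where "H_Jac k = fsum UNIV (\<lambda>n.
    var (Vt (2 * (n + 1))) * dx_pow (n + 1) k +
    var (Vt (2 * n + 1)) * (dx_pow n \<odot> d_xi) k)"

definition H_MR :: "'a::supercomm_algebra sdop"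
  where "H_MR k = fsum {1..} (\<lambda>n. var (Vt n) * D_pow (int n) k)"

fun times_of :: "hierarchy \<Rightarrow> svar set" where
  "times_of Maximal = Vtp ` {1..} \<union> Vtm ` {1..}"
| "times_of Jacobian = Vt ` {1..}"
| "times_of Manin_Radul = Vt ` {1..}"

fun U_op :: "hierarchy \<Rightarrow> 'a::supercomm_algebra sdop" where
  "U_op Maximal = op_exp H_odd \<odot> op_exp H_even"
| "U_op Jacobian = op_exp H_Jac"
| "U_op Manin_Radul = op_exp H_MR"

section \<open>Super-wave functions\<close>

text \<open>Series in \<open>z\<close> are families indexed by the exponent of \<open>z\<close>, with \<open>\<theta>\<close> a variable of the
  coefficients: the coefficient of \<open>z\<^sup>k\<close> comprises the terms in \<open>\<zeta>\<^bsup>2k\<^esup> = z\<^sup>k\<close> and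
  \<open>\<zeta>\<^bsup>2k+1\<^esup> = z\<^sup>k \<theta>\<close>. Below \<open>\<epsilon> = \<plusminus>1\<close>.\<close>

definition exp_ser :: "complex \<Rightarrow> int \<Rightarrow> 'a::supercomm_algebra sser"
  where "exp_ser \<epsilon> k = (if k < 0 then 0 else
    cscale (\<epsilon> powi k / fact (nat k)) (var Vx ^ nat k) * (1 + cscale \<epsilon> (var Vxi * var Vtheta)))"

text \<open>\<open>D\<^sup>n e\<^bsup>\<epsilon>(xz + \<xi>\<theta>)\<^esup> = (\<epsilon> z)\<^sup>l D\<^sup>r e\<^bsup>\<epsilon>(xz + \<xi>\<theta>)\<^esup>\<close> for \<open>n = 2 l + r\<close>, \<open>r \<in> {0, 1}\<close>.\<close>

definition D_pow_exp :: "complex \<Rightarrow> int \<Rightarrow> int \<Rightarrow> 'a::supercomm_algebra sser"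
  where "D_pow_exp \<epsilon> n k = cscale (\<epsilon> powi (n div 2))
    ((D_ser ^^ nat (n mod 2)) (exp_ser \<epsilon> (k - n div 2)))"

definition op_apply_exp :: "complex \<Rightarrow> 'a::supercomm_algebra sdop \<Rightarrow> int \<Rightarrow> 'a sser"
  where "op_apply_exp \<epsilon> P k = fsum UNIV (\<lambda>n. P n * D_pow_exp \<epsilon> n k)"

definition wave :: "hierarchy \<Rightarrow> 'a::supercomm_algebra sdop \<Rightarrow> int \<Rightarrow> 'a sser"
  where "wave h S = op_apply_exp 1 (S \<odot> U_op h)"

definition dual_wave :: "hierarchy \<Rightarrow> 'a::supercomm_algebra sdop \<Rightarrow> int \<Rightarrow> 'a sser"
  where "dual_wave h S =
    op_apply_exp (- 1) (op_star (times_of h) S \<odot> op_star (times_of h) (U_op h))"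

section \<open>The B-C system\<close>

definition C_vars :: "svar set"
  where "C_vars = range Vc"

definition B_vars :: "svar set"
  where "B_vars = Vb ` {1..}"

text \<open>\<open>C\<^sub>m\<close> and \<open>B\<^sub>m\<close> as operators on the Fock space: the creation operators multiply by a
  variable, the annihilation operators are determined by the commutation relations and by their
  action on the vacuum \<open>1\<close>, see \<open>C_B_commutator\<close>, \<open>C_C_commutator\<close> and
  \<open>B_B_commutator\<close>.\<close>

definition C_mode :: "int \<Rightarrow> 'a::supercomm_algebra sser \<Rightarrow> 'a sser"
  where "C_mode m f = (if m \<le> 0 then var (Vc (nat (- m))) * f else dvar (Vb (nat m)) f)"

definition B_mode :: "int \<Rightarrow> 'a::supercomm_algebra sser \<Rightarrow> 'a sser"
  where "B_mode m f = (if m < 0 then var (Vb (nat (- m))) * f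
    else if even m then dvar (Vc (nat m)) f else - dvar (Vc (nat m)) f)"

lemma C_B_commutator:
  "C_mode m (B_mode n f) - (- 1) ^ nat \<bar>(m + 1) * (n + 1)\<bar> * B_mode n (C_mode m f) =
    (if m + n = 0 then f else 0)"
proof -
  have "(- 1) ^ nat \<bar>(m + 1) * (n + 1)\<bar> = (if even m \<and> even n then - 1 else (1 :: 'a sser))"
    by (simp add: even_nat_iff)
  moreover have "n = - m" "even n \<longleftrightarrow> even m" if "m + n = 0" using that by presburger+
  ultimately show ?thesis
    by (cases "m + n = 0") (auto simp: C_mode_def B_mode_def dvar_minus var_var[of "Vc _" "Vb _"]
        dvar_dvar[of "Vb _" "Vc _"] dvar_var_mult swap_sign_def even_nat_iff)
qed

lemma C_C_commutator:
  "C_mode m (C_mode n f) = (- 1) ^ nat \<bar>(m + 1) * (n + 1)\<bar> * C_mode n (C_mode m f)"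
proof -
  have "(- 1) ^ nat \<bar>(m + 1) * (n + 1)\<bar> = (if even m \<and> even n then - 1 else (1 :: 'a sser))"
    by (simp add: even_nat_iff)
  then show ?thesis
    using var_var[of "Vc (nat (- m))" "Vc (nat (- n))" f] dvar_dvar[of "Vb (nat m)" "Vb (nat n)" f]
    by (auto simp: C_mode_def dvar_var_mult swap_sign_def even_nat_iff)
qed

lemma B_B_commutator:
  "B_mode m (B_mode n f) = (- 1) ^ nat \<bar>(m + 1) * (n + 1)\<bar> * B_mode n (B_mode m f)"
proof -
  have "(- 1) ^ nat \<bar>(m + 1) * (n + 1)\<bar> = (if even m \<and> even n then - 1 else (1 :: 'a sser))"
    by (simp add: even_nat_iff)
  then show ?thesis
    using var_var[of "Vb (nat (- m))" "Vb (nat (- n))" f] dvar_dvar[of "Vc (nat m)" "Vc (nat n)" f]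
    by (auto simp: B_mode_def dvar_var_mult dvar_minus swap_sign_def even_nat_iff)
qed

text \<open>\<open>\<langle>(1,0)| f\<close> is the part of \<open>f\<close> without creation operators. The coefficient on the right of
  \<open>c\<^sub>0 |(0,0)\<rangle>\<close> in \<open>f\<close> is obtained by stripping \<open>c\<^sub>0\<close> off from the left.\<close>

lift_definition bra10 :: "'a::supercomm_algebra sser \<Rightarrow> 'a sser" is
  "\<lambda>f m. if set_mset m \<inter> (C_vars \<union> B_vars) = {} then f m else 0"
  by simp

definition bra00 :: "'a::supercomm_algebra sser \<Rightarrow> 'a sser"
  where "bra00 f = bra10 (dvar (Vc 0) f)"

text \<open>The currents \<open>j\<^sup>+\<^sub>n\<close>, \<open>j\<^sup>-\<^sub>n\<close>, \<open>j\<^sup>t\<^sub>n\<close>, \<open>\<psi>\<^sup>+\<close> and \<open>\<psi>\<^sup>-\<close> of index \<open>n + 1/2\<close>, and \<open>\<sigma>\<close>;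
  the half-integer \<open>r\<close> in the sum for \<open>j\<^sup>-\<^sub>n\<close> is \<open>l + 1/2\<close>.\<close>

definition j_plus :: "nat \<Rightarrow> 'a::supercomm_algebra sser \<Rightarrow> 'a sser"
  where "j_plus n f = fsum UNIV (\<lambda>l. C_mode (2 * l) (B_mode (2 * (int n - l)) f))"

definition j_minus :: "nat \<Rightarrow> 'a::supercomm_algebra sser \<Rightarrow> 'a sser"
  where "j_minus n f = - fsum UNIV (\<lambda>l. C_mode (2 * l + 1) (B_mode (2 * (int n - l) - 1) f))"

definition j_total :: "nat \<Rightarrow> 'a::supercomm_algebra sser \<Rightarrow> 'a sser"
  where "j_total n f = j_plus n f + j_minus n f"

definition psi_plus :: "nat \<Rightarrow> 'a::supercomm_algebra sser \<Rightarrow> 'a sser"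
  where "psi_plus n f = fsum UNIV (\<lambda>l. C_mode (2 * l) (B_mode (2 * (int n - l) + 1) f))"

definition psi_minus :: "nat \<Rightarrow> 'a::supercomm_algebra sser \<Rightarrow> 'a sser"
  where "psi_minus n f = fsum UNIV (\<lambda>l. C_mode (2 * l + 1) (B_mode (2 * (int n - l)) f))"

definition sigma :: "'a::supercomm_algebra sser \<Rightarrow> 'a sser"
  where "sigma f = psi_plus 0 f + psi_minus 0 f"

definition fock_exp :: "('a::supercomm_algebra sser \<Rightarrow> 'a sser) \<Rightarrow> 'a sser \<Rightarrow> 'a sser"
  where "fock_exp H f = fsum UNIV (\<lambda>j. cscale (1 / fact j) ((H ^^ j) f))"

fun Phi :: "hierarchy \<Rightarrow> 'a::supercomm_algebra sser \<Rightarrow> 'a sser" where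
  "Phi Maximal f =
    fock_exp (\<lambda>g. fsum UNIV (\<lambda>n. var (Vtp (2 * n + 1)) * psi_plus n g
      - var (Vtm (2 * n + 1)) * psi_minus n g))
    (fock_exp (\<lambda>g. fsum {1..} (\<lambda>n. var (Vtp (2 * n)) * j_plus n g
      + var (Vtm (2 * n)) * j_minus n g)) f)"
| "Phi Jacobian f =
    fock_exp (\<lambda>g. fsum UNIV (\<lambda>n. var (Vt (2 * n + 1)) * psi_plus n g)
      + fsum {1..} (\<lambda>n. var (Vt (2 * n)) * j_total n g)) f"
| "Phi Manin_Radul f =
    fock_exp (\<lambda>g. fsum UNIV (\<lambda>n. var (Vt (2 * n + 1)) * (psi_plus n g - psi_minus n g))
      + fsum {1..} (\<lambda>n. var (Vt (2 * n)) * j_total n g)) f"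

definition translation :: "'a::supercomm_algebra sser \<Rightarrow> 'a sser"
  where "translation = fock_exp (\<lambda>g. var Vx * j_total 1 g + var Vxi * sigma g)"

text \<open>Coefficients of \<open>z\<^sup>k\<close> in \<open>C(\<zeta>)\<close> and \<open>B(\<zeta>)\<close>, applied to \<open>f\<close>.\<close>

definition C_field :: "int \<Rightarrow> 'a::supercomm_algebra sser \<Rightarrow> 'a sser"
  where "C_field k f = C_mode (- 2 * k) f + C_mode (- 2 * k - 1) (var Vtheta * f)"

definition B_field :: "int \<Rightarrow> 'a::supercomm_algebra sser \<Rightarrow> 'a sser"
  where "B_field k f = B_mode (- 2 * k - 1) f + var Vtheta * B_mode (- 2 * k - 2) f"

text \<open>The conditions that determine \<open>v = |\<Xi>\<^bsub>0<\<^esub>\<rangle>\<close> when \<open>M = \<Xi>\<^sub>0\<close>.\<close>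

definition is_state :: "(int \<Rightarrow> int \<Rightarrow> 'a::supercomm_algebra) \<Rightarrow> 'a sser \<Rightarrow> bool"
  where "is_state M v \<longleftrightarrow>
    in_vars (C_vars \<union> B_vars) v \<and>
    (\<forall>m. coeff v m \<noteq> 0 \<longrightarrow>
      size {#u \<in># m. u \<in> C_vars#} = size {#u \<in># m. u \<in> B_vars#}) \<and>
    (\<forall>j>0. fsum UNIV (\<lambda>k. C_mode k (const (M (- k) (- j)) * v)) = 0) \<and>
    bra10 v = 1"

definition tau :: "hierarchy \<Rightarrow> 'a::supercomm_algebra sser \<Rightarrow> 'a sser"
  where "tau h v = bra10 (translation (Phi h v))"

end

theory Submission
  imports Defs
begin

text \<open>Write \<open>G = e\<^bsup>x j + \<xi> \<sigma>\<^esup> \<Phi>(t)\<close> and \<open>v = |\<Xi>\<^bsub>0<\<^esub>\<rangle>\<close>, which is even by uniqueness. Commuting \<open>G\<close> with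
  modes multiplies the modes \<open>C\<^sub>-\<^sub>k\<close> by \<open>\<Xi>[U]\<close> and by the coefficients of \<open>D\<^sup>l e\<^bsup>xz + \<xi>\<theta>\<^esup>\<close>. Consequently, for
  \<open>i \<ge> 0\<close> and \<open>r\<^sub>i = \<Sum>\<^sub>k r\<^sub>i\<^sub>k D\<^sup>k\<close> with \<open>\<tau> r\<^sub>i\<^sub>k\<close> the coefficient of \<open>C\<^sub>-\<^sub>i |(0,0)\<rangle>\<close> in \<open>C\<^sub>-\<^sub>k G v\<close>, the series
  \<open>r\<^sub>i U e\<^bsup>xz + \<xi>\<theta>\<^esup>\<close> collects the coefficients of \<open>C\<^sub>-\<^sub>i |(0,0)\<rangle>\<close> in \<open>\<tau>\<^sup>-\<^sup>1 G C\<^sub>-\<^sub>k v\<close>. The conditions that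
  determine \<open>v\<close> then say \<open>(r\<^sub>i U S\<^sub>0\<^sup>-\<^sup>1)\<^sub>- = 0\<close>, and since \<open>S U S\<^sub>0\<^sup>-\<^sup>1\<close> is invertible without negative
  powers, \<open>(r\<^sub>i S\<^sup>-\<^sup>1)\<^sub>- = 0\<close>. Now \<open>r\<^sub>i\<close> is \<open>D\<^sup>i\<close> up to negative powers. For \<open>i = 0\<close> this gives \<open>r\<^sub>0 = S\<close>, the
  formula for \<open>w\<close>. For all \<open>i\<close> it shows that the coefficient of \<open>D\<^sup>-\<^sup>1\<close> in \<open>D\<^sup>i S\<^sup>-\<^sup>1\<close>, which is up to sign
  the coefficient of \<open>D\<^bsup>-i-1\<^esup>\<close> in \<open>S\<^sup>\<star>\<close>, is \<open>- r\<^bsub>i,-1\<^esub>\<close>; since \<open>B\<^sub>i\<close> takes coefficients of \<open>C\<^sub>-\<^sub>i\<close>, the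
  \<open>r\<^bsub>i,-1\<^esub>\<close> are also what the formula for the dual function produces.\<close>

section \<open>Coefficientwise sums\<close>

text \<open>Infinite sums are coefficientwise, so every interchange of sums needs a proof that each
  monomial meets finitely many terms. For operators these proofs rest on two gradings: the weight of
  the times, and the degree in which x counts 2 and \<xi> counts 1. D is not invertible on
  functions, yet negative powers of D occur everywhere. Identities for \<open>D_pow j\<close> with j
  < 0 are therefore not read off from the Leibniz formula: both sides are families over all integers
  j with the same recursion under D, and left multiplication by D is injective on admissible
  operators, so agreement at j = 0 suffices. Associativity and the formula for D^j times an adjoint
  are obtained in this way. The same recursion for functions gives a Taylor formula, which makes
  \<open>Xi\<close> multiplicative and explains how the translation restores the dependence on x and
  \<xi> that \<open>Xi\<close> has lost. Evenness of v is what lets all matrix entries be moved to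
  the right of G v, where the bra vectors are linear over them.\<close>

definition fsummable :: "'i set \<Rightarrow> ('i \<Rightarrow> 'a::supercomm_algebra sser) \<Rightarrow> bool"
  where "fsummable I f \<longleftrightarrow> (\<forall>m. finite {i \<in> I. coeff (f i) m \<noteq> 0})"

lemma fsummableI: "(\<And>m. finite {i \<in> I. coeff (f i) m \<noteq> 0}) \<Longrightarrow> fsummable I f"
  by (simp add: fsummable_def)

lemma fsummableD: "fsummable I f \<Longrightarrow> finite {i \<in> I. coeff (f i) m \<noteq> 0}"
  by (simp add: fsummable_def)

lemma coeff_0 [simp]: "coeff 0 m = 0" by (simp add: zero_sser.rep_eq)

lemma coeff_add: "coeff (f + g) m = coeff f m + coeff g m" by (simp add: plus_sser.rep_eq)

lemma coeff_minus: "coeff (- f) m = - coeff f m" by (simp add: uminus_sser.rep_eq)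

lemma coeff_diff: "coeff (f - g) m = coeff f m - coeff g m" by (simp add: minus_sser.rep_eq)

lemma coeff_cscale: "coeff (cscale c f) m = cscale c (coeff f m)" by (simp add: cscale_sser.rep_eq)

lemma coeff_sum: "coeff (sum f I) m = (\<Sum>i\<in>I. coeff (f i) m)"
  by (induction I rule: infinite_finite_induct) (auto simp: coeff_add)

lemma coeff_one: "coeff 1 m = (if m = {#} then 1 else 0)"
  by (simp add: one_sser.rep_eq)

lemma coeff_fsum:
  assumes "finite J" "J \<subseteq> I" "\<And>i. i \<in> I \<Longrightarrow> i \<notin> J \<Longrightarrow> coeff (f i) m = 0"
  shows "coeff (fsum I f) m = (\<Sum>i\<in>J. coeff (f i) m)"
  unfolding fsum.rep_eq by (rule sum.mono_neutral_left) (use assms in auto)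

lemma coeff_fsum_nonzero:
  assumes "coeff (fsum I f) m \<noteq> 0"
  obtains i where "i \<in> I" "coeff (f i) m \<noteq> 0"
proof -
  from assms have "{i \<in> I. coeff (f i) m \<noteq> 0} \<noteq> {}" unfolding fsum.rep_eq by force
  then show ?thesis using that by blast
qed

lemma fsum_cong: "(\<And>i. i \<in> I \<Longrightarrow> f i = g i) \<Longrightarrow> fsum I f = fsum I g"
  by (intro sser_eqI) (auto simp: fsum.rep_eq intro!: sum.cong)

lemma fsum_zero [simp]: "fsum I (\<lambda>i. 0) = 0"
  by (intro sser_eqI) (simp add: fsum.rep_eq)

lemma fsum_neutral: "(\<And>i. i \<in> I \<Longrightarrow> f i = 0) \<Longrightarrow> fsum I f = 0"
  using fsum_cong[of I f "\<lambda>_. 0"] by simp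

lemma fsummable_finite: "finite I \<Longrightarrow> fsummable I f"
  by (simp add: fsummable_def)

lemma fsum_finite: "finite I \<Longrightarrow> fsum I f = sum f I"
  by (intro sser_eqI, subst coeff_fsum[of I I]) (simp_all add: coeff_sum)

lemma fsummable_add:
  assumes "fsummable I f" "fsummable I g"
  shows "fsummable I (\<lambda>i. f i + g i)"
proof (rule fsummableI)
  fix m
  show "finite {i \<in> I. coeff (f i + g i) m \<noteq> 0}"
    by (rule finite_subset[of _ "{i \<in> I. coeff (f i) m \<noteq> 0} \<union> {i \<in> I. coeff (g i) m \<noteq> 0}"])
      (use assms in \<open>auto simp: coeff_add dest: fsummableD[where m=m]\<close>)
qed

lemma fsum_add:
  assumes "fsummable I f" "fsummable I g"
  shows "fsum I (\<lambda>i. f i + g i) = fsum I f + fsum I g"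
proof (rule sser_eqI)
  fix m
  let ?J = "{i \<in> I. coeff (f i) m \<noteq> 0} \<union> {i \<in> I. coeff (g i) m \<noteq> 0}"
  have J: "finite ?J" "?J \<subseteq> I" using assms by (auto dest: fsummableD[where m=m])
  show "coeff (fsum I (\<lambda>i. f i + g i)) m = coeff (fsum I f + fsum I g) m"
    unfolding coeff_add
    by (subst (1 2 3) coeff_fsum[OF J]) (auto simp: coeff_add sum.distrib)
qed

lemma fsummable_minus: "fsummable I f \<Longrightarrow> fsummable I (\<lambda>i. - f i)"
  by (simp add: fsummable_def coeff_minus)

lemma fsum_minus: "fsum I (\<lambda>i. - f i) = - fsum I f"
  by (intro sser_eqI) (simp add: fsum.rep_eq coeff_minus sum_negf)

lemma fsum_diff:
  "fsummable I f \<Longrightarrow> fsummable I g \<Longrightarrow> fsum I (\<lambda>i. f i - g i) = fsum I f - fsum I g"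
  using fsum_add[of I f "\<lambda>i. - g i"] by (simp add: fsummable_minus fsum_minus)

lemma fsum_restrict: "J \<subseteq> I \<Longrightarrow> fsum J f = fsum I (\<lambda>i. if i \<in> J then f i else 0)"
  by (intro sser_eqI) (auto simp: fsum.rep_eq intro!: sum.cong)

lemma fsum_single:
  assumes "i \<in> I" "\<And>j. j \<in> I \<Longrightarrow> j \<noteq> i \<Longrightarrow> f j = 0"
  shows "fsum I f = f i"
  by (intro sser_eqI, subst coeff_fsum[of "{i}"]) (use assms in auto)

lemma fsum_delta: "fsum UNIV (\<lambda>i. if i = a then f i else 0) = f a"
  by (subst fsum_single[of a]) auto

lemma fsum_reindex:
  assumes "bij_betw h J I"
  shows "fsum I f = fsum J (\<lambda>j. f (h j))"
proof (rule sser_eqI)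
  fix m
  have "bij_betw h {j \<in> J. coeff (f (h j)) m \<noteq> 0} {i \<in> I. coeff (f i) m \<noteq> 0}"
    using assms by (auto simp: bij_betw_def inj_on_def)
  then show "coeff (fsum I f) m = coeff (fsum J (\<lambda>j. f (h j))) m"
    unfolding fsum.rep_eq by (rule sum.reindex_bij_betw[symmetric])
qed

lemma fsummable_reindex:
  assumes "fsummable I f" "inj_on h J" "h ` J \<subseteq> I"
  shows "fsummable J (\<lambda>j. f (h j))"
proof (rule fsummableI)
  fix m
  have "inj_on h {j \<in> J. coeff (f (h j)) m \<noteq> 0}"
    using assms(2) by (rule inj_on_subset) auto
  moreover have "finite (h ` {j \<in> J. coeff (f (h j)) m \<noteq> 0})"
    by (rule finite_subset[OF _ fsummableD[OF assms(1), of m]]) (use assms(3) in auto)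
  ultimately show "finite {j \<in> J. coeff (f (h j)) m \<noteq> 0}"
    by (rule finite_imageD[rotated])
qed

lemma fsum_shift: "fsum UNIV (\<lambda>k::int. f (k + a)) = fsum UNIV f"
  by (rule fsum_reindex[symmetric]) (auto intro!: bij_betw_byWitness[where f' = "\<lambda>x. x - a"])

lemma fsum_uminus: "fsum UNIV (\<lambda>k::int. f (- k)) = fsum UNIV f"
  by (rule fsum_reindex[symmetric]) (auto intro!: bij_betw_byWitness[where f' = "\<lambda>x. - x"])

lemma fsummable_shift: "fsummable UNIV f \<Longrightarrow> fsummable UNIV (\<lambda>k::int. f (k + a))"
  by (rule fsummable_reindex) auto

lemma fsummable_uminus: "fsummable UNIV f \<Longrightarrow> fsummable UNIV (\<lambda>k::int. f (- k))"
  by (rule fsummable_reindex) (auto intro: injI)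

text \<open>Joint summability is essential: cancellation inside the inner sums could hide infinitely
  many nonzero pairs. With it, both sides are the same finite sum at each monomial.\<close>

lemma fsum_Sigma:
  assumes "fsummable (Sigma I J) (\<lambda>(i, j). f i j)"
  shows "fsum I (\<lambda>i. fsum (J i) (f i)) = fsum (Sigma I J) (\<lambda>(i, j). f i j)"
proof (rule sser_eqI)
  fix m
  let ?S = "{x \<in> Sigma I J. coeff (f (fst x) (snd x)) m \<noteq> 0}"
  have S: "finite ?S" using fsummableD[OF assms, of m] by (simp add: split_def)
  have F: "fst ` ?S \<subseteq> I" by auto
  have inner: "coeff (fsum (J i) (f i)) m =
      (\<Sum>j\<in>{j \<in> J i. coeff (f i j) m \<noteq> 0}. coeff (f i j) m)" for i
    by (simp add: fsum.rep_eq)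
  have fin: "finite {j \<in> J i. coeff (f i j) m \<noteq> 0}" if "i \<in> I" for i
    by (rule finite_subset[of _ "snd ` ?S"]) (use that S in force)+
  have "coeff (fsum I (\<lambda>i. fsum (J i) (f i))) m =
    (\<Sum>i\<in>fst ` ?S. coeff (fsum (J i) (f i)) m)"
  proof (rule coeff_fsum)
    show "coeff (fsum (J i) (f i)) m = 0" if "i \<in> I" "i \<notin> fst ` ?S" for i
    proof (rule ccontr)
      assume "coeff (fsum (J i) (f i)) m \<noteq> 0"
      then obtain j where "j \<in> J i" "coeff (f i j) m \<noteq> 0" by (rule coeff_fsum_nonzero)
      then have "(i, j) \<in> ?S" using that(1) by simp
      then show False using that(2) by force
    qed
  qed (use S F in auto)
  also have "\<dots> = (\<Sum>x\<in>(SIGMA i:fst ` ?S. {j \<in> J i. coeff (f i j) m \<noteq> 0}).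
      coeff (f (fst x) (snd x)) m)"
    unfolding inner by (subst sum.Sigma) (use S F fin in \<open>auto simp: split_def\<close>)
  also have "(SIGMA i:fst ` ?S. {j \<in> J i. coeff (f i j) m \<noteq> 0}) = ?S" by force
  also have "(\<Sum>x\<in>?S. coeff (f (fst x) (snd x)) m) = coeff (fsum (Sigma I J) (\<lambda>(i, j). f i j)) m"
    by (simp add: fsum.rep_eq split_def)
  finally show "coeff (fsum I (\<lambda>i. fsum (J i) (f i))) m =
    coeff (fsum (Sigma I J) (\<lambda>(i, j). f i j)) m" .
qed

lemma fsum_prod:
  assumes "fsummable UNIV (\<lambda>(i, j). f i j)"
  shows "fsum UNIV (\<lambda>i. fsum UNIV (f i)) = fsum UNIV (\<lambda>(i, j). f i j)"
  using fsum_Sigma[of UNIV "\<lambda>_. UNIV" f] assms by simp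

lemma fsummable_swap:
  assumes "fsummable UNIV (\<lambda>(i, j). f i j)"
  shows "fsummable UNIV (\<lambda>(j, i). f i j)"
  using fsummable_reindex[OF assms, of "\<lambda>(j, i). (i, j)" UNIV]
  by (simp add: inj_on_def split_def)

lemma fsum_swap:
  assumes "fsummable UNIV (\<lambda>(i, j). f i j)"
  shows "fsum UNIV (\<lambda>i. fsum UNIV (f i)) = fsum UNIV (\<lambda>j. fsum UNIV (\<lambda>i. f i j))"
proof -
  have "fsum UNIV (\<lambda>j. fsum UNIV (\<lambda>i. f i j)) = fsum UNIV (\<lambda>(j, i). f i j)"
    by (rule fsum_prod[OF fsummable_swap[OF assms]])
  also have "\<dots> = fsum UNIV (\<lambda>(i, j). f i j)"
    using fsum_reindex[of "\<lambda>(j, i). (i, j)" UNIV UNIV "\<lambda>(i, j). f i j"]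
    by (simp add: bij_betw_def inj_on_def surj_def split_def)
  finally show ?thesis using fsum_prod[OF assms] by simp
qed

lemma fsummable_row:
  assumes "fsummable UNIV (\<lambda>(i, j). f i j)" shows "fsummable UNIV (f i)"
  using fsummable_reindex[OF assms, of "\<lambda>j. (i, j)" UNIV] by (simp add: inj_on_def)

lemma fsummable_fsum:
  assumes "fsummable UNIV (\<lambda>(i, j). f i j)"
  shows "fsummable UNIV (\<lambda>i. fsum UNIV (f i))"
proof (rule fsummableI)
  fix m
  have "{i \<in> UNIV. coeff (fsum UNIV (f i)) m \<noteq> 0} \<subseteq>
      fst ` {x \<in> UNIV. coeff (case x of (i, j) \<Rightarrow> f i j) m \<noteq> 0}"
  proof
    fix i assume "i \<in> {i \<in> UNIV. coeff (fsum UNIV (f i)) m \<noteq> 0}"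
    then obtain j where "coeff (f i j) m \<noteq> 0" by (auto elim: coeff_fsum_nonzero)
    then show "i \<in> fst ` {x \<in> UNIV. coeff (case x of (i, j) \<Rightarrow> f i j) m \<noteq> 0}"
      by (intro image_eqI[of _ _ "(i, j)"]) auto
  qed
  then show "finite {i \<in> UNIV. coeff (fsum UNIV (f i)) m \<noteq> 0}"
    by (rule finite_subset) (rule finite_imageI[OF fsummableD[OF assms]])
qed

lemma coeff_mult_nonzero:
  assumes "coeff (f * g) m \<noteq> 0"
  obtains p q where "m = p + q" "coeff f p \<noteq> 0" "coeff g q \<noteq> 0"
proof -
  have v: "valid_mono m" using assms coeff_invalid by blast
  have "\<exists>x\<in>mono_splits m. coeff f (fst x) \<noteq> 0 \<and> coeff g (snd x) \<noteq> 0"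
  proof (rule ccontr)
    assume "\<not> ?thesis"
    then have "coeff (f * g) m = 0"
      unfolding coeff_mult[OF v] by (intro sum.neutral) (auto simp: split_def)
    then show False using assms by simp
  qed
  then show ?thesis using that by (auto simp: mono_splits_def)
qed

lemma finite_submonos: "finite {p. p \<subseteq># (m :: svar multiset)}"
proof -
  have "{p. p \<subseteq># m} = fst ` mono_splits m"
    by (auto simp: mono_splits_def image_iff subset_mset.le_iff_add)
  then show ?thesis by simp
qed

text \<open>A monomial has finitely many factors, so only finitely many i can contribute through f
  i, and the inner families matter for these i alone. This is why the summability of g i may depend
  on i.\<close>

lemma fsummable_mult_Sigma:
  assumes "fsummable I f" "\<And>i. i \<in> I \<Longrightarrow> fsummable (J i) (g i)"
  shows "fsummable (Sigma I J) (\<lambda>(i, j). f i * g i j)"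
proof (rule fsummableI)
  fix m
  let ?K = "\<Union>p\<in>{p. p \<subseteq># m}. {i \<in> I. coeff (f i) p \<noteq> 0}"
  let ?L = "\<lambda>i. \<Union>q\<in>{q. q \<subseteq># m}. {j \<in> J i. coeff (g i j) q \<noteq> 0}"
  have fin: "finite (Sigma ?K ?L)"
    using assms by (intro finite_SigmaI finite_UN_I finite_submonos) (auto dest: fsummableD)
  have "{x \<in> Sigma I J. coeff (case x of (i, j) \<Rightarrow> f i * g i j) m \<noteq> 0} \<subseteq> Sigma ?K ?L"
  proof
    fix x assume "x \<in> {x \<in> Sigma I J. coeff (case x of (i, j) \<Rightarrow> f i * g i j) m \<noteq> 0}"
    then obtain i j where x: "x = (i, j)" "i \<in> I" "j \<in> J i" "coeff (f i * g i j) m \<noteq> 0"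
      by auto
    from x(4) obtain p q where "m = p + q" "coeff (f i) p \<noteq> 0" "coeff (g i j) q \<noteq> 0"
      by (rule coeff_mult_nonzero)
    then have "i \<in> ?K" "j \<in> ?L i"
      using x mset_subset_eq_add_left[of p q] mset_subset_eq_add_right[of q p] by blast+
    then show "x \<in> Sigma ?K ?L" using x by simp
  qed
  then show "finite {x \<in> Sigma I J. coeff (case x of (i, j) \<Rightarrow> f i * g i j) m \<noteq> 0}"
    using fin by (rule finite_subset)
qed

lemma fsummable_mult_right:
  assumes "fsummable I f" shows "fsummable I (\<lambda>i. f i * g i)"
  using fsummable_reindex[OF fsummable_mult_Sigma[OF assms, of "\<lambda>_. {()}" "\<lambda>i _. g i"],
      of "\<lambda>i. (i, ())" I]
  by (auto simp: fsummable_finite inj_on_def)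

lemma fsummable_mult_left:
  assumes "fsummable I f" shows "fsummable I (\<lambda>i. g i * f i)"
proof (rule fsummableI)
  fix m
  have "{i \<in> I. coeff (g i * f i) m \<noteq> 0} \<subseteq> (\<Union>q\<in>{q. q \<subseteq># m}. {i \<in> I. coeff (f i) q \<noteq> 0})"
  proof
    fix i assume "i \<in> {i \<in> I. coeff (g i * f i) m \<noteq> 0}"
    then obtain p q where "i \<in> I" "m = p + q" "coeff (f i) q \<noteq> 0"
      by (auto elim: coeff_mult_nonzero)
    then show "i \<in> (\<Union>q\<in>{q. q \<subseteq># m}. {i \<in> I. coeff (f i) q \<noteq> 0})"
      by (auto intro!: exI[of _ q])
  qed
  then show "finite {i \<in> I. coeff (g i * f i) m \<noteq> 0}"
    by (rule finite_subset) (use assms in \<open>auto intro!: finite_submonos dest: fsummableD\<close>)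
qed

section \<open>Finitary maps\<close>

text \<open>Additive maps that are continuous for the product topology on coefficients.\<close>

definition finitary :: "('a::supercomm_algebra sser \<Rightarrow> 'a sser) \<Rightarrow> bool"
  where "finitary T \<longleftrightarrow> (\<forall>f g. T (f + g) = T f + T g) \<and>
    (\<forall>m. \<exists>F. finite F \<and> (\<forall>f. (\<forall>p\<in>F. coeff f p = 0) \<longrightarrow> coeff (T f) m = 0))"

lemma finitary_add: "finitary T \<Longrightarrow> T (f + g) = T f + T g"
  by (simp add: finitary_def)

lemma finitary_0: "finitary T \<Longrightarrow> T 0 = 0"
  using finitary_add[of T 0 0] by simp

lemma finitary_uminus: "finitary T \<Longrightarrow> T (- f) = - T f"
  using finitary_add[of T f "- f"] by (simp add: finitary_0 eq_neg_iff_add_eq_0 add.commute)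

lemma finitary_diff: "finitary T \<Longrightarrow> T (f - g) = T f - T g"
  using finitary_add[of T f "- g"] by (simp add: finitary_uminus)

lemma finitary_sum: "finitary T \<Longrightarrow> T (sum f I) = (\<Sum>i\<in>I. T (f i))"
  by (induction I rule: infinite_finite_induct) (auto simp: finitary_0 finitary_add)

lemma finitaryI:
  assumes "\<And>f g. T (f + g) = T f + T g"
    and "\<And>m. finite (F m)" "\<And>m f. (\<And>p. p \<in> F m \<Longrightarrow> coeff f p = 0) \<Longrightarrow> coeff (T f) m = 0"
  shows "finitary T"
  unfolding finitary_def using assms by metis

lemma finitaryE:
  assumes "finitary T"
  obtains F where "finite F" "\<And>f. (\<And>p. p \<in> F \<Longrightarrow> coeff f p = 0) \<Longrightarrow> coeff (T f) m = 0"
  using assms unfolding finitary_def by metis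

lemma finitary_fsummable:
  assumes T: "finitary T" and f: "fsummable I f"
  shows "fsummable I (\<lambda>i. T (f i))"
proof (rule fsummableI)
  fix m
  obtain F where F: "finite F" "\<And>f. (\<And>p. p \<in> F \<Longrightarrow> coeff f p = 0) \<Longrightarrow> coeff (T f) m = 0"
    using finitaryE[OF T, of m] by metis
  have "{i \<in> I. coeff (T (f i)) m \<noteq> 0} \<subseteq> (\<Union>p\<in>F. {i \<in> I. coeff (f i) p \<noteq> 0})"
    using F(2) by auto
  then show "finite {i \<in> I. coeff (T (f i)) m \<noteq> 0}"
    by (rule finite_subset) (use F(1) f in \<open>auto dest: fsummableD\<close>)
qed

lemma finitary_fsum:
  assumes T: "finitary T" and f: "fsummable I f"
  shows "T (fsum I f) = fsum I (\<lambda>i. T (f i))"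
proof (rule sser_eqI)
  fix m
  obtain F where F: "finite F" "\<And>f. (\<And>p. p \<in> F \<Longrightarrow> coeff f p = 0) \<Longrightarrow> coeff (T f) m = 0"
    using finitaryE[OF T, of m] by metis
  define J where "J = (\<Union>p\<in>F. {i \<in> I. coeff (f i) p \<noteq> 0})"
  have J: "finite J" "J \<subseteq> I" using F(1) f by (auto simp: J_def dest: fsummableD)
  have "coeff (fsum I f - sum f J) p = 0" if "p \<in> F" for p
    using that by (simp add: coeff_diff coeff_sum) (subst coeff_fsum[OF J], auto simp: J_def)
  then have "coeff (T (fsum I f - sum f J)) m = 0" by (rule F(2))
  then have "coeff (T (fsum I f)) m = (\<Sum>i\<in>J. coeff (T (f i)) m)"
    by (simp add: finitary_diff[OF T] finitary_sum[OF T] coeff_diff coeff_sum)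
  also have "\<dots> = coeff (fsum I (\<lambda>i. T (f i))) m"
    by (rule coeff_fsum[symmetric, OF J]) (rule F(2), auto simp: J_def)
  finally show "coeff (T (fsum I f)) m = coeff (fsum I (\<lambda>i. T (f i))) m" .
qed

lemma finitary_comp:
  assumes S: "finitary S" and T: "finitary T"
  shows "finitary (\<lambda>f. S (T f))"
  unfolding finitary_def
proof (intro conjI allI)
  fix m
  obtain F where F: "finite F" "\<And>f. (\<And>p. p \<in> F \<Longrightarrow> coeff f p = 0) \<Longrightarrow> coeff (S f) m = 0"
    using finitaryE[OF S, of m] by metis
  obtain G where G: "\<And>p. finite (G p)"
    "\<And>p f. (\<And>q. q \<in> G p \<Longrightarrow> coeff f q = 0) \<Longrightarrow> coeff (T f) p = 0"
    using T unfolding finitary_def by metis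
  have "finite (\<Union>p\<in>F. G p)" using F G by auto
  moreover have "coeff (S (T f)) m = 0" if "\<forall>q\<in>(\<Union>p\<in>F. G p). coeff f q = 0" for f
    by (intro F(2) G(2)) (use that in auto)
  ultimately show "\<exists>F. finite F \<and> (\<forall>f. (\<forall>p\<in>F. coeff f p = 0) \<longrightarrow> coeff (S (T f)) m = 0)"
    by blast
qed (simp add: finitary_add[OF S] finitary_add[OF T])

lemma finitary_id: "finitary (\<lambda>f. f)"
  by (rule finitaryI[where F = "\<lambda>m. {m}"]) auto

lemma finitary_zero: "finitary (\<lambda>f. 0)"
  by (rule finitaryI[where F = "\<lambda>m. {m}"]) auto

lemma finitary_plus:
  assumes S: "finitary S" and T: "finitary T"
  shows "finitary (\<lambda>f. S f + T f)"
  unfolding finitary_def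
proof (intro conjI allI)
  fix m
  obtain F where F: "finite F" "\<And>f. (\<And>p. p \<in> F \<Longrightarrow> coeff f p = 0) \<Longrightarrow> coeff (S f) m = 0"
    using finitaryE[OF S, of m] by metis
  obtain G where G: "finite G" "\<And>f. (\<And>p. p \<in> G \<Longrightarrow> coeff f p = 0) \<Longrightarrow> coeff (T f) m = 0"
    using finitaryE[OF T, of m] by metis
  have "finite (F \<union> G)" using F G by auto
  moreover have "coeff (S f + T f) m = 0" if "\<forall>q\<in>F \<union> G. coeff f q = 0" for f
    using that F(2)[of f] G(2)[of f] by (simp add: coeff_add)
  ultimately show "\<exists>F. finite F \<and> (\<forall>f. (\<forall>p\<in>F. coeff f p = 0) \<longrightarrow> coeff (S f + T f) m = 0)"
    by blast
qed (simp add: finitary_add[OF S] finitary_add[OF T] algebra_simps)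

lemma finitary_cscale: "finitary (cscale c)"
  by (rule finitaryI[where F = "\<lambda>m. {m}"]) (auto simp: cscale_add_right coeff_cscale)

lemma finitary_neg: "finitary (\<lambda>f. - f)"
  by (rule finitaryI[where F = "\<lambda>m. {m}"]) (auto simp: coeff_minus)

lemma finitary_minus: "finitary S \<Longrightarrow> finitary T \<Longrightarrow> finitary (\<lambda>f. S f - T f)"
  using finitary_plus[of S "\<lambda>f. - T f"] finitary_comp[OF finitary_neg, of T] by simp

lemma finitary_mult_left: "finitary (\<lambda>f. g * f)"
proof (rule finitaryI[where F = "\<lambda>m. {p. p \<subseteq># m}"])
  show "coeff (g * f) m = 0" if "\<And>p. p \<in> {p. p \<subseteq># m} \<Longrightarrow> coeff f p = 0" for m f
    using that by (metis coeff_mult_nonzero mem_Collect_eq mset_subset_eq_add_right)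
qed (auto simp: finite_submonos distrib_left)

lemma finitary_mult_right: "finitary (\<lambda>f. f * g)"
proof (rule finitaryI[where F = "\<lambda>m. {p. p \<subseteq># m}"])
  show "coeff (f * g) m = 0" if "\<And>p. p \<in> {p. p \<subseteq># m} \<Longrightarrow> coeff f p = 0" for m f
    using that by (metis coeff_mult_nonzero mem_Collect_eq mset_subset_eq_add_left)
qed (auto simp: finite_submonos distrib_right)

lemma coeff_sign_twist: "coeff (sign_twist n f) m =
    (if odd n \<and> odd (mono_deg m) then - sign_twist n (coeff f m) else sign_twist n (coeff f m))"
  by (auto simp: sign_twist_def even_part_sser.rep_eq odd_part_def coeff_diff)

lemma finitary_sign_twist: "finitary (sign_twist n)"
  by (rule finitaryI[where F = "\<lambda>m. {m}"]) (auto simp: sign_twist_add coeff_sign_twist)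

lemma dvar_add: "dvar v (f + g) = dvar v f + dvar v g"
  by (intro sser_eqI) (simp add: dvar.rep_eq coeff_add sign_twist_add distrib_left)

lemma finitary_dvar: "finitary (dvar v)"
  by (rule finitaryI[where F = "\<lambda>m. {add_mset v m}"]) (auto simp: dvar_add dvar.rep_eq)

text \<open>The bound \<open>loc\<close> is uniform in the argument: for each monomial, the maps
  that can contribute at all are finitely many. Pointwise summability would not make the sum
  continuous.\<close>

lemma finitary_family:
  assumes T: "\<And>i. i \<in> I \<Longrightarrow> finitary (T i)"
    and loc: "\<And>m. finite {i \<in> I. \<exists>f. coeff (T i f) m \<noteq> 0}"
  shows "fsummable I (\<lambda>i. T i (f i))" and "finitary (\<lambda>f. fsum I (\<lambda>i. T i f))"
proof -
  show s: "fsummable I (\<lambda>i. T i (f i))" for f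
    by (rule fsummableI) (rule finite_subset[OF _ loc], auto)
  obtain F where F: "\<And>i m. i \<in> I \<Longrightarrow> finite (F i m)"
    "\<And>i m f. i \<in> I \<Longrightarrow> (\<And>p. p \<in> F i m \<Longrightarrow> coeff f p = 0) \<Longrightarrow> coeff (T i f) m = 0"
    using T unfolding finitary_def by metis
  show "finitary (\<lambda>f. fsum I (\<lambda>i. T i f))"
  proof (rule finitaryI[where F = "\<lambda>m. \<Union>i\<in>{i \<in> I. \<exists>f. coeff (T i f) m \<noteq> 0}. F i m"])
    show "fsum I (\<lambda>i. T i (f + g)) = fsum I (\<lambda>i. T i f) + fsum I (\<lambda>i. T i g)" for f g
      unfolding fsum_add[OF s s, symmetric] by (rule fsum_cong) (simp add: finitary_add[OF T])
    show "finite (\<Union>i\<in>{i \<in> I. \<exists>f. coeff (T i f) m \<noteq> 0}. F i m)" for m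
      using F(1) loc by auto
    show "coeff (fsum I (\<lambda>i. T i f)) m = 0"
      if "\<And>p. p \<in> (\<Union>i\<in>{i \<in> I. \<exists>f. coeff (T i f) m \<noteq> 0}. F i m) \<Longrightarrow> coeff f p = 0" for m f
    proof (rule ccontr)
      assume "coeff (fsum I (\<lambda>i. T i f)) m \<noteq> 0"
      then obtain i where i: "i \<in> I" "coeff (T i f) m \<noteq> 0" by (rule coeff_fsum_nonzero)
      have "coeff (T i f) m = 0" by (rule F(2)[OF i(1)]) (use that i in blast)
      then show False using i by simp
    qed
  qed
qed

lift_definition single :: "svar multiset \<Rightarrow> 'a::supercomm_algebra \<Rightarrow> 'a sser" is
  "\<lambda>m a p. if p = m \<and> valid_mono m then a else 0"
  by auto

text \<open>A coefficient of S f - T f depends on finitely many coefficients of f, and on these f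
  agrees with a finite sum of terms \<open>single p a\<close>.\<close>

lemma finitary_ext:
  fixes S T :: "'a::supercomm_algebra sser \<Rightarrow> 'a sser"
  assumes S: "finitary S" and T: "finitary T" and eq: "\<And>m a. S (single m a) = T (single m a)"
  shows "S = T"
proof (intro ext sser_eqI)
  fix f :: "'a sser" and m
  have U: "finitary (\<lambda>f. S f - T f)" by (rule finitary_minus[OF S T])
  obtain F where F: "finite F" "\<And>f. (\<And>p. p \<in> F \<Longrightarrow> coeff f p = 0) \<Longrightarrow> coeff (S f - T f) m = 0"
    using finitaryE[OF U, of m] by metis
  define g where "g = (\<Sum>p\<in>F. single p (coeff f p))"
  have "coeff (f - g) p = 0" if "p \<in> F" for p
  proof -
    have "coeff g p = (\<Sum>q\<in>F. if q = p then coeff f p else 0)"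
      unfolding g_def coeff_sum by (rule sum.cong) (auto simp: single.rep_eq coeff_invalid)
    then show ?thesis using that F(1) by (simp add: coeff_diff)
  qed
  then have "coeff (S (f - g) - T (f - g)) m = 0" by (rule F(2))
  moreover have "S g = T g"
    unfolding g_def by (simp add: finitary_sum[OF S] finitary_sum[OF T] eq)
  ultimately show "coeff (S f) m = coeff (T f) m"
    by (simp add: finitary_diff[OF S] finitary_diff[OF T] coeff_diff)
qed

lemma single_empty: "single {#} a = const a"
  by (intro sser_eqI) (simp add: single.rep_eq const.rep_eq)

lemma sign_twist_self_inverse [simp]: "sign_twist n (sign_twist n a) = a"
  by (simp add: sign_twist_twist sign_twist_even)

lemma single_add_mset:
  "\<exists>b. single (add_mset v m) a = var v * single m b"
proof (cases "valid_mono (add_mset v m)")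
  case True
  then have m: "valid_mono m" by (simp add: valid_add_mset_iff)
  let ?b = "mono_sign {#v#} m * sign_twist (mono_deg {#v#}) a"
  have "coeff (single (add_mset v m) a) p = coeff (var v * single m ?b) p" for p
  proof (cases "v \<in># p")
    case True
    then obtain q where p: "p = add_mset v q" by (meson multi_member_split)
    show ?thesis using \<open>valid_mono (add_mset v m)\<close> m
      by (auto simp: p coeff_var_mult single.rep_eq sign_twist_mono_sign mono_sign_square)
  next
    case False
    then show ?thesis by (auto simp: coeff_var_mult_0 single.rep_eq)
  qed
  then show ?thesis by (metis sser_eqI)
next
  case False
  then have "single (add_mset v m) a = 0" by (intro sser_eqI) (simp add: single.rep_eq)
  moreover have "single m 0 = 0" by (intro sser_eqI) (simp add: single.rep_eq)
  ultimately have "single (add_mset v m) a = var v * single m 0"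
    by (metis mult_zero_right)
  then show ?thesis by blast
qed

text \<open>Induction over monomials, extended to infinite series by continuity. Every
  \<open>single\<close> term arises from a constant by multiplying with variables from the
  left.\<close>

lemma sser_induct_finitary:
  assumes S: "finitary S" and T: "finitary T"
    and "\<And>a. S (const a) = T (const a)"
    and "\<And>v f. S f = T f \<Longrightarrow> S (var v * f) = T (var v * f)"
  shows "S f = T f"
proof -
  have "S (single m a) = T (single m a)" for m a
  proof (induction m arbitrary: a)
    case empty
    show ?case using assms(3) by (simp add: single_empty)
  next
    case (add v m)
    obtain b where "single (add_mset v m) a = var v * single m b" using single_add_mset by blast
    then show ?case using assms(4)[OF add.IH[of b]] by simp
  qed
  then have "S = T" by (rule finitary_ext[OF S T])
  then show ?thesis by simp
qed

section \<open>Parity\<close>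

text \<open>A sign that depends on the parity of an integer, so that negative indices cause no
  trouble and products of signs normalise by adding exponents.\<close>

definition psign :: "int \<Rightarrow> 'a::ring_1"
  where "psign n = (if even n then 1 else - 1)"

lemma psign_mult [simp]: "psign m * psign n = psign (m + n)"
  by (simp add: psign_def)

lemma psign_mult' [simp]: "psign m * (psign n * a) = psign (m + n) * a"
  by (simp add: psign_def)

lemma psign_left_commute: "a * (psign n * b) = psign n * (a * b)"
  by (simp add: psign_def)

lemma psign_even [simp]: "even n \<Longrightarrow> psign n = 1" and psign_odd [simp]: "odd n \<Longrightarrow> psign n = - 1"
  by (simp_all add: psign_def)

lemma psign_cong: "even m = even n \<Longrightarrow> psign m = psign n"
  by (simp add: psign_def)

lemma finitary_psign: "finitary T \<Longrightarrow> T (psign n * f) = psign n * T f"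
  by (simp add: psign_def finitary_uminus)

lemma sign_twist_psign [simp]: "sign_twist k (psign n * a) = psign n * sign_twist k a"
  by (simp add: psign_def sign_twist_minus)

lemma sign_twist_odd: "odd n \<Longrightarrow> sign_twist n a = sign_twist 1 a"
  by (simp add: sign_twist_def)

lemma sign_twist_cong: "even m = even n \<Longrightarrow> sign_twist m a = sign_twist n a"
  by (simp add: sign_twist_def)

text \<open>Phrased as an eigenvector equation of the grading involution. Thus 0 has every parity,
  parities add under products, and n ranges over all integers; the equivalence with a vanishing odd
  or even part uses that 2 is invertible.\<close>

definition has_parity :: "int \<Rightarrow> 'a::supercomm_algebra \<Rightarrow> bool"
  where "has_parity n a \<longleftrightarrow> sign_twist 1 a = psign n * a"

lemma double_eq_0:
  assumes "a + a = (0 :: 'a::supercomm_algebra)" shows "a = 0"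
proof -
  have "a = cscale (1/2 + 1/2) a" by (simp add: cscale_one)
  also have "\<dots> = cscale (1/2) (a + a)" unfolding cscale_add_left cscale_add_right ..
  finally show ?thesis using assms by simp
qed

lemma has_parity_even_iff:
  assumes "even n" shows "has_parity n a \<longleftrightarrow> odd_part a = 0"
proof
  assume "has_parity n a"
  then have "even_part a - odd_part a = even_part a + odd_part a"
    using assms by (simp add: has_parity_def sign_twist_def parts_sum)
  then have "odd_part a + odd_part a = 0"
    by (simp add: algebra_simps eq_neg_iff_add_eq_0)
  then show "odd_part a = 0" by (rule double_eq_0)
next
  assume "odd_part a = 0"
  then show "has_parity n a"
    using assms parts_sum[of a] by (simp add: has_parity_def sign_twist_def)
qed

lemma has_parity_odd_iff:
  assumes "odd n" shows "has_parity n a \<longleftrightarrow> even_part a = 0"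
proof
  assume "has_parity n a"
  then have "even_part a - odd_part a = - (even_part a + odd_part a)"
    using assms by (simp add: has_parity_def sign_twist_def parts_sum)
  then have "even_part a = - even_part a" by simp
  then have "even_part a + even_part a = 0" by (simp only: eq_neg_iff_add_eq_0)
  then show "even_part a = 0" by (rule double_eq_0)
next
  assume "even_part a = 0"
  then show "has_parity n a"
    using assms parts_sum[of a] by (simp add: has_parity_def sign_twist_def)
qed

lemma is_even_has_parity: "is_even a \<Longrightarrow> has_parity 0 a"
  by (simp add: is_even_def has_parity_even_iff odd_part_def)

lemma is_odd_has_parity: "is_odd a \<Longrightarrow> has_parity 1 a"
  unfolding is_odd_def using even_part_odd_part[of a] by (simp add: has_parity_odd_iff)

lemma has_parity_cong: "even m = even n \<Longrightarrow> has_parity m a = has_parity n a"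
  by (simp add: has_parity_def psign_def)

lemma has_parity_sign_twist: "has_parity n a \<Longrightarrow> sign_twist k a = psign (k * n) * a"
  by (cases "even k") (auto simp: sign_twist_even sign_twist_odd[of k] has_parity_def psign_def)

text \<open>Here b may be inhomogeneous; one equation covers both commuting and anticommuting
  factors.\<close>

lemma has_parity_commute:
  assumes "has_parity n a" shows "a * b = sign_twist n b * a"
proof (cases "even n")
  case True
  then have "a = even_part a" using assms parts_sum[of a] by (simp add: has_parity_even_iff)
  then show ?thesis using True even_commute[of a b] by (simp add: sign_twist_even)
next
  case False
  then have a: "a = odd_part a" using assms parts_sum[of a] by (simp add: has_parity_odd_iff)
  have "a * b = a * even_part b + a * odd_part b"
    by (simp add: distrib_left[symmetric] parts_sum)
  also have "\<dots> = even_part b * a - odd_part b * a"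
    using odd_anticommute'[of a b] by (simp only: even_commute a[symmetric])
      simp
  finally show ?thesis using False by (simp add: sign_twist_def left_diff_distrib)
qed

lemma has_parity_mult: "has_parity i a \<Longrightarrow> has_parity j b \<Longrightarrow> has_parity (i + j) (a * b)"
  by (auto simp: has_parity_def sign_twist_mult psign_def split: if_splits)

lemma has_parity_0 [simp]: "has_parity n 0"
  by (simp add: has_parity_def)

lemma has_parity_1 [simp]: "has_parity 0 1"
  by (simp add: has_parity_def)

lemma has_parity_add: "has_parity n a \<Longrightarrow> has_parity n b \<Longrightarrow> has_parity n (a + b)"
  by (simp add: has_parity_def sign_twist_add distrib_left)

lemma has_parity_minus: "has_parity n a \<Longrightarrow> has_parity n (- a)"
  by (simp add: has_parity_def sign_twist_minus)

lemma has_parity_diff: "has_parity n a \<Longrightarrow> has_parity n b \<Longrightarrow> has_parity n (a - b)"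
  using has_parity_add[of n a "- b"] by (simp add: has_parity_minus)

lemma has_parity_psign: "has_parity n a \<Longrightarrow> has_parity n (psign k * a)"
  by (simp add: psign_def has_parity_minus)

lemma has_parity_cscale: "has_parity n a \<Longrightarrow> has_parity n (cscale c a)"
  by (simp add: has_parity_def sign_twist_cscale mult_cscale_right)

lemma has_parity_twist: "has_parity n a \<Longrightarrow> has_parity n (sign_twist k a)"
  by (simp add: has_parity_sign_twist has_parity_psign)

lemma has_parity_coeff:
  assumes "has_parity n f" shows "has_parity (n + mono_deg m) (coeff f m)"
proof -
  have "coeff (sign_twist 1 f) m = coeff (psign n * f) m" using assms by (simp add: has_parity_def)
  then show ?thesis
    by (cases "even n"; cases "even (mono_deg m)")
      (simp_all add: coeff_sign_twist has_parity_def coeff_minus, metis minus_minus)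
qed

lemma finitary_twist_fsum:
  "fsummable I f \<Longrightarrow> sign_twist n (fsum I f) = fsum I (\<lambda>i. sign_twist n (f i))"
  by (rule finitary_fsum[OF finitary_sign_twist])

lemma has_parity_fsum:
  assumes "fsummable I f" "\<And>i. i \<in> I \<Longrightarrow> has_parity n (f i)"
  shows "has_parity n (fsum I f)"
proof -
  have "sign_twist 1 (fsum I f) = fsum I (\<lambda>i. psign n * f i)"
    unfolding finitary_twist_fsum[OF assms(1)]
    by (rule fsum_cong) (use assms(2) in \<open>simp add: has_parity_def\<close>)
  also have "\<dots> = psign n * fsum I f"
    by (rule finitary_fsum[OF finitary_mult_left assms(1), symmetric])
  finally show ?thesis by (simp add: has_parity_def)
qed

section \<open>Derivations\<close>

abbreviation vpar :: "svar \<Rightarrow> int"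
  where "vpar v \<equiv> mono_deg {#v#}"

lemma has_parity_var: "has_parity (vpar v) (var v)"
  by (cases "odd_var v")
    (simp_all add: mono_deg_single has_parity_even_iff has_parity_odd_iff even_part_var odd_part_def)

lemma even_var_has_parity: "\<not> odd_var v \<Longrightarrow> has_parity 0 (var v)"
  and odd_var_has_parity: "odd_var v \<Longrightarrow> has_parity 1 (var v)"
  by (rule has_parity_cong[THEN iffD2, OF _ has_parity_var], simp add: mono_deg_single)+

lemma coeff_const_mult: "coeff (const a * f) m = a * coeff f m"
proof (cases "valid_mono m")
  case True
  have "coeff (const a * f) m = (\<Sum>x\<in>mono_splits m. if x = ({#}, m) then a * coeff f m else 0)"
    unfolding coeff_mult[OF True]
    by (intro sum.cong refl)
      (auto simp: mono_splits_def const.rep_eq sign_twist_even split: if_split_asm)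
  moreover have "({#}, m) \<in> mono_splits m" by (simp add: mono_splits_def)
  ultimately show ?thesis by (simp add: sum.delta)
qed (simp add: coeff_invalid)

lemma sign_twist_const: "sign_twist n (const a) = const (sign_twist n a)"
  by (intro sser_eqI) (simp add: coeff_sign_twist const.rep_eq)

lemma dvar_const [simp]: "dvar v (const a) = 0"
  by (intro sser_eqI) (simp add: dvar.rep_eq const.rep_eq)

lemma mono_sign_left_commute: "a * (mono_sign p q * b) = mono_sign p q * (a * (b::'a::ring_1))"
  by (cases "even (inversions p q)") (simp_all add: mono_sign_def)

lemma of_nat_left_commute: "a * (of_nat n * b) = of_nat n * (a * (b::'a::ring_1))"
  by (metis mult.assoc mult_of_nat_commute)

lemma dvar_const_mult:
  "dvar v (const a * f) = sign_twist (vpar v) (const a) * dvar v f"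
proof (rule sser_eqI)
  fix m
  show "coeff (dvar v (const a * f)) m = coeff (sign_twist (vpar v) (const a) * dvar v f) m"
    unfolding sign_twist_const coeff_const_mult dvar.rep_eq sign_twist_mult
    by (simp add: mono_sign_left_commute[of "sign_twist (vpar v) a"]
        of_nat_left_commute[of "sign_twist (vpar v) a"] del: of_nat_Suc)
qed

lemma sign_twist_var: "sign_twist (vpar u) (var v) = swap_sign u v * var v"
  by (cases "odd_var v"; cases "odd_var u")
    (simp_all add: sign_twist_def odd_part_def even_part_var swap_sign_def mono_deg_single)

lemma swap_sign_left_commute: "a * (swap_sign u v * b) = swap_sign u v * (a * (b::'a::ring_1))"
  by (simp add: swap_sign_def)

text \<open>Both sides are continuous in f, so it is enough to let f be built from constants by left
  multiplication with variables, where \<open>dvar_var_mult\<close> applies.\<close>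

lemma dvar_mult: "dvar v (f * g) = dvar v f * g + sign_twist (vpar v) f * dvar v g"
proof (rule sser_induct_finitary[where f = f])
  show "finitary (\<lambda>f. dvar v (f * g))" by (rule finitary_comp[OF finitary_dvar finitary_mult_right])
  show "finitary (\<lambda>f. dvar v f * g + sign_twist (vpar v) f * dvar v g)"
    by (intro finitary_plus finitary_comp[OF finitary_mult_right finitary_dvar]
        finitary_comp[OF finitary_mult_right finitary_sign_twist])
  show "dvar v (const a * g) = dvar v (const a) * g + sign_twist (vpar v) (const a) * dvar v g" for a
    by (simp add: dvar_const_mult)
  show "dvar v (var u * f * g) = dvar v (var u * f) * g + sign_twist (vpar v) (var u * f) * dvar v g"
    if "dvar v (f * g) = dvar v f * g + sign_twist (vpar v) f * dvar v g" for u and f :: "'a sser"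
    unfolding mult.assoc dvar_var_mult that sign_twist_mult sign_twist_var
    by (auto simp: algebra_simps swap_sign_left_commute)
qed

lemma sign_twist_dvar: "sign_twist n (dvar v f) = psign (n * vpar v) * dvar v (sign_twist n f)"
proof (rule sser_eqI)
  fix m
  have "mono_deg (add_mset v m) = vpar v + mono_deg m" using mono_deg_add[of "{#v#}" m] by simp
  then show "coeff (sign_twist n (dvar v f)) m = coeff (psign (n * vpar v) * dvar v (sign_twist n f)) m"
    by (cases "even n"; cases "even (vpar v)"; cases "even (mono_deg m)")
      (simp_all add: coeff_sign_twist dvar.rep_eq sign_twist_of_nat sign_twist_mono_sign coeff_minus
        sign_twist_twist sign_twist_minus add.commute del: of_nat_Suc of_nat_add)
qed

lemma has_parity_dvar: "has_parity n f \<Longrightarrow> has_parity (n + vpar v) (dvar v f)"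
  by (simp add: has_parity_def sign_twist_dvar finitary_psign[OF finitary_dvar] add.commute)

section \<open>Dependence on variables\<close>

lemma in_varsI: "(\<And>m. coeff f m \<noteq> 0 \<Longrightarrow> set_mset m \<subseteq> V) \<Longrightarrow> in_vars V f"
  by (simp add: in_vars_def)

lemma in_varsD: "in_vars V f \<Longrightarrow> coeff f m \<noteq> 0 \<Longrightarrow> set_mset m \<subseteq> V"
  by (simp add: in_vars_def)

lemma in_vars_mono: "in_vars V f \<Longrightarrow> V \<subseteq> W \<Longrightarrow> in_vars W f"
  by (auto simp: in_vars_def)

lemma in_vars_0 [simp]: "in_vars V 0" by (simp add: in_vars_def)

lemma in_vars_1 [simp]: "in_vars V 1" by (simp add: in_vars_def coeff_one)

lemma in_vars_const [simp]: "in_vars V (const a)" by (simp add: in_vars_def const.rep_eq)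

lemma in_vars_var [simp]: "v \<in> V \<Longrightarrow> in_vars V (var v)" by (simp add: in_vars_def var.rep_eq)

lemma in_vars_mult: "in_vars V f \<Longrightarrow> in_vars V g \<Longrightarrow> in_vars V (f * g)"
  by (rule in_varsI) (elim coeff_mult_nonzero, auto dest: in_varsD)

lemma in_vars_add: "in_vars V f \<Longrightarrow> in_vars V g \<Longrightarrow> in_vars V (f + g)"
  by (rule in_varsI) (metis add.right_neutral coeff_add in_varsD)

lemma in_vars_minus: "in_vars V f \<Longrightarrow> in_vars V (- f)"
  by (simp add: in_vars_def coeff_minus)

lemma in_vars_diff: "in_vars V f \<Longrightarrow> in_vars V g \<Longrightarrow> in_vars V (f - g)"
  using in_vars_add[of V f "- g"] by (simp add: in_vars_minus)

lemma in_vars_psign: "in_vars V f \<Longrightarrow> in_vars V (psign n * f)"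
  by (simp add: psign_def in_vars_minus)

lemma in_vars_cscale: "in_vars V f \<Longrightarrow> in_vars V (cscale c f)"
  by (rule in_varsI) (metis coeff_cscale cscale_0 in_varsD)

lemma in_vars_sign_twist: "in_vars V f \<Longrightarrow> in_vars V (sign_twist n f)"
  by (rule in_varsI) (metis coeff_sign_twist in_varsD neg_equal_0_iff_equal sign_twist_0)

lemma coeff_dvar_nonzero:
  assumes "coeff (dvar v f) m \<noteq> 0" shows "coeff f (add_mset v m) \<noteq> 0"
  using assms by (auto simp: dvar.rep_eq split: if_split_asm)

lemma in_vars_dvar: "in_vars V f \<Longrightarrow> in_vars V (dvar v f)"
  by (rule in_varsI) (drule coeff_dvar_nonzero, drule (1) in_varsD, auto)

lemma in_vars_fsum: "(\<And>i. i \<in> I \<Longrightarrow> in_vars V (f i)) \<Longrightarrow> in_vars V (fsum I f)"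
  by (rule in_varsI) (metis coeff_fsum_nonzero in_varsD)

lemma dvar_in_vars: "in_vars V f \<Longrightarrow> v \<notin> V \<Longrightarrow> dvar v f = 0"
  by (rule sser_eqI) (metis coeff_0 coeff_dvar_nonzero in_varsD insert_subset set_mset_add_mset_insert)

text \<open>Substitution of 0 for the variables in V. The evaluation at x = \<xi> = 0 and the vacuum
  functional \<open>bra10\<close> are both of this kind, so that multiplicativity is proved once for
  the two.\<close>

lift_definition kill :: "svar set \<Rightarrow> 'a::supercomm_algebra sser \<Rightarrow> 'a sser" is
  "\<lambda>V f m. if set_mset m \<inter> V = {} then f m else 0"
  by simp

lemma bra10_kill: "bra10 = kill (C_vars \<union> B_vars)"
  by (intro ext sser_eqI) (simp add: bra10.rep_eq kill.rep_eq)

lemma finitary_kill: "finitary (kill V)"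
  by (rule finitaryI[where F = "\<lambda>m. {m}"]) (auto simp: kill.rep_eq coeff_add intro!: sser_eqI)

lemma kill_mult: "kill V (f * g) = kill V f * kill V g"
proof (rule sser_eqI)
  fix m
  show "coeff (kill V (f * g)) m = coeff (kill V f * kill V g) m"
  proof (cases "valid_mono m")
    case True
    show ?thesis
    proof (cases "set_mset m \<inter> V = {}")
      case V: True
      then show ?thesis
        unfolding kill.rep_eq coeff_mult[OF True]
        by (auto simp: mono_splits_def intro!: sum.cong)
    next
      case False
      have "coeff (kill V f * kill V g) m = 0"
      proof (rule ccontr)
        assume "coeff (kill V f * kill V g) m \<noteq> 0"
        then obtain p q where "m = p + q" "coeff (kill V f) p \<noteq> 0" "coeff (kill V g) q \<noteq> 0"
          by (rule coeff_mult_nonzero)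
        then show False using False by (auto simp: kill.rep_eq split: if_split_asm)
      qed
      then show ?thesis using False by (simp add: kill.rep_eq)
    qed
  qed (simp add: coeff_invalid)
qed

lemma kill_id: "in_vars W f \<Longrightarrow> W \<inter> V = {} \<Longrightarrow> kill V f = f"
  by (rule sser_eqI) (force simp: kill.rep_eq dest: in_varsD)

lemma kill_1 [simp]: "kill V 1 = 1"
  by (intro sser_eqI) (simp add: kill.rep_eq coeff_one)

lemma kill_0 [simp]: "kill V 0 = 0"
  by (rule finitary_0[OF finitary_kill])

lemma kill_var: "v \<in> V \<Longrightarrow> kill V (var v) = 0"
  by (intro sser_eqI) (auto simp: kill.rep_eq var.rep_eq)

lemma in_vars_kill: "in_vars (- V) (kill V f)"
  by (rule in_varsI) (auto simp: kill.rep_eq split: if_split_asm)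

lemma in_vars_kill': "in_vars W f \<Longrightarrow> in_vars W (kill V f)"
  by (rule in_varsI) (auto simp: kill.rep_eq dest: in_varsD split: if_split_asm)

section \<open>The derivation \<open>D\<close> and Taylor expansion\<close>

lemma finitary_D: "finitary D_ser"
  unfolding D_ser_def
  by (intro finitary_plus finitary_dvar finitary_comp[OF finitary_mult_left finitary_dvar])

lemma vpar_simps [simp]: "vpar Vx = 0" "vpar Vxi = 1" "vpar Vtheta = 1"
  by (simp_all add: mono_deg_def)

lemma D_mult: "D_ser (f * g) = D_ser f * g + sign_twist 1 f * D_ser g"
proof -
  have "var Vxi * (f * dvar Vx g) = sign_twist 1 f * (var Vxi * dvar Vx g)"
    using has_parity_commute[OF odd_var_has_parity[of Vxi], of f] by (simp add: mult.assoc[symmetric])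
  then show ?thesis
    by (simp add: D_ser_def dvar_mult sign_twist_even algebra_simps)
qed

lemma sign_twist_D:
  fixes f :: "'a::supercomm_algebra sser"
  shows "sign_twist n (D_ser f) = psign n * D_ser (sign_twist n f)"
proof -
  have "sign_twist n (var Vxi :: 'a sser) = psign n * var Vxi"
    using has_parity_sign_twist[OF odd_var_has_parity[of Vxi], of n] by simp
  then show ?thesis
    by (simp add: D_ser_def sign_twist_add sign_twist_mult sign_twist_dvar distrib_left mult.assoc)
qed

lemma sign_twist_D_pow: "sign_twist n ((D_ser ^^ r) f) = psign (n * int r) * (D_ser ^^ r) (sign_twist n f)"
  by (induction r) (simp_all add: sign_twist_D finitary_psign[OF finitary_D] algebra_simps)

lemma has_parity_D: "has_parity n f \<Longrightarrow> has_parity (n + 1) (D_ser f)"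
  by (simp add: has_parity_def sign_twist_D finitary_psign[OF finitary_D] psign_def
      finitary_uminus[OF finitary_D])

lemma in_vars_D: "in_vars V f \<Longrightarrow> Vxi \<in> V \<Longrightarrow> in_vars V (D_ser f)"
  unfolding D_ser_def by (intro in_vars_add in_vars_mult in_vars_dvar in_vars_var)

lemma in_vars_D_pow: "in_vars V f \<Longrightarrow> Vxi \<in> V \<Longrightarrow> in_vars V ((D_ser ^^ r) f)"
  by (induction r) (simp_all add: in_vars_D)

lemma finitary_funpow: "finitary T \<Longrightarrow> finitary (T ^^ n)"
proof (induction n)
  case (Suc n)
  then show ?case using finitary_comp[of T "T ^^ n"] by (simp add: comp_def)
qed (simp add: finitary_id id_def)

lemma D_in_vars: "in_vars (- {Vx, Vxi}) f \<Longrightarrow> D_ser f = 0"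
  by (simp add: D_ser_def dvar_in_vars)

lemma D_1 [simp]: "D_ser 1 = 0"
  by (rule D_in_vars) simp

lemma D_0 [simp]: "D_ser 0 = 0"
  by (rule finitary_0[OF finitary_D])

definition xpow :: "nat \<Rightarrow> 'a::supercomm_algebra sser"
  where "xpow i = cscale (1 / fact i) (var Vx ^ i)"

text \<open>The coefficient of \<open>\<zeta>\<^sup>k\<close> in \<open>D\<^sup>l e\<^bsup>xz + \<xi>\<theta>\<^esup>\<close>.\<close>

definition emat :: "int \<Rightarrow> int \<Rightarrow> 'a::supercomm_algebra sser"
  where "emat l k = (if k < l then 0 else if even (k - l) then xpow (nat ((k - l) div 2))
    else var Vxi * xpow (nat ((k - l) div 2)))"

text \<open>The grading for which D lowers the degree by 1. In it \<open>emat l k\<close> is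
  homogeneous of degree k - l, which is the source of all finiteness statements about
  \<open>emat\<close>.\<close>

definition xweight :: "svar multiset \<Rightarrow> int"
  where "xweight m = 2 * int (count m Vx) + int (count m Vxi)"

lemma xweight_add: "xweight (p + q) = xweight p + xweight q"
  by (simp add: xweight_def)

lemma xweight_nonneg: "xweight m \<ge> 0"
  by (simp add: xweight_def)

lemma coeff_var_nonzero: "coeff (var v) m \<noteq> 0 \<Longrightarrow> m = {#v#}"
  by (simp add: var.rep_eq split: if_split_asm)

lemma coeff_xpow_nonzero:
  assumes "coeff (xpow i :: 'a::supercomm_algebra sser) m \<noteq> 0"
  shows "xweight m = 2 * int i"
proof -
  have "coeff (var Vx ^ i) m \<noteq> (0 :: 'a) \<Longrightarrow> xweight m = 2 * int i"
    by (induction i arbitrary: m)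
      (auto simp: coeff_one xweight_def split: if_split_asm elim!: coeff_mult_nonzero
        dest!: coeff_var_nonzero)
  moreover have "coeff (var Vx ^ i) m \<noteq> (0 :: 'a)"
    using assms by (auto simp: xpow_def coeff_cscale)
  ultimately show ?thesis by blast
qed

lemma coeff_emat_nonzero:
  assumes "coeff (emat l k) m \<noteq> 0" shows "k - l = xweight m"
proof (cases "even (k - l)")
  case True
  then have "coeff (xpow (nat ((k - l) div 2)) :: 'a sser) m \<noteq> 0" "k \<ge> l"
    using assms by (auto simp: emat_def split: if_split_asm)
  then show ?thesis using True by (auto dest!: coeff_xpow_nonzero)
next
  case False
  then have "coeff (var Vxi * xpow (nat ((k - l) div 2)) :: 'a sser) m \<noteq> 0" "k \<ge> l"
    using assms by (auto simp: emat_def split: if_split_asm)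
  then obtain p q where "m = p + q" "p = {#Vxi#}" "xweight q = 2 * int (nat ((k - l) div 2))"
    by (auto elim!: coeff_mult_nonzero dest!: coeff_var_nonzero coeff_xpow_nonzero)
  moreover have "xweight {#Vxi#} = 1" by (simp add: xweight_def)
  moreover have "k - l = 2 * ((k - l) div 2) + 1" using False by presburger
  ultimately show ?thesis using \<open>k \<ge> l\<close> xweight_add[of p q] by simp
qed

lemma in_vars_power: "in_vars V f \<Longrightarrow> in_vars V (f ^ n)"
  by (induction n) (auto intro: in_vars_mult)

lemma in_vars_emat: "in_vars {Vx, Vxi} (emat l k)"
  by (auto simp: emat_def xpow_def intro!: in_vars_mult in_vars_cscale in_vars_power)

lemma has_parity_power: "has_parity 0 a \<Longrightarrow> has_parity 0 (a ^ n)"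
  using has_parity_mult[of 0 a 0] by (induction n) auto

lemma has_parity_emat: "has_parity (k - l) (emat l k)"
proof -
  have x: "has_parity 0 (xpow i)" for i
    unfolding xpow_def by (intro has_parity_cscale has_parity_power even_var_has_parity) simp
  then show ?thesis
    using has_parity_mult[OF odd_var_has_parity[of Vxi] x[of "nat ((k - l) div 2)"]]
      has_parity_cong[of 0 "k - l" "xpow (nat ((k - l) div 2))"]
      has_parity_cong[of 1 "k - l" "var Vxi * xpow (nat ((k - l) div 2))"]
    by (auto simp: emat_def)
qed

lemma emat_less: "k < l \<Longrightarrow> emat l k = 0" by (simp add: emat_def)

lemma emat_refl [simp]: "emat k k = 1" by (simp add: emat_def xpow_def cscale_one)

lemma emat_shift: "emat (l + a) (k + a) = emat l k"
  by (simp add: emat_def)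

lemma dvar_even_power:
  assumes "\<not> odd_var v"
  shows "dvar v (var v ^ Suc i) = of_nat (Suc i) * (var v ^ i :: 'a::supercomm_algebra sser)"
proof (induction i)
  case 0
  show ?case using dvar_var_mult[of v v 1] by (simp add: dvar_in_vars[of "{}"])
next
  case (Suc i)
  have "dvar v (var v ^ Suc (Suc i) :: 'a sser) = var v ^ Suc i + var v * dvar v (var v ^ Suc i)"
    unfolding power_Suc[of _ "Suc i"] dvar_var_mult using assms by (simp add: swap_sign_def)
  also have "\<dots> = of_nat (Suc (Suc i)) * var v ^ Suc i"
    unfolding Suc.IH of_nat_left_commute[of "var v"] by (simp only: of_nat_Suc[of "Suc i"] distrib_right
        power_Suc mult_1_left)
  finally show ?case .
qed

lemma of_nat_cscale: "of_nat n * a = cscale (of_nat n) (a :: 'a::supercomm_algebra)"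
proof (induction n)
  case 0
  have "cscale 0 a = 0" using cscale_add_left[of 0 0 a] by simp
  then show ?case by simp
next
  case (Suc n)
  then show ?case by (simp add: distrib_right cscale_add_left cscale_one)
qed

lemma cscale_0_left [simp]: "cscale 0 a = (0 :: 'a::supercomm_algebra)"
  using of_nat_cscale[of 0 a] by simp

lemma finitary_cscale_commute:
  "dvar v (cscale c f) = cscale c (dvar v f)" "D_ser (cscale c f) = cscale c (D_ser f)"
proof -
  show d: "dvar v (cscale c f) = cscale c (dvar v f)" for v
    by (intro sser_eqI)
      (simp add: dvar.rep_eq coeff_cscale sign_twist_cscale mult_cscale_right)
  show "D_ser (cscale c f) = cscale c (D_ser f)"
    by (simp add: D_ser_def d cscale_add_right mult_cscale_right)
qed

lemma dvar_xpow: "dvar Vx (xpow (Suc i)) = xpow i" "dvar Vxi (xpow i) = 0" "dvar Vx (xpow 0) = 0"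
proof -
  have "dvar Vx (xpow (Suc i)) = cscale (1 / fact (Suc i) * of_nat (Suc i)) (var Vx ^ i)"
    unfolding xpow_def finitary_cscale_commute
    by (subst dvar_even_power) (simp_all only: odd_var.simps of_nat_cscale cscale_cscale not_False_eq_True)
  also have "1 / fact (Suc i) * of_nat (Suc i) = (1 / fact i :: complex)"
    by (simp add: field_simps del: of_nat_Suc)
  finally show "dvar Vx (xpow (Suc i)) = xpow i" by (simp add: xpow_def)
  show "dvar Vxi (xpow i) = 0"
    by (rule dvar_in_vars[of "{Vx}"]) (auto simp: xpow_def intro!: in_vars_cscale in_vars_power)
  show "dvar Vx (xpow 0) = 0"
    by (rule dvar_in_vars[of "{}"]) (auto simp: xpow_def intro!: in_vars_cscale)
qed

lemma xi_square: "var Vxi * (var Vxi * f) = 0"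
  using var_var[of Vxi Vxi f] double_eq_0[of "var Vxi * (var Vxi * f)"]
  by (simp add: swap_sign_def eq_neg_iff_add_eq_0)

text \<open>For an even difference, D turns x^i / i! into \<xi> x^(i-1) / (i-1)!; for an odd one it
  turns \<xi> x^i / i! into x^i / i!, the other term dying by \<xi>^2 = 0.\<close>

lemma D_emat: "D_ser (emat l k) = emat (l + 1) k"
proof (cases "k < l")
  case True
  then show ?thesis by (simp add: emat_def)
next
  case kl: False
  show ?thesis
  proof (cases "even (k - l)")
    case True
    define i where "i = nat ((k - l) div 2)"
    have k: "k = l + 2 * int i" using True kl by (simp add: i_def)
    show ?thesis
    proof (cases i)
      case 0
      then show ?thesis by (simp add: k emat_def xpow_def cscale_one)
    next
      case (Suc j)
      have "(l + 2 * int i - (l + 1)) div 2 = int j" using Suc by simp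
      moreover have "nat (1 + int j) = Suc j" by simp
      ultimately show ?thesis
        using Suc by (simp add: k emat_def D_ser_def dvar_xpow)
    qed
  next
    case False
    define i where "i = nat ((k - l) div 2)"
    have "k = l + 2 * ((k - l) div 2) + 1" using False by presburger
    then have "k = l + 2 * int i + 1" using kl by (simp add: i_def)
    then show ?thesis
      by (simp add: emat_def D_ser_def dvar_var_mult dvar_xpow swap_sign_def xi_square)
  qed
qed

abbreviation ev0 :: "'a::supercomm_algebra sser \<Rightarrow> 'a sser"
  where "ev0 \<equiv> kill {Vx, Vxi}"

lemma ev0_emat: "ev0 (emat l k) = (if k = l then 1 else 0)"
proof (cases "k = l")
  case False
  have "coeff (ev0 (emat l k)) m = (0 :: 'a)" for m
  proof (rule ccontr)
    assume "coeff (ev0 (emat l k)) m \<noteq> (0 :: 'a)"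
    then have "coeff (emat l k) m \<noteq> (0 :: 'a)" and "Vx \<notin># m" "Vxi \<notin># m"
      by (auto simp: kill.rep_eq split: if_split_asm)
    then have "k - l = 0"
      by (auto dest!: coeff_emat_nonzero simp: xweight_def not_in_iff)
    then show False using False by simp
  qed
  then show ?thesis using False by (auto intro: sser_eqI)
qed simp

lemma D_ev0 [simp]: "D_ser (ev0 f) = 0"
  by (rule D_in_vars) (rule in_vars_kill)

lemma of_nat_mult_eq_0:
  assumes "of_nat (Suc n) * a = (0 :: 'a::supercomm_algebra)" shows "a = 0"
proof -
  have "cscale (1 / of_nat (Suc n)) (cscale (of_nat (Suc n)) a) = 0"
    using assms by (simp only: of_nat_cscale cscale_0)
  then show ?thesis by (simp add: cscale_cscale cscale_one del: of_nat_Suc)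
qed

lemma mono_sign_mult_eq_0: "mono_sign p q * a = 0 \<longleftrightarrow> a = (0 :: 'a::ring_1)"
  by (cases "even (inversions p q)") (simp_all add: mono_sign_def)

lemma sign_twist_eq_0 [simp]: "sign_twist n a = 0 \<longleftrightarrow> a = 0"
  by (metis sign_twist_0 sign_twist_self_inverse)

lemma coeff_dvar_eq_0_iff:
  "valid_mono m \<Longrightarrow> coeff (dvar v f) m = 0 \<longleftrightarrow> coeff f (add_mset v m) = 0"
  using of_nat_mult_eq_0[of "count m v"]
  by (auto simp: dvar.rep_eq mono_sign_mult_eq_0 simp del: of_nat_Suc of_nat_add
      dest!: of_nat_mult_eq_0)

lemma coeff_var_mult_eq_0_iff:
  "valid_mono (add_mset v m) \<Longrightarrow> coeff (var v * f) (add_mset v m) = 0 \<longleftrightarrow> coeff f m = 0"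
  by (simp add: coeff_var_mult mono_sign_mult_eq_0)

text \<open>Induction on \<open>xweight\<close>, with j arbitrary because D replaces X j by X (j +
  1). Monomials of degree 0 are controlled by \<open>ev0\<close>, all others by a coefficient of D
  (X j) of smaller degree.\<close>

lemma taylor_unique:
  assumes D: "\<And>j::int. D_ser (X j) = X (j + 1)" and ev: "\<And>j. ev0 (X j) = 0"
  shows "X j = 0"
proof -
  have "coeff (X j) m = 0" if "xweight m = int n" for n m j
    using that
  proof (induction n arbitrary: m j)
    case 0
    then have "Vx \<notin># m" "Vxi \<notin># m" by (auto simp: xweight_def not_in_iff)
    then have "coeff (X j) m = coeff (ev0 (X j)) m" by (simp add: kill.rep_eq)
    then show ?case by (simp add: ev)
  next
    case (Suc n)
    show ?case
    proof (cases "valid_mono m")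
      case valid: True
      have "Vx \<in># m \<or> Vxi \<in># m"
        using Suc.prems by (cases "count m Vx = 0") (auto simp: xweight_def not_in_iff)
      moreover have ?thesis if xi: "Vxi \<in># m"
      proof -
        obtain p where m: "m = add_mset Vxi p" using xi by (meson multi_member_split)
        have p: "valid_mono p" "Vxi \<notin># p" using valid by (auto simp: m valid_add_mset_iff)
        have "xweight p = int n" using Suc.prems by (simp add: m xweight_def)
        then have "coeff (D_ser (X j)) p = 0" unfolding D by (rule Suc.IH)
        then have "coeff (dvar Vxi (X j)) p = 0"
          using coeff_var_mult_0[OF p(2), of "dvar Vx (X j)"] by (simp add: D_ser_def coeff_add)
        then show ?thesis using p(1) by (simp add: coeff_dvar_eq_0_iff m)
      qed
      \<comment> \<open>In D the x-derivative carries a factor \<xi>, so it is read off at the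
        monomial p with \<xi> adjoined. This lowers the degree by 1 only, which is enough, and the
        \<xi>-derivative cannot interfere since \<xi>^2 = 0.\<close>
      moreover have ?thesis if x: "Vx \<in># m" and xi: "Vxi \<notin># m"
      proof -
        obtain p where m: "m = add_mset Vx p" using x by (meson multi_member_split)
        have v: "valid_mono p" "Vxi \<notin># p" "valid_mono (add_mset Vxi p)"
          using valid xi by (auto simp: m valid_add_mset_iff)
        have "xweight (add_mset Vxi p) = int n" using Suc.prems by (simp add: m xweight_def)
        then have "coeff (D_ser (X j)) (add_mset Vxi p) = 0" unfolding D by (rule Suc.IH)
        moreover have "\<not> valid_mono (add_mset Vxi (add_mset Vxi p))"
          by (simp add: valid_add_mset_iff)
        then have "coeff (dvar Vxi (X j)) (add_mset Vxi p) = 0"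
          using v by (simp add: coeff_dvar_eq_0_iff coeff_invalid)
        ultimately have "coeff (var Vxi * dvar Vx (X j)) (add_mset Vxi p) = 0"
          by (simp add: D_ser_def coeff_add)
        then show ?thesis using v by (simp add: coeff_var_mult_eq_0_iff coeff_dvar_eq_0_iff m)
      qed
      ultimately show ?thesis by blast
    qed (simp add: coeff_invalid)
  qed
  then show ?thesis
    by (intro sser_eqI) (metis coeff_0 xweight_nonneg nonneg_int_cases)
qed

lemma fsummable_emat: "fsummable UNIV (emat l)"
proof (rule fsummableI)
  fix m
  show "finite {k \<in> UNIV. coeff (emat l k) m \<noteq> 0}"
    by (rule finite_subset[of _ "{l + xweight m}"]) (auto dest: coeff_emat_nonzero)
qed

lemma fsummable_emat': "fsummable UNIV (\<lambda>l. emat l k)"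
proof (rule fsummableI)
  fix m
  show "finite {l \<in> UNIV. coeff (emat l k) m \<noteq> 0}"
    by (rule finite_subset[of _ "{k - xweight m}"]) (auto dest: coeff_emat_nonzero)
qed

text \<open>Both sides satisfy the recursion under D and agree at x = \<xi> = 0. The index runs over
  all integers since the formula is applied to operators D^j Q with negative j as well.\<close>

lemma taylor_expansion:
  assumes D: "\<And>j::int. D_ser (X j) = X (j + 1)"
  shows "X j = fsum UNIV (\<lambda>l. emat j l * ev0 (X l))"
proof -
  define T where "T j = fsum UNIV (\<lambda>l. emat j l * ev0 (X l))" for j
  have s: "fsummable UNIV (\<lambda>l. emat j l * ev0 (X l))" for j
    by (rule fsummable_mult_right[OF fsummable_emat])
  have "X j - T j = 0"
  proof (rule taylor_unique)
    show "D_ser (X j - T j) = X (j + 1) - T (j + 1)" for j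
      by (simp add: finitary_diff[OF finitary_D] D T_def finitary_fsum[OF finitary_D s] D_mult D_emat)
    show "ev0 (X j - T j) = 0" for j
    proof -
      have "ev0 (T j) = fsum UNIV (\<lambda>l. ev0 (emat j l) * ev0 (ev0 (X l)))"
        by (simp add: T_def finitary_fsum[OF finitary_kill s] kill_mult)
      also have "\<dots> = ev0 (emat j j) * ev0 (ev0 (X j))"
        by (rule fsum_single) (auto simp: ev0_emat)
      also have "\<dots> = ev0 (X j)" by (simp add: kill_id[OF in_vars_kill])
      finally show ?thesis by (simp add: finitary_diff[OF finitary_kill])
    qed
  qed
  then show ?thesis by (simp add: T_def)
qed

section \<open>The algebra of super-pseudodifferential operators\<close>

lemma weight_add: "weight (p + q) = weight p + weight q"
  by (simp add: weight_def)

text \<open>Three values of a are used: a = 0 bounds the order alone, a = 1 is the growth condition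
  of \<open>Ehat\<close>, and a = 3 is the condition under which products are associative.\<close>

definition fil :: "nat \<Rightarrow> int \<Rightarrow> 'a::supercomm_algebra sdop \<Rightarrow> bool"
  where "fil a d P \<longleftrightarrow> (\<forall>n m. coeff (P n) m \<noteq> 0 \<longrightarrow> int a * int (weight m) - n \<ge> d)"

text \<open>Products are associative as soon as three times the weight minus the order is bounded below; the
  algebra of operators with this property contains \<open>\<E>^\<close>, and \<open>U - 1\<close> and \<open>S - 1\<close> both increase
  this difference. A factor 2 would not do: \<open>t\<^sub>1 \<xi> D\<^sup>2\<close> has weight 1 and order 2.\<close>

definition admissible :: "'a::supercomm_algebra sdop \<Rightarrow> bool"
  where "admissible P \<longleftrightarrow> (\<exists>d. fil 3 d P)"

lemma filD: "fil a d P \<Longrightarrow> coeff (P n) m \<noteq> 0 \<Longrightarrow> int a * int (weight m) - n \<ge> d"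
  by (simp add: fil_def)

lemma filD3: "fil 3 d P \<Longrightarrow> coeff (P n) m \<noteq> 0 \<Longrightarrow> 3 * int (weight m) - n \<ge> d"
  by (simp add: fil_def)

lemma filI: "(\<And>n m. coeff (P n) m \<noteq> 0 \<Longrightarrow> int a * int (weight m) - n \<ge> d) \<Longrightarrow> fil a d P"
  by (simp add: fil_def)

lemma fil_mono: "fil a d P \<Longrightarrow> a \<le> b \<Longrightarrow> d' \<le> d \<Longrightarrow> fil b d' P"
  unfolding fil_def
proof (intro allI impI)
  fix n m assume *: "\<forall>n m. coeff (P n) m \<noteq> 0 \<longrightarrow> d \<le> int a * int (weight m) - n"
    and ab: "a \<le> b" "d' \<le> d" and nz: "coeff (P n) m \<noteq> 0"
  have "int a * int (weight m) \<le> int b * int (weight m)" using ab by (intro mult_right_mono) auto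
  then show "d' \<le> int b * int (weight m) - n" using * ab nz by force
qed

lemma fil_admissible: "fil a d P \<Longrightarrow> a \<le> 3 \<Longrightarrow> admissible P"
  unfolding admissible_def using fil_mono[of a d P 3 d] by auto

lemma admissibleE: assumes "admissible P" obtains d where "fil 3 d P"
  using assms by (auto simp: admissible_def)

lemma fil_D_pow: "fil a (- n) (D_pow n)"
  by (rule filI) (auto simp: D_pow_def coeff_one split: if_split_asm)

lemma fil_add: "fil a d P \<Longrightarrow> fil a d Q \<Longrightarrow> fil a d (\<lambda>n. P n + Q n)"
  unfolding fil_def coeff_add by (metis add.right_neutral)

lemma fil_minus: "fil a d P \<Longrightarrow> fil a d (\<lambda>n. - P n)"
  by (simp add: fil_def coeff_minus)

lemma fil_diff: "fil a d P \<Longrightarrow> fil a d Q \<Longrightarrow> fil a d (\<lambda>n. P n - Q n)"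
  using fil_add[of a d P "\<lambda>n. - Q n"] by (simp add: fil_minus)

lemma fil_cscale: "fil a d P \<Longrightarrow> fil a d (\<lambda>n. cscale c (P n))"
  unfolding fil_def coeff_cscale by (metis cscale_0)

lemma fil_fsum: "(\<And>i. i \<in> I \<Longrightarrow> fil a d (P i)) \<Longrightarrow> fil a d (\<lambda>n. fsum I (\<lambda>i. P i n))"
  by (rule filI) (elim coeff_fsum_nonzero, auto dest: filD)

lemma admissible_uniform:
  assumes "admissible P" "admissible Q" obtains d where "fil 3 d P" "fil 3 d Q"
  using assms unfolding admissible_def by (metis fil_mono linorder_linear order_refl)

lemma admissible_minus: "admissible P \<Longrightarrow> admissible (\<lambda>n. - P n)"
  using fil_minus admissible_def by blast

lemma admissible_diff: "admissible P \<Longrightarrow> admissible Q \<Longrightarrow> admissible (\<lambda>n. P n - Q n)"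
  by (metis admissible_def admissible_uniform fil_diff)

lemma admissible_cscale: "admissible P \<Longrightarrow> admissible (\<lambda>n. cscale c (P n))"
  using fil_cscale admissible_def by blast

lemma coeff_sign_twist_eq_0 [simp]: "coeff (sign_twist n f) m = 0 \<longleftrightarrow> coeff f m = 0"
  by (simp add: coeff_sign_twist)

lemma fil_sign_twist: "fil a d P \<Longrightarrow> fil a d (\<lambda>n. sign_twist k (P n))"
  by (simp add: fil_def)

lemma coeff_D_nonzero:
  assumes "coeff (D_ser f) m \<noteq> 0"
  obtains p where "coeff f p \<noteq> 0" "weight p = weight m"
proof -
  have "coeff (dvar Vxi f) m \<noteq> 0 \<or> coeff (var Vxi * dvar Vx f) m \<noteq> 0"
    using assms by (auto simp: D_ser_def coeff_add)
  then consider "coeff f (add_mset Vxi m) \<noteq> 0"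
    | q where "m = {#Vxi#} + q" "coeff f (add_mset Vx q) \<noteq> 0"
    by (auto dest!: coeff_dvar_nonzero coeff_var_nonzero elim!: coeff_mult_nonzero)
  then show ?thesis by cases (auto intro!: that simp: weight_def)
qed

lemma coeff_D_pow_nonzero:
  assumes "coeff ((D_ser ^^ r) f) m \<noteq> 0"
  obtains p where "coeff f p \<noteq> 0" "weight p = weight m"
proof -
  have "\<exists>p. coeff f p \<noteq> 0 \<and> weight p = weight m" using assms
    by (induction r arbitrary: m) (auto elim!: coeff_D_nonzero, metis)
  then show ?thesis using that by blast
qed

lemma fil_D: "fil a d P \<Longrightarrow> fil a d (\<lambda>n. D_ser (P n))"
  by (rule filI) (metis coeff_D_nonzero filD)

text \<open>The coefficient of \<open>D\<^bsup>m-r\<^esup>\<close> in \<open>D\<^sup>m f\<close>, for any integer \<open>r\<close>.\<close>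

definition leib :: "int \<Rightarrow> int \<Rightarrow> 'a::supercomm_algebra sser \<Rightarrow> 'a sser"
  where "leib m r f = (if r < 0 then 0 else leibniz m (nat r) f)"

lemma coeff_leib_nonzero:
  assumes "coeff (leib m r f) q \<noteq> 0"
  obtains p where "coeff f p \<noteq> 0" "weight p = weight q" "r \<ge> 0"
proof -
  have r: "r \<ge> 0" using assms by (auto simp: leib_def split: if_split_asm)
  then have "coeff ((D_ser ^^ nat r) (sign_twist (m - r) f)) q \<noteq> 0"
    using assms by (auto simp: leib_def leibniz_def coeff_cscale)
  then obtain p where "coeff (sign_twist (m - r) f) p \<noteq> 0" "weight p = weight q"
    by (rule coeff_D_pow_nonzero)
  then show ?thesis using that r by simp
qed

lemma finitary_leib: "finitary (leib m r :: 'a::supercomm_algebra sser \<Rightarrow> 'a sser)"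
proof (cases "r < 0")
  case False
  have "finitary (\<lambda>f. cscale (super_binom m (nat r)) ((D_ser ^^ nat r) (sign_twist (m - int (nat r)) f)))"
    by (intro finitary_comp[OF finitary_cscale] finitary_comp[OF finitary_funpow[OF finitary_D]]
        finitary_sign_twist)
  with False show ?thesis unfolding leib_def leibniz_def by simp
next
  case True
  then have "leib m r = (\<lambda>f :: 'a sser. 0)" by (simp add: leib_def fun_eq_iff)
  then show ?thesis by (simp add: finitary_zero)
qed

section \<open>Super-binomial coefficients and the Leibniz formula\<close>

lemma cscale_uminus: "cscale (- c) a = - cscale c (a :: 'a::supercomm_algebra)"
  using cscale_add_left[of c "- c" a] by (simp add: eq_neg_iff_add_eq_0 add.commute)

lemma cscale_neg_one: "cscale (- 1) a = - (a :: 'a::supercomm_algebra)"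
  by (simp add: cscale_uminus cscale_one)

text \<open>Pascal's rule in super form. It is the ordinary Pascal rule when m and r are both odd;
  in the other cases the halves do not move or a term vanishes.\<close>

lemma super_binom_Suc:
  "super_binom (m + 1) (Suc r) =
    super_binom m r + (if even r then - 1 else 1) * super_binom m (Suc r)"
proof -
  have P: "(a + 1 :: complex) gchoose Suc k = (a gchoose Suc k) + (a gchoose k)" for a k
    using gbinomial_Suc_Suc[of a k] by simp
  consider a where "m = 2 * a" | a where "m = 2 * a + 1" by (metis evenE oddE)
  moreover consider b where "r = 2 * b" | b where "r = 2 * b + 1" by (metis evenE oddE)
  ultimately show ?thesis
  proof cases
    case (1 a)
    then show ?thesis
      by (cases "even r") (auto simp: super_binom_def elim!: evenE oddE)
  next
    case (2 a)
    then show ?thesis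
    proof (cases "even r")
      case True
      then show ?thesis using 2 by (auto simp: super_binom_def elim!: evenE)
    next
      case False
      then obtain b where r: "r = 2 * b + 1" by (rule oddE)
      have "(2 * a + 1 + 1) div 2 = a + 1" "(2 * a + 1) div 2 = a" "Suc (2 * b + 1) div 2 = Suc b"
        "(2 * b + 1) div 2 = b" by auto
      then show ?thesis
        using P[of "of_int a" b] unfolding 2 r super_binom_def by (simp add: add.commute)
    qed
  qed
qed

lemma super_binom_0 [simp]: "super_binom m 0 = 1"
  by (simp add: super_binom_def)

text \<open>This compares coefficients in D^(m+1) f = D (D^m f), for every integer m. The sign from
  commuting the twist with D^r is the sign in the super Pascal rule.\<close>

lemma leib_rec: "leib (m + 1) r f = D_ser (leib m (r - 1) f) + sign_twist 1 (leib m r f)"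
proof (cases "r \<le> 0")
  case True
  then show ?thesis
    by (auto simp: leib_def leibniz_def cscale_one sign_twist_twist add.commute)
next
  case False
  define s where "s = nat (r - 1)"
  have r: "r = int (Suc s)" using False by (simp add: s_def)
  have n: "nat r = Suc s" "nat (r - 1) = s" "nat (int (Suc s)) = Suc s" "nat (int (Suc s) - 1) = s"
    "nat (1 + int s) = Suc s"
    using r by simp_all
  have t: "sign_twist 1 ((D_ser ^^ Suc s) (sign_twist (m - int (Suc s)) f)) =
      psign (int (Suc s)) * (D_ser ^^ Suc s) (sign_twist (m - int s) f)"
    by (simp only: sign_twist_D_pow sign_twist_twist) simp
  have e1: "D_ser (leib m (r - 1) f) =
      cscale (super_binom m s) ((D_ser ^^ Suc s) (sign_twist (m - int s) f))"
    using False by (simp add: leib_def leibniz_def n finitary_cscale_commute)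
  have "leib m r f = cscale (super_binom m (Suc s)) ((D_ser ^^ Suc s) (sign_twist (m - int (Suc s)) f))"
    unfolding leib_def leibniz_def n using False by simp
  then have e2: "sign_twist 1 (leib m r f) =
      psign (int (Suc s)) * cscale (super_binom m (Suc s)) ((D_ser ^^ Suc s) (sign_twist (m - int s) f))"
    by (simp only: sign_twist_cscale t mult_cscale_right)
  have "leib (m + 1) r f = cscale (super_binom (m + 1) (Suc s)) ((D_ser ^^ Suc s) (sign_twist (m - int s) f))"
    by (simp add: leib_def leibniz_def r n del: funpow.simps)
  also have "\<dots> = cscale (super_binom m s) ((D_ser ^^ Suc s) (sign_twist (m - int s) f)) +
    psign (int (Suc s)) * cscale (super_binom m (Suc s)) ((D_ser ^^ Suc s) (sign_twist (m - int s) f))"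
    unfolding super_binom_Suc cscale_add_left
    by (cases "even s") (simp_all add: psign_def cscale_uminus)
  also have "\<dots> = D_ser (leib m (r - 1) f) + sign_twist 1 (leib m r f)"
    unfolding e1 e2 ..
  finally show ?thesis .
qed

lemma leib_0_left: "leib 0 r f = (if r = 0 then f else 0)"
proof (cases "r \<le> 0")
  case False
  have "super_binom 0 (nat r) = 0"
  proof (cases "even r")
    case True
    then obtain j where "r = 2 * j" by (rule evenE)
    then have "nat r = 2 * Suc (nat (j - 1))" using False by simp
    then show ?thesis by (simp add: super_binom_def)
  qed (use False in \<open>simp add: super_binom_def even_nat_iff\<close>)
  then show ?thesis using False by (simp add: leib_def leibniz_def)
qed (auto simp: leib_def leibniz_def cscale_one sign_twist_even)

section \<open>Products of operators computed row by row\<close>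

lemma op_mult_nonzero:
  assumes "coeff ((P \<odot> Q) k) m \<noteq> 0"
  obtains i n p q q' where "k \<le> i + n" "m = p + q'" "coeff (P i) p \<noteq> 0"
    "coeff (Q n) q \<noteq> 0" "weight q = weight q'"
proof -
  obtain i n where *: "i + n \<ge> k" "coeff (P i * leibniz i (nat (i + n - k)) (Q n)) m \<noteq> 0"
    using assms unfolding op_mult_def by (auto elim!: coeff_fsum_nonzero)
  then have "coeff (P i * leib i (i + n - k) (Q n)) m \<noteq> 0" by (simp add: leib_def)
  then obtain p q where pq: "m = p + q" "coeff (P i) p \<noteq> 0" "coeff (leib i (i + n - k) (Q n)) q \<noteq> 0"
    by (rule coeff_mult_nonzero)
  from pq(3) obtain r where "coeff (Q n) r \<noteq> 0" "weight r = weight q" by (rule coeff_leib_nonzero)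
  then show ?thesis using that[of i n p q r] *(1) pq by simp
qed

text \<open>Derivatives in x and \<xi> do not change the weight, and the Leibniz formula only lowers
  orders.\<close>

lemma fil_mult: "fil a d P \<Longrightarrow> fil a e Q \<Longrightarrow> fil a (d + e) (P \<odot> Q)"
proof (rule filI)
  fix k m assume P: "fil a d P" and Q: "fil a e Q" and "coeff ((P \<odot> Q) k) m \<noteq> 0"
  then obtain i n p q q' where *: "k \<le> i + n" "m = p + q'" "coeff (P i) p \<noteq> 0"
    "coeff (Q n) q \<noteq> 0" "weight q = weight q'" by (elim op_mult_nonzero)
  then show "d + e \<le> int a * int (weight m) - k"
    using filD[OF P *(3)] filD[OF Q *(4)] by (simp add: weight_add distrib_left)
qed

lemma admissible_mult: "admissible P \<Longrightarrow> admissible Q \<Longrightarrow> admissible (P \<odot> Q)"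
  unfolding admissible_def using fil_mult by blast

lemma admissible_D_pow: "admissible (D_pow n)"
  using fil_D_pow admissible_def by blast

lemma fil_D_pow_mult: "fil a d Q \<Longrightarrow> fil a (d - n) (D_pow n \<odot> Q)"
  using fil_mult[OF fil_D_pow[of a n]] by (simp add: add.commute)

lemma fsum_neutral_superset:
  "J \<subseteq> I \<Longrightarrow> (\<And>i. i \<in> I \<Longrightarrow> i \<notin> J \<Longrightarrow> f i = 0) \<Longrightarrow> fsum I f = fsum J f"
  by (subst (2) fsum_restrict) (auto intro: fsum_cong)

lemma D_pow_mult: "(D_pow i \<odot> Q) k = fsum UNIV (\<lambda>n. leib i (i + n - k) (Q n))"
proof -
  have "(D_pow i \<odot> Q) k = fsum {(m, n). m + n \<ge> k} (\<lambda>(m, n). D_pow i m * leib m (m + n - k) (Q n))"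
    unfolding op_mult_def by (rule fsum_cong) (auto simp: leib_def)
  also have "\<dots> = fsum UNIV (\<lambda>(m, n). D_pow i m * leib m (m + n - k) (Q n))"
    by (rule fsum_neutral_superset[symmetric]) (auto simp: leib_def)
  also have "\<dots> = fsum ({i} \<times> UNIV) (\<lambda>(m, n). D_pow i m * leib m (m + n - k) (Q n))"
    by (rule fsum_neutral_superset) (auto simp: D_pow_def split: if_split_asm)
  also have "\<dots> = fsum UNIV (\<lambda>n. leib i (i + n - k) (Q n))"
    by (subst fsum_reindex[of "\<lambda>n. (i, n)" UNIV]) (auto simp: bij_betw_def inj_on_def D_pow_def)
  finally show ?thesis .
qed

lemma fsummable_bounded:
  assumes "\<And>m. finite (N m)" "\<And>n i m. coeff (f n i) m \<noteq> 0 \<Longrightarrow> n \<in> N m"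
    and "\<And>n. fsummable UNIV (f n)"
  shows "fsummable UNIV (\<lambda>(n, i). f n i)"
proof (rule fsummableI)
  fix m
  have "{x \<in> UNIV. coeff (case x of (n, i) \<Rightarrow> f n i) m \<noteq> 0} \<subseteq>
      (SIGMA n:N m. {i \<in> UNIV. coeff (f n i) m \<noteq> 0})"
    using assms(2) by auto
  then show "finite {x \<in> UNIV. coeff (case x of (n, i) \<Rightarrow> f n i) m \<noteq> 0}"
    by (rule finite_subset) (use assms in \<open>auto simp: fsummable_def\<close>)
qed

lemma coeff_leib_bound:
  assumes "fil 3 d Q" "coeff (leib i r (Q n)) m \<noteq> 0"
  shows "r \<ge> 0 \<and> 3 * int (weight m) - n \<ge> d"
proof -
  from assms(2) obtain p where "coeff (Q n) p \<noteq> 0" "weight p = weight m" "r \<ge> 0"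
    by (rule coeff_leib_nonzero)
  then show ?thesis using filD3[OF assms(1)] by metis
qed

lemma weight_le: "m = p + q \<Longrightarrow> weight p \<le> weight m \<and> weight q \<le> weight m"
  by (simp add: weight_add)

lemma coeff_mult_bound:
  assumes P: "fil 3 d P" and Q: "fil 3 e Q" and nz: "coeff (P i * Q j) m \<noteq> 0"
  shows "3 * int (weight m) - i \<ge> d \<and> 3 * int (weight m) - j \<ge> e"
proof -
  obtain p q where pq: "m = p + q" "coeff (P i) p \<noteq> 0" "coeff (Q j) q \<noteq> 0"
    using nz by (rule coeff_mult_nonzero)
  show ?thesis using filD3[OF P pq(2)] filD3[OF Q pq(3)] weight_le[OF pq(1)] by auto
qed

lemma fsummable_leib:
  assumes Q: "fil 3 d Q" shows "fsummable UNIV (\<lambda>n. leib i (i + n - k) (Q n))"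
proof (rule fsummableI)
  fix m
  have "n \<in> {k - i .. 3 * int (weight m) - d}" if "coeff (leib i (i + n - k) (Q n)) m \<noteq> 0" for n
    using coeff_leib_bound[OF Q that] by auto
  then show "finite {n \<in> UNIV. coeff (leib i (i + n - k) (Q n)) m \<noteq> 0}"
    by - (rule finite_subset[of _ "{k - i .. 3 * int (weight m) - d}"], auto)
qed

lemma fsummable_rows:
  assumes P: "fil 3 d P" and X: "\<And>m. fil 3 (e - m) (X m)"
  shows "fsummable UNIV (\<lambda>m. P m * X m k)"
proof (rule fsummableI)
  fix \<mu>
  have "m \<in> {e + k - 3 * int (weight \<mu>) .. 3 * int (weight \<mu>) - d}"
    if "coeff (P m * X m k) \<mu> \<noteq> 0" for m
    using coeff_mult_bound[OF P X that] by auto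
  then show "finite {m \<in> UNIV. coeff (P m * X m k) \<mu> \<noteq> 0}"
    by - (rule finite_subset[of _ "{e + k - 3 * int (weight \<mu>) .. 3 * int (weight \<mu>) - d}"], auto)
qed

lemma fsummable_op_rows:
  assumes "admissible P" "admissible Q"
  shows "fsummable UNIV (\<lambda>m. P m * (D_pow m \<odot> Q) k)"
proof -
  obtain d e where "fil 3 d P" "fil 3 e Q" using assms by (auto simp: admissible_def)
  then show ?thesis by (intro fsummable_rows) (auto intro: fil_D_pow_mult)
qed

text \<open>Reduces a product to left multiplication by powers of D. For a fixed monomial the
  filtrations of P and Q bound m and n from above, and m + n \<ge> k bounds them from below.\<close>

lemma op_mult_rows:
  assumes "admissible P" "admissible Q"
  shows "(P \<odot> Q) k = fsum UNIV (\<lambda>m. P m * (D_pow m \<odot> Q) k)"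
proof -
  obtain d e where P: "fil 3 d P" and Q: "fil 3 e Q" using assms by (auto simp: admissible_def)
  have s: "fsummable UNIV (\<lambda>(m, n). P m * leib m (m + n - k) (Q n))"
  proof (rule fsummableI)
    fix \<mu>
    let ?w = "3 * int (weight \<mu>)"
    have "(m, n) \<in> {k - (?w - e) .. ?w - d} \<times> {k - (?w - d) .. ?w - e}"
      if "coeff (P m * leib m (m + n - k) (Q n)) \<mu> \<noteq> 0" for m n
    proof -
      obtain p q where pq: "\<mu> = p + q" "coeff (P m) p \<noteq> 0" "coeff (leib m (m + n - k) (Q n)) q \<noteq> 0"
        using \<open>coeff (P m * leib m (m + n - k) (Q n)) \<mu> \<noteq> 0\<close> by (rule coeff_mult_nonzero)
      from pq(3) obtain r where r: "coeff (Q n) r \<noteq> 0" "weight r = weight q" "m + n - k \<ge> 0"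
        by (rule coeff_leib_nonzero)
      show ?thesis using filD3[OF P pq(2)] filD3[OF Q r(1)] r(2,3) weight_le[OF pq(1)] by auto
    qed
    then show "finite {x \<in> UNIV. coeff (case x of (m, n) \<Rightarrow> P m * leib m (m + n - k) (Q n)) \<mu> \<noteq> 0}"
      by - (rule finite_subset[of _ "{k - (?w - e) .. ?w - d} \<times> {k - (?w - d) .. ?w - e}"], auto)
  qed
  have "(P \<odot> Q) k = fsum {(m, n). m + n \<ge> k} (\<lambda>(m, n). P m * leib m (m + n - k) (Q n))"
    unfolding op_mult_def by (rule fsum_cong) (auto simp: leib_def)
  also have "\<dots> = fsum UNIV (\<lambda>(m, n). P m * leib m (m + n - k) (Q n))"
    by (rule fsum_neutral_superset[symmetric]) (auto simp: leib_def)
  also have "\<dots> = fsum UNIV (\<lambda>m. fsum UNIV (\<lambda>n. P m * leib m (m + n - k) (Q n)))"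
    by (rule fsum_prod[OF s, symmetric])
  also have "\<dots> = fsum UNIV (\<lambda>m. P m * (D_pow m \<odot> Q) k)"
    unfolding D_pow_mult
    by (rule fsum_cong) (rule finitary_fsum[OF finitary_mult_left fsummable_leib[OF Q], symmetric])
  finally show ?thesis .
qed

lemma D_pow_0_mult [simp]: "D_pow 0 \<odot> Q = Q"
proof
  fix k
  have "(D_pow 0 \<odot> Q) k = fsum UNIV (\<lambda>n. if n = k then Q n else 0)"
    unfolding D_pow_mult by (rule fsum_cong) (simp add: leib_0_left)
  then show "(D_pow 0 \<odot> Q) k = Q k" by (simp add: fsum_delta)
qed

section \<open>Left multiplication by D and associativity\<close>

text \<open>\<open>D f = D(f) + (-1)\<^bsup>|f|\<^esup> f D\<close>.\<close>

definition opD :: "'a::supercomm_algebra sdop \<Rightarrow> 'a sdop"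
  where "opD Q k = D_ser (Q k) + sign_twist 1 (Q (k - 1))"

lemma opD_D_pow:
  assumes "admissible Q" shows "opD (D_pow i \<odot> Q) = D_pow (i + 1) \<odot> Q"
proof
  fix k
  obtain d where Q: "fil 3 d Q" using assms by (auto simp: admissible_def)
  note s = fsummable_leib[OF Q]
  have "opD (D_pow i \<odot> Q) k = fsum UNIV (\<lambda>n. D_ser (leib i (i + n - k) (Q n))) +
      fsum UNIV (\<lambda>n. sign_twist 1 (leib i (i + n - (k - 1)) (Q n)))"
    unfolding opD_def D_pow_mult
    by (simp add: finitary_fsum[OF finitary_D s] finitary_fsum[OF finitary_sign_twist s])
  also have "\<dots> = fsum UNIV (\<lambda>n. D_ser (leib i (i + n - k) (Q n)) +
      sign_twist 1 (leib i (i + n - (k - 1)) (Q n)))"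
    by (rule fsum_add[symmetric])
      (rule finitary_fsummable[OF finitary_D s] finitary_fsummable[OF finitary_sign_twist s])+
  also have "\<dots> = (D_pow (i + 1) \<odot> Q) k"
    unfolding D_pow_mult leib_rec by (rule fsum_cong) (simp add: algebra_simps)
  finally show "opD (D_pow i \<odot> Q) k = (D_pow (i + 1) \<odot> Q) k" .
qed

text \<open>If D Z = 0 then the coefficient of D^(k-1) in Z is, up to twist, minus the derivative of
  that of D^k. So a nonzero coefficient forces nonzero coefficients of the same weight at
  arbitrarily high orders, which admissibility forbids.\<close>

lemma opD_inj:
  assumes Z: "admissible Z" and 0: "\<And>k. opD Z k = 0"
  shows "Z k = 0"
proof -
  obtain d where d: "fil 3 d Z" using Z by (auto simp: admissible_def)
  have *: "coeff (Z (k - int n)) m \<noteq> 0 \<Longrightarrow> \<exists>p. coeff (Z k) p \<noteq> 0 \<and> weight p = weight m" for n m k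
  proof (induction n arbitrary: k m)
    case (Suc n)
    have "sign_twist 1 (Z (k - int n - 1)) = - D_ser (Z (k - int n))"
      using 0[of "k - int n"] by (simp add: opD_def eq_neg_iff_add_eq_0 add.commute)
    then have "coeff (sign_twist 1 (Z (k - int n - 1))) m = - coeff (D_ser (Z (k - int n))) m"
      by (simp add: coeff_minus)
    moreover have "coeff (sign_twist 1 (Z (k - int n - 1))) m \<noteq> 0"
      using Suc.prems by (simp add: algebra_simps)
    ultimately have "coeff (D_ser (Z (k - int n))) m \<noteq> 0" by simp
    then obtain p where "coeff (Z (k - int n)) p \<noteq> 0" "weight p = weight m"
      by (rule coeff_D_nonzero)
    then show ?case using Suc.IH by metis
  qed auto
  have "coeff (Z k) m = 0" for m
  proof (rule ccontr)
    assume "coeff (Z k) m \<noteq> 0"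
    \<comment> \<open>Chosen so that the order k + n exceeds 3 weight - d, the largest order that
      occurs at this weight.\<close>
    define n where "n = nat (3 * int (weight m) - d - k + 1)"
    have "coeff (Z (k + int n - int n)) m \<noteq> 0" using \<open>coeff (Z k) m \<noteq> 0\<close> by simp
    then obtain p where "coeff (Z (k + int n)) p \<noteq> 0" "weight p = weight m" using * by blast
    then have "3 * int (weight m) - (k + int n) \<ge> d" using filD3[OF d] by metis
    moreover have "int n \<ge> 3 * int (weight m) - d - k + 1" by (simp add: n_def)
    ultimately show False by linarith
  qed
  then show ?thesis by (intro sser_eqI) simp
qed

lemma opD_cancel:
  assumes "admissible Z" "admissible W" "opD Z = opD W" shows "Z = W"
proof
  fix k
  have "admissible (\<lambda>k. Z k - W k)"
    using assms(1,2) by (rule admissible_diff)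
  moreover have "opD (\<lambda>k. Z k - W k) k = 0" for k
  proof -
    have "opD (\<lambda>k. Z k - W k) k = opD Z k - opD W k"
      by (simp add: opD_def finitary_diff[OF finitary_D] finitary_diff[OF finitary_sign_twist]
          algebra_simps)
    then show ?thesis using fun_cong[OF assms(3), of k] by simp
  qed
  ultimately have "Z k - W k = 0" by (rule opD_inj)
  then show "Z k = W k" by simp
qed

text \<open>Upwards from 0 this is the recursion itself; downwards it is the injectivity of D. It
  stands in for multiplying by the inverse of D.\<close>

lemma opD_sequence_unique:
  assumes Z: "\<And>j::int. opD (Z j) = Z (j + 1)" "\<And>j. admissible (Z j)"
    and W: "\<And>j. opD (W j) = W (j + 1)" "\<And>j. admissible (W j)"
    and 0: "Z 0 = W 0"
  shows "Z j = W j"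
proof -
  have "Z (int n) = W (int n)" for n
    by (induction n) (use 0 Z(1)[symmetric] W(1)[symmetric] in \<open>simp_all add: add.commute[of 1]\<close>)
  moreover have "Z (- int n) = W (- int n)" for n
  proof (induction n)
    case (Suc n)
    show ?case
      by (rule opD_cancel[OF Z(2) W(2)]) (use Suc in \<open>simp add: Z(1) W(1)\<close>)
  qed (use 0 in simp)
  ultimately show ?thesis by (metis int_cases2)
qed

text \<open>The derivation rule for D on each product of coefficients, followed by D X_n = X_(n+1)
  for the rows X_n of R and a shift of the summation index.\<close>

lemma opD_mult:
  assumes Q: "admissible Q" and R: "admissible R"
  shows "opD (Q \<odot> R) = opD Q \<odot> R"
proof
  fix k
  obtain d e where d: "fil 3 d Q" and e: "fil 3 e R" using Q R by (auto simp: admissible_def)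
  let ?X = "\<lambda>n. D_pow n \<odot> R"
  have X: "fil 3 (e - n) (?X n)" for n by (rule fil_D_pow_mult[OF e])
  have X1: "fil 3 (e - 1 - n) (?X (n + 1))" for n using X[of "n + 1"] by (simp add: algebra_simps)
  have rec: "D_ser (?X n k) + sign_twist 1 (?X n (k - 1)) = ?X (n + 1) k" for n
    using fun_cong[OF opD_D_pow[OF R], of n k] by (simp add: opD_def)
  have adm: "admissible (opD Q)"
  proof -
    have "fil 3 (d - 1) (\<lambda>n. D_ser (Q n))" using fil_D[OF d] by (rule fil_mono) auto
    moreover have "fil 3 (d - 1) (\<lambda>n. sign_twist 1 (Q (n - 1)))"
      by (rule filI) (use d in \<open>auto dest!: filD3\<close>)
    ultimately show ?thesis
      unfolding opD_def[abs_def] admissible_def using fil_add by blast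
  qed
  have sD: "fsummable UNIV (\<lambda>n. D_ser (Q n) * ?X n k)"
    by (rule fsummable_rows[OF fil_D[OF d] X])
  have sT: "fsummable UNIV (\<lambda>n. sign_twist 1 (Q n) * ?X (n + 1) k)"
    by (rule fsummable_rows[OF fil_sign_twist[OF d] X1])
  have s: "fsummable UNIV (\<lambda>n. Q n * ?X n k)" for k by (rule fsummable_rows[OF d X])
  have "opD (Q \<odot> R) k = fsum UNIV (\<lambda>n. D_ser (Q n * ?X n k)) + fsum UNIV (\<lambda>n. sign_twist 1 (Q n * ?X n (k - 1)))"
    unfolding opD_def op_mult_rows[OF Q R]
    by (simp add: finitary_fsum[OF finitary_D s] finitary_fsum[OF finitary_sign_twist s])
  also have "\<dots> = fsum UNIV (\<lambda>n. D_ser (Q n * ?X n k) + sign_twist 1 (Q n * ?X n (k - 1)))"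
    by (rule fsum_add[symmetric])
      (rule finitary_fsummable[OF finitary_D s] finitary_fsummable[OF finitary_sign_twist s])+
  also have "\<dots> = fsum UNIV (\<lambda>n. D_ser (Q n) * ?X n k + sign_twist 1 (Q n) * ?X (n + 1) k)"
    by (rule fsum_cong) (simp add: D_mult sign_twist_mult rec[symmetric] distrib_left add.assoc)
  also have "\<dots> = fsum UNIV (\<lambda>n. D_ser (Q n) * ?X n k) + fsum UNIV (\<lambda>n. sign_twist 1 (Q n) * ?X (n + 1) k)"
    by (rule fsum_add[OF sD sT])
  also have "fsum UNIV (\<lambda>n. sign_twist 1 (Q n) * ?X (n + 1) k) =
      fsum UNIV (\<lambda>n. sign_twist 1 (Q (n - 1)) * ?X n k)"
    using fsum_shift[of "\<lambda>n. sign_twist 1 (Q (n - 1)) * ?X n k" 1] by simp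
  also have "fsum UNIV (\<lambda>n. D_ser (Q n) * ?X n k) + \<dots> =
      fsum UNIV (\<lambda>n. D_ser (Q n) * ?X n k + sign_twist 1 (Q (n - 1)) * ?X n k)"
    by (rule fsum_add[symmetric, OF sD])
      (use fsummable_shift[OF sT, of "-1"] in simp)
  also have "\<dots> = (opD Q \<odot> R) k"
    unfolding op_mult_rows[OF adm R] opD_def by (rule fsum_cong) (simp add: distrib_right)
  finally show "opD (Q \<odot> R) k = (opD Q \<odot> R) k" .
qed

text \<open>Both sides are D-sequences that start with Q R at j = 0; no identity between products of
  super-binomials enters.\<close>

lemma D_pow_mult_assoc:
  assumes Q: "admissible Q" and R: "admissible R"
  shows "D_pow j \<odot> (Q \<odot> R) = (D_pow j \<odot> Q) \<odot> R"
proof (rule opD_sequence_unique)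
  show "opD (D_pow j \<odot> (Q \<odot> R)) = D_pow (j + 1) \<odot> (Q \<odot> R)" for j
    by (rule opD_D_pow[OF admissible_mult[OF Q R]])
  show "opD (D_pow j \<odot> Q \<odot> R) = D_pow (j + 1) \<odot> Q \<odot> R" for j
    by (simp add: opD_mult[OF admissible_mult[OF admissible_D_pow Q] R] opD_D_pow[OF Q])
qed (auto intro: admissible_mult admissible_D_pow Q R)

lemma op_mult_assoc:
  assumes P: "admissible P" and Q: "admissible Q" and R: "admissible R"
  shows "P \<odot> Q \<odot> R = P \<odot> (Q \<odot> R)"
proof
  fix k
  obtain d e f where d: "fil 3 d P" and e: "fil 3 e Q" and f: "fil 3 f R"
    using P Q R by (auto simp: admissible_def)
  let ?F = "\<lambda>n m. P m * (D_pow m \<odot> Q) n * (D_pow n \<odot> R) k"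
  have s: "fsummable UNIV (\<lambda>(n, m). ?F n m)"
  proof (rule fsummableI)
    fix \<mu>
    let ?w = "3 * int (weight \<mu>)"
    \<comment> \<open>The three filtrations give m \<le> w - d, n \<le> m + w - e and n \<ge> f + k
      - w, where w is three times the weight; together they confine n and m to a finite box.\<close>
    let ?A = "{f + k - ?w .. ?w - e + ?w - d} \<times> {f + k - ?w + e - ?w .. ?w - d}"
    have "(n, m) \<in> ?A" if nz: "coeff (?F n m) \<mu> \<noteq> 0" for n m
    proof -
      obtain p q where pq: "\<mu> = p + q" "coeff (P m * (D_pow m \<odot> Q) n) p \<noteq> 0"
        "coeff ((D_pow n \<odot> R) k) q \<noteq> 0"
        using nz by (rule coeff_mult_nonzero)
      obtain p1 p2 where pp: "p = p1 + p2" "coeff (P m) p1 \<noteq> 0" "coeff ((D_pow m \<odot> Q) n) p2 \<noteq> 0"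
        using pq(2) by (rule coeff_mult_nonzero)
      show ?thesis
        using filD3[OF d pp(2)] filD3[OF fil_D_pow_mult[OF e] pp(3)]
          filD3[OF fil_D_pow_mult[OF f] pq(3)] weight_le[OF pp(1)] weight_le[OF pq(1)] by auto
    qed
    then show "finite {x \<in> UNIV. coeff (case x of (n, m) \<Rightarrow> ?F n m) \<mu> \<noteq> 0}"
      by - (rule finite_subset[of _ ?A], auto)
  qed
  have "(P \<odot> Q \<odot> R) k = fsum UNIV (\<lambda>n. fsum UNIV (?F n))"
    unfolding op_mult_rows[OF admissible_mult[OF P Q] R]
    by (rule fsum_cong) (simp add: op_mult_rows[OF P Q]
        finitary_fsum[OF finitary_mult_right fsummable_op_rows[OF P Q]])
  also have "\<dots> = fsum UNIV (\<lambda>m. fsum UNIV (\<lambda>n. ?F n m))" by (rule fsum_swap[OF s])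
  also have "\<dots> = fsum UNIV (\<lambda>m. P m * (D_pow m \<odot> Q \<odot> R) k)"
    by (rule fsum_cong) (simp add: mult.assoc op_mult_rows[OF admissible_mult[OF admissible_D_pow Q] R]
        finitary_fsum[OF finitary_mult_left fsummable_op_rows[OF admissible_mult[OF admissible_D_pow Q] R]])
  also have "\<dots> = (P \<odot> (Q \<odot> R)) k"
    by (simp add: op_mult_rows[OF P admissible_mult[OF Q R]] D_pow_mult_assoc[OF Q R])
  finally show "(P \<odot> Q \<odot> R) k = (P \<odot> (Q \<odot> R)) k" .
qed

lemma leib_const: "leib m r 1 = (if r = 0 then 1 else 0)"
proof (cases "r \<le> 0")
  case False
  then obtain s where "nat r = Suc s" by (metis not_le_imp_less zero_less_nat_eq gr0_implies_Suc)
  moreover have "(D_ser ^^ Suc s) 1 = (0 :: 'a sser)"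
    by (induction s) auto
  ultimately show ?thesis using False by (simp add: leib_def leibniz_def del: funpow.simps)
qed (auto simp: leib_def leibniz_def cscale_one)

lemma D_pow_mult_D_pow: "D_pow i \<odot> D_pow j = D_pow (i + j)"
proof
  fix k
  have "(D_pow i \<odot> D_pow j) k = fsum UNIV (\<lambda>n. leib i (i + n - k) (D_pow j n))"
    by (rule D_pow_mult)
  also have "\<dots> = leib i (i + j - k) (D_pow j j)"
    by (rule fsum_single) (auto simp: D_pow_def finitary_0[OF finitary_leib])
  also have "\<dots> = D_pow (i + j) k" by (auto simp: D_pow_def leib_const)
  finally show "(D_pow i \<odot> D_pow j) k = D_pow (i + j) k" .
qed

lemma op_mult_D_pow_0 [simp]: assumes "admissible P" shows "P \<odot> D_pow 0 = P"
proof
  fix k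
  have "(P \<odot> D_pow 0) k = fsum UNIV (\<lambda>m. if m = k then P m else 0)"
    unfolding op_mult_rows[OF assms admissible_D_pow] D_pow_mult_D_pow
    by (rule fsum_cong) (auto simp: D_pow_def)
  then show "(P \<odot> D_pow 0) k = P k" by (simp add: fsum_delta)
qed

section \<open>Linearity of the product, also in infinite sums\<close>

lemma op_mult_fsum_right:
  assumes P: "admissible P" and Q: "\<And>i. fil 3 d (Q i)" and s: "\<And>k. fsummable UNIV (\<lambda>i. Q i k)"
  shows "(P \<odot> (\<lambda>k. fsum UNIV (\<lambda>i. Q i k))) k = fsum UNIV (\<lambda>i. (P \<odot> Q i) k)" (is ?eq)
    and "fsummable UNIV (\<lambda>i. (P \<odot> Q i) k)"
proof -
  obtain e where e: "fil 3 e P" using P by (auto simp: admissible_def)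
  have Qa: "admissible (Q i)" for i using Q by (auto simp: admissible_def)
  have S: "fil 3 d (\<lambda>k. fsum UNIV (\<lambda>i. Q i k))" by (rule fil_fsum) (rule Q)
  then have Sa: "admissible (\<lambda>k. fsum UNIV (\<lambda>i. Q i k))" by (auto simp: admissible_def)
  have s1: "fsummable UNIV (\<lambda>(n, i). leib m (m + n - k) (Q i n))" for m
  proof (rule fsummable_bounded[where N = "\<lambda>\<mu>. {k - m .. 3 * int (weight \<mu>) - d}"])
    show "n \<in> {k - m .. 3 * int (weight \<mu>) - d}" if "coeff (leib m (m + n - k) (Q i n)) \<mu> \<noteq> 0" for n i \<mu>
      using coeff_leib_bound[OF Q that] by auto
  qed (auto intro: finitary_fsummable[OF finitary_leib s])
  have r1: "(D_pow m \<odot> (\<lambda>k. fsum UNIV (\<lambda>i. Q i k))) k = fsum UNIV (\<lambda>i. (D_pow m \<odot> Q i) k)"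
    and s2: "fsummable UNIV (\<lambda>i. (D_pow m \<odot> Q i) k)" for m
    unfolding D_pow_mult finitary_fsum[OF finitary_leib s]
    using fsum_swap[OF s1[of m]] fsummable_fsum[OF fsummable_swap[OF s1[of m]]] by simp_all
  have s3: "fsummable UNIV (\<lambda>(m, i). P m * (D_pow m \<odot> Q i) k)"
  proof (rule fsummable_bounded[where N = "\<lambda>\<mu>. {d + k - 3 * int (weight \<mu>) .. 3 * int (weight \<mu>) - e}"])
    show "m \<in> {d + k - 3 * int (weight \<mu>) .. 3 * int (weight \<mu>) - e}"
      if "coeff (P m * (D_pow m \<odot> Q i) k) \<mu> \<noteq> 0" for m i \<mu>
      using coeff_mult_bound[OF e fil_D_pow_mult[OF Q] that] by auto
  qed (auto intro: fsummable_mult_left s2)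
  show "fsummable UNIV (\<lambda>i. (P \<odot> Q i) k)"
    unfolding op_mult_rows[OF P Qa] by (rule fsummable_fsum[OF fsummable_swap[OF s3]])
  show ?eq
    unfolding op_mult_rows[OF P Qa] op_mult_rows[OF P Sa] r1
    using fsum_swap[OF s3] by (simp add: finitary_fsum[OF finitary_mult_left s2])
qed

lemma op_mult_fsum_left:
  assumes R: "admissible R" and Q: "\<And>i. fil 3 d (Q i)" and s: "\<And>k. fsummable UNIV (\<lambda>i. Q i k)"
  shows "((\<lambda>k. fsum UNIV (\<lambda>i. Q i k)) \<odot> R) k = fsum UNIV (\<lambda>i. (Q i \<odot> R) k)" (is ?eq)
    and "fsummable UNIV (\<lambda>i. (Q i \<odot> R) k)"
proof -
  obtain e where e: "fil 3 e R" using R by (auto simp: admissible_def)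
  have Qa: "admissible (Q i)" for i using Q by (auto simp: admissible_def)
  have S: "fil 3 d (\<lambda>k. fsum UNIV (\<lambda>i. Q i k))" by (rule fil_fsum) (rule Q)
  then have Sa: "admissible (\<lambda>k. fsum UNIV (\<lambda>i. Q i k))" by (auto simp: admissible_def)
  have s3: "fsummable UNIV (\<lambda>(m, i). Q i m * (D_pow m \<odot> R) k)"
  proof (rule fsummable_bounded[where N = "\<lambda>\<mu>. {e + k - 3 * int (weight \<mu>) .. 3 * int (weight \<mu>) - d}"])
    show "m \<in> {e + k - 3 * int (weight \<mu>) .. 3 * int (weight \<mu>) - d}"
      if "coeff (Q i m * (D_pow m \<odot> R) k) \<mu> \<noteq> 0" for m i \<mu>
      using coeff_mult_bound[OF Q fil_D_pow_mult[OF e] that] by auto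
  qed (auto intro: fsummable_mult_right s)
  show "fsummable UNIV (\<lambda>i. (Q i \<odot> R) k)"
    unfolding op_mult_rows[OF Qa R] by (rule fsummable_fsum[OF fsummable_swap[OF s3]])
  show ?eq
    unfolding op_mult_rows[OF Qa R] op_mult_rows[OF Sa R]
    using fsum_swap[OF s3] by (simp add: finitary_fsum[OF finitary_mult_right s])
qed

lemma op_mult_add_left:
  assumes P: "admissible P" "admissible P'" and Q: "admissible Q"
  shows "(\<lambda>n. P n + P' n) \<odot> Q = (\<lambda>k. (P \<odot> Q) k + (P' \<odot> Q) k)"
proof
  fix k
  obtain d where "fil 3 d P" "fil 3 d P'" using admissible_uniform[OF P] .
  then have "admissible (\<lambda>n. P n + P' n)" using fil_add admissible_def by blast
  then show "((\<lambda>n. P n + P' n) \<odot> Q) k = (P \<odot> Q) k + (P' \<odot> Q) k"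
    by (simp add: op_mult_rows P Q distrib_right fsum_add fsummable_op_rows)
qed

lemma op_mult_add_right:
  assumes P: "admissible P" and Q: "admissible Q" "admissible Q'"
  shows "P \<odot> (\<lambda>n. Q n + Q' n) = (\<lambda>k. (P \<odot> Q) k + (P \<odot> Q') k)"
proof
  fix k
  obtain d where d: "fil 3 d Q" "fil 3 d Q'" using admissible_uniform[OF Q] .
  then have a: "admissible (\<lambda>n. Q n + Q' n)" using fil_add admissible_def by blast
  have "(D_pow m \<odot> (\<lambda>n. Q n + Q' n)) k = (D_pow m \<odot> Q) k + (D_pow m \<odot> Q') k" for m
    by (simp add: D_pow_mult finitary_add[OF finitary_leib] fsum_add fsummable_leib[OF d(1)]
        fsummable_leib[OF d(2)])
  then show "(P \<odot> (\<lambda>n. Q n + Q' n)) k = (P \<odot> Q) k + (P \<odot> Q') k"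
    by (simp add: op_mult_rows P Q a distrib_left fsum_add fsummable_op_rows)
qed

lemma op_mult_cscale_left:
  assumes PQ: "admissible P" "admissible Q"
  shows "(\<lambda>n. cscale c (P n)) \<odot> Q = (\<lambda>k. cscale c ((P \<odot> Q) k))"
proof
  fix k
  have "admissible (\<lambda>n. cscale c (P n))" using PQ(1) fil_cscale admissible_def by blast
  then show "((\<lambda>n. cscale c (P n)) \<odot> Q) k = cscale c ((P \<odot> Q) k)"
    by (simp add: op_mult_rows PQ mult_cscale_left finitary_fsum[OF finitary_cscale] fsummable_op_rows)
qed

lemma leib_cscale: "leib m r (cscale c f) = cscale c (leib m r f)"
proof -
  have "(D_ser ^^ n) (cscale c g) = cscale c ((D_ser ^^ n) g)" for n and g :: "'a sser"
    by (induction n) (simp_all add: finitary_cscale_commute)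
  then show ?thesis
    by (simp add: leib_def leibniz_def sign_twist_cscale cscale_cscale mult.commute)
qed

lemma op_mult_cscale_right:
  assumes PQ: "admissible P" "admissible Q"
  shows "P \<odot> (\<lambda>n. cscale c (Q n)) = (\<lambda>k. cscale c ((P \<odot> Q) k))"
proof
  fix k
  obtain d where d: "fil 3 d Q" using PQ(2) by (auto simp: admissible_def)
  have a: "admissible (\<lambda>n. cscale c (Q n))" using PQ(2) fil_cscale admissible_def by blast
  have "(D_pow m \<odot> (\<lambda>n. cscale c (Q n))) k = cscale c ((D_pow m \<odot> Q) k)" for m
    by (simp add: D_pow_mult leib_cscale finitary_fsum[OF finitary_cscale] fsummable_leib[OF d])
  then show "(P \<odot> (\<lambda>n. cscale c (Q n))) k = cscale c ((P \<odot> Q) k)"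
    by (simp add: op_mult_rows PQ a mult_cscale_right finitary_fsum[OF finitary_cscale] fsummable_op_rows)
qed

lemma op_mult_minus_left: "admissible P \<Longrightarrow> admissible Q \<Longrightarrow> (\<lambda>n. - P n) \<odot> Q = (\<lambda>k. - (P \<odot> Q) k)"
  using op_mult_cscale_left[of P Q "- 1"] by (simp add: cscale_neg_one)

lemma op_mult_minus_right: "admissible P \<Longrightarrow> admissible Q \<Longrightarrow> P \<odot> (\<lambda>n. - Q n) = (\<lambda>k. - (P \<odot> Q) k)"
  using op_mult_cscale_right[of P Q "- 1"] by (simp add: cscale_neg_one)

lemma op_mult_diff_left:
  "admissible P \<Longrightarrow> admissible P' \<Longrightarrow> admissible Q \<Longrightarrow>
    (\<lambda>n. P n - P' n) \<odot> Q = (\<lambda>k. (P \<odot> Q) k - (P' \<odot> Q) k)"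
  using op_mult_add_left[of P "\<lambda>n. - P' n" Q] by (simp add: admissible_minus op_mult_minus_left)

lemma op_mult_diff_right:
  "admissible P \<Longrightarrow> admissible Q \<Longrightarrow> admissible Q' \<Longrightarrow>
    P \<odot> (\<lambda>n. Q n - Q' n) = (\<lambda>k. (P \<odot> Q) k - (P \<odot> Q') k)"
  using op_mult_add_right[of P Q "\<lambda>n. - Q' n"] by (simp add: admissible_minus op_mult_minus_right)

section \<open>Unipotent operators\<close>

lemma fsum_Suc:
  assumes "fsummable UNIV f"
  shows "fsum UNIV f = f 0 + fsum UNIV (\<lambda>n. f (Suc n))"
proof -
  have "fsum UNIV f = fsum UNIV (\<lambda>n. (if n = 0 then f n else 0) + (if n \<in> range Suc then f n else 0))"
    by (rule fsum_cong) (auto simp: image_iff gr0_conv_Suc)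
  also have "\<dots> = fsum UNIV (\<lambda>n. if n = 0 then f n else 0) + fsum UNIV (\<lambda>n. if n \<in> range Suc then f n else 0)"
    by (rule fsum_add; rule fsummableI, rule finite_subset[OF _ fsummableD[OF assms]]) auto
  also have "fsum UNIV (\<lambda>n. if n \<in> range Suc then f n else 0) = fsum (range Suc) f"
    by (rule fsum_restrict[symmetric]) simp
  also have "\<dots> = fsum UNIV (\<lambda>n. f (Suc n))"
    by (rule fsum_reindex) (simp add: bij_betw_def)
  finally show ?thesis by (simp add: fsum_delta)
qed

lemma fsum_triangle:
  fixes f :: "nat \<Rightarrow> nat \<Rightarrow> 'a::supercomm_algebra sser"
  assumes s: "fsummable UNIV (\<lambda>(i, j). f i j)"
  shows "fsum UNIV (\<lambda>(i, j). f i j) = fsum UNIV (\<lambda>n. \<Sum>i\<le>n. f i (n - i))"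
proof -
  let ?S = "SIGMA n:UNIV. {..n::nat}"
  have bij: "bij_betw (\<lambda>(n, i). (i, n - i)) ?S UNIV"
    by (rule bij_betw_byWitness[where f' = "\<lambda>(i, j). (i + j, i)"]) auto
  have "fsum UNIV (\<lambda>(i, j). f i j) = fsum ?S (\<lambda>(n, i). f i (n - i))"
    by (subst fsum_reindex[OF bij]) (auto intro: fsum_cong)
  also have "\<dots> = fsum UNIV (\<lambda>n. fsum {..n} (\<lambda>i. f i (n - i)))"
  proof (rule fsum_Sigma[symmetric])
    have "fsummable ?S (\<lambda>x. (case (case x of (n, i) \<Rightarrow> (i, n - i)) of (i, j) \<Rightarrow> f i j))"
      by (rule fsummable_reindex[OF s]) (use bij in \<open>auto simp: bij_betw_def\<close>)
    then show "fsummable ?S (\<lambda>(n, i). f i (n - i))" by (simp add: split_def)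
  qed
  finally show ?thesis by (simp add: fsum_finite)
qed

definition unipotent :: "'a::supercomm_algebra sdop \<Rightarrow> bool"
  where "unipotent P \<longleftrightarrow> fil 3 1 (\<lambda>n. P n - D_pow 0 n)"

lemma fil_D_pow_0: "fil a 0 (D_pow 0)"
  using fil_D_pow[of a 0] by simp

lemma fil_op_pow: "fil a d X \<Longrightarrow> fil a (int j * d) (op_pow X j)"
proof (induction j)
  case (Suc j)
  then have "fil a (d + int j * d) (X \<odot> op_pow X j)" by (intro fil_mult)
  then show ?case by (simp add: algebra_simps)
qed (simp add: fil_D_pow_0)

lemma fil_op_pow_1: "fil 3 1 X \<Longrightarrow> fil 3 (int j) (op_pow X j)"
  using fil_op_pow[of 3 1 X j] by simp

lemma fsummable_graded:
  assumes "\<And>j::nat. fil 3 (int j) (X j)" shows "fsummable UNIV (\<lambda>j. X j k)"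
proof (rule fsummableI)
  fix m
  have "j \<in> {..nat (3 * int (weight m) - k)}" if "coeff (X j k) m \<noteq> 0" for j
    using filD3[OF assms that] by auto
  then show "finite {j \<in> UNIV. coeff (X j k) m \<noteq> 0}"
    by - (rule finite_subset[of _ "{..nat (3 * int (weight m) - k)}"], auto)
qed

definition geometric :: "'a::supercomm_algebra sdop \<Rightarrow> 'a sdop"
  where "geometric X k = fsum UNIV (\<lambda>j. op_pow X j k)"

definition op_inverse :: "'a::supercomm_algebra sdop \<Rightarrow> 'a sdop"
  where "op_inverse P = geometric (\<lambda>n. D_pow 0 n - P n)"

lemma fil_geometric: "fil a d X \<Longrightarrow> d \<ge> 0 \<Longrightarrow> fil a 0 (geometric X)"
  unfolding geometric_def[abs_def]
  by (rule fil_fsum) (auto intro!: fil_mono[OF fil_op_pow])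

lemma geometric_eq:
  assumes X: "fil 3 1 X"
  shows "X \<odot> geometric X = (\<lambda>k. geometric X k - D_pow 0 k)"
proof
  fix k
  note s = fsummable_graded[of "op_pow X", OF fil_op_pow_1[OF X]]
  have "(X \<odot> geometric X) k = fsum UNIV (\<lambda>j. (X \<odot> op_pow X j) k)"
    unfolding geometric_def[abs_def]
    by (rule op_mult_fsum_right(1)[where d = 0])
      (use s fil_admissible[OF X] in \<open>auto intro: fil_mono[OF fil_op_pow_1[OF X]]\<close>)
  then show "(X \<odot> geometric X) k = geometric X k - D_pow 0 k"
    using fsum_Suc[OF s, of k] by (simp add: geometric_def)
qed

lemma unipotent_fil: "unipotent P \<Longrightarrow> fil 3 0 P"
proof -
  assume "unipotent P"
  then have "fil 3 0 (\<lambda>n. P n - D_pow 0 n)" unfolding unipotent_def by (rule fil_mono) auto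
  from fil_add[OF this fil_D_pow_0] show ?thesis by simp
qed

lemma unipotent_admissible: "unipotent P \<Longrightarrow> admissible P"
  using unipotent_fil admissible_def by blast

lemma fil_flip: "fil a d (\<lambda>n. P n - Q n) \<Longrightarrow> fil a d (\<lambda>n. Q n - P n)"
  using fil_minus[of a d "\<lambda>n. P n - Q n"] by simp

text \<open>The inverse minus 1 is X times the geometric series in X. The parameter a is kept free:
  a = 0 shows that inverses of elements of \<open>Gamma\<close> again have the form 1 + negative
  powers, a = 1 that they lie in \<open>Ehat\<close>.\<close>

lemma fil_op_inverse:
  assumes P: "unipotent P" and d: "fil a d (\<lambda>n. P n - D_pow 0 n)" "d \<ge> 0"
  shows "fil a d (\<lambda>n. op_inverse P n - D_pow 0 n)"
proof -
  define X where "X = (\<lambda>n. D_pow 0 n - P n)"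
  have X: "fil 3 1 X" "fil a d X" unfolding X_def using P d(1) by (auto simp: unipotent_def intro: fil_flip)
  have "fil a (d + 0) (X \<odot> geometric X)" by (rule fil_mult[OF X(2) fil_geometric[OF X(2) d(2)]])
  then show ?thesis unfolding geometric_eq[OF X(1)] by (simp add: op_inverse_def X_def)
qed

lemma unipotent_op_inverse: "unipotent P \<Longrightarrow> unipotent (op_inverse P)"
  using fil_op_inverse[of P 3 1] by (simp add: unipotent_def)

lemma op_inverse_right:
  assumes P: "unipotent P" shows "P \<odot> op_inverse P = D_pow 0"
proof -
  define X where "X = (\<lambda>n. D_pow 0 n - P n)"
  have X: "fil 3 1 X" unfolding X_def using P by (auto simp: unipotent_def intro: fil_flip)
  have g: "admissible (geometric X)" using fil_geometric[OF X] by (auto simp: admissible_def)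
  have "P = (\<lambda>n. D_pow 0 n - X n)" by (simp add: X_def)
  then have "P \<odot> op_inverse P = (\<lambda>n. D_pow 0 n - X n) \<odot> geometric X"
    by (simp add: op_inverse_def X_def)
  also have "\<dots> = (\<lambda>k. (D_pow 0 \<odot> geometric X) k - (X \<odot> geometric X) k)"
    by (rule op_mult_diff_left[OF admissible_D_pow _ g]) (rule fil_admissible[OF X], simp)
  also have "\<dots> = D_pow 0" by (simp add: geometric_eq[OF X])
  finally show ?thesis .
qed

text \<open>Right inverses suffice: if Q is a right inverse of P and R one of Q, then P = P Q R =
  R.\<close>

lemma op_inverse_left:
  assumes P: "unipotent P" shows "op_inverse P \<odot> P = D_pow 0"
proof -
  let ?Q = "op_inverse P"
  let ?R = "op_inverse ?Q"
  note a = unipotent_admissible unipotent_op_inverse P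
  have "P = P \<odot> (?Q \<odot> ?R)" by (simp add: op_inverse_right a)
  also have "\<dots> = P \<odot> ?Q \<odot> ?R" by (simp add: op_mult_assoc a)
  also have "\<dots> = ?R" by (simp add: op_inverse_right P)
  finally have "P = ?R" .
  then show ?thesis using op_inverse_right[OF unipotent_op_inverse[OF P]] by simp
qed

lemma unipotent_mult:
  assumes P: "unipotent P" and Q: "unipotent Q" shows "unipotent (P \<odot> Q)"
proof -
  let ?N = "\<lambda>n. P n - D_pow 0 n"
  have "fil 3 (1 + 0) (?N \<odot> Q)"
    using P unipotent_fil[OF Q] unfolding unipotent_def by (intro fil_mult)
  then have "fil 3 1 (\<lambda>n. (?N \<odot> Q) n + (Q n - D_pow 0 n))"
    using Q unfolding unipotent_def by (intro fil_add) auto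
  moreover have "?N \<odot> Q = (\<lambda>k. (P \<odot> Q) k - Q k)"
    using op_mult_diff_left[OF unipotent_admissible[OF P] admissible_D_pow unipotent_admissible[OF Q]]
    by simp
  ultimately show ?thesis by (simp add: unipotent_def)
qed

lemma in_vars_leib: "in_vars V f \<Longrightarrow> Vxi \<in> V \<Longrightarrow> in_vars V (leib m r f)"
  by (auto simp: leib_def leibniz_def intro!: in_vars_cscale in_vars_D_pow in_vars_sign_twist)

lemma in_vars_op_mult:
  assumes "\<And>n. in_vars V (P n)" "\<And>n. in_vars V (Q n)" "Vxi \<in> V"
  shows "in_vars V ((P \<odot> Q) k)"
proof -
  have "in_vars V (leibniz m r (Q n))" for m r n
    using in_vars_leib[OF assms(2,3), of m "int r"] by (simp add: leib_def)
  then show ?thesis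
    unfolding op_mult_def by (auto intro!: in_vars_fsum in_vars_mult assms)
qed

lemma in_vars_D_pow_op: "in_vars V (D_pow n k)"
  by (simp add: D_pow_def)

lemma in_vars_op_pow:
  "(\<And>n. in_vars V (X n)) \<Longrightarrow> Vxi \<in> V \<Longrightarrow> in_vars V (op_pow X j k)"
  by (induction j arbitrary: k) (auto intro: in_vars_op_mult in_vars_D_pow_op)

lemma in_vars_op_inverse:
  "(\<And>n. in_vars V (P n)) \<Longrightarrow> Vxi \<in> V \<Longrightarrow> in_vars V (op_inverse P k)"
  unfolding op_inverse_def geometric_def
  by (intro in_vars_fsum in_vars_op_pow in_vars_diff in_vars_D_pow_op)

text \<open>Since D is odd, this says that every summand \<open>P n\<close> times D^n is
  even.\<close>

definition even_op :: "'a::supercomm_algebra sdop \<Rightarrow> bool"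
  where "even_op P \<longleftrightarrow> (\<forall>n. has_parity n (P n))"

lemma has_parity_leib:
  assumes "has_parity n f" shows "has_parity (n + r) (leib m r f)"
proof (cases "r < 0")
  case False
  have "has_parity (n + int i) ((D_ser ^^ i) (sign_twist k f))" for i k
  proof (induction i)
    case (Suc i)
    from has_parity_D[OF this] show ?case by (simp add: ac_simps)
  qed (simp add: has_parity_twist assms)
  from this[of "nat r"] False show ?thesis
    by (simp add: leib_def leibniz_def has_parity_cscale)
qed (simp add: leib_def)

lemma has_parity_D_pow_mult:
  assumes P: "even_op P" "admissible P" shows "has_parity (m + k) ((D_pow m \<odot> P) k)"
  unfolding D_pow_mult
proof (rule has_parity_fsum)
  obtain d where d: "fil 3 d P" using P(2) by (auto simp: admissible_def)
  show "fsummable UNIV (\<lambda>n. leib m (m + n - k) (P n))" by (rule fsummable_leib[OF d])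
  show "has_parity (m + k) (leib m (m + n - k) (P n))" for n
    using has_parity_leib[of n "P n" "m + n - k" m] P(1) unfolding even_op_def
    by (subst has_parity_cong[of _ "n + (m + n - k)"]) auto
qed

lemma even_op_mult:
  assumes P: "even_op P" "admissible P" and Q: "even_op Q" "admissible Q"
  shows "even_op (P \<odot> Q)"
  unfolding even_op_def op_mult_rows[OF P(2) Q(2)]
proof (intro allI has_parity_fsum fsummable_op_rows P Q)
  fix n m
  show "has_parity n (P m * (D_pow m \<odot> Q) n)"
    using has_parity_mult[of m "P m" "m + n" "(D_pow m \<odot> Q) n"] P(1) has_parity_D_pow_mult[OF Q, of m n]
    unfolding even_op_def by (subst has_parity_cong[of n "m + (m + n)"]) auto
qed

lemma even_op_D_pow_0: "even_op (D_pow 0)"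
  by (simp add: even_op_def D_pow_def)

lemma even_op_minus: "even_op P \<Longrightarrow> even_op (\<lambda>n. - P n)"
  by (simp add: even_op_def has_parity_minus)

lemma even_op_diff: "even_op P \<Longrightarrow> even_op Q \<Longrightarrow> even_op (\<lambda>n. P n - Q n)"
  by (simp add: even_op_def has_parity_diff)

lemma admissible_op_pow: "admissible X \<Longrightarrow> admissible (op_pow X j)"
  by (induction j) (auto intro: admissible_mult admissible_D_pow)

lemma even_op_pow: "even_op X \<Longrightarrow> admissible X \<Longrightarrow> even_op (op_pow X j)"
  by (induction j) (auto intro: even_op_mult even_op_D_pow_0 admissible_op_pow)

lemma even_op_inverse:
  assumes "unipotent P" "even_op P" shows "even_op (op_inverse P)"
  unfolding op_inverse_def geometric_def even_op_def
proof (intro allI has_parity_fsum fsummable_graded)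
  let ?X = "\<lambda>n. D_pow 0 n - P n"
  have X: "fil 3 1 ?X" using assms(1) by (auto simp: unipotent_def intro: fil_flip)
  show "fil 3 (int j) (op_pow ?X j)" for j by (rule fil_op_pow_1[OF X])
  have "even_op (op_pow ?X j)" for j
    by (intro even_op_pow even_op_diff even_op_D_pow_0 assms fil_admissible[OF X]) simp
  then show "has_parity n (op_pow ?X j n)" for j n by (simp add: even_op_def)
qed

lemma Ehat_fil: "P \<in> Ehat T \<Longrightarrow> \<exists>d. fil 1 d P"
proof -
  assume "P \<in> Ehat T"
  then obtain C where "\<forall>n m. coeff (P n) m \<noteq> 0 \<longrightarrow> int (weight m) \<ge> n - C"
    by (auto simp: Ehat_def)
  then have "fil 1 (- C) P" by (intro filI) (simp add: algebra_simps)
  then show ?thesis ..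
qed

lemma Ehat_admissible: "P \<in> Ehat T \<Longrightarrow> admissible P"
  using Ehat_fil fil_admissible[of 1] by fastforce

lemma EhatI: "(\<And>n. in_vars ({Vx, Vxi} \<union> T) (P n)) \<Longrightarrow> fil 1 d P \<Longrightarrow> P \<in> Ehat T"
  unfolding Ehat_def by (auto intro!: exI[of _ "- d"] dest: filD)

text \<open>Two-sided inverses are unique by associativity, which turns the definite description in
  \<open>op_inv\<close> into an explicit operator.\<close>

lemma op_inv_eqI:
  assumes "Q \<in> Ehat T" "P \<odot> Q = D_pow 0" "Q \<odot> P = D_pow 0" "admissible P"
  shows "op_inv T P = Q"
  unfolding op_inv_def
proof (rule the_equality)
  fix R assume R: "R \<in> Ehat T \<and> P \<odot> R = D_pow 0 \<and> R \<odot> P = D_pow 0"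
  then have a: "admissible R" "admissible Q" using assms(1) Ehat_admissible by blast+
  have "R = R \<odot> (P \<odot> Q)" using assms(2) a by simp
  also have "\<dots> = R \<odot> P \<odot> Q" using a assms(4) by (simp add: op_mult_assoc)
  also have "\<dots> = Q" using R by simp
  finally show "R = Q" .
qed (use assms in simp)

lemma op_inv_unipotent:
  assumes P: "unipotent P" and "fil 1 0 P" "\<And>n. in_vars ({Vx, Vxi} \<union> T) (P n)"
  shows "op_inv T P = op_inverse P"
proof (rule op_inv_eqI)
  have "fil 1 0 (\<lambda>n. P n - D_pow 0 n)" by (intro fil_diff assms fil_D_pow_0)
  then have "fil 1 0 (\<lambda>n. op_inverse P n - D_pow 0 n)" by (intro fil_op_inverse P) auto
  from fil_add[OF this fil_D_pow_0] have "fil 1 0 (op_inverse P)" by simp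
  then show "op_inverse P \<in> Ehat T" by (intro EhatI in_vars_op_inverse assms) auto
qed (use P in \<open>auto intro: op_inverse_right op_inverse_left unipotent_admissible\<close>)

section \<open>Exponentials\<close>

lemma op_pow_add: "admissible X \<Longrightarrow> op_pow X i \<odot> op_pow X j = op_pow X (i + j)"
  by (induction i) (simp_all add: op_mult_assoc admissible_op_pow)

lemma op_pow_Suc_right: "admissible X \<Longrightarrow> op_pow X (Suc j) = op_pow X j \<odot> X"
  using op_pow_add[of X j 1] by simp

lemma op_pow_minus:
  "admissible X \<Longrightarrow> op_pow (\<lambda>n. - X n) j = (\<lambda>k. psign (int j) * op_pow X j k)"
proof (induction j)
  case (Suc j)
  have a: "admissible (op_pow X j)" by (rule admissible_op_pow[OF Suc.prems])
  have "op_pow (\<lambda>n. - X n) (Suc j) = (\<lambda>n. - X n) \<odot> (\<lambda>k. psign (int j) * op_pow X j k)"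
    using Suc by simp
  also have "\<dots> = (\<lambda>k. psign (int (Suc j)) * op_pow X (Suc j) k)"
    using Suc.prems a
    by (cases "even j") (simp_all add: op_mult_minus_left op_mult_minus_right admissible_minus)
  finally show ?case .
qed simp

definition exp_term :: "'a::supercomm_algebra sdop \<Rightarrow> nat \<Rightarrow> 'a sdop"
  where "exp_term X j k = cscale (1 / fact j) (op_pow X j k)"

lemma op_exp_terms: "op_exp X = (\<lambda>k. fsum UNIV (\<lambda>j. exp_term X j k))"
  by (simp add: op_exp_def exp_term_def fun_eq_iff)

lemma fil_exp_term: "fil a d X \<Longrightarrow> fil a (int j * d) (exp_term X j)"
  unfolding exp_term_def[abs_def] by (intro fil_cscale fil_op_pow)

lemma fil_exp_term_1: "fil 3 1 X \<Longrightarrow> fil 3 (int j) (exp_term X j)"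
  using fil_exp_term[of 3 1 X j] by simp

lemma fsummable_exp_term: "fil 3 1 X \<Longrightarrow> fsummable UNIV (\<lambda>j. exp_term X j k)"
  by (intro fsummable_graded fil_exp_term_1)

lemma exp_term_0 [simp]: "exp_term X 0 = D_pow 0"
  by (simp add: exp_term_def fun_eq_iff cscale_one)

lemma unipotent_op_exp:
  assumes X: "fil 3 1 X" shows "unipotent (op_exp X)"
proof -
  have "fil 3 1 (\<lambda>k. fsum UNIV (\<lambda>j. exp_term X (Suc j) k))"
    by (rule fil_fsum) (auto intro: fil_mono[OF fil_exp_term_1[OF X]])
  then show ?thesis
    by (simp add: unipotent_def op_exp_terms fsum_Suc[OF fsummable_exp_term[OF X]])
qed

lemma in_vars_op_exp:
  "(\<And>n. in_vars V (X n)) \<Longrightarrow> Vxi \<in> V \<Longrightarrow> in_vars V (op_exp X k)"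
  unfolding op_exp_def by (intro in_vars_fsum in_vars_cscale in_vars_op_pow)

lemma even_op_exp:
  assumes "fil 3 1 X" "even_op X" shows "even_op (op_exp X)"
  unfolding op_exp_terms even_op_def
proof (intro allI has_parity_fsum fsummable_exp_term assms)
  have "even_op (op_pow X j)" for j by (intro even_op_pow assms fil_admissible[OF assms(1)]) simp
  then show "has_parity n (exp_term X j n)" for j n
    by (simp add: exp_term_def even_op_def has_parity_cscale)
qed

lemma psign_cscale: "psign n * a = cscale (psign n) (a :: 'a::supercomm_algebra)"
  by (simp add: psign_def cscale_one cscale_uminus)

lemma exp_coeff_cancel:
  "(\<Sum>i\<le>n. (1 / fact i) * (psign (int (n - i)) / fact (n - i))) = (if n = 0 then 1 else (0::complex))"
proof -
  have "(\<Sum>i\<le>n. (1 / fact i) * (psign (int (n - i)) / fact (n - i))) =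
    (\<Sum>i\<le>n. of_nat (n choose i) * 1 ^ i * (- 1) ^ (n - i)) / (fact n :: complex)"
    unfolding sum_divide_distrib
    by (rule sum.cong) (auto simp: binomial_fact psign_def)
  also have "\<dots> = (1 + - 1) ^ n / fact n" by (simp only: binomial_ring)
  finally show ?thesis by (auto simp: power_0_left)
qed

text \<open>Powers of a single operator commute, so the double series can be regrouped along i + j =
  n, where the coefficients add up to (1 - 1)^n / n!.\<close>

lemma op_exp_mult_minus:
  assumes X: "fil 3 1 X" shows "op_exp X \<odot> op_exp (\<lambda>n. - X n) = D_pow 0"
proof
  fix k
  let ?Y = "\<lambda>n. - X n"
  have Y: "fil 3 1 ?Y" by (rule fil_minus[OF X])
  have Xa: "admissible X" by (rule fil_admissible[OF X]) simp
  have a: "admissible (op_exp X)" by (rule unipotent_admissible[OF unipotent_op_exp[OF X]])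
  have ta: "admissible (exp_term X j)" "admissible (exp_term ?Y j)" for j
    using fil_exp_term_1[OF X] fil_exp_term_1[OF Y] admissible_def by blast+
  define F where "F i j = cscale ((1 / fact i) * (psign (int j) / fact j)) (op_pow X (i + j) k)" for i j
  have t: "(exp_term X i \<odot> exp_term ?Y j) k = F i j" for i j
  proof -
    have "exp_term ?Y j = (\<lambda>n. cscale (psign (int j) / fact j) (op_pow X j n))"
      by (simp add: exp_term_def op_pow_minus[OF Xa] psign_cscale cscale_cscale fun_eq_iff)
    then show ?thesis
      by (simp add: exp_term_def[abs_def] F_def op_mult_cscale_left op_mult_cscale_right op_pow_add
          admissible_op_pow admissible_cscale Xa cscale_cscale)
  qed
  have fF: "fil 3 (int i + int j) (\<lambda>k. (exp_term X i \<odot> exp_term ?Y j) k)" for i j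
    using fil_mult[OF fil_exp_term_1[OF X] fil_exp_term_1[OF Y]] by simp
  have s: "fsummable UNIV (\<lambda>(j, i). F i j)"
  proof (rule fsummableI)
    fix m
    let ?n = "nat (3 * int (weight m) - k)"
    have "(j, i) \<in> {..?n} \<times> {..?n}" if "coeff (F i j) m \<noteq> 0" for i j
      using filD3[OF fF[of i j], of k m] that by (auto simp: t)
    then show "finite {x \<in> UNIV. coeff (case x of (j, i) \<Rightarrow> F i j) m \<noteq> 0}"
      by - (rule finite_subset[of _ "{..?n} \<times> {..?n}"], auto)
  qed
  have "(op_exp X \<odot> op_exp ?Y) k = fsum UNIV (\<lambda>j. (op_exp X \<odot> exp_term ?Y j) k)"
    unfolding op_exp_terms[of ?Y]
    by (rule op_mult_fsum_right(1)[where d = 0, OF a])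
      (auto intro: fsummable_exp_term[OF Y] fil_mono[OF fil_exp_term_1[OF Y]])
  also have "\<dots> = fsum UNIV (\<lambda>j. fsum UNIV (\<lambda>i. F i j))"
    unfolding op_exp_terms[of X] t[symmetric]
    by (intro fsum_cong op_mult_fsum_left(1)[where d = 0, OF ta(2)])
      (auto intro: fsummable_exp_term[OF X] fil_mono[OF fil_exp_term_1[OF X]])
  also have "\<dots> = fsum UNIV (\<lambda>i. fsum UNIV (F i))" by (rule fsum_swap[OF s])
  also have "\<dots> = fsum UNIV (\<lambda>(i, j). F i j)" by (rule fsum_prod[OF fsummable_swap[OF s]])
  also have "\<dots> = fsum UNIV (\<lambda>n. \<Sum>i\<le>n. F i (n - i))"
    by (rule fsum_triangle[OF fsummable_swap[OF s]])
  also have "\<dots> = fsum UNIV (\<lambda>n. if n = 0 then op_pow X n k else 0)"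
  proof (rule fsum_cong)
    fix n
    have c: "(\<Sum>i\<in>I. cscale (f i) a) = cscale (\<Sum>i\<in>I. f i) a" for I :: "nat set" and f and a :: "'a sser"
      by (induction I rule: infinite_finite_induct) (auto simp: cscale_add_left)
    have "(\<Sum>i\<le>n. F i (n - i)) =
        (\<Sum>i\<le>n. cscale ((1 / fact i) * (psign (int (n - i)) / fact (n - i))) (op_pow X n k))"
      by (rule sum.cong) (auto simp: F_def)
    then show "(\<Sum>i\<le>n. F i (n - i)) = (if n = 0 then op_pow X n k else 0)"
      unfolding c exp_coeff_cancel by (simp add: cscale_one)
  qed
  also have "\<dots> = D_pow 0 k" by (simp add: fsum_delta)
  finally show "(op_exp X \<odot> op_exp ?Y) k = D_pow 0 k" .
qed

section \<open>Adjoints\<close>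

text \<open>The sign between the coefficient of D^k in D^j times the adjoint of P and the
  coefficient of D^(-j-1) in D^(-k-1) P. At j = 0 it is the sign of the adjoint of D^k; the terms
  with j make it compatible with the recursion under D.\<close>

definition adj_sign :: "int \<Rightarrow> int \<Rightarrow> int"
  where "adj_sign j k = k * (k + 1) div 2 + k * j + j * (j - 1) div 2"

text \<open>Upper negation for ordinary binomials, applied to the halves in each of the four parity
  cases. For even n and odd r both sides vanish.\<close>

lemma super_binom_reflect:
  "psign (n * (n + 1) div 2 + int r * n) * super_binom n r =
    psign ((n - int r) * (n - int r + 1) div 2) * (super_binom (int r - n - 1) r :: complex)"
proof -
  have neg: "(of_int (int b - a - 1) gchoose b :: complex) = psign (int b) * (of_int a gchoose b)" for a b
    using gbinomial_negated_upper[of "of_int (int b - a - 1) :: complex" b] by (simp add: psign_def minus_one_power_iff)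
  obtain a where a: "n = 2 * a \<or> n = 2 * a + 1" by (metis evenE oddE)
  obtain b where b: "r = 2 * b \<or> r = 2 * b + 1" by (metis evenE oddE)
  have half: "x div 2 = y" if "x = 2 * y" for x y :: int using that by simp
  consider (ee) "n = 2 * a" "r = 2 * b" | (eo) "n = 2 * a" "r = 2 * b + 1"
    | (oe) "n = 2 * a + 1" "r = 2 * b" | (oo) "n = 2 * a + 1" "r = 2 * b + 1"
    using a b by blast
  then show ?thesis
  proof cases
    case ee
    have d: "2 * a * (2 * a + 1) div 2 = a * (2 * a + 1)"
      "(2 * a - int (2 * b)) * (2 * a - int (2 * b) + 1) div 2 = (a - int b) * (2 * a - 2 * int b + 1)"
      by (rule half, simp add: algebra_simps)+
    have e: "(int (2 * b) - 2 * a - 1) div 2 = int b - a - 1" "2 * a div 2 = a" "2 * b div 2 = b"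
      by simp_all
    show ?thesis unfolding ee super_binom_def d e neg by simp (simp add: psign_def)
  next
    case eo
    then show ?thesis by (simp add: super_binom_def)
  next
    case oe
    have d: "(2 * a + 1) * (2 * a + 1 + 1) div 2 = (2 * a + 1) * (a + 1)"
      "(2 * a + 1 - int (2 * b)) * (2 * a + 1 - int (2 * b) + 1) div 2 =
        (2 * a - 2 * int b + 1) * (a - int b + 1)"
      by (rule half, simp add: algebra_simps)+
    have e: "(int (2 * b) - (2 * a + 1) - 1) div 2 = int b - a - 1" "(2 * a + 1) div 2 = a"
      "2 * b div 2 = b" by simp_all
    show ?thesis unfolding oe super_binom_def d e neg by simp (simp add: psign_def)
  next
    case oo
    have d: "(2 * a + 1) * (2 * a + 1 + 1) div 2 = (2 * a + 1) * (a + 1)"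
      "(2 * a + 1 - int (2 * b + 1)) * (2 * a + 1 - int (2 * b + 1) + 1) div 2 =
        (a - int b) * (2 * a - 2 * int b + 1)"
      by (rule half, simp add: algebra_simps)+
    have e: "(int (2 * b + 1) - (2 * a + 1) - 1) div 2 = int b - a - 1" "(2 * a + 1) div 2 = a"
      "(2 * b + 1) div 2 = b" by simp_all
    show ?thesis unfolding oo super_binom_def d e neg by simp (simp add: psign_def)
  qed
qed

lemma D_pow_mult_coeff_op: "(D_pow n \<odot> coeff_op g) k = leib n (n - k) g"
proof -
  have "(D_pow n \<odot> coeff_op g) k = fsum UNIV (\<lambda>i. leib n (n + i - k) (coeff_op g i))"
    by (rule D_pow_mult)
  also have "\<dots> = leib n (n + 0 - k) (coeff_op g 0)"
    by (rule fsum_single) (auto simp: coeff_op_def finitary_0[OF finitary_leib])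
  finally show ?thesis by (simp add: coeff_op_def)
qed

abbreviation eps :: "int \<Rightarrow> int" where "eps n \<equiv> n * (n + 1) div 2"

text \<open>For a single term f D^n: the coefficient of D^k in its adjoint equals, up to sign, the
  coefficient of D^(-1) in D^(-k-1) f D^n.\<close>

lemma leib_reflect:
  fixes f :: "'a::supercomm_algebra sser"
  assumes f: "has_parity n f"
  shows "psign (eps n) * leib n (n - k) (sign_twist n f) = psign (eps k) * leib (- k - 1) (n - k) f"
proof (cases "n - k < 0")
  case False
  define r where "r = nat (n - k)"
  have k: "n - k = int r" "k = n - int r" "- k - 1 = int r - n - 1" using False by (simp_all add: r_def)
  have t1: "sign_twist (n - int r) (sign_twist n f) = psign (int r * n) * f"
  proof -
    have "sign_twist (n - int r) (sign_twist n f) = psign ((n - int r + n) * n) * f"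
      unfolding sign_twist_twist by (rule has_parity_sign_twist[OF f])
    also have "psign ((n - int r + n) * n) = (psign (int r * n) :: 'a sser)"
      by (rule psign_cong) auto
    finally show ?thesis .
  qed
  have t2: "sign_twist (int r - n - 1 - int r) f = f"
    by (simp add: has_parity_sign_twist[OF f])
  have "psign (eps n) * leib n (n - k) (sign_twist n f) =
      cscale (psign (eps n + int r * n) * super_binom n r) ((D_ser ^^ r) f)"
    unfolding k(1) leib_def leibniz_def
    by (simp add: t1 finitary_psign[OF finitary_funpow[OF finitary_D]])
      (simp add: psign_cscale cscale_cscale ac_simps del: psign_mult psign_mult' flip: psign_mult)
  also have "\<dots> = cscale (psign (eps (n - int r)) * super_binom (int r - n - 1) r) ((D_ser ^^ r) f)"
    unfolding super_binom_reflect ..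
  also have "\<dots> = psign (eps k) * leib (- k - 1) (n - k) f"
    unfolding k(1,3) leib_def leibniz_def nat_int t2
    by (simp add: k(2) psign_cscale cscale_cscale)
  finally show ?thesis .
qed (simp add: leib_def)

text \<open>The adjoint as a super residue. This is the form in which the negative part of the
  inverse of S later meets the dual wave function.\<close>

lemma op_adj_eq:
  assumes P: "even_op P" "admissible P"
  shows "op_adj P k = psign (eps k) * (D_pow (- k - 1) \<odot> P) (- 1)"
proof -
  obtain d where d: "fil 3 d P" using P(2) by (auto simp: admissible_def)
  have "op_adj P k = fsum UNIV (\<lambda>n. psign (eps k) * leib (- k - 1) (- k - 1 + n - (- 1)) (P n))"
    unfolding op_adj_def D_pow_mult_coeff_op
  proof (rule fsum_cong)
    fix n
    have "has_parity n (P n)" "- k - 1 + n - (- 1) = n - k" using P(1) by (simp_all add: even_op_def)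
    then show "(if even (n * (n + 1) div 2) then 1 else - 1) * leib n (n - k) (sign_twist n (P n)) =
      psign (eps k) * leib (- k - 1) (- k - 1 + n - - 1) (P n)"
      unfolding psign_def[of "eps n", symmetric] by (simp only: leib_reflect)
  qed
  then show ?thesis
    unfolding D_pow_mult by (simp only: finitary_fsum[OF finitary_mult_left fsummable_leib[OF d]])
qed

lemma eps_pred: "even (eps k + eps (k - 1) + k)"
proof -
  have "k * (k + 1) = (k - 1) * (k - 1 + 1) + 2 * k" by (simp add: algebra_simps)
  then have "eps k = (k - 1) * (k - 1 + 1) div 2 + k" by simp
  then show ?thesis by simp
qed

lemma adj_sign_0: "adj_sign 0 k = eps k"
  by (simp add: adj_sign_def)

lemma adj_sign_col: "even (adj_sign j k + adj_sign j (k - 1) + j + k)"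
  using eps_pred[of k] unfolding adj_sign_def by (auto simp: right_diff_distrib)

lemma adj_sign_row: "even (adj_sign (j + 1) k + adj_sign j k + j + k)"
proof -
  have "(j + 1) * (j + 1 - 1) div 2 = eps j" "j * (j - 1) div 2 = eps (j - 1)" "k * (j + 1) = k * j + k"
    by (simp_all add: mult.commute distrib_left)
  then have "adj_sign (j + 1) k + adj_sign j k + j + k =
      2 * (eps k + k * j + k) + (eps j + eps (j - 1) + j)"
    by (simp add: adj_sign_def)
  then show ?thesis by (metis dvd_add dvd_triv_left eps_pred)
qed

text \<open>The right-hand side of the first claim, taken as a family Z j, agrees with the adjoint
  at j = 0 by the residue formula, and it satisfies the recursion under D.\<close>

lemma D_pow_op_adj:
  assumes P: "even_op P" "admissible P"
  shows "(D_pow j \<odot> op_adj P) k = psign (adj_sign j k) * (D_pow (- k - 1) \<odot> P) (- j - 1)"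
    and "fil a d P \<Longrightarrow> fil a d (op_adj P)" and "even_op (op_adj P)" and "admissible (op_adj P)"
proof -
  define X where "X i j = (D_pow i \<odot> P) j" for i j
  define Z where "Z j k = psign (adj_sign j k) * X (- k - 1) (- j - 1)" for j k
  have adj: "op_adj P = Z 0"
    by (simp add: fun_eq_iff Z_def X_def op_adj_eq[OF P] adj_sign_0)
  have parX: "has_parity (i + j) (X i j)" for i j
    unfolding X_def by (rule has_parity_D_pow_mult[OF P])
  have filZ: "fil a (d - j) (Z j)" if "fil a d P" for a d j
  proof (rule filI)
    fix n m assume "coeff (Z j n) m \<noteq> 0"
    then have "coeff ((D_pow (- n - 1) \<odot> P) (- j - 1)) m \<noteq> 0"
      by (auto simp: Z_def X_def psign_def coeff_minus split: if_splits)
    from filD[OF fil_D_pow_mult[OF that] this] show "d - j \<le> int a * int (weight m) - n" by simp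
  qed
  show "fil a d P \<Longrightarrow> fil a d (op_adj P)" for a d using filZ[of a d 0] by (simp add: adj)
  have "has_parity k (X (- k - 1) (- 1))" for k
    using parX[of "- k - 1" "- 1"] by (subst has_parity_cong[of k "- k - 1 + - 1"]) auto
  then show "even_op (op_adj P)"
    unfolding even_op_def adj Z_def by (simp add: has_parity_psign)
  have admZ: "admissible (Z j)" for j
    using filZ P(2) unfolding admissible_def by blast
  then show "admissible (op_adj P)" by (simp add: adj)
  have rec: "opD (Z j) = Z (j + 1)" for j
  proof
    fix k
    \<comment> \<open>The recursion for D^i P is solved for the derivative. In D (Z j) the term with
      D^(i+1) then cancels against the shifted coefficient by \<open>adj_sign_col\<close>, and what
      remains is Z (j + 1) by \<open>adj_sign_row\<close>.\<close>
    have X: "D_ser (X i l) = X (i + 1) l - psign (i + l - 1) * X i (l - 1)" for i l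
    proof -
      have "X (i + 1) l = D_ser (X i l) + sign_twist 1 (X i (l - 1))"
        using fun_cong[OF opD_D_pow[OF P(2)], of i l] by (simp add: opD_def X_def)
      then show ?thesis using parX[of i "l - 1"] by (simp add: has_parity_def add_diff_eq)
    qed
    have T: "sign_twist 1 (X (- k) (- j - 1)) = psign (- k + (- j - 1)) * X (- k) (- j - 1)"
      using parX[of "- k" "- j - 1"] by (simp add: has_parity_def)
    have "opD (Z j) k = psign (adj_sign j k) * (X (- k - 1 + 1) (- j - 1)
        - psign (- k - 1 + (- j - 1) - 1) * X (- k - 1) (- j - 1 - 1)) +
      psign (adj_sign j (k - 1)) * (psign (- k + (- j - 1)) * X (- k) (- j - 1))"
      unfolding opD_def Z_def finitary_psign[OF finitary_D] sign_twist_psign X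
      by (simp add: T)
    also have "\<dots> = psign (adj_sign j k) * X (- k) (- j - 1)
        - psign (adj_sign j k + (- k - 1 + (- j - 1) - 1)) * X (- k - 1) (- 2 - j) +
      psign (adj_sign j (k - 1) + (- k + (- j - 1))) * X (- k) (- j - 1)"
      by (simp add: right_diff_distrib)
    also have "psign (adj_sign j (k - 1) + (- k + (- j - 1))) * X (- k) (- j - 1) =
        - (psign (adj_sign j k) * X (- k) (- j - 1))"
      using adj_sign_col[of j k] by (auto simp: psign_def)
    also have "psign (adj_sign j k + (- k - 1 + (- j - 1) - 1)) * X (- k - 1) (- 2 - j) =
        - (psign (adj_sign (j + 1) k) * X (- k - 1) (- 2 - j))"
      using adj_sign_row[of j k] by (auto simp: psign_def)
    finally show "opD (Z j) k = Z (j + 1) k" by (simp add: Z_def[of "j + 1"])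
  qed
  have "Z j = D_pow j \<odot> op_adj P" for j
  proof (rule opD_sequence_unique[where Z = Z and W = "\<lambda>j. D_pow j \<odot> op_adj P"])
    show "opD (D_pow j \<odot> op_adj P) = D_pow (j + 1) \<odot> op_adj P" for j
      by (rule opD_D_pow) (simp add: adj admZ)
  qed (auto simp: rec adj intro: admissible_mult admissible_D_pow admZ)
  then show "(D_pow j \<odot> op_adj P) k = psign (adj_sign j k) * (D_pow (- k - 1) \<odot> P) (- j - 1)"
    by (metis Z_def X_def)
qed

lemma adj_sign_antihom: "even (eps k + eps m + adj_sign m k + (k + m) * m)"
proof -
  have "eps m = m * (m - 1) div 2 + m"
  proof -
    have "m * (m + 1) = m * (m - 1) + 2 * m" by (simp add: algebra_simps)
    then show ?thesis by simp
  qed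
  then have "eps k + eps m + adj_sign m k + (k + m) * m =
      2 * (eps k + m * (m - 1) div 2 + k * m) + (m + m * m)"
    unfolding adj_sign_def by (simp add: distrib_right)
  then show ?thesis by simp
qed

text \<open>No sign appears because both operators are even. Both sides are sums over products of
  rows of P and Q, matched by the substitution n = - m - 1; moving one factor past the other
  produces the sign absorbed by \<open>adj_sign_antihom\<close>.\<close>

lemma op_adj_mult:
  assumes P: "even_op P" "admissible P" and Q: "even_op Q" "admissible Q"
  shows "op_adj (P \<odot> Q) = op_adj Q \<odot> op_adj P"
proof
  fix k
  have DP: "admissible (D_pow (- k - 1) \<odot> P)" by (intro admissible_mult admissible_D_pow P)
  define F where "F n = (D_pow (- k - 1) \<odot> P) n * (D_pow n \<odot> Q) (- 1)" for n
  have sF: "fsummable UNIV F" unfolding F_def by (rule fsummable_op_rows[OF DP Q(2)])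
  have G: "op_adj Q m * (D_pow m \<odot> op_adj P) k = psign (eps k) * F (- m - 1)" for m
  proof -
    have "op_adj Q m * (D_pow m \<odot> op_adj P) k = psign (eps m + adj_sign m k) *
        ((D_pow (- m - 1) \<odot> Q) (- 1) * (D_pow (- k - 1) \<odot> P) (- m - 1))"
      unfolding op_adj_eq[OF Q] D_pow_op_adj(1)[OF P]
      by (simp add: mult.assoc psign_left_commute[of "(D_pow (- m - 1) \<odot> Q) (- 1)"])
    also have "(D_pow (- m - 1) \<odot> Q) (- 1) * (D_pow (- k - 1) \<odot> P) (- m - 1) =
        psign ((k + m) * m) * F (- m - 1)"
    proof -
      have "sign_twist (- m - 1 + - 1) ((D_pow (- k - 1) \<odot> P) (- m - 1)) =
          psign ((- m - 1 + - 1) * (- k - 1 + (- m - 1))) * (D_pow (- k - 1) \<odot> P) (- m - 1)"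
        by (rule has_parity_sign_twist[OF has_parity_D_pow_mult[OF P]])
      also have "psign ((- m - 1 + - 1) * (- k - 1 + (- m - 1))) = (psign ((k + m) * m) :: 'a sser)"
        by (rule psign_cong) auto
      finally show ?thesis
        unfolding F_def
        by (subst has_parity_commute[OF has_parity_D_pow_mult[OF Q]]) (simp add: mult.assoc)
    qed
    also have "psign (eps m + adj_sign m k) * (psign ((k + m) * m) * F (- m - 1)) = psign (eps k) * F (- m - 1)"
      using adj_sign_antihom[of k m] by (auto simp: psign_def)
    finally show ?thesis .
  qed
  have "op_adj (P \<odot> Q) k = psign (eps k) * (D_pow (- k - 1) \<odot> P \<odot> Q) (- 1)"
    unfolding op_adj_eq[OF even_op_mult[OF P Q] admissible_mult[OF P(2) Q(2)]]
      D_pow_mult_assoc[OF P(2) Q(2)] ..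
  also have "(D_pow (- k - 1) \<odot> P \<odot> Q) (- 1) = fsum UNIV F"
    unfolding op_mult_rows[OF DP Q(2)] F_def ..
  also have "\<dots> = fsum UNIV (\<lambda>m. F (- m - 1))"
    using fsum_shift[of "\<lambda>m. F (- m)" 1] by (simp add: fsum_uminus)
  also have "psign (eps k) * \<dots> = fsum UNIV (\<lambda>m. psign (eps k) * F (- m - 1))"
    by (rule finitary_fsum[OF finitary_mult_left])
      (use fsummable_shift[OF fsummable_uminus[OF sF], of 1] in simp)
  also have "\<dots> = (op_adj Q \<odot> op_adj P) k"
    unfolding op_mult_rows[OF D_pow_op_adj(4)[OF Q] D_pow_op_adj(4)[OF P]] G ..
  finally show "op_adj (P \<odot> Q) k = (op_adj Q \<odot> op_adj P) k" .
qed

lemma op_adj_D_pow_0 [simp]: "op_adj (D_pow 0) = D_pow 0"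
proof
  fix k :: int
  show "op_adj (D_pow 0) k = (D_pow 0 :: 'a sdop) k"
    unfolding op_adj_eq[OF even_op_D_pow_0 admissible_D_pow] D_pow_mult_D_pow
    by (simp add: D_pow_def)
qed

lemma op_adj_pow:
  assumes X: "even_op X" "admissible X" shows "op_adj (op_pow X j) = op_pow (op_adj X) j"
proof (induction j)
  case (Suc j)
  have "op_adj (op_pow X (Suc j)) = op_adj (op_pow X j) \<odot> op_adj X"
    by (simp add: op_adj_mult even_op_pow admissible_op_pow X)
  then show ?case using Suc op_pow_Suc_right[OF D_pow_op_adj(4)[OF X]] by simp
qed simp

lemma op_adj_minus:
  assumes X: "even_op X" "admissible X"
  shows "op_adj (\<lambda>n. - X n) = (\<lambda>k. - op_adj X k)"
  by (simp add: fun_eq_iff op_adj_eq even_op_minus admissible_minus X op_mult_minus_right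
      admissible_D_pow)

lemma op_adj_exp:
  assumes X: "even_op X" "fil 3 1 X" shows "op_adj (op_exp X) = op_exp (op_adj X)"
proof
  fix k
  have a: "admissible X" by (rule fil_admissible[OF X(2)]) simp
  have e: "even_op (exp_term X j)" "admissible (exp_term X j)" for j
    using even_op_pow[OF X(1) a, of j] admissible_op_pow[OF a, of j]
    by (auto simp: exp_term_def[abs_def] even_op_def intro: has_parity_cscale admissible_cscale)
  have t: "exp_term (op_adj X) j k = op_adj (exp_term X j) k" for j
  proof -
    have "op_adj (exp_term X j) k = cscale (1 / fact j) (op_adj (op_pow X j) k)"
      unfolding op_adj_eq[OF e] op_adj_eq[OF even_op_pow[OF X(1) a] admissible_op_pow[OF a]]
      by (simp add: exp_term_def[abs_def] op_mult_cscale_right admissible_D_pow admissible_op_pow[OF a]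
          mult_cscale_right)
    then show ?thesis by (simp add: exp_term_def op_adj_pow[OF X(1) a])
  qed
  note f = op_mult_fsum_right[where d = 0, OF admissible_D_pow fil_mono[OF fil_exp_term_1[OF X(2)]]
      fsummable_exp_term[OF X(2)]]
  show "op_adj (op_exp X) k = op_exp (op_adj X) k"
    unfolding op_adj_eq[OF even_op_exp[OF X(2,1)] unipotent_admissible[OF unipotent_op_exp[OF X(2)]]]
    unfolding op_exp_terms t op_adj_eq[OF e]
    by (subst f(1)) (auto intro!: finitary_fsum[OF finitary_mult_left] f(2))
qed

section \<open>Action on the exponential\<close>

text \<open>The coefficient of \<open>\<zeta>\<^sup>k\<close> in \<open>P e\<^bsup>xz + \<xi>\<theta>\<^esup>\<close>.\<close>

definition eval_row :: "'a::supercomm_algebra sdop \<Rightarrow> int \<Rightarrow> 'a sser"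
  where "eval_row P k = fsum UNIV (\<lambda>l. P l * emat l k)"

text \<open>The matrix \<open>\<Xi>[Q]\<close>, with entries depending on the times.\<close>

definition Xi :: "'a::supercomm_algebra sdop \<Rightarrow> int \<Rightarrow> int \<Rightarrow> 'a sser"
  where "Xi Q j k = ev0 ((D_pow j \<odot> Q) k)"

lemma fsummable_eval_row: "fsummable UNIV (\<lambda>l. P l * emat l k)"
  by (rule fsummable_mult_left[OF fsummable_emat'])

lemma D_eval_row: "D_ser (eval_row P k) = eval_row (opD P) k"
proof -
  note s = fsummable_eval_row
  have s1: "fsummable UNIV (\<lambda>l. sign_twist 1 (P l) * emat (l + 1) k)"
    using fsummable_shift[OF s[of "\<lambda>l. sign_twist 1 (P (l - 1))" k], of 1] by simp
  have "D_ser (eval_row P k) =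
      fsum UNIV (\<lambda>l. D_ser (P l) * emat l k + sign_twist 1 (P l) * emat (l + 1) k)"
    by (simp add: eval_row_def finitary_fsum[OF finitary_D s] D_mult D_emat)
  also have "\<dots> = fsum UNIV (\<lambda>l. D_ser (P l) * emat l k) +
      fsum UNIV (\<lambda>l. sign_twist 1 (P l) * emat (l + 1) k)"
    by (rule fsum_add[OF s s1])
  also have "fsum UNIV (\<lambda>l. sign_twist 1 (P l) * emat (l + 1) k) =
      fsum UNIV (\<lambda>l. sign_twist 1 (P (l - 1)) * emat l k)"
    using fsum_shift[of "\<lambda>l. sign_twist 1 (P (l - 1)) * emat l k" 1] by simp
  also have "fsum UNIV (\<lambda>l. D_ser (P l) * emat l k) + \<dots> = eval_row (opD P) k"
    unfolding eval_row_def opD_def distrib_right by (rule fsum_add[symmetric, OF s s])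
  finally show ?thesis .
qed

lemma ev0_eval_row: "ev0 (eval_row P k) = ev0 (P k)"
proof -
  have "ev0 (eval_row P k) = fsum UNIV (\<lambda>l. if l = k then ev0 (P l) else 0)"
    unfolding eval_row_def finitary_fsum[OF finitary_kill fsummable_eval_row]
    by (rule fsum_cong) (simp add: kill_mult ev0_emat)
  then show ?thesis by (simp add: fsum_delta)
qed

text \<open>For fixed k the functions obtained from D^j Q form a D-orbit in j, so the Taylor formula
  applies.\<close>

lemma eval_row_D_pow_mult:
  assumes "admissible Q"
  shows "eval_row (D_pow j \<odot> Q) k = fsum UNIV (\<lambda>l. emat j l * Xi Q l k)"
  using taylor_expansion[of "\<lambda>j. eval_row (D_pow j \<odot> Q) k" j]
  by (simp add: D_eval_row opD_D_pow assms Xi_def ev0_eval_row)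

lemma xweight_le: "m = p + q \<Longrightarrow> xweight p \<le> xweight m \<and> xweight q \<le> xweight m"
  using xweight_nonneg[of p] xweight_nonneg[of q] by (simp add: xweight_add)

lemma coeff_emat_bound:
  assumes "coeff (emat l k :: 'a::supercomm_algebra sser) q \<noteq> 0" "m = p + q"
  shows "0 \<le> k - l \<and> k - l \<le> xweight m"
  using coeff_emat_nonzero[OF assms(1)] xweight_le[OF assms(2)] xweight_nonneg[of q] by linarith

lemma coeff_Xi_bound:
  assumes "fil a d Q" "coeff (Xi Q j k) m \<noteq> 0"
  shows "int a * int (weight m) - k \<ge> d - j"
proof -
  have "coeff ((D_pow j \<odot> Q) k) m \<noteq> 0"
    using assms(2) by (auto simp: Xi_def kill.rep_eq split: if_split_asm)
  with fil_D_pow_mult[OF assms(1)] show ?thesis by (rule filD)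
qed

text \<open>Composing with Q on the right multiplies the row of coefficients on the exponential by a
  matrix independent of x and \<xi>: the dependence on these variables sits entirely in the row of
  P.\<close>

lemma eval_row_mult:
  assumes P: "admissible P" and Q: "admissible Q"
  shows "eval_row (P \<odot> Q) k = fsum UNIV (\<lambda>l. eval_row P l * Xi Q l k)"
proof -
  obtain d e where d: "fil 3 d P" and e: "fil 3 e Q" using assms by (auto simp: admissible_def)
  let ?X = "\<lambda>m. D_pow m \<odot> Q"
  have s1: "fsummable UNIV (\<lambda>(l, m). P m * ?X m l * emat l k)"
  proof (rule fsummable_bounded[where N = "\<lambda>\<mu>. {k - xweight \<mu> .. k}"])
    show "l \<in> {k - xweight \<mu> .. k}" if nz: "coeff (P m * ?X m l * emat l k) \<mu> \<noteq> 0" for l m \<mu>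
    proof -
      obtain p q where "\<mu> = p + q" "coeff (emat l k :: 'a sser) q \<noteq> 0"
        using nz by (rule coeff_mult_nonzero)
      from coeff_emat_bound[OF this(2,1)] show ?thesis by simp
    qed
  qed (auto intro: fsummable_mult_right fsummable_op_rows[OF P Q])
  have s2: "fsummable UNIV (\<lambda>(m, l). P m * emat m l * Xi Q l k)"
  proof (rule fsummableI)
    fix \<mu>
    let ?w = "3 * int (weight \<mu>)"
    let ?A = "{e + k - ?w - xweight \<mu> .. ?w - d} \<times> {e + k - ?w .. ?w - d + xweight \<mu>}"
    have "(m, l) \<in> ?A" if nz: "coeff (P m * emat m l * Xi Q l k) \<mu> \<noteq> 0" for m l
    proof -
      obtain p q where pq: "\<mu> = p + q" "coeff (P m * emat m l) p \<noteq> 0" "coeff (Xi Q l k) q \<noteq> 0"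
        using nz by (rule coeff_mult_nonzero)
      obtain p1 p2 where pp: "p = p1 + p2" "coeff (P m) p1 \<noteq> 0" "coeff (emat m l :: 'a sser) p2 \<noteq> 0"
        using pq(2) by (rule coeff_mult_nonzero)
      show ?thesis
        using filD3[OF d pp(2)] coeff_emat_bound[OF pp(3,1)] coeff_Xi_bound[OF e pq(3), simplified]
          weight_le[OF pq(1)] weight_le[OF pp(1)] xweight_le[OF pq(1)] by auto
    qed
    then show "finite {x \<in> UNIV. coeff (case x of (m, l) \<Rightarrow> P m * emat m l * Xi Q l k) \<mu> \<noteq> 0}"
      by - (rule finite_subset[of _ ?A], auto)
  qed
  have "eval_row (P \<odot> Q) k = fsum UNIV (\<lambda>l. fsum UNIV (\<lambda>m. P m * ?X m l * emat l k))"
    unfolding eval_row_def op_mult_rows[OF P Q]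
    by (rule fsum_cong) (rule finitary_fsum[OF finitary_mult_right fsummable_op_rows[OF P Q]])
  also have "\<dots> = fsum UNIV (\<lambda>m. fsum UNIV (\<lambda>l. P m * ?X m l * emat l k))" by (rule fsum_swap[OF s1])
  also have "\<dots> = fsum UNIV (\<lambda>m. P m * eval_row (?X m) k)"
    by (rule fsum_cong)
      (simp add: eval_row_def mult.assoc finitary_fsum[OF finitary_mult_left fsummable_eval_row])
  also have "\<dots> = fsum UNIV (\<lambda>m. fsum UNIV (\<lambda>l. P m * emat m l * Xi Q l k))"
    unfolding eval_row_D_pow_mult[OF Q]
    by (rule fsum_cong)
      (simp add: mult.assoc finitary_fsum[OF finitary_mult_left fsummable_mult_right[OF fsummable_emat]])
  also have "\<dots> = fsum UNIV (\<lambda>l. fsum UNIV (\<lambda>m. P m * emat m l * Xi Q l k))" by (rule fsum_swap[OF s2])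
  also have "\<dots> = fsum UNIV (\<lambda>l. eval_row P l * Xi Q l k)"
    unfolding eval_row_def
    by (rule fsum_cong) (rule finitary_fsum[OF finitary_mult_right fsummable_eval_row, symmetric])
  finally show ?thesis .
qed

lemma fsummable_Xi_rows:
  assumes P: "admissible P" and Q: "admissible Q"
  shows "fsummable UNIV (\<lambda>i. Xi P j i * Xi Q i k)"
proof (rule fsummableI)
  fix \<mu>
  obtain d e where d: "fil 3 d P" and e: "fil 3 e Q" using assms by (auto simp: admissible_def)
  let ?w = "3 * int (weight \<mu>)"
  have "i \<in> {e + k - ?w .. ?w - d + j}" if nz: "coeff (Xi P j i * Xi Q i k) \<mu> \<noteq> 0" for i
  proof -
    obtain p q where pq: "\<mu> = p + q" "coeff (Xi P j i) p \<noteq> 0" "coeff (Xi Q i k) q \<noteq> 0"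
      using nz by (rule coeff_mult_nonzero)
    show ?thesis
      using coeff_Xi_bound[OF d pq(2), simplified] coeff_Xi_bound[OF e pq(3), simplified] weight_le[OF pq(1)] by auto
  qed
  then show "finite {i \<in> UNIV. coeff (Xi P j i * Xi Q i k) \<mu> \<noteq> 0}"
    by - (rule finite_subset[of _ "{e + k - ?w .. ?w - d + j}"], auto)
qed

lemma kill_idem [simp]: "kill V (kill V f) = kill V f"
  by (rule kill_id[OF in_vars_kill]) simp

text \<open>The specialisation of \<open>eval_row_mult\<close> at x = \<xi> = 0, with D^j P in place
  of P.\<close>

lemma Xi_mult:
  assumes P: "admissible P" and Q: "admissible Q"
  shows "Xi (P \<odot> Q) j k = fsum UNIV (\<lambda>i. Xi P j i * Xi Q i k)"
proof -
  obtain e where e: "fil 3 e Q" using Q by (auto simp: admissible_def)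
  have DP: "admissible (D_pow j \<odot> P)" by (intro admissible_mult admissible_D_pow P)
  obtain d where d: "fil 3 d (D_pow j \<odot> P)" using DP by (auto simp: admissible_def)
  have s: "fsummable UNIV (\<lambda>i. eval_row (D_pow j \<odot> P) i * Xi Q i k)"
  proof (rule fsummableI)
    fix \<mu>
    let ?w = "3 * int (weight \<mu>)"
    let ?A = "{e + k - ?w .. ?w - d + xweight \<mu>}"
    have "i \<in> ?A" if nz: "coeff (eval_row (D_pow j \<odot> P) i * Xi Q i k) \<mu> \<noteq> 0" for i
    proof -
      obtain p q where pq: "\<mu> = p + q" "coeff (eval_row (D_pow j \<odot> P) i) p \<noteq> 0" "coeff (Xi Q i k) q \<noteq> 0"
        using nz by (rule coeff_mult_nonzero)
      obtain m where "coeff ((D_pow j \<odot> P) m * emat m i) p \<noteq> 0"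
        using pq(2) unfolding eval_row_def by (rule coeff_fsum_nonzero)
      then obtain p1 p2 where pp: "p = p1 + p2" "coeff ((D_pow j \<odot> P) m) p1 \<noteq> 0"
        "coeff (emat m i :: 'a sser) p2 \<noteq> 0"
        by (rule coeff_mult_nonzero)
      show ?thesis
        using filD3[OF d pp(2)] coeff_emat_bound[OF pp(3,1)] coeff_Xi_bound[OF e pq(3), simplified]
          weight_le[OF pq(1)] weight_le[OF pp(1)] xweight_le[OF pq(1)] by auto
    qed
    then show "finite {i \<in> UNIV. coeff (eval_row (D_pow j \<odot> P) i * Xi Q i k) \<mu> \<noteq> 0}"
      by - (rule finite_subset[of _ ?A], auto)
  qed
  have "Xi (P \<odot> Q) j k = ev0 (eval_row ((D_pow j \<odot> P) \<odot> Q) k)"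
    by (simp add: Xi_def ev0_eval_row D_pow_mult_assoc P Q)
  also have "\<dots> = fsum UNIV (\<lambda>i. ev0 (eval_row (D_pow j \<odot> P) i) * ev0 (Xi Q i k))"
    by (simp add: eval_row_mult[OF DP Q] finitary_fsum[OF finitary_kill s] kill_mult)
  also have "\<dots> = fsum UNIV (\<lambda>i. Xi P j i * Xi Q i k)"
    by (simp add: ev0_eval_row Xi_def)
  finally show ?thesis .
qed

lemma Xi_D_pow_0: "Xi (D_pow 0) j k = (if j = k then 1 else 0)"
  unfolding Xi_def D_pow_mult_D_pow by (simp add: D_pow_def)

text \<open>\<open>emat\<close> is triangular with unit diagonal, and its other entries have no
  constant term. So the coefficient of \<zeta>^n involves, besides Y n, only Y l with l < n at
  proper submonomials, and these vanish by induction on the size.\<close>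

lemma eval_row_negative:
  assumes 0: "\<And>k. k < 0 \<Longrightarrow> eval_row Y k = 0" and "n < 0" shows "Y n = 0"
proof -
  have "coeff (Y n) m = 0" if "n < 0" for n m
    using that
  proof (induction "size m" arbitrary: n m rule: less_induct)
    case less
    have other: "coeff (Y l * emat l n) m = 0" if "l \<noteq> n" for l
    proof (rule ccontr)
      assume "coeff (Y l * emat l n) m \<noteq> 0"
      then obtain p q where pq: "m = p + q" "coeff (Y l) p \<noteq> 0" "coeff (emat l n :: 'a sser) q \<noteq> 0"
        by (rule coeff_mult_nonzero)
      have "n - l = xweight q" by (rule coeff_emat_nonzero[OF pq(3)])
      moreover from this have "q \<noteq> {#}" using that by (auto simp: xweight_def)
      ultimately have "l < 0" "size p < size m"
        using less.prems xweight_nonneg[of q] by (auto simp: pq(1) nonempty_has_size)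
      then show False using less.hyps pq(2) by blast
    qed
    have "coeff (eval_row Y n) m = (\<Sum>l\<in>{n}. coeff (Y l * emat l n) m)"
      unfolding eval_row_def by (rule coeff_fsum) (use other in auto)
    then show ?case using 0[OF less.prems] by simp
  qed
  then show ?thesis using assms(2) by (intro sser_eqI) simp
qed

section \<open>From powers of \<zeta> to the variables z and \<theta>\<close>

lemma exp_ser_emat:
  "(exp_ser \<epsilon> i :: 'a::supercomm_algebra sser) =
    cscale (\<epsilon> powi i) (emat 0 (2 * i) + cscale \<epsilon> (emat 0 (2 * i + 1) * var Vtheta))"
proof (cases "i < 0")
  case False
  have "2 * i + 1 - 0 = 2 * i + 1" "(2 * i + 1) div 2 = i" by simp_all
  moreover have "xpow (nat i) * (var Vxi * var Vtheta) = (var Vxi * xpow (nat i) * var Vtheta :: 'a sser)"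
  proof -
    have "has_parity 0 (xpow (nat i) :: 'a sser)"
      using has_parity_emat[of "2 * int (nat i)" 0]
      by (subst has_parity_cong[of 0 "2 * int (nat i)"]) (auto simp: emat_def)
    from has_parity_commute[OF this, of "var Vxi"]
    have "xpow (nat i) * var Vxi = (var Vxi * xpow (nat i) :: 'a sser)" by (simp add: sign_twist_even)
    then show ?thesis by (simp only: mult.assoc[symmetric])
  qed
  moreover have "cscale (\<epsilon> powi i / fact (nat i)) (var Vx ^ nat i) =
      (cscale (\<epsilon> powi i) (xpow (nat i)) :: 'a sser)"
    by (simp add: xpow_def cscale_cscale)
  ultimately show ?thesis using False
    by (simp add: exp_ser_def emat_def mult_cscale_left mult_cscale_right distrib_left
        cscale_add_right cscale_cscale mult.commute)
qed (simp add: exp_ser_def emat_def)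

lemma D_pow_exp_emat:
  assumes "\<epsilon> \<noteq> 0"
  shows "(D_pow_exp \<epsilon> n k :: 'a::supercomm_algebra sser) =
    cscale (\<epsilon> powi k) (emat n (2 * k) + cscale \<epsilon> (emat n (2 * k + 1) * var Vtheta))"
proof -
  define i where "i = k - n div 2"
  have th: "D_ser (var Vtheta) = (0 :: 'a sser)"
    by (rule D_in_vars) (rule in_varsI, auto dest: coeff_var_nonzero)
  have D: "(D_ser ^^ nat (n mod 2)) (exp_ser \<epsilon> i :: 'a sser) = cscale (\<epsilon> powi i)
      (emat (n mod 2) (2 * i) + cscale \<epsilon> (emat (n mod 2) (2 * i + 1) * var Vtheta))"
    by (cases "n mod 2 = 0")
      (simp_all add: exp_ser_emat finitary_cscale_commute finitary_add[OF finitary_D] D_mult D_emat th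
        not_mod_2_eq_0_eq_1)
  have n: "n = n mod 2 + 2 * (n div 2)" by simp
  have s: "emat (n mod 2) (2 * i) = (emat n (2 * k) :: 'a sser)"
    "emat (n mod 2) (2 * i + 1) = (emat n (2 * k + 1) :: 'a sser)"
    using emat_shift[of "n mod 2" "2 * (n div 2)" "2 * i", where 'a = 'a]
      emat_shift[of "n mod 2" "2 * (n div 2)" "2 * i + 1", where 'a = 'a]
    by (simp_all add: i_def algebra_simps)
  have p: "\<epsilon> powi (n div 2) * \<epsilon> powi i = \<epsilon> powi k"
    using assms by (simp add: i_def flip: power_int_add)
  show ?thesis
    unfolding D_pow_exp_def i_def[symmetric] D s by (simp add: cscale_cscale p)
qed

text \<open>The case \<epsilon> = -1 needs no separate calculus: it is the case \<epsilon> = 1 with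
  z and \<theta> negated.\<close>

lemma op_apply_exp_eval:
  assumes "\<epsilon> \<noteq> 0"
  shows "op_apply_exp \<epsilon> P k =
    cscale (\<epsilon> powi k) (eval_row P (2 * k) + cscale \<epsilon> (eval_row P (2 * k + 1) * var Vtheta))"
proof -
  define a where "a l = P l * emat l (2 * k)" for l
  define b where "b l = P l * emat l (2 * k + 1) * var Vtheta" for l
  have s: "fsummable UNIV a" "fsummable UNIV b"
    unfolding a_def b_def by (intro fsummable_eval_row fsummable_mult_right)+
  have c: "fsummable UNIV (\<lambda>l. cscale \<epsilon> (b l))" by (rule finitary_fsummable[OF finitary_cscale s(2)])
  have "op_apply_exp \<epsilon> P k = fsum UNIV (\<lambda>l. cscale (\<epsilon> powi k) (a l + cscale \<epsilon> (b l)))"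
    unfolding op_apply_exp_def D_pow_exp_emat[OF assms] a_def b_def
    by (simp add: distrib_left mult_cscale_right mult.assoc)
  also have "\<dots> = cscale (\<epsilon> powi k) (fsum UNIV (\<lambda>l. a l + cscale \<epsilon> (b l)))"
    by (rule finitary_fsum[OF finitary_cscale fsummable_add[OF s(1) c], symmetric])
  also have "fsum UNIV (\<lambda>l. a l + cscale \<epsilon> (b l)) = fsum UNIV a + cscale \<epsilon> (fsum UNIV b)"
    by (simp add: fsum_add[OF s(1) c] finitary_fsum[OF finitary_cscale s(2)])
  also have "fsum UNIV b = eval_row P (2 * k + 1) * var Vtheta"
    unfolding b_def eval_row_def
    by (rule finitary_fsum[OF finitary_mult_right fsummable_eval_row, symmetric])
  finally show ?thesis by (simp add: a_def[abs_def] eval_row_def)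
qed

section \<open>Currents on the Fock space\<close>

text \<open>The coefficients that may be moved through modes and currents. Besides the times, x and
  \<xi> they include \<theta>, which enters through the fields.\<close>

definition scalar :: "'a::supercomm_algebra sser \<Rightarrow> bool"
  where "scalar a \<longleftrightarrow> in_vars (- (range Vc \<union> range Vb)) a"

lemma psign_nat_abs: "(- 1) ^ nat \<bar>n\<bar> = psign n"
  by (simp add: psign_def even_nat_iff minus_one_power_iff)

lemma C_B_exchange:
  "C_mode m (B_mode n f) =
    psign ((m + 1) * (n + 1)) * B_mode n (C_mode m f) + (if m + n = 0 then f else 0)"
  using C_B_commutator[of m n f] by (simp add: psign_nat_abs diff_eq_eq)

lemma C_C_exchange: "C_mode m (C_mode n f) = psign ((m + 1) * (n + 1)) * C_mode n (C_mode m f)"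
  using C_C_commutator[of m n f] by (simp add: psign_nat_abs)

lemma B_B_exchange: "B_mode m (B_mode n f) = psign ((m + 1) * (n + 1)) * B_mode n (B_mode m f)"
  using B_B_commutator[of m n f] by (simp add: psign_nat_abs)

lemma B_C_exchange:
  "B_mode n (C_mode m f) =
    psign ((m + 1) * (n + 1)) * (C_mode m (B_mode n f) - (if m + n = 0 then f else 0))"
  using C_B_exchange[of m n f] by (simp add: psign_def)

lemma finitary_C_mode: "finitary (C_mode m)"
  by (cases "m \<le> 0") (simp_all add: C_mode_def[abs_def] finitary_mult_left finitary_dvar)

lemma finitary_B_mode: "finitary (B_mode m)"
  using finitary_comp[OF finitary_neg finitary_dvar]
  by (cases "m < 0"; cases "even m")
    (simp_all add: B_mode_def[abs_def] finitary_mult_left finitary_dvar)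

lemma even_vpar_Vc [simp]: "even (vpar (Vc k)) \<longleftrightarrow> odd k" "even (vpar (Vb k)) \<longleftrightarrow> odd k"
  by (simp_all add: mono_deg_single)

lemma dvar_scalar: "scalar a \<Longrightarrow> dvar (Vc k) a = 0" "scalar a \<Longrightarrow> dvar (Vb k) a = 0"
  unfolding scalar_def by (erule dvar_in_vars, simp)+

lemma has_parity_fock_var:
  "m \<le> 0 \<Longrightarrow> has_parity (m + 1) (var (Vc (nat (- m))))"
  "m < 0 \<Longrightarrow> has_parity (m + 1) (var (Vb (nat (- m))))"
  by (subst has_parity_cong[OF _ , of _ "vpar (Vc (nat (- m)))"], simp add: even_nat_iff,
      rule has_parity_var)
    (subst has_parity_cong[OF _ , of _ "vpar (Vb (nat (- m)))"], simp add: even_nat_iff,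
      rule has_parity_var)

lemma C_mode_scalar: "scalar a \<Longrightarrow> C_mode m (a * f) = sign_twist (m + 1) a * C_mode m f"
proof (cases "m \<le> 0")
  case True
  from has_parity_commute[OF has_parity_fock_var(1)[OF this], of a] show ?thesis
    using True by (simp add: C_mode_def flip: mult.assoc)
next
  case False
  assume "scalar a"
  moreover have "sign_twist (vpar (Vb (nat m))) a = sign_twist (m + 1) a"
    using False by (intro sign_twist_cong) (simp add: even_nat_iff)
  ultimately show ?thesis using False by (simp add: C_mode_def dvar_mult dvar_scalar)
qed

lemma B_mode_scalar: "scalar a \<Longrightarrow> B_mode m (a * f) = sign_twist (m + 1) a * B_mode m f"
proof (cases "m < 0")
  case True
  from has_parity_commute[OF has_parity_fock_var(2)[OF this], of a] show ?thesis
    using True by (simp add: B_mode_def flip: mult.assoc)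
next
  case False
  assume "scalar a"
  moreover have "sign_twist (vpar (Vc (nat m))) a = sign_twist (m + 1) a"
    using False by (intro sign_twist_cong) (simp add: even_nat_iff)
  ultimately show ?thesis using False by (simp add: B_mode_def dvar_mult dvar_scalar)
qed

lemma C_mode_right: "scalar a \<Longrightarrow> C_mode m (f * a) = C_mode m f * a"
  by (simp add: C_mode_def dvar_mult dvar_scalar mult.assoc)

lemma B_mode_right: "scalar a \<Longrightarrow> B_mode m (f * a) = B_mode m f * a"
  by (simp add: B_mode_def dvar_mult dvar_scalar mult.assoc)

lemma has_parity_C_mode: "has_parity n f \<Longrightarrow> has_parity (n + m + 1) (C_mode m f)"
proof (cases "m \<le> 0")
  case True
  assume "has_parity n f"
  from has_parity_mult[OF has_parity_fock_var(1)[OF True] this] show ?thesis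
    using True by (simp add: C_mode_def ac_simps)
next
  case False
  assume "has_parity n f"
  from has_parity_dvar[OF this, of "Vb (nat m)"] show ?thesis
    using False by (subst has_parity_cong[of _ "n + vpar (Vb (nat m))"])
      (auto simp: C_mode_def even_nat_iff)
qed

lemma has_parity_B_mode: "has_parity n f \<Longrightarrow> has_parity (n + m + 1) (B_mode m f)"
proof (cases "m < 0")
  case True
  assume "has_parity n f"
  from has_parity_mult[OF has_parity_fock_var(2)[OF True] this] show ?thesis
    using True by (simp add: B_mode_def ac_simps)
next
  case False
  assume "has_parity n f"
  from has_parity_dvar[OF this, of "Vc (nat m)"]
  have "has_parity (n + m + 1) (dvar (Vc (nat m)) f)"
    using False by (subst has_parity_cong[of _ "n + vpar (Vc (nat m))"]) (auto simp: even_nat_iff)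
  then show ?thesis using False by (simp add: B_mode_def has_parity_minus)
qed

section \<open>Currents as infinite sums of products of two modes\<close>

definition vdeg :: "svar set \<Rightarrow> svar multiset \<Rightarrow> nat"
  where "vdeg V m = size {#v \<in># m. v \<in> V#}"

lemma vdeg_add: "vdeg V (p + q) = vdeg V p + vdeg V q"
  by (simp add: vdeg_def)

lemma coeff_C_mode_nonzero:
  assumes "coeff (C_mode m f) \<mu> \<noteq> 0"
  obtains \<nu> where "coeff f \<nu> \<noteq> 0" "V \<inter> (range Vc \<union> range Vb) = {} \<Longrightarrow> vdeg V \<nu> = vdeg V \<mu>"
    "m \<le> 0 \<Longrightarrow> Vc (nat (- m)) \<in># \<mu>"
proof (cases "m \<le> 0")
  case True
  then have "coeff (var (Vc (nat (- m))) * f) \<mu> \<noteq> 0" using assms by (simp add: C_mode_def)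
  then obtain q where "\<mu> = {#Vc (nat (- m))#} + q" "coeff f q \<noteq> 0"
    by (auto elim!: coeff_mult_nonzero dest!: coeff_var_nonzero)
  then show ?thesis by (intro that[of q]) (auto simp: vdeg_def)
next
  case False
  then have "coeff f (add_mset (Vb (nat m)) \<mu>) \<noteq> 0"
    using assms by (simp add: C_mode_def coeff_dvar_nonzero)
  then show ?thesis by (rule that) (use False in \<open>auto simp: vdeg_def\<close>)
qed

lemma coeff_B_mode_nonzero:
  assumes "coeff (B_mode m f) \<mu> \<noteq> 0"
  obtains \<nu> where "coeff f \<nu> \<noteq> 0" "V \<inter> (range Vc \<union> range Vb) = {} \<Longrightarrow> vdeg V \<nu> = vdeg V \<mu>"
    "m < 0 \<Longrightarrow> Vb (nat (- m)) \<in># \<mu>"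
proof (cases "m < 0")
  case True
  then have "coeff (var (Vb (nat (- m))) * f) \<mu> \<noteq> 0" using assms by (simp add: B_mode_def)
  then obtain q where "\<mu> = {#Vb (nat (- m))#} + q" "coeff f q \<noteq> 0"
    by (auto elim!: coeff_mult_nonzero dest!: coeff_var_nonzero)
  then show ?thesis by (intro that[of q]) (auto simp: vdeg_def)
next
  case False
  then have "coeff (dvar (Vc (nat m)) f) \<mu> \<noteq> 0"
    using assms by (auto simp: B_mode_def coeff_minus split: if_split_asm)
  then have "coeff f (add_mset (Vc (nat m)) \<mu>) \<noteq> 0" by (rule coeff_dvar_nonzero)
  then show ?thesis by (rule that) (use False in \<open>auto simp: vdeg_def\<close>)
qed

text \<open>\<open>cur 0\<close> and \<open>cur 1\<close> comprise \<open>j\<^sup>+\<close>, \<open>\<psi>\<^sup>+\<close> and \<open>- j\<^sup>-\<close>, \<open>\<psi>\<^sup>-\<close>, for even and odd \<open>N\<close>.\<close>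

definition cur :: "int \<Rightarrow> int \<Rightarrow> 'a::supercomm_algebra sser \<Rightarrow> 'a sser"
  where "cur a N f = fsum UNIV (\<lambda>l. C_mode (2 * l + a) (B_mode (N - 2 * l - a) f))"

text \<open>If the left mode creates, its variable occurs in the monomial. If the right mode
  creates, it is first moved to the left. In the remaining range of l both modes annihilate or have
  bounded index.\<close>

lemma cur_local:
  assumes "N > 0"
  shows "finite {l \<in> UNIV. \<exists>f::'a::supercomm_algebra sser. coeff (C_mode (2 * l + a) (B_mode (N - 2 * l - a) f)) \<mu> \<noteq> 0}"
proof -
  define idx where "idx = (\<lambda>v. case v of Vc k \<Rightarrow> k | Vb k \<Rightarrow> k | _ \<Rightarrow> 0)"
  define K where "K = int (Max (insert 0 (idx ` set_mset \<mu>)))"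
  have K: "int k \<le> K" if "Vc k \<in># \<mu> \<or> Vb k \<in># \<mu>" for k
  proof -
    have "k \<in> idx ` set_mset \<mu>" using that by (auto simp: idx_def image_iff intro: bexI[rotated])
    then have "k \<le> Max (insert 0 (idx ` set_mset \<mu>))" by (intro Max_ge) auto
    then show ?thesis by (simp add: K_def)
  qed
  have K0: "K \<ge> 0" by (simp add: K_def)
  let ?B = "N + K + \<bar>a\<bar>"
  have "l \<in> {- ?B .. ?B}" if nz: "coeff (C_mode (2 * l + a) (B_mode (N - 2 * l - a) f)) \<mu> \<noteq> 0"
    for l and f :: "'a sser"
  proof -
    obtain \<nu> where "2 * l + a \<le> 0 \<Longrightarrow> Vc (nat (- (2 * l + a))) \<in># \<mu>"
      using nz by (rule coeff_C_mode_nonzero[where V = "{}"]) (rule that)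
    then have 1: "2 * l + a \<le> 0 \<Longrightarrow> - (2 * l + a) \<le> K" using K[of "nat (- (2 * l + a))"] by auto
    \<comment> \<open>The two indices add up to N > 0, so the exchange has no contraction
      term.\<close>
    have "C_mode (2 * l + a) (B_mode (N - 2 * l - a) f) =
        psign ((2 * l + a + 1) * (N - 2 * l - a + 1)) * B_mode (N - 2 * l - a) (C_mode (2 * l + a) f)"
      unfolding C_B_exchange[of "2 * l + a"] using assms by simp
    then have "coeff (B_mode (N - 2 * l - a) (C_mode (2 * l + a) f)) \<mu> \<noteq> 0"
      using nz by (auto simp: psign_def coeff_minus split: if_splits)
    then obtain \<nu> where "N - 2 * l - a < 0 \<Longrightarrow> Vb (nat (- (N - 2 * l - a))) \<in># \<mu>"
      by (rule coeff_B_mode_nonzero[where V = "{}"]) (rule that)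
    then have 2: "N - 2 * l - a < 0 \<Longrightarrow> - (N - 2 * l - a) \<le> K"
      using K[of "nat (- (N - 2 * l - a))"] by auto
    have "2 * l + a \<ge> - K" "2 * l + a \<le> N + K" using 1 2 K0 assms by linarith+
    then show ?thesis using K0 assms abs_ge_self[of a] abs_ge_minus_self[of a] by auto
  qed
  then have "{l \<in> UNIV. \<exists>f::'a sser. coeff (C_mode (2 * l + a) (B_mode (N - 2 * l - a) f)) \<mu> \<noteq> 0}
      \<subseteq> {- ?B .. ?B}" by auto
  then show ?thesis by (rule finite_subset) simp
qed

lemma fsummable_cur:
  assumes "N > 0" shows "fsummable UNIV (\<lambda>l. C_mode (2 * l + a) (B_mode (N - 2 * l - a) f))"
  by (rule finitary_family(1)[where I = UNIV and f = "\<lambda>_. f" and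
        T = "\<lambda>l f. C_mode (2 * l + a) (B_mode (N - 2 * l - a) f)"])
    (rule finitary_comp[OF finitary_C_mode finitary_B_mode], rule cur_local[OF assms])

lemma finitary_cur:
  assumes "N > 0" shows "finitary (cur a N)"
  unfolding cur_def[abs_def]
  by (rule finitary_family(2)) (rule finitary_comp[OF finitary_C_mode finitary_B_mode], rule cur_local[OF assms])

lemma fsum_parity_delta:
  "fsum UNIV (\<lambda>l::int. if 2 * l + a = b then F else 0) = (if even (a + b) then F else 0)"
proof (cases "even (a + b)")
  case True
  define l where "l = (b - a) div 2"
  have "2 * l + a = b" using True by (simp add: l_def)
  then have "2 * i + a = b \<longleftrightarrow> i = l" for i by auto
  then show ?thesis using True fsum_delta[of l "\<lambda>_. F"] by simp
next
  case False
  then have "2 * i + a \<noteq> b" for i by auto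
  then show ?thesis using False by simp
qed

lemma fsummable_parity_delta: "fsummable UNIV (\<lambda>l::int. if 2 * l + a = b then F else 0)"
  by (rule fsummableI, rule finite_subset[of _ "{(b - a) div 2}"]) (auto split: if_split_asm)

text \<open>Only the summand C_i B_(N-i) with i = m + N contracts with C_m; the sum contains that
  index exactly when m + N + a is even.\<close>

lemma cur_C_mode:
  assumes N: "N > 0"
  shows "cur a N (C_mode m f) = psign ((m + 1) * N) * C_mode m (cur a N f) +
    (if even (m + N + a) then psign m * C_mode (m + N) f else 0)"
proof -
  note s = fsummable_cur[OF N]
  have t: "C_mode i (B_mode (N - i) (C_mode m f)) = psign ((m + 1) * N) * C_mode m (C_mode i (B_mode (N - i) f))
      + (if i = m + N then psign m * C_mode (m + N) f else 0)" for i
  proof -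
    have p: "psign ((m + 1) * (N - i + 1) + (i + 1) * (m + 1)) = (psign ((m + 1) * N) :: 'a sser)"
      by (rule psign_cong) auto
    have q: "psign ((m + 1) * (- m + 1)) = (- psign m :: 'a sser)"
      by (simp add: psign_def)
    show ?thesis
      unfolding B_C_exchange finitary_psign[OF finitary_C_mode] finitary_diff[OF finitary_C_mode]
        C_C_exchange[of i m]
      using p q by (auto simp: right_diff_distrib finitary_0[OF finitary_C_mode])
  qed
  have "cur a N (C_mode m f) =
      fsum UNIV (\<lambda>l. psign ((m + 1) * N) * C_mode m (C_mode (2 * l + a) (B_mode (N - 2 * l - a) f)) +
        (if 2 * l + a = m + N then psign m * C_mode (m + N) f else 0))"
    unfolding cur_def using t[of "2 * _ + a"] by (intro fsum_cong) (simp add: algebra_simps)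
  also have "\<dots> = fsum UNIV (\<lambda>l. psign ((m + 1) * N) * C_mode m (C_mode (2 * l + a) (B_mode (N - 2 * l - a) f))) +
      fsum UNIV (\<lambda>l. if 2 * l + a = m + N then psign m * C_mode (m + N) f else 0)"
    by (intro fsum_add fsummable_mult_left finitary_fsummable[OF finitary_C_mode] s fsummable_parity_delta)
  also have "fsum UNIV (\<lambda>l. psign ((m + 1) * N) * C_mode m (C_mode (2 * l + a) (B_mode (N - 2 * l - a) f))) =
      psign ((m + 1) * N) * C_mode m (cur a N f)"
    unfolding cur_def finitary_fsum[OF finitary_C_mode s]
    by (rule finitary_fsum[OF finitary_mult_left, symmetric])
      (rule finitary_fsummable[OF finitary_C_mode s])
  also note fsum_parity_delta
  finally show ?thesis by (simp add: ac_simps)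
qed

text \<open>The contracting summand is the one with i = - m, hence the condition on m + a.\<close>

lemma cur_B_mode:
  assumes N: "N > 0"
  shows "cur a N (B_mode m f) = psign ((m + 1) * N) * B_mode m (cur a N f) +
    (if even (m + a) then psign ((N + m + 1) * (m + 1)) * B_mode (m + N) f else 0)"
proof -
  note s = fsummable_cur[OF N]
  have t: "C_mode i (B_mode (N - i) (B_mode m f)) = psign ((m + 1) * N) * B_mode m (C_mode i (B_mode (N - i) f))
      + (if i = - m then psign ((N + m + 1) * (m + 1)) * B_mode (m + N) f else 0)" for i
  proof -
    have i: "i + m = 0 \<longleftrightarrow> i = - m" by auto
    have p: "psign ((N - i + 1) * (m + 1) + (i + 1) * (m + 1)) = (psign ((m + 1) * N) :: 'a sser)"
      by (rule psign_cong) auto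
    show ?thesis
      unfolding B_B_exchange[of "N - i" m] finitary_psign[OF finitary_C_mode] C_B_exchange[of i m] i
      by (cases "i = - m") (use p in \<open>simp_all add: distrib_left ac_simps\<close>)
  qed
  have "cur a N (B_mode m f) =
      fsum UNIV (\<lambda>l. psign ((m + 1) * N) * B_mode m (C_mode (2 * l + a) (B_mode (N - 2 * l - a) f)) +
        (if 2 * l + a = - m then psign ((N + m + 1) * (m + 1)) * B_mode (m + N) f else 0))"
    unfolding cur_def using t[of "2 * _ + a"] by (intro fsum_cong) (simp add: algebra_simps)
  also have "\<dots> = fsum UNIV (\<lambda>l. psign ((m + 1) * N) * B_mode m (C_mode (2 * l + a) (B_mode (N - 2 * l - a) f))) +
      fsum UNIV (\<lambda>l. if 2 * l + a = - m then psign ((N + m + 1) * (m + 1)) * B_mode (m + N) f else 0)"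
    by (intro fsum_add fsummable_mult_left finitary_fsummable[OF finitary_B_mode] s fsummable_parity_delta)
  also have "fsum UNIV (\<lambda>l. psign ((m + 1) * N) * B_mode m (C_mode (2 * l + a) (B_mode (N - 2 * l - a) f))) =
      psign ((m + 1) * N) * B_mode m (cur a N f)"
    unfolding cur_def finitary_fsum[OF finitary_B_mode s]
    by (rule finitary_fsum[OF finitary_mult_left, symmetric])
      (rule finitary_fsummable[OF finitary_B_mode s])
  also note fsum_parity_delta
  finally show ?thesis by (simp add: ac_simps)
qed

lemma scalar_sign_twist: "scalar a \<Longrightarrow> scalar (sign_twist n a)"
  by (simp add: scalar_def in_vars_sign_twist)

lemma cur_scalar:
  assumes N: "N > 0" and a: "scalar a" shows "cur b N (a * f) = sign_twist N a * cur b N f"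
proof -
  have "C_mode i (B_mode (N - i) (a * f)) = sign_twist N a * C_mode i (B_mode (N - i) f)" for i
  proof -
    have "sign_twist (i + 1 + (N - i + 1)) a = sign_twist N a" by (rule sign_twist_cong) auto
    then show ?thesis
      by (simp add: B_mode_scalar C_mode_scalar a scalar_sign_twist sign_twist_twist)
  qed
  then have "C_mode (2 * l + b) (B_mode (N - 2 * l - b) (a * f)) =
      sign_twist N a * C_mode (2 * l + b) (B_mode (N - 2 * l - b) f)" for l
    by (metis diff_diff_eq)
  then show ?thesis
    unfolding cur_def by (simp only: finitary_fsum[OF finitary_mult_left fsummable_cur[OF N]])
qed

lemma cur_right: "N > 0 \<Longrightarrow> scalar a \<Longrightarrow> cur b N (f * a) = cur b N f * a"
  by (simp add: cur_def B_mode_right C_mode_right finitary_fsum[OF finitary_mult_right fsummable_cur])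

lemma has_parity_cur:
  assumes N: "N > 0" and f: "has_parity n f" shows "has_parity (n + N) (cur b N f)"
  unfolding cur_def
proof (rule has_parity_fsum[OF fsummable_cur[OF N]])
  fix l
  from has_parity_C_mode[OF has_parity_B_mode[OF f, of "N - 2 * l - b"], of "2 * l + b"]
  show "has_parity (n + N) (C_mode (2 * l + b) (B_mode (N - 2 * l - b) f))"
    by (rule has_parity_cong[THEN iffD1, rotated]) auto
qed

lemma coeff_cur_nonzero:
  assumes "coeff (cur b N f) \<mu> \<noteq> 0" "V \<inter> (range Vc \<union> range Vb) = {}"
  obtains \<nu> where "coeff f \<nu> \<noteq> 0" "vdeg V \<nu> = vdeg V \<mu>"
proof -
  obtain l where "coeff (C_mode (2 * l + b) (B_mode (N - 2 * l - b) f)) \<mu> \<noteq> 0"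
    using assms(1) unfolding cur_def by (rule coeff_fsum_nonzero)
  then obtain \<nu> where 1: "coeff (B_mode (N - 2 * l - b) f) \<nu> \<noteq> 0"
    "V \<inter> (range Vc \<union> range Vb) = {} \<Longrightarrow> vdeg V \<nu> = vdeg V \<mu>"
    by (rule coeff_C_mode_nonzero[where V = V]) (rule that)
  from 1(1) obtain \<rho> where 2: "coeff f \<rho> \<noteq> 0"
    "V \<inter> (range Vc \<union> range Vb) = {} \<Longrightarrow> vdeg V \<rho> = vdeg V \<nu>"
    by (rule coeff_B_mode_nonzero[where V = V]) (rule that)
  show ?thesis by (rule that[OF 2(1)]) (simp add: 1 2 assms(2))
qed

text \<open>\<open>H = \<Sum>\<^sub>N ge\<^sub>N cur\<^sub>0\<^sub>N + (-1)\<^bsup>N+1\<^esup> go\<^sub>N cur\<^sub>1\<^sub>N\<close>; the signs are such that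
  \<open>[H, C\<^sub>m] = \<Sum>\<^sub>N C\<^bsub>m+N\<^esub> g\<^sub>N\<close> with \<open>g = ge\<close> for even and \<open>g = go\<close> for odd \<open>m + N\<close>.\<close>

definition current_term ::
  "(nat \<Rightarrow> 'a::supercomm_algebra sser) \<Rightarrow> (nat \<Rightarrow> 'a sser) \<Rightarrow> nat \<Rightarrow> 'a sser \<Rightarrow> 'a sser"
  where "current_term ge go N f =
    ge N * cur 0 (int N) f + psign (int N + 1) * (go N * cur 1 (int N) f)"

definition current ::
  "(nat \<Rightarrow> 'a::supercomm_algebra sser) \<Rightarrow> (nat \<Rightarrow> 'a sser) \<Rightarrow> 'a sser \<Rightarrow> 'a sser"
  where "current ge go f = fsum {1..} (\<lambda>N. current_term ge go N f)"

text \<open>Each monomial of a coefficient contains a variable of V, so every application of the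
  current raises the degree in V and the exponential is a finite sum at each monomial. Since the
  N-th coefficient has parity N, the whole current is even.\<close>

definition flow :: "svar set \<Rightarrow> (nat \<Rightarrow> 'a::supercomm_algebra sser) \<Rightarrow> bool"
  where "flow V g \<longleftrightarrow> V \<inter> (range Vc \<union> range Vb) = {} \<and> fsummable UNIV g \<and>
    (\<forall>N. in_vars V (g N) \<and> has_parity (int N) (g N)) \<and>
    (\<forall>N m. coeff (g N) m \<noteq> 0 \<longrightarrow> vdeg V m \<ge> 1)"

lemma flow_scalar: "flow V g \<Longrightarrow> scalar (g N)"
  unfolding flow_def scalar_def by (auto intro: in_vars_mono)

lemma finitary_current_term: "N \<ge> 1 \<Longrightarrow> finitary (current_term ge go N)"
  unfolding current_term_def[abs_def]
  by (intro finitary_plus finitary_comp[OF finitary_mult_left] finitary_cur) auto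

lemma coeff_current_term_nonzero:
  assumes "flow V ge" "flow V go" "coeff (current_term ge go N f) \<mu> \<noteq> 0"
  obtains \<nu> p where "coeff f \<nu> \<noteq> 0" "vdeg V \<nu> + 1 \<le> vdeg V \<mu>" "p \<subseteq># \<mu>"
    "coeff (ge N) p \<noteq> 0 \<or> coeff (go N) p \<noteq> 0"
proof -
  have V: "V \<inter> (range Vc \<union> range Vb) = {}" using assms(1) by (simp add: flow_def)
  obtain g b where g: "flow V g" "g = ge \<or> g = go" "coeff (g N * cur b (int N) f) \<mu> \<noteq> 0"
  proof -
    have "coeff (ge N * cur 0 (int N) f) \<mu> \<noteq> 0 \<or> coeff (go N * cur 1 (int N) f) \<mu> \<noteq> 0"
      using assms(3) by (auto simp: current_term_def coeff_add psign_def coeff_minus split: if_split_asm)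
    then show ?thesis using that assms(1,2) by blast
  qed
  obtain p q where pq: "\<mu> = p + q" "coeff (g N) p \<noteq> 0" "coeff (cur b (int N) f) q \<noteq> 0"
    using g(3) by (rule coeff_mult_nonzero)
  obtain \<nu> where "coeff f \<nu> \<noteq> 0" "vdeg V \<nu> = vdeg V q" using coeff_cur_nonzero[OF pq(3) V] .
  moreover have "vdeg V p \<ge> 1" using g(1) pq(2) by (auto simp: flow_def)
  ultimately show ?thesis
    using that[of \<nu> p] pq g(2) mset_subset_eq_add_left[of p q] by (auto simp: vdeg_add)
qed

lemma current_local:
  assumes "flow V ge" "flow V go"
  shows "finite {N \<in> {1..}. \<exists>f. coeff (current_term ge go N f) \<mu> \<noteq> 0}"
proof (rule finite_subset)
  show "{N \<in> {1..}. \<exists>f. coeff (current_term ge go N f) \<mu> \<noteq> 0} \<subseteq>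
      (\<Union>p\<in>{p. p \<subseteq># \<mu>}. {N \<in> UNIV. coeff (ge N) p \<noteq> 0} \<union> {N \<in> UNIV. coeff (go N) p \<noteq> 0})"
    by (auto elim!: coeff_current_term_nonzero[OF assms])
  show "finite \<dots>"
    using assms by (auto simp: flow_def fsummable_def finite_submonos)
qed

lemma fsummable_current: "flow V ge \<Longrightarrow> flow V go \<Longrightarrow> fsummable {1..} (\<lambda>N. current_term ge go N f)"
  and finitary_current: "flow V ge \<Longrightarrow> flow V go \<Longrightarrow> finitary (current ge go)"
  using finitary_family[of "{1..}" "current_term ge go"] current_local[of V ge go]
    finitary_current_term[of _ ge go]
  by (simp_all add: current_def[abs_def])

lemma current_scalar:
  assumes g: "flow V ge" "flow V go" and a: "scalar a"
  shows "current ge go (a * f) = a * current ge go f"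
proof -
  have "current_term ge go N (a * f) = a * current_term ge go N f" if "N \<ge> 1" for N
  proof -
    have "g N * (sign_twist (int N) a * X) = a * (g N * X)" if "flow V g" for g and X :: "'a sser"
    proof -
      have "has_parity (int N) (g N)" using that by (simp add: flow_def)
      from has_parity_commute[OF this, of "sign_twist (int N) a"] show ?thesis
        by (simp flip: mult.assoc)
    qed
    then show ?thesis using that g a
      by (simp add: current_term_def cur_scalar distrib_left psign_left_commute[of a])
  qed
  then have "current ge go (a * f) = fsum {1..} (\<lambda>N. a * current_term ge go N f)"
    unfolding current_def by (intro fsum_cong) simp
  then show ?thesis
    unfolding current_def by (simp only: finitary_fsum[OF finitary_mult_left fsummable_current[OF g]])
qed

lemma current_right:
  assumes g: "flow V ge" "flow V go" and a: "scalar a"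
  shows "current ge go (f * a) = current ge go f * a"
proof -
  have "current ge go (f * a) = fsum {1..} (\<lambda>N. current_term ge go N f * a)"
    unfolding current_def
    by (intro fsum_cong) (simp add: current_term_def cur_right a distrib_right mult.assoc)
  then show ?thesis
    unfolding current_def by (simp only: finitary_fsum[OF finitary_mult_right fsummable_current[OF g]])
qed

lemma has_parity_current:
  assumes g: "flow V ge" "flow V go" and f: "has_parity n f"
  shows "has_parity n (current ge go f)"
  unfolding current_def
proof (rule has_parity_fsum[OF fsummable_current[OF g]])
  fix N :: nat assume "N \<in> {1..}"
  then have c: "has_parity (n + int N) (cur b (int N) f)" for b by (intro has_parity_cur f) simp
  have w: "has_parity n (h N * cur b (int N) f)" if "flow V h" for h b
  proof -
    have "has_parity (int N) (h N)" using that by (simp add: flow_def)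
    from has_parity_mult[OF this c[of b]] show ?thesis
      by (rule has_parity_cong[THEN iffD1, rotated]) simp
  qed
  show "has_parity n (current_term ge go N f)"
    unfolding current_term_def by (intro has_parity_add has_parity_psign w g)
qed

lemma coeff_current_nonzero:
  assumes "coeff (current ge go f) \<mu> \<noteq> 0"
  obtains N where "coeff (current_term ge go N f) \<mu> \<noteq> 0"
  using assms unfolding current_def by (rule coeff_fsum_nonzero)

lemma fsummable_flow_if:
  assumes "flow V ge" "flow V go"
  shows "fsummable I (\<lambda>N. if P N then ge N else go N)"
proof (rule fsummableI)
  fix m
  show "finite {N \<in> I. coeff (if P N then ge N else go N) m \<noteq> 0}"
    by (rule finite_subset[of _ "{N \<in> UNIV. coeff (ge N) m \<noteq> 0} \<union> {N \<in> UNIV. coeff (go N) m \<noteq> 0}"])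
      (use assms in \<open>auto simp: flow_def fsummable_def\<close>)
qed

lemma fsummable_sign_twist: "fsummable I f \<Longrightarrow> fsummable I (\<lambda>i. sign_twist (k i) (f i))"
  by (simp add: fsummable_def)

lemma fsummable_psign: "fsummable I f \<Longrightarrow> fsummable I (\<lambda>i. psign (k i) * f i)"
  by (rule fsummable_mult_left)

lemma fsum_int_reindex:
  "fsum {1..} (\<lambda>N. f (k - int N) N) = fsum UNIV (\<lambda>l. if l < k then f l (nat (k - l)) else 0)"
proof -
  have b: "bij_betw (\<lambda>l. nat (k - l)) {..<k} {1..}"
    by (rule bij_betw_byWitness[where f' = "\<lambda>N. k - int N"]) auto
  have "fsum {1..} (\<lambda>N. f (k - int N) N) = fsum {..<k} (\<lambda>l. f l (nat (k - l)))"
    by (subst fsum_reindex[OF b]) (auto intro: fsum_cong)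
  also have "\<dots> = fsum UNIV (\<lambda>l. if l \<in> {..<k} then f l (nat (k - l)) else 0)"
    by (rule fsum_restrict) simp
  finally show ?thesis by simp
qed

text \<open>The matrix of the commutator of a current with the modes of \<open>C\<close>.\<close>

definition hmat :: "(nat \<Rightarrow> 'a::supercomm_algebra sser) \<Rightarrow> (nat \<Rightarrow> 'a sser) \<Rightarrow> int \<Rightarrow> int \<Rightarrow> 'a sser"
  where "hmat ge go l k = (if l < k then (if even l then ge else go) (nat (k - l)) else 0)"

definition cmode :: "int \<Rightarrow> 'a::supercomm_algebra sser \<Rightarrow> 'a sser"
  where "cmode k = C_mode (- k)"

text \<open>The signs make the dual modes transform with the matrix of \<open>- H\<^sup>*\<close>.\<close>

definition bmode :: "int \<Rightarrow> 'a::supercomm_algebra sser \<Rightarrow> 'a sser"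
  where "bmode k f = psign (k * (k - 1) div 2) * B_mode (- k - 1) f"

lemma flow_twist: "flow V h \<Longrightarrow> sign_twist k (h N) = psign (k * int N) * h N"
  by (rule has_parity_sign_twist) (simp add: flow_def)

section \<open>Commutators of currents with modes\<close>

lemma current_C_mode:
  assumes g: "flow V ge" "flow V go"
  shows "current ge go (C_mode m f) = C_mode m (current ge go f) +
    fsum {1..} (\<lambda>N. C_mode (m + int N) ((if even (m + int N) then ge N else go N) * f))"
proof -
  have t: "current_term ge go N (C_mode m f) = C_mode m (current_term ge go N f) +
      C_mode (m + int N) ((if even (m + int N) then ge N else go N) * f)" if N: "N \<ge> 1" for N
  proof -
    have 1: "psign ((m + 1) * int N) * (h N * C_mode m X) = C_mode m (h N * X)" if "flow V h" for h X
    proof -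
      have "has_parity (int N) (h N)" using that by (simp add: flow_def)
      from has_parity_sign_twist[OF this, of "m + 1"] show ?thesis
        by (simp add: C_mode_scalar[OF flow_scalar[OF that]] psign_left_commute[of "h N"] mult.assoc)
    qed
    have 2: "h N * C_mode (m + int N) f = psign (m * int N) * C_mode (m + int N) (h N * f)"
      if "flow V h" for h
    proof -
      have "has_parity (int N) (h N)" using that by (simp add: flow_def)
      from has_parity_sign_twist[OF this, of "m + int N + 1"]
      have "C_mode (m + int N) (h N * f) = psign ((m + int N + 1) * int N) * (h N * C_mode (m + int N) f)"
        by (simp add: C_mode_scalar[OF flow_scalar[OF that]] mult.assoc)
      also have "psign ((m + int N + 1) * int N) = (psign (m * int N) :: 'a sser)"
        by (rule psign_cong) auto
      finally show ?thesis by (simp add: psign_def)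
    qed
    \<comment> \<open>With the coefficient moved inside the mode the sign left over is that of m + m
      N. For even m + N it is trivial; for odd m + N it is cancelled by the factor
      \<open>psign (int N + 1)\<close> in \<open>current_term\<close>.\<close>
    have A: "h N * cur b (int N) (C_mode m f) = C_mode m (h N * cur b (int N) f) +
        (if even (m + int N + b) then psign (m + m * int N) * C_mode (m + int N) (h N * f) else 0)"
      if "flow V h" for h b
    proof -
      have "int N > 0" using N by simp
      from cur_C_mode[OF this, of b m f] show ?thesis
        by (simp add: distrib_left 1[OF that] 2[OF that] psign_left_commute[of "h N"])
    qed
    show ?thesis
    proof (cases "even (m + int N)")
      case True
      then have "psign (m + m * int N) = (1 :: 'a sser)" by (cases "even m") auto
      then show ?thesis using True A[OF g(1), of 0] A[OF g(2), of 1]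
        by (simp add: current_term_def finitary_add[OF finitary_C_mode]
            finitary_psign[OF finitary_C_mode])
    next
      case False
      then have "psign (int N + 1) * psign (m + m * int N) = (1 :: 'a sser)"
        unfolding psign_mult by (cases "even m") auto
      then have "psign (int N + 1) * (psign (m + m * int N) * X) = X" for X :: "'a sser"
        by (simp only: mult.assoc[symmetric] mult_1_left)
      then show ?thesis using False A[OF g(1), of 0] A[OF g(2), of 1]
        by (simp add: current_term_def finitary_add[OF finitary_C_mode] distrib_left
            finitary_psign[OF finitary_C_mode] del: psign_mult')
    qed
  qed
  have s: "fsummable {1..} (\<lambda>N. C_mode (m + int N) ((if even (m + int N) then ge N else go N) * f))"
  proof -
    have "C_mode (m + int N) ((if even (m + int N) then ge N else go N) * f) =
        sign_twist (m + int N + 1) (if even (m + int N) then ge N else go N) * C_mode (m + int N) f" for N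
      using flow_scalar[OF g(1)] flow_scalar[OF g(2)] by (simp add: C_mode_scalar)
    then show ?thesis
      by (simp only:) (intro fsummable_mult_right fsummable_sign_twist fsummable_flow_if[OF g])
  qed
  have "current ge go (C_mode m f) = fsum {1..} (\<lambda>N. C_mode m (current_term ge go N f) +
      C_mode (m + int N) ((if even (m + int N) then ge N else go N) * f))"
    unfolding current_def by (rule fsum_cong, rule t) simp
  also have "\<dots> = fsum {1..} (\<lambda>N. C_mode m (current_term ge go N f)) +
      fsum {1..} (\<lambda>N. C_mode (m + int N) ((if even (m + int N) then ge N else go N) * f))"
    by (rule fsum_add[OF finitary_fsummable[OF finitary_C_mode fsummable_current[OF g]] s])
  also have "fsum {1..} (\<lambda>N. C_mode m (current_term ge go N f)) = C_mode m (current ge go f)"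
    unfolding current_def by (rule finitary_fsum[OF finitary_C_mode fsummable_current[OF g], symmetric])
  finally show ?thesis .
qed

text \<open>Unlike for the modes of C, a sign depending on N survives for even m. Removing it is one
  purpose of the normalisation in \<open>bmode\<close>.\<close>

lemma current_B_mode:
  assumes g: "flow V ge" "flow V go"
  shows "current ge go (B_mode m f) = B_mode m (current ge go f) +
    fsum {1..} (\<lambda>N. psign (if even m then int N + 1 else 1) *
      B_mode (m + int N) ((if even m then ge N else go N) * f))"
proof -
  have t: "current_term ge go N (B_mode m f) = B_mode m (current_term ge go N f) +
      psign (if even m then int N + 1 else 1) *
        B_mode (m + int N) ((if even m then ge N else go N) * f)" if N: "N \<ge> 1" for N
  proof -
    have 1: "psign ((m + 1) * int N) * (h N * B_mode m X) = B_mode m (h N * X)" if "flow V h" for h X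
      by (simp add: B_mode_scalar[OF flow_scalar[OF that]] flow_twist[OF that]
          psign_left_commute[of "h N"] mult.assoc)
    have 2: "h N * B_mode (m + int N) f = psign (m * int N) * B_mode (m + int N) (h N * f)"
      if "flow V h" for h
    proof -
      have "B_mode (m + int N) (h N * f) = psign ((m + int N + 1) * int N) * (h N * B_mode (m + int N) f)"
        by (simp add: B_mode_scalar[OF flow_scalar[OF that]] flow_twist[OF that] mult.assoc)
      also have "psign ((m + int N + 1) * int N) = (psign (m * int N) :: 'a sser)"
        by (rule psign_cong) auto
      finally show ?thesis by (simp add: psign_def)
    qed
    have A: "h N * cur b (int N) (B_mode m f) = B_mode m (h N * cur b (int N) f) +
        (if even (m + b) then psign ((int N + m + 1) * (m + 1) + m * int N) *
          B_mode (m + int N) (h N * f) else 0)"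
      if "flow V h" for h b
    proof -
      have "int N > 0" using N by simp
      from cur_B_mode[OF this, of b m f] show ?thesis
        by (simp add: distrib_left 1[OF that] 2[OF that] psign_left_commute[of "h N"])
    qed
    show ?thesis
    proof (cases "even m")
      case True
      then have "psign ((int N + m + 1) * (m + 1) + m * int N) = (psign (int N + 1) :: 'a sser)"
        by (intro psign_cong) auto
      then show ?thesis using True A[OF g(1), of 0] A[OF g(2), of 1]
        by (simp add: current_term_def finitary_add[OF finitary_B_mode]
            finitary_psign[OF finitary_B_mode])
    next
      case False
      then have "psign (int N + 1) * psign ((int N + m + 1) * (m + 1) + m * int N) = (- 1 :: 'a sser)"
        unfolding psign_mult by (subst psign_odd) auto
      then have "psign (int N + 1) * (psign ((int N + m + 1) * (m + 1) + m * int N) * X) = - X"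
        for X :: "'a sser"
        by (simp only: mult.assoc[symmetric] mult_minus1)
      then show ?thesis using False A[OF g(1), of 0] A[OF g(2), of 1]
        by (simp add: current_term_def finitary_add[OF finitary_B_mode] distrib_left
            finitary_psign[OF finitary_B_mode] del: psign_mult')
    qed
  qed
  have s: "fsummable {1..} (\<lambda>N. psign (if even m then int N + 1 else 1) *
      B_mode (m + int N) ((if even m then ge N else go N) * f))"
  proof -
    have "B_mode (m + int N) ((if even m then ge N else go N) * f) =
        sign_twist (m + int N + 1) (if even m then ge N else go N) * B_mode (m + int N) f" for N
      using flow_scalar[OF g(1)] flow_scalar[OF g(2)] by (simp add: B_mode_scalar)
    then show ?thesis
      by (simp only:)
        (intro fsummable_psign fsummable_mult_right fsummable_sign_twist fsummable_flow_if[OF g])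
  qed
  have "current ge go (B_mode m f) = fsum {1..} (\<lambda>N. B_mode m (current_term ge go N f) +
      psign (if even m then int N + 1 else 1) *
        B_mode (m + int N) ((if even m then ge N else go N) * f))"
    unfolding current_def by (rule fsum_cong, rule t) simp
  also have "\<dots> = fsum {1..} (\<lambda>N. B_mode m (current_term ge go N f)) +
      fsum {1..} (\<lambda>N. psign (if even m then int N + 1 else 1) *
        B_mode (m + int N) ((if even m then ge N else go N) * f))"
    by (rule fsum_add[OF finitary_fsummable[OF finitary_B_mode fsummable_current[OF g]] s])
  also have "fsum {1..} (\<lambda>N. B_mode m (current_term ge go N f)) = B_mode m (current ge go f)"
    unfolding current_def by (rule finitary_fsum[OF finitary_B_mode fsummable_current[OF g], symmetric])
  finally show ?thesis .
qed

lemma current_cmode: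
  assumes g: "flow V ge" "flow V go"
  shows "current ge go (cmode k f) =
    cmode k (current ge go f) + fsum UNIV (\<lambda>l. cmode l (hmat ge go l k * f))"
proof -
  have "fsum {1..} (\<lambda>N. C_mode (- k + int N) ((if even (- k + int N) then ge N else go N) * f)) =
      fsum {1..} (\<lambda>N. cmode (k - int N) ((if even (k - int N) then ge N else go N) * f))"
    by (rule fsum_cong) (simp add: cmode_def)
  also have "\<dots> = fsum UNIV (\<lambda>l. cmode l (hmat ge go l k * f))"
    unfolding fsum_int_reindex[of "\<lambda>l N. cmode l ((if even l then ge N else go N) * f)"]
    by (rule fsum_cong) (simp add: hmat_def cmode_def finitary_0[OF finitary_C_mode])
  finally show ?thesis using current_C_mode[OF g, of "- k" f] by (simp add: cmode_def)
qed

text \<open>By the first part of \<open>D_pow_op_adj\<close> this is the matrix of minus the adjoint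
  of an operator whose matrix is \<open>hmat\<close>.\<close>

definition hmat_dual :: "(nat \<Rightarrow> 'a::supercomm_algebra sser) \<Rightarrow> (nat \<Rightarrow> 'a sser) \<Rightarrow> int \<Rightarrow> int \<Rightarrow> 'a sser"
  where "hmat_dual ge go l k = - (psign (adj_sign l k) * hmat ge go (- k - 1) (- l - 1))"

lemma eps_eta: "k * (k + 1) div 2 = k * (k - 1) div 2 + (k :: int)"
proof -
  have "k * (k + 1) = k * (k - 1) + 2 * k" by (simp add: algebra_simps)
  then show ?thesis by simp
qed

lemma current_bmode:
  assumes g: "flow V ge" "flow V go"
  shows "current ge go (bmode k f) =
    bmode k (current ge go f) + fsum UNIV (\<lambda>l. bmode l (hmat_dual ge go l k * f))"
proof -
  let ?e = "\<lambda>k::int. k * (k - 1) div 2"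
  have t: "psign (?e k) * (psign (if even (- k - 1) then int N + 1 else 1) *
        B_mode (- k - 1 + int N) ((if even (- k - 1) then ge N else go N) * f)) =
      bmode (k - int N) (psign (1 + adj_sign (k - int N) k) * (if odd k then ge N else go N) * f)" for N
  proof -
    have "adj_sign (k - int N) k = ?e k + k + k * (k - int N) + ?e (k - int N)"
      by (simp add: adj_sign_def eps_eta)
    then have "psign (?e (k - int N) + (1 + adj_sign (k - int N) k)) =
        (psign (?e k + (if odd k then int N + 1 else 1)) :: 'a sser)"
      by (intro psign_cong) auto
    then show ?thesis
      by (simp add: bmode_def mult.assoc finitary_psign[OF finitary_B_mode] algebra_simps)
  qed
  have "current ge go (bmode k f) = bmode k (current ge go f) +
      psign (?e k) * fsum {1..} (\<lambda>N. psign (if even (- k - 1) then int N + 1 else 1) *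
        B_mode (- k - 1 + int N) ((if even (- k - 1) then ge N else go N) * f))"
    unfolding bmode_def finitary_psign[OF finitary_current[OF g]] current_B_mode[OF g] distrib_left ..
  also have "psign (?e k) * fsum {1..} (\<lambda>N. psign (if even (- k - 1) then int N + 1 else 1) *
        B_mode (- k - 1 + int N) ((if even (- k - 1) then ge N else go N) * f)) =
      fsum {1..} (\<lambda>N. bmode (k - int N) (psign (1 + adj_sign (k - int N) k) *
        (if odd k then ge N else go N) * f))"
    unfolding t[symmetric]
    by (cases "even (?e k)") (simp_all add: fsum_minus)
  also have "\<dots> = fsum UNIV (\<lambda>l. bmode l (hmat_dual ge go l k * f))"
    unfolding fsum_int_reindex[of "\<lambda>l N. bmode l (psign (1 + adj_sign l k) * (if odd k then ge N else go N) * f)"]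
    by (rule fsum_cong) (auto simp: hmat_dual_def hmat_def bmode_def finitary_0[OF finitary_B_mode]
        psign_def algebra_simps)
  finally show ?thesis .
qed

section \<open>Exponentials of currents\<close>

abbreviation cexp where "cexp ge go \<equiv> fock_exp (current ge go)"

lemma coeff_current_pow_vdeg:
  assumes g: "flow V ge" "flow V go" and "coeff ((current ge go ^^ j) f) \<mu> \<noteq> 0"
  shows "j \<le> vdeg V \<mu>"
  using assms(3)
proof (induction j arbitrary: \<mu>)
  case (Suc j)
  then have "coeff (current ge go ((current ge go ^^ j) f)) \<mu> \<noteq> 0" by simp
  then obtain N where "coeff (current_term ge go N ((current ge go ^^ j) f)) \<mu> \<noteq> 0"
    by (rule coeff_current_nonzero)
  then obtain \<nu> where "coeff ((current ge go ^^ j) f) \<nu> \<noteq> 0" "vdeg V \<nu> + 1 \<le> vdeg V \<mu>"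
    by (rule coeff_current_term_nonzero[OF g])
  then show ?case using Suc.IH[of \<nu>] by simp
qed simp

lemma coeff_cscale_nonzero: "coeff (cscale c f) m \<noteq> 0 \<Longrightarrow> coeff f m \<noteq> 0"
  by (auto simp: coeff_cscale)

lemma fsummable_current_pow_terms:
  assumes g: "flow V ge" "flow V go"
  shows "fsummable UNIV (\<lambda>j. cscale (c j) ((current ge go ^^ j) f))"
proof (rule fsummableI)
  fix m
  have "j \<in> {..vdeg V m}" if "coeff (cscale (c j) ((current ge go ^^ j) f)) m \<noteq> 0" for j
    using coeff_current_pow_vdeg[OF g coeff_cscale_nonzero[OF that]] by simp
  then show "finite {j \<in> UNIV. coeff (cscale (c j) ((current ge go ^^ j) f)) m \<noteq> 0}"
    by - (rule finite_subset[of _ "{..vdeg V m}"], auto)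
qed

lemma finitary_cexp:
  assumes g: "flow V ge" "flow V go" shows "finitary (cexp ge go)"
  unfolding fock_exp_def[abs_def]
proof (rule finitary_family(2))
  show "finitary (\<lambda>f. cscale (1 / fact j) ((current ge go ^^ j) f))" for j
    by (rule finitary_comp[OF finitary_cscale finitary_funpow[OF finitary_current[OF g]]])
  fix m
  have "j \<in> {..vdeg V m}" if "coeff (cscale (1 / fact j) ((current ge go ^^ j) f)) m \<noteq> 0" for j f
    using coeff_current_pow_vdeg[OF g coeff_cscale_nonzero[OF that]] by simp
  then show "finite {j \<in> UNIV. \<exists>f. coeff (cscale (1 / fact j) ((current ge go ^^ j) f)) m \<noteq> 0}"
    by - (rule finite_subset[of _ "{..vdeg V m}"], auto)
qed

text \<open>The current is even, so even odd scalars pass through without a sign.\<close>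

lemma cexp_scalar:
  assumes g: "flow V ge" "flow V go" and a: "scalar a"
  shows "cexp ge go (a * f) = a * cexp ge go f"
proof -
  have "(current ge go ^^ j) (a * f) = a * (current ge go ^^ j) f" for j
    by (induction j) (simp_all add: current_scalar[OF g a])
  then show ?thesis
    by (simp add: fock_exp_def finitary_fsum[OF finitary_mult_left fsummable_current_pow_terms[OF g]]
        mult_cscale_right)
qed

lemma cexp_right:
  assumes g: "flow V ge" "flow V go" and a: "scalar a"
  shows "cexp ge go (f * a) = cexp ge go f * a"
proof -
  have "(current ge go ^^ j) (f * a) = (current ge go ^^ j) f * a" for j
    by (induction j) (simp_all add: current_right[OF g a])
  then show ?thesis
    by (simp add: fock_exp_def finitary_fsum[OF finitary_mult_right fsummable_current_pow_terms[OF g]]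
        mult_cscale_left)
qed

lemma has_parity_cexp:
  assumes g: "flow V ge" "flow V go" and f: "has_parity n f"
  shows "has_parity n (cexp ge go f)"
  unfolding fock_exp_def
proof (rule has_parity_fsum[OF fsummable_current_pow_terms[OF g]])
  have "has_parity n ((current ge go ^^ j) f)" for j
    by (induction j) (simp_all add: f has_parity_current[OF g])
  then show "has_parity n (cscale (1 / fact j) ((current ge go ^^ j) f))" for j
    by (rule has_parity_cscale)
qed

lemma coeff_cexp_vdeg_0:
  assumes g: "flow V ge" "flow V go" and m: "vdeg V m = 0"
  shows "coeff (cexp ge go f) m = coeff f m"
proof -
  have "coeff (cexp ge go f) m = (\<Sum>j\<in>{0}. coeff (cscale (1 / fact j) ((current ge go ^^ j) f)) m)"
    unfolding fock_exp_def
  proof (rule coeff_fsum)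
    show "coeff (cscale (1 / fact j) ((current ge go ^^ j) f)) m = 0" if "j \<notin> {0}" for j
      using coeff_current_pow_vdeg[OF g coeff_cscale_nonzero, of "1 / fact j" j f m] m that by auto
  qed auto
  then show ?thesis by (simp add: cscale_one)
qed

lemma in_vars_fsum_scalar: "(\<And>i. i \<in> I \<Longrightarrow> scalar (f i)) \<Longrightarrow> scalar (fsum I f)"
  unfolding scalar_def by (rule in_vars_fsum)

lemma scalar_mult: "scalar a \<Longrightarrow> scalar b \<Longrightarrow> scalar (a * b)"
  unfolding scalar_def by (rule in_vars_mult)

lemma scalar_cscale: "scalar a \<Longrightarrow> scalar (cscale c a)"
  unfolding scalar_def by (rule in_vars_cscale)

lemma scalar_1 [simp]: "scalar 1" and scalar_0 [simp]: "scalar 0"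
  by (simp_all add: scalar_def)

text \<open>The binomial formula for H^n acting on a product: R (k + i) plays the role of the i-fold
  commutator of H with R k.\<close>

lemma iterated_commutator:
  fixes H :: "'a::supercomm_algebra sser \<Rightarrow> 'a sser"
  assumes "\<And>i f. H (R i f) = R i (H f) + R (Suc i) f" and H: "finitary H"
  shows "(H ^^ n) (R k f) = (\<Sum>i\<le>n. cscale (of_nat (n choose i)) (R (k + i) ((H ^^ (n - i)) f)))"
proof (induction n arbitrary: k f)
  case (Suc n)
  let ?X = "\<lambda>i. R (k + i) ((H ^^ (Suc n - i)) f)"
  have pow: "(H ^^ (n - i)) (H f) = (H ^^ (Suc n - i)) f" if "i \<le> n" for i
    using that by (simp add: Suc_diff_le funpow_swap1)
  have add: "(H ^^ n) (a + b) = (H ^^ n) a + (H ^^ n) b" for a b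
    by (rule finitary_add[OF finitary_funpow[OF H]])
  have "(H ^^ Suc n) (R k f) = (H ^^ n) (R k (H f)) + (H ^^ n) (R (Suc k) f)"
    by (simp add: funpow_swap1 assms(1) add)
  also have "(H ^^ n) (R k (H f)) = (\<Sum>i\<le>n. cscale (of_nat (n choose i)) (?X i))"
    unfolding Suc.IH by (rule sum.cong) (simp_all add: pow)
  also have "\<dots> = (\<Sum>i\<le>Suc n. cscale (of_nat (n choose i)) (?X i))"
    by (simp add: binomial_eq_0)
  also have "\<dots> = ?X 0 + (\<Sum>i\<le>n. cscale (of_nat (n choose Suc i)) (?X (Suc i)))"
    by (subst sum.atMost_Suc_shift) (simp add: cscale_one)
  also have "(H ^^ n) (R (Suc k) f) = (\<Sum>i\<le>n. cscale (of_nat (n choose i)) (?X (Suc i)))"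
    unfolding Suc.IH by (rule sum.cong) simp_all
  also have "?X 0 + (\<Sum>i\<le>n. cscale (of_nat (n choose Suc i)) (?X (Suc i))) + \<dots> =
      (\<Sum>i\<le>Suc n. cscale (of_nat (Suc n choose i)) (?X i))"
    by (subst sum.atMost_Suc_shift)
      (simp add: cscale_one cscale_add_left sum.distrib algebra_simps)
  finally show ?case .
qed (simp add: cscale_one)

lemma fsummable_mult_Sigma':
  assumes "fsummable UNIV f" "\<And>i. fsummable UNIV (g i)"
  shows "fsummable UNIV (\<lambda>(i, j). g i j * f i)"
proof (rule fsummable_bounded[where N = "\<lambda>m. \<Union>q\<in>{q. q \<subseteq># m}. {i \<in> UNIV. coeff (f i) q \<noteq> 0}"])
  show "finite (\<Union>q\<in>{q. q \<subseteq># m}. {i \<in> UNIV. coeff (f i) q \<noteq> 0})" for m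
    by (intro finite_UN_I finite_submonos fsummableD[OF assms(1)])
  show "i \<in> (\<Union>q\<in>{q. q \<subseteq># m}. {i \<in> UNIV. coeff (f i) q \<noteq> 0})" if nz: "coeff (g i j * f i) m \<noteq> 0" for i j m
  proof -
    obtain p q where "m = p + q" "coeff (f i) q \<noteq> 0" using nz by (rule coeff_mult_nonzero)
    then show ?thesis using mset_subset_eq_add_right[of q p] by blast
  qed
  show "fsummable UNIV (\<lambda>j. g i j * f i)" for i by (rule fsummable_mult_right[OF assms(2)])
qed

text \<open>\<open>p n l\<close> is the entry \<open>(l, j)\<close> of the matrix \<open>h\<^sup>n\<close>.\<close>

lemma cexp_mode:
  fixes A :: "int \<Rightarrow> 'a::supercomm_algebra sser \<Rightarrow> 'a sser"
  assumes g: "flow V ge" "flow V go"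
    and A: "\<And>k. finitary (A k)"
    and As: "\<And>k a f. scalar a \<Longrightarrow> A k (a * f) = sign_twist (par k) a * A k f"
    and comm: "\<And>k f. current ge go (A k f) = A k (current ge go f) + fsum UNIV (\<lambda>l. A l (h l k * f))"
    and h: "\<And>l k. scalar (h l k)" "\<And>k. fsummable UNIV (\<lambda>l. h l k)"
    and p0: "\<And>l. p 0 l = (if l = j then 1 else 0)"
    and pS: "\<And>n l. p (Suc n) l = fsum UNIV (\<lambda>k. h l k * p n k)"
    and p: "\<And>n l. scalar (p n l)" "fsummable UNIV (\<lambda>(n, l). p n l)"
  shows "cexp ge go (A j f) =
    fsum UNIV (\<lambda>l. A l (fsum UNIV (\<lambda>n. cscale (1 / fact n) (p n l)) * cexp ge go f))"
proof -
  let ?H = "current ge go"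
  \<comment> \<open>The n-fold commutator of the current with A j, expanded in the modes by means of
    the matrix power.\<close>
  define R where "R n f = fsum UNIV (\<lambda>l. A l (p n l * f))" for n f
  note Hf = finitary_current[OF g]
  have pn: "fsummable UNIV (p n)" for n by (rule fsummable_row[OF p(2)])
  have hp: "fsummable UNIV (\<lambda>(k, l). h l k * p n k)" for n
    by (rule fsummable_mult_Sigma'[OF pn h(2)])
  have hps: "scalar (h l k * p n k)" for n l k by (intro scalar_mult h p)
  have Ap: "fsummable UNIV (\<lambda>l. A l (p n l * f))" for n f
    unfolding As[OF p(1)] by (intro fsummable_mult_right fsummable_sign_twist pn)
  have Ahp: "fsummable UNIV (\<lambda>(k, l). A l (h l k * p n k * f))" for n f
    unfolding As[OF hps] split_def
    by (rule fsummable_mult_right, rule fsummable_sign_twist) (use hp in \<open>simp add: split_def\<close>)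
  have Rf: "finitary (R n)" for n
    unfolding R_def[abs_def] As[OF p(1)]
  proof (rule finitary_family(2))
    show "finitary (\<lambda>f. sign_twist (par l) (p n l) * A l f)" for l
      by (rule finitary_comp[OF finitary_mult_left A])
    fix m
    have "{l \<in> UNIV. \<exists>f. coeff (sign_twist (par l) (p n l) * A l f) m \<noteq> 0} \<subseteq>
        (\<Union>q\<in>{q. q \<subseteq># m}. {l \<in> UNIV. coeff (p n l) q \<noteq> 0})"
    proof
      fix l assume "l \<in> {l \<in> UNIV. \<exists>f. coeff (sign_twist (par l) (p n l) * A l f) m \<noteq> 0}"
      then obtain f where "coeff (sign_twist (par l) (p n l) * A l f) m \<noteq> 0" by auto
      then obtain q r where "m = q + r" "coeff (sign_twist (par l) (p n l)) q \<noteq> 0"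
        by (rule coeff_mult_nonzero)
      then show "l \<in> (\<Union>q\<in>{q. q \<subseteq># m}. {l \<in> UNIV. coeff (p n l) q \<noteq> 0})"
        using mset_subset_eq_add_left[of q r] by (auto intro!: exI[of _ q])
    qed
    then show "finite {l \<in> UNIV. \<exists>f. coeff (sign_twist (par l) (p n l) * A l f) m \<noteq> 0}"
      by (rule finite_subset) (intro finite_UN_I finite_submonos fsummableD[OF pn])
  qed
  have HR: "?H (R n f) = R n (?H f) + R (Suc n) f" for n f
  proof -
    have "?H (R n f) = fsum UNIV (\<lambda>k. A k (p n k * ?H f) + fsum UNIV (\<lambda>l. A l (h l k * p n k * f)))"
      unfolding R_def finitary_fsum[OF Hf Ap] comm current_scalar[OF g p(1)] mult.assoc ..
    also have "\<dots> = R n (?H f) + fsum UNIV (\<lambda>k. fsum UNIV (\<lambda>l. A l (h l k * p n k * f)))"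
      unfolding R_def by (rule fsum_add[OF Ap fsummable_fsum[OF Ahp]])
    also have "fsum UNIV (\<lambda>k. fsum UNIV (\<lambda>l. A l (h l k * p n k * f))) =
        fsum UNIV (\<lambda>l. fsum UNIV (\<lambda>k. A l (h l k * p n k * f)))"
      by (rule fsum_swap[OF Ahp])
    also have "\<dots> = R (Suc n) f"
      unfolding R_def pS
    proof (rule fsum_cong)
      fix l
      have s: "fsummable UNIV (\<lambda>k. h l k * p n k)" by (rule fsummable_mult_left[OF pn])
      show "fsum UNIV (\<lambda>k. A l (h l k * p n k * f)) = A l (fsum UNIV (\<lambda>k. h l k * p n k) * f)"
        unfolding finitary_fsum[OF finitary_mult_right s]
        by (rule finitary_fsum[OF A fsummable_mult_right[OF s], symmetric])
    qed
    finally show ?thesis .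
  qed
  \<comment> \<open>The general term of the double series: i commutators and l further applications
    of the current.\<close>
  define F where "F i l = cscale (1 / fact i * (1 / fact l)) (R i ((?H ^^ l) f))" for i l
  have Ac: "A k (cscale c f) = cscale c (A k f)" for k c f
    using As[of "cscale c 1" k f] by (simp add: scalar_cscale mult_cscale_left sign_twist_cscale)
  have Rc: "R n (cscale c f) = cscale c (R n f)" for n c f
    by (simp add: R_def mult_cscale_right Ac finitary_fsum[OF finitary_cscale Ap])
  have FR: "F i = (\<lambda>l. cscale (1 / fact i) (R i (cscale (1 / fact l) ((?H ^^ l) f))))" for i
    by (simp add: F_def[abs_def] Rc cscale_cscale)
  have R0: "R 0 f = A j f" for f
  proof -
    have "R 0 f = fsum UNIV (\<lambda>l. if l = j then A l f else 0)"
      unfolding R_def p0 by (rule fsum_cong) (simp add: finitary_0[OF A])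
    then show ?thesis by (simp add: fsum_delta)
  qed
  have sF: "fsummable UNIV (\<lambda>(i, l). F i l)"
  proof (rule fsummable_bounded[where N =
          "\<lambda>m. fst ` (\<Union>q\<in>{q. q \<subseteq># m}. {x \<in> UNIV. coeff (case x of (n, l) \<Rightarrow> p n l) q \<noteq> 0})"])
    show "finite (fst ` (\<Union>q\<in>{q. q \<subseteq># m}. {x \<in> UNIV. coeff (case x of (n, l) \<Rightarrow> p n l) q \<noteq> 0}))" for m
      by (intro finite_imageI finite_UN_I finite_submonos fsummableD[OF p(2)])
    show "i \<in> fst ` (\<Union>q\<in>{q. q \<subseteq># m}. {x \<in> UNIV. coeff (case x of (n, l) \<Rightarrow> p n l) q \<noteq> 0})"
      if nz: "coeff (F i l) m \<noteq> 0" for i l m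
    proof -
      have "coeff (R i ((?H ^^ l) f)) m \<noteq> 0" using nz by (auto simp: F_def coeff_cscale)
      then obtain k where "coeff (A k (p i k * (?H ^^ l) f)) m \<noteq> 0"
        unfolding R_def by (rule coeff_fsum_nonzero)
      then have "coeff (sign_twist (par k) (p i k) * A k ((?H ^^ l) f)) m \<noteq> 0" by (simp add: As[OF p(1)])
      then obtain q r where "m = q + r" "coeff (sign_twist (par k) (p i k)) q \<noteq> 0"
        by (rule coeff_mult_nonzero)
      then show ?thesis using mset_subset_eq_add_left[of q r] 
        by (intro image_eqI[of _ _ "(i, k)"]) (auto intro!: exI[of _ q])
    qed
    show "fsummable UNIV (F i)" for i
      unfolding FR by (intro finitary_fsummable[OF finitary_cscale] finitary_fsummable[OF Rf]
          fsummable_current_pow_terms[OF g])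
  qed
  \<comment> \<open>The binomial coefficient divided by n! splits into 1 / i! and 1 / (n - i)!, so
    that the exponential series becomes a Cauchy product.\<close>
  have "cexp ge go (A j f) = fsum UNIV (\<lambda>n. \<Sum>i\<le>n. F i (n - i))"
    unfolding fock_exp_def R0[symmetric] iterated_commutator[of ?H R, OF HR Hf] F_def cscale_sum cscale_cscale
    by (intro fsum_cong sum.cong) (simp_all add: binomial_fact)
  also have "\<dots> = fsum UNIV (\<lambda>(i, l). F i l)" by (rule fsum_triangle[OF sF, symmetric])
  also have "\<dots> = fsum UNIV (\<lambda>i. fsum UNIV (F i))" by (rule fsum_prod[OF sF, symmetric])
  also have "\<dots> = fsum UNIV (\<lambda>i. cscale (1 / fact i) (R i (cexp ge go f)))"
    unfolding FR fock_exp_def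
    by (simp add: finitary_fsum[OF finitary_cscale finitary_fsummable[OF Rf fsummable_current_pow_terms[OF g]]]
        finitary_fsum[OF Rf fsummable_current_pow_terms[OF g]])
  also have "\<dots> = fsum UNIV (\<lambda>i. fsum UNIV (\<lambda>l. A l (cscale (1 / fact i) (p i l) * cexp ge go f)))"
    by (simp add: R_def mult_cscale_left Ac finitary_fsum[OF finitary_cscale Ap])
  also have "\<dots> = fsum UNIV (\<lambda>l. fsum UNIV (\<lambda>i. A l (cscale (1 / fact i) (p i l) * cexp ge go f)))"
  proof (rule fsum_swap)
    have "fsummable UNIV (\<lambda>x. cscale (1 / fact (fst x)) (case x of (i, l) \<Rightarrow> p i l))"
      using p(2) unfolding fsummable_def
      by (elim all_forward) (erule finite_subset[rotated], auto dest: coeff_cscale_nonzero)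
    then show "fsummable UNIV (\<lambda>(i, l). A l (cscale (1 / fact i) (p i l) * cexp ge go f))"
      unfolding As[OF scalar_cscale[OF p(1)]] split_def
      by (intro fsummable_mult_right fsummable_sign_twist)
  qed
  also have "\<dots> = fsum UNIV (\<lambda>l. A l (fsum UNIV (\<lambda>n. cscale (1 / fact n) (p n l)) * cexp ge go f))"
  proof (rule fsum_cong)
    fix l
    have s: "fsummable UNIV (\<lambda>i. cscale (1 / fact i) (p i l))"
      using fsummable_row[OF fsummable_swap[OF p(2)], of l] unfolding fsummable_def
      by (elim all_forward) (erule finite_subset[rotated], auto dest: coeff_cscale_nonzero)
    show "fsum UNIV (\<lambda>i. A l (cscale (1 / fact i) (p i l) * cexp ge go f)) =
        A l (fsum UNIV (\<lambda>n. cscale (1 / fact n) (p n l)) * cexp ge go f)"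
      unfolding finitary_fsum[OF finitary_mult_right s]
      by (rule finitary_fsum[OF A fsummable_mult_right[OF s], symmetric])
  qed
  finally show ?thesis .
qed

section \<open>Exponentials of currents through the matrices of operators\<close>

lemma scalar_kill: "scalar a \<Longrightarrow> scalar (kill V a)"
  unfolding scalar_def by (rule in_vars_kill')

lemma Xi_op_pow_triangular:
  assumes X: "admissible X" and tri: "\<And>l k. k \<le> l \<Longrightarrow> Xi X l k = 0" and "k < l"
  shows "Xi (op_pow X n) l k = 0"
  using assms(3)
proof (induction n arbitrary: l)
  case (Suc n)
  have "Xi X l i * Xi (op_pow X n) i k = 0" for i
    using tri[of i l] Suc.IH[of i] Suc.prems by (cases "i \<le> l") auto
  then show ?case by (simp add: Xi_mult[OF X admissible_op_pow[OF X]])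
qed (simp add: Xi_D_pow_0)

lemma Xi_op_exp:
  assumes X: "fil 3 1 X"
  shows "Xi (op_exp X) l j = fsum UNIV (\<lambda>n. cscale (1 / fact n) (Xi (op_pow X n) l j))"
proof -
  have pa: "admissible (op_pow X n)" for n
    by (rule admissible_op_pow) (rule fil_admissible[OF X], simp)
  note f = op_mult_fsum_right[where d = 0, OF admissible_D_pow fil_mono[OF fil_exp_term_1[OF X]]
      fsummable_exp_term[OF X]]
  have "Xi (op_exp X) l j = ev0 (fsum UNIV (\<lambda>n. (D_pow l \<odot> exp_term X n) j))"
    unfolding Xi_def op_exp_terms by (subst f(1)) auto
  also have "\<dots> = fsum UNIV (\<lambda>n. ev0 ((D_pow l \<odot> exp_term X n) j))"
    by (rule finitary_fsum[OF finitary_kill f(2)]) auto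
  also have "\<dots> = fsum UNIV (\<lambda>n. cscale (1 / fact n) (Xi (op_pow X n) l j))"
    unfolding exp_term_def[abs_def] op_mult_cscale_right[OF admissible_D_pow pa] Xi_def
    by (rule fsum_cong) (auto intro!: sser_eqI simp: kill.rep_eq coeff_cscale)
  finally show ?thesis .
qed

text \<open>The powers of the matrix of X are the matrices of the powers of X. At a fixed monomial,
  triangularity gives l \<le> j and the filtration gives l \<ge> n + j - 3 weight; together they
  bound both n and l.\<close>

lemma cexp_mode_Xi:
  fixes A :: "int \<Rightarrow> 'a::supercomm_algebra sser \<Rightarrow> 'a sser"
  assumes g: "flow V ge" "flow V go"
    and A: "\<And>k. finitary (A k)"
    and As: "\<And>k a f. scalar a \<Longrightarrow> A k (a * f) = sign_twist (par k) a * A k f"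
    and comm: "\<And>k f. current ge go (A k f) = A k (current ge go f) + fsum UNIV (\<lambda>l. A l (Xi X l k * f))"
    and X: "fil 3 1 X" "\<And>n. scalar (X n)" and tri: "\<And>l k. k \<le> l \<Longrightarrow> Xi X l k = 0"
  shows "cexp ge go (A j f) = fsum UNIV (\<lambda>l. A l (Xi (op_exp X) l j * cexp ge go f))"
proof -
  have Xa: "admissible X" by (rule fil_admissible[OF X(1)]) simp
  have pa: "admissible (op_pow X n)" for n by (rule admissible_op_pow[OF Xa])
  have sc: "scalar (Xi (op_pow X n) l k)" for n l k
  proof -
    have "scalar ((D_pow l \<odot> op_pow X n) k)"
      using X(2) unfolding scalar_def by (intro in_vars_op_mult in_vars_op_pow in_vars_D_pow_op) auto
    then show ?thesis unfolding Xi_def by (rule scalar_kill)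
  qed
  note tri' = Xi_op_pow_triangular[OF Xa tri]
  have "cexp ge go (A j f) = fsum UNIV (\<lambda>l. A l (fsum UNIV (\<lambda>n. cscale (1 / fact n) (Xi (op_pow X n) l j)) * cexp ge go f))"
  proof (rule cexp_mode[OF g A As comm, where p = "\<lambda>n l. Xi (op_pow X n) l j"])
    show "scalar (Xi X l k)" for l k using sc[of 1 l k] Xa by simp
    show "fsummable UNIV (\<lambda>l. Xi X l k)" for k
    proof (rule fsummableI)
      fix m
      have "l \<in> {1 + k - 3 * int (weight m) .. k}" if "coeff (Xi X l k) m \<noteq> 0" for l
        using coeff_Xi_bound[OF X(1) that] tri[of k l] that by (cases "k \<le> l") auto
      then show "finite {l \<in> UNIV. coeff (Xi X l k) m \<noteq> 0}"
        by - (rule finite_subset[of _ "{1 + k - 3 * int (weight m) .. k}"], auto)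
    qed
    show "Xi (op_pow X 0) l j = (if l = j then 1 else 0)" for l
      by (simp add: Xi_D_pow_0)
    show "Xi (op_pow X (Suc n)) l j = fsum UNIV (\<lambda>k. Xi X l k * Xi (op_pow X n) k j)" for n l
      by (simp add: Xi_mult[OF Xa pa])
    show "scalar (Xi (op_pow X n) l j)" for n l by (rule sc)
    show "fsummable UNIV (\<lambda>(n, l). Xi (op_pow X n) l j)"
    proof (rule fsummableI)
      fix m
      let ?w = "3 * int (weight m)"
      have "(n, l) \<in> {.. nat ?w} \<times> {j - ?w .. j}" if "coeff (Xi (op_pow X n) l j) m \<noteq> 0" for n l
        using coeff_Xi_bound[OF fil_op_pow_1[OF X(1)] that] tri'[of j l n] that by (cases "j < l") auto
      then show "finite {x \<in> UNIV. coeff (case x of (n, l) \<Rightarrow> Xi (op_pow X n) l j) m \<noteq> 0}"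
        by - (rule finite_subset[of _ "{.. nat ?w} \<times> {j - ?w .. j}"], auto)
    qed
  qed
  then show ?thesis by (simp only: Xi_op_exp[OF X(1)])
qed

lemma cur_currents:
  "j_plus n f = cur 0 (2 * int n) f" "j_minus n f = - cur 1 (2 * int n) f"
  "psi_plus n f = cur 0 (2 * int n + 1) f" "psi_minus n f = cur 1 (2 * int n + 1) f"
  unfolding j_plus_def j_minus_def psi_plus_def psi_minus_def cur_def
  by (auto intro!: fsum_cong simp: algebra_simps)

lemma finitary_cmode: "finitary (cmode k)"
  by (simp add: cmode_def finitary_C_mode)

lemma finitary_bmode: "finitary (bmode k)"
  unfolding bmode_def[abs_def] by (rule finitary_comp[OF finitary_mult_left finitary_B_mode])

lemma cmode_scalar: "scalar a \<Longrightarrow> cmode k (a * f) = sign_twist (- k + 1) a * cmode k f"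
  by (simp add: cmode_def C_mode_scalar)

lemma bmode_scalar: "scalar a \<Longrightarrow> bmode k (a * f) = sign_twist (- k) a * bmode k f"
  by (simp add: bmode_def B_mode_scalar psign_left_commute[of "sign_twist _ _"])

section \<open>Translation\<close>

text \<open>x and \<xi> act as the times of index 2 and 1. They need a treatment of their own, since
  the entries of \<open>Xi\<close> never contain x or \<xi>: no evolution operator describes the
  translation.\<close>

definition txi :: "nat \<Rightarrow> 'a::supercomm_algebra sser"
  where "txi N = (if N = 1 then var Vxi else if N = 2 then var Vx else 0)"

lemma flow_txi: "flow {Vx, Vxi} txi"
  unfolding flow_def
proof (intro conjI allI impI)
  show "fsummable UNIV (txi :: nat \<Rightarrow> 'a sser)"
    by (rule fsummableI, rule finite_subset[of _ "{1, 2}"]) (auto simp: txi_def split: if_split_asm)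
  show "has_parity (int N) (txi N)" for N
    using odd_var_has_parity[of Vxi] even_var_has_parity[of Vx] has_parity_cong[of 2 0 "var Vx"]
    by (auto simp: txi_def)
  show "vdeg {Vx, Vxi} m \<ge> 1" if "coeff (txi N) m \<noteq> 0" for N m
    using that by (auto simp: txi_def vdeg_def split: if_split_asm dest!: coeff_var_nonzero)
qed (auto simp: txi_def)

lemma translation_cexp: "translation = cexp txi txi"
proof -
  have "var Vx * j_total 1 g + var Vxi * sigma g = current txi txi g" for g :: "'a sser"
  proof -
    have "current txi txi g = fsum {1, 2} (\<lambda>N. current_term txi txi N g)"
      unfolding current_def by (rule fsum_neutral_superset) (auto simp: current_term_def txi_def)
    also have "\<dots> = current_term txi txi 1 g + current_term txi txi 2 g"
      by (simp add: fsum_finite)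
    finally show ?thesis
      by (simp add: current_term_def txi_def sigma_def j_total_def cur_currents distrib_left
          right_diff_distrib)
  qed
  then show ?thesis by (simp add: translation_def fun_eq_iff)
qed

lemma hmat_txi: "hmat txi txi l k = (if k = l + 1 then var Vxi else if k = l + 2 then var Vx else 0)"
  by (auto simp: hmat_def txi_def)

text \<open>The nonzero entries have k - l = 1 or 2, and there \<open>adj_sign\<close> is odd, which
  cancels the minus sign. So the translation moves both kinds of modes by the same matrix.\<close>

lemma hmat_dual_txi: "hmat_dual txi txi l k = hmat txi txi l k"
proof -
  define c where "c = l * (l - 1) div 2"
  have e1: "(l + 1) * (l + 2) div 2 = c + l + (l + 1)"
    using eps_eta[of "l + 1"] eps_eta[of l] by (simp add: algebra_simps c_def)
  have e2: "(l + 2) * (l + 3) div 2 = c + l + (l + 1) + (l + 2)"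
    using eps_eta[of "l + 2"] e1 by (simp add: algebra_simps)
  have "adj_sign l (l + 1) = 2 * c + (2 * l + 1) + (l + 1) * l"
    using e1 by (simp add: adj_sign_def c_def[symmetric] add.commute[of 2 l])
  then have 1: "odd (adj_sign l (l + 1))" by simp
  have "adj_sign l (l + 2) = 2 * c + (3 * l + 3) + (l + 2) * l"
    using e2 by (simp add: adj_sign_def c_def[symmetric] add.commute[of 3 l])
  then have 2: "odd (adj_sign l (l + 2))" by simp
  have "- l - 1 = - k - 1 + i \<longleftrightarrow> k = l + i" for i by auto
  then show ?thesis using 1 2 by (auto simp: hmat_dual_def hmat_txi)
qed

lemma coeff_emat_parity: "coeff (emat l k :: 'a::supercomm_algebra sser) m \<noteq> 0 \<Longrightarrow> k = l + xweight m"
  using coeff_emat_nonzero[of l k m, where 'a = 'a] by simp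

lemma x_xpow: "var Vx * xpow i = cscale (of_nat (Suc i)) (xpow (Suc i))"
proof -
  have "of_nat (Suc i) * (1 / fact (Suc i)) = (1 / fact i :: complex)"
    by (simp add: field_simps del: of_nat_Suc)
  then show ?thesis by (simp add: xpow_def cscale_cscale mult_cscale_right)
qed

lemma emat_even: "emat l (l + 2 * int i) = xpow i"
  by (simp add: emat_def)

lemma emat_odd: "emat l (l + 2 * int i + 1) = var Vxi * xpow i"
  by (simp add: emat_def)

text \<open>The recursion for the powers of the translation matrix, up to factorials: it says that
  the entries of \<open>emat\<close> at distance 2n + 2 and 2n + 1 arise from step n.\<close>

lemma emat_step:
  assumes n: "j - l = 2 * int n + 2 \<or> j - l = 2 * int n + 1"
  shows "cscale (of_nat (Suc n)) (emat l j :: 'a::supercomm_algebra sser) =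
    var Vxi * (if j - l = 2 * int n + 1 then emat (l + 1) j else 0) + var Vx * emat (l + 2) j"
  using n
proof
  assume "j - l = 2 * int n + 2"
  then have j: "j = l + 2 * int (Suc n)" "j = l + 2 + 2 * int n" by simp_all
  have "2 * int (Suc n) \<noteq> 2 * int n + 1" by simp
  then
  show ?thesis
    using emat_even[of l "Suc n", folded j(1), where 'a = 'a]
      emat_even[of "l + 2" n, folded j(2), where 'a = 'a] j(1)
    by (simp add: x_xpow del: of_nat_Suc)
next
  assume "j - l = 2 * int n + 1"
  then have j: "j = l + 2 * int n + 1" "j = l + 1 + 2 * int n" by simp_all
  have x: "var Vx * emat (l + 2) j = cscale (of_nat n) (var Vxi * xpow n :: 'a sser)"
  proof (cases n)
    case 0
    then show ?thesis using j by (simp add: emat_less)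
  next
    case (Suc i)
    then have j2: "j = l + 2 + 2 * int i + 1" using j by simp
    have "var Vx * (var Vxi * xpow i) = var Vxi * (var Vx * xpow i :: 'a sser)"
      using var_var[of Vx Vxi "xpow i"] by (simp add: swap_sign_def)
    then show ?thesis
      using emat_odd[of "l + 2" i, folded j2, where 'a = 'a] Suc by (simp add: x_xpow mult_cscale_right del: of_nat_Suc)
  qed
  show ?thesis
    unfolding x using emat_odd[of l n, folded j(1), where 'a = 'a]
      emat_even[of "l + 1" n, folded j(2), where 'a = 'a] j(1)
    by (simp add: cscale_add_left cscale_one)
qed

lemma translation_mode:
  fixes A :: "int \<Rightarrow> 'a::supercomm_algebra sser \<Rightarrow> 'a sser"
  assumes A: "\<And>k. finitary (A k)"
    and As: "\<And>k a f. scalar a \<Longrightarrow> A k (a * f) = sign_twist (par k) a * A k f"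
    and comm: "\<And>k f. current txi txi (A k f) = A k (current txi txi f) +
      fsum UNIV (\<lambda>l. A l (hmat txi txi l k * f))"
  shows "translation (A j f) = fsum UNIV (\<lambda>l. A l (emat l j * translation f))"
proof -
  \<comment> \<open>The n-th power of the translation matrix is n! times q n: because \<xi>^2 = 0,
    only x^n at distance 2n and n \<xi> x^(n-1) at distance 2n - 1 survive.\<close>
  define q where "q n l = (if j - l = 2 * int n \<or> j - l = 2 * int n - 1 then emat l j else (0 :: 'a sser))"
    for n l
  define p where "p n l = cscale (fact n) (q n l)" for n l
  have sc: "scalar (emat l k :: 'a sser)" for l k
    unfolding scalar_def by (rule in_vars_mono[OF in_vars_emat]) auto
  have h: "scalar (hmat txi txi l k :: 'a sser)" for l k
    by (auto simp: hmat_txi scalar_def intro!: in_vars_var)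
  have "cexp txi txi (A j f) =
      fsum UNIV (\<lambda>l. A l (fsum UNIV (\<lambda>n. cscale (1 / fact n) (p n l)) * cexp txi txi f))"
  proof (rule cexp_mode[OF flow_txi flow_txi A As comm h])
    show "fsummable UNIV (\<lambda>l. hmat txi txi l k)" for k
      by (rule fsummableI, rule finite_subset[of _ "{k - 1, k - 2}"])
        (auto simp: hmat_txi split: if_split_asm)
    show "p 0 l = (if l = j then 1 else 0)" for l
      by (auto simp: p_def q_def cscale_one emat_less)
    show "scalar (p n l)" for n l
      by (simp add: p_def q_def scalar_cscale sc)
    show "fsummable UNIV (\<lambda>(n, l). p n l)"
    proof (rule fsummableI)
      fix m
      have "(n, l) = (nat ((xweight m + 1) div 2), j - xweight m)" if "coeff (p n l) m \<noteq> 0" for n l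
      proof -
        have nz: "coeff (q n l) m \<noteq> 0" using that unfolding p_def by (rule coeff_cscale_nonzero)
        then have "j = l + xweight m" "j - l = 2 * int n \<or> j - l = 2 * int n - 1"
          by (auto simp: q_def dest: coeff_emat_parity split: if_split_asm)
        then show ?thesis by auto
      qed
      then show "finite {x \<in> UNIV. coeff (case x of (n, l) \<Rightarrow> p n l) m \<noteq> 0}"
        by - (rule finite_subset[of _ "{(nat ((xweight m + 1) div 2), j - xweight m)}"], auto)
    qed
    show "p (Suc n) l = fsum UNIV (\<lambda>k. hmat txi txi l k * p n k)" for n l
    proof -
      have "fsum UNIV (\<lambda>k. hmat txi txi l k * p n k) = fsum {l + 1, l + 2} (\<lambda>k. hmat txi txi l k * p n k)"
        by (rule fsum_neutral_superset) (auto simp: hmat_txi)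
      also have "\<dots> = cscale (fact n) (var Vxi * q n (l + 1) + var Vx * q n (l + 2))"
        by (simp add: fsum_finite hmat_txi p_def mult_cscale_right cscale_add_right)
      also have "var Vxi * q n (l + 1) + var Vx * q n (l + 2) = cscale (of_nat (Suc n)) (q (Suc n) l)"
      proof (cases "j - l = 2 * int n + 2 \<or> j - l = 2 * int n + 1")
        case True
        have "q n (l + 1) = (if j - l = 2 * int n + 1 then emat (l + 1) j else 0)"
          "q n (l + 2) = emat (l + 2) j" "q (Suc n) l = emat l j"
          using True unfolding q_def by auto
        then show ?thesis by (simp only: emat_step[OF True])
      next
        case False
        have "var Vxi * q n (l + 1) = 0"
        proof (cases "j - l = 2 * int n")
          case True
          then have n: "n = 0 \<or> j = l + 1 + 2 * int (n - 1) + 1" by (cases n) simp_all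
          then show ?thesis
          proof
            assume "n = 0"
            then show ?thesis using True by (simp add: q_def emat_less)
          next
            assume j: "j = l + 1 + 2 * int (n - 1) + 1"
            show ?thesis
              using emat_odd[of "l + 1" "n - 1", folded j, where 'a = 'a] by (simp add: q_def xi_square)
          qed
        qed (use False in \<open>simp add: q_def\<close>)
        moreover have "q n (l + 2) = 0" "q (Suc n) l = 0" using False by (auto simp: q_def)
        ultimately show ?thesis by simp
      qed
      finally show ?thesis by (simp add: p_def cscale_cscale mult.commute)
    qed
  qed
  moreover have "fsum UNIV (\<lambda>n. cscale (1 / fact n) (p n l)) = emat l j" for l
  proof -
    have "fsum UNIV (\<lambda>n. cscale (1 / fact n) (p n l)) = fsum UNIV (\<lambda>n. q n l)"
      by (simp add: p_def cscale_cscale cscale_one)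
    also have "\<dots> = q (nat ((j - l + 1) div 2)) l"
      by (rule fsum_single) (auto simp: q_def)
    also have "\<dots> = emat l j" by (auto simp: q_def emat_less)
    finally show ?thesis .
  qed
  ultimately show ?thesis by (simp add: translation_cexp)
qed

lemma translation_cmode: "translation (cmode j f) = fsum UNIV (\<lambda>l. cmode l (emat l j * translation f))"
  by (rule translation_mode[where par = "\<lambda>k. - k + 1"])
    (rule finitary_cmode cmode_scalar current_cmode[OF flow_txi flow_txi], assumption?)+

lemma translation_bmode: "translation (bmode j f) = fsum UNIV (\<lambda>l. bmode l (emat l j * translation f))"
  by (rule translation_mode[where par = "\<lambda>k. - k"])
    (rule finitary_bmode bmode_scalar current_bmode[OF flow_txi flow_txi, unfolded hmat_dual_txi],
      assumption?)+

section \<open>Evolution operators\<close>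

text \<open>The operator whose matrix \<open>\<Xi>\<close> is \<^term>\<open>hmat ge go\<close>.\<close>

definition evo :: "(nat \<Rightarrow> 'a::supercomm_algebra sser) \<Rightarrow> (nat \<Rightarrow> 'a sser) \<Rightarrow> 'a sdop"
  where "evo ge go k = (if k \<le> 0 then 0 else
    ge (nat k) + (psign (k - 1) * go (nat (k - 1)) - ge (nat (k - 1))) * var Vxi)"

definition time_flow :: "svar set \<Rightarrow> (nat \<Rightarrow> 'a::supercomm_algebra sser) \<Rightarrow> bool"
  where "time_flow T g \<longleftrightarrow> flow T g \<and> Vx \<notin> T \<and> Vxi \<notin> T \<and> g 0 = 0 \<and>
    (\<forall>n m. coeff (g n) m \<noteq> 0 \<longrightarrow> weight m = n)"

lemma time_flow_flow: "time_flow T g \<Longrightarrow> flow T g"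
  by (simp add: time_flow_def)

lemma time_flow_in_vars: "time_flow T g \<Longrightarrow> in_vars T (g n)"
  by (simp add: time_flow_def flow_def)

lemma time_flow_ev0: "time_flow T g \<Longrightarrow> in_vars (- {Vx, Vxi}) (g n)"
  by (rule in_vars_mono[OF time_flow_in_vars]) (auto simp: time_flow_def)

lemma time_flow_parity: "time_flow T g \<Longrightarrow> has_parity (int n) (g n)"
  by (simp add: time_flow_def flow_def)

lemma time_flow_weight: "time_flow T g \<Longrightarrow> coeff (g n) m \<noteq> 0 \<Longrightarrow> weight m = n \<and> n \<ge> 1"
  by (cases n) (auto simp: time_flow_def)

lemma leib_constant:
  assumes "in_vars (- {Vx, Vxi}) a"
  shows "leib j r a = (if r = 0 then sign_twist j a else 0)"
proof (cases "r \<le> 0")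
  case False
  then obtain s where s: "nat r = Suc s" by (metis not_le_imp_less zero_less_nat_eq gr0_implies_Suc)
  have "(D_ser ^^ Suc s) (sign_twist k a) = 0" for k
    by (induction s) (simp_all add: D_in_vars[OF in_vars_sign_twist[OF assms]])
  then show ?thesis using False by (simp add: leib_def leibniz_def s del: funpow.simps)
qed (auto simp: leib_def leibniz_def cscale_one)

lemma D_xi [simp]: "D_ser (var Vxi) = (1 :: 'a::supercomm_algebra sser)"
  using dvar_var_mult[of Vxi Vxi "1 :: 'a sser"] dvar_in_vars[of "{Vxi}" "var Vxi :: 'a sser" Vx]
  by (simp add: D_ser_def dvar_in_vars[of "{}"])

text \<open>At \<xi> = 0 a term survives only if exactly one derivative has removed \<xi>; its
  super-binomial coefficient is 1 for odd j and 0 for even j.\<close>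

lemma ev0_leib_xi:
  assumes b: "in_vars (- {Vx, Vxi}) b"
  shows "ev0 (leib j r (b * var Vxi)) = (if r = 1 \<and> odd j then sign_twist 1 b else 0)"
proof -
  have D: "D_ser (sign_twist k b * var Vxi) = sign_twist (k + 1) b" for k
    by (simp add: D_mult D_in_vars in_vars_sign_twist b sign_twist_twist add.commute)
  have tw: "sign_twist k (b * var Vxi) = psign k * (sign_twist k b * var Vxi)" for k
  proof -
    have "has_parity 1 (var Vxi :: 'a sser)" by (rule odd_var_has_parity) simp
    from has_parity_sign_twist[OF this, of k] show ?thesis
      by (simp add: sign_twist_mult psign_left_commute[of "sign_twist k b"])
  qed
  consider "r < 0" | "r = 0" | "r = 1" | s where "r > 1" "nat r = Suc (Suc s)"
  proof -
    have "r > 1 \<Longrightarrow> nat r = Suc (Suc (nat (r - 2)))" by simp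
    then show ?thesis using that by fastforce
  qed
  then show ?thesis
  proof cases
    case 2
    then show ?thesis
      by (simp add: leib_def leibniz_def cscale_one tw finitary_psign[OF finitary_kill] kill_mult kill_var)
  next
    case 3
    have "ev0 (sign_twist j b) = sign_twist j b"
      by (rule kill_id[OF in_vars_sign_twist[OF b]]) auto
    moreover have "odd j \<Longrightarrow> sign_twist j b = sign_twist 1 b" by (rule sign_twist_odd)
    moreover have "super_binom j 1 = (if odd j then 1 else 0)" by (simp add: super_binom_def)
    moreover have "psign (j - 1) * X = (if odd j then X else - X)" for X :: "'a sser"
      by (simp add: psign_def)
    ultimately show ?thesis using 3
      by (auto simp: leib_def leibniz_def tw finitary_psign[OF finitary_D] D cscale_one)
  next
    case 4
    have "D_ser (sign_twist k b) = 0" for k by (rule D_in_vars[OF in_vars_sign_twist[OF b]])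
    then have "(D_ser ^^ Suc (Suc s)) (sign_twist k b * var Vxi) = 0" for k
      by (induction s) (simp_all add: D)
    then show ?thesis using 4
      by (simp add: leib_def leibniz_def tw finitary_psign[OF finitary_funpow[OF finitary_D]]
          del: funpow.simps)
  qed (simp add: leib_def)
qed

lemma sign_twist_diff: "sign_twist n (a - b) = sign_twist n a - sign_twist n b"
  using sign_twist_add[of n a "- b"] by (simp add: sign_twist_minus)

text \<open>In even rows the \<xi>-term of \<open>evo\<close> disappears at \<xi> = 0. In odd rows
  it contributes through one derivative, cancels ge and puts go in its place; the sign in
  \<open>evo\<close> is chosen for this.\<close>

lemma Xi_evo:
  assumes g: "time_flow T ge" "time_flow T go" and adm: "admissible (evo ge go)"
  shows "Xi (evo ge go) j k = hmat ge go j k"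
proof -
  define a where "a n = (if n \<le> 0 then 0 else ge (nat n))" for n :: int
  define b where "b n = (if n \<le> 0 then 0 else psign (n - 1) * go (nat (n - 1)) - ge (nat (n - 1)))" for n :: int
  have E: "evo ge go n = a n + b n * var Vxi" for n by (simp add: evo_def a_def b_def)
  have ab: "in_vars (- {Vx, Vxi}) (a n)" "in_vars (- {Vx, Vxi}) (b n)" for n
    using time_flow_ev0[OF g(1)] time_flow_ev0[OF g(2)]
    by (simp_all add: a_def b_def in_vars_diff in_vars_psign)
  obtain d where d: "fil 3 d (evo ge go)" using adm by (auto simp: admissible_def)
  have ev: "ev0 (sign_twist i (a n)) = sign_twist i (a n)" for i n
    by (rule kill_id[OF in_vars_sign_twist[OF ab(1)]]) auto
  have t: "ev0 (leib j (j + n - k) (evo ge go n)) = (if n = k - j then sign_twist j (a n) else 0) +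
      (if n = k - j + 1 \<and> odd j then sign_twist 1 (b n) else 0)" for n
    unfolding E finitary_add[OF finitary_leib] finitary_add[OF finitary_kill] ev0_leib_xi[OF ab(2)]
      leib_constant[OF ab(1)] by (auto simp: ev)
  have "Xi (evo ge go) j k = fsum UNIV (\<lambda>n. ev0 (leib j (j + n - k) (evo ge go n)))"
    unfolding Xi_def D_pow_mult by (rule finitary_fsum[OF finitary_kill fsummable_leib[OF d]])
  also have "\<dots> = fsum {k - j, k - j + 1} (\<lambda>n. ev0 (leib j (j + n - k) (evo ge go n)))"
    unfolding t by (rule fsum_neutral_superset) auto
  also have "\<dots> = sign_twist j (a (k - j)) + (if odd j then sign_twist 1 (b (k - j + 1)) else 0)"
    by (simp add: fsum_finite t)
  also have "\<dots> = hmat ge go j k"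
  proof (cases "k - j \<ge> 1")
    case True
    define N where "N = nat (k - j)"
    have k: "k = j + int N" "N \<ge> 1" using True by (simp_all add: N_def)
    have p: "sign_twist i (g N) = psign (i * int N) * g N" if "time_flow T g" for i g
      by (rule has_parity_sign_twist[OF time_flow_parity[OF that]])
    have "nat (1 + int N - 1) = N" by simp
    then show ?thesis using k
      by (cases "even j"; cases "even N")
        (simp_all add: a_def b_def hmat_def p[OF g(1)] p[OF g(2)] sign_twist_diff sign_twist_minus)
  next
    case False
    then have "k - j = 0 \<or> k - j < 0" by auto
    then show ?thesis
      using g by (auto simp: a_def b_def hmat_def time_flow_def)
  qed
  finally show ?thesis .
qed

text \<open>The order can exceed the weight by 1, but only in the presence of a factor \<xi>, and
  then the order is at least 2. Both \<open>fil_evo\<close> and \<open>filx_evo\<close> follow from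
  this.\<close>

lemma coeff_evo_nonzero:
  assumes g: "time_flow T ge" "time_flow T go" and nz: "coeff (evo ge go k) m \<noteq> 0"
  shows "(int (weight m) = k \<and> k \<ge> 1) \<or> (int (weight m) = k - 1 \<and> k \<ge> 2 \<and> Vxi \<in># m)"
proof -
  have k: "k > 0" using nz by (cases "k \<le> 0") (simp_all add: evo_def)
  let ?b = "psign (k - 1) * go (nat (k - 1)) - ge (nat (k - 1))"
  consider "coeff (ge (nat k)) m \<noteq> 0" | "coeff (?b * var Vxi) m \<noteq> 0"
  proof -
    have "coeff (ge (nat k)) m \<noteq> 0 \<or> coeff (?b * var Vxi) m \<noteq> 0"
      using nz k by (auto simp: evo_def coeff_add)
    then show ?thesis using that by blast
  qed
  then show ?thesis
  proof cases
    case 1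
    then show ?thesis using time_flow_weight[OF g(1)] k by force
  next
    case 2
    obtain p q where pq: "m = p + q" "coeff ?b p \<noteq> 0" "coeff (var Vxi :: 'a sser) q \<noteq> 0"
      using 2 by (rule coeff_mult_nonzero)
    have "coeff (go (nat (k - 1))) p \<noteq> 0 \<or> coeff (ge (nat (k - 1))) p \<noteq> 0"
      using pq(2) by (auto simp: coeff_diff psign_def coeff_minus split: if_split_asm)
    then have "weight p = nat (k - 1) \<and> nat (k - 1) \<ge> 1"
      using time_flow_weight[OF g(1)] time_flow_weight[OF g(2)] by blast
    moreover have "q = {#Vxi#}" using pq(3) by (rule coeff_var_nonzero)
    ultimately show ?thesis using pq(1) by (auto simp: weight_def)
  qed
qed

lemma fil_evo:
  assumes g: "time_flow T ge" "time_flow T go" shows "fil 3 1 (evo ge go)"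
  by (rule filI) (drule coeff_evo_nonzero[OF g], auto)

lemma admissible_evo: "time_flow T ge \<Longrightarrow> time_flow T go \<Longrightarrow> admissible (evo ge go)"
  using fil_evo admissible_def by blast

lemma even_op_evo:
  assumes g: "time_flow T ge" "time_flow T go" shows "even_op (evo ge go)"
  unfolding even_op_def
proof
  fix k
  show "has_parity k (evo ge go k)"
  proof (cases "k \<le> 0")
    case False
    have "has_parity (k - 1 + 1) ((psign (k - 1) * go (nat (k - 1)) - ge (nat (k - 1))) * var Vxi)"
      using time_flow_parity[OF g(1), of "nat (k - 1)"] time_flow_parity[OF g(2), of "nat (k - 1)"] False
      by (intro has_parity_mult has_parity_diff has_parity_psign odd_var_has_parity) auto
    moreover have "has_parity k (ge (nat k))" using time_flow_parity[OF g(1), of "nat k"] False by simp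
    ultimately show ?thesis using False by (simp add: evo_def has_parity_add)
  qed (simp add: evo_def)
qed

lemma in_vars_evo:
  assumes g: "time_flow T ge" "time_flow T go" shows "in_vars (insert Vxi T) (evo ge go k)"
proof -
  have "in_vars (insert Vxi T) (ge n)" "in_vars (insert Vxi T) (go n)" for n
    using in_vars_mono[OF time_flow_in_vars[OF g(1)]] in_vars_mono[OF time_flow_in_vars[OF g(2)]] by blast+
  then show ?thesis
    by (auto simp: evo_def intro!: in_vars_add in_vars_mult in_vars_diff in_vars_psign)
qed

lemma time_flow_fock: "time_flow T g \<Longrightarrow> T \<inter> (range Vc \<union> range Vb) = {}"
  by (simp add: time_flow_def flow_def)

lemma scalar_evo:
  assumes g: "time_flow T ge" "time_flow T go" shows "scalar (evo ge go k)"
  unfolding scalar_def by (rule in_vars_mono[OF in_vars_evo[OF g]]) (use time_flow_fock[OF g(1)] in auto)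

section \<open>Growth of evolution operators and of their inverses\<close>

text \<open>The operator \<open>t\<^sub>1 \<xi> D\<^sup>2\<close> has order larger than its weight, so \<open>U\<close> is not in \<open>fil 1 0\<close>;
  giving \<open>x\<close> and \<open>\<xi>\<close> the weights 2 and 1 repairs this.\<close>

definition filx :: "int \<Rightarrow> 'a::supercomm_algebra sdop \<Rightarrow> bool"
  where "filx d P \<longleftrightarrow> (\<forall>n m. coeff (P n) m \<noteq> 0 \<longrightarrow> int (weight m) + xweight m - n \<ge> d)"

lemma coeff_D_nonzero_xweight:
  assumes "coeff (D_ser f) m \<noteq> 0"
  obtains p where "coeff f p \<noteq> 0" "weight p = weight m" "xweight p = xweight m + 1"
proof -
  have "coeff (dvar Vxi f) m \<noteq> 0 \<or> coeff (var Vxi * dvar Vx f) m \<noteq> 0"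
    using assms by (auto simp: D_ser_def coeff_add)
  then consider "coeff f (add_mset Vxi m) \<noteq> 0"
    | q where "m = {#Vxi#} + q" "coeff f (add_mset Vx q) \<noteq> 0"
    by (auto dest!: coeff_dvar_nonzero coeff_var_nonzero elim!: coeff_mult_nonzero)
  then show ?thesis by cases (auto intro!: that simp: weight_def xweight_def)
qed

lemma coeff_leib_nonzero_xweight:
  assumes "coeff (leib i r f) m \<noteq> 0"
  obtains p where "coeff f p \<noteq> 0" "weight p = weight m" "xweight p = xweight m + r" "r \<ge> 0"
proof -
  have r: "r \<ge> 0" using assms by (auto simp: leib_def split: if_split_asm)
  have D: "\<exists>p. coeff g p \<noteq> 0 \<and> weight p = weight m \<and> xweight p = xweight m + int n"
    if "coeff ((D_ser ^^ n) g) m \<noteq> 0" for n m and g :: "'a sser"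
    using that
  proof (induction n arbitrary: m)
    case (Suc n)
    then have "coeff (D_ser ((D_ser ^^ n) g)) m \<noteq> 0" by simp
    then obtain p where "coeff ((D_ser ^^ n) g) p \<noteq> 0" "weight p = weight m" "xweight p = xweight m + 1"
      by (rule coeff_D_nonzero_xweight)
    then show ?case using Suc.IH[of p] by force
  qed auto
  have "coeff ((D_ser ^^ nat r) (sign_twist (i - r) f)) m \<noteq> 0"
    using assms r by (auto simp: leib_def leibniz_def coeff_cscale)
  then show ?thesis using D[of "nat r" "sign_twist (i - r) f" m] r by (auto intro: that)
qed

lemma filx_mult:
  assumes P: "filx d P" and Q: "filx e Q" shows "filx (d + e) (P \<odot> Q)"
  unfolding filx_def
proof (intro allI impI)
  fix k m assume "coeff ((P \<odot> Q) k) m \<noteq> 0"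
  then obtain i n where "i + n \<ge> k" "coeff (P i * leibniz i (nat (i + n - k)) (Q n)) m \<noteq> 0"
    unfolding op_mult_def by (auto elim!: coeff_fsum_nonzero)
  then have "coeff (P i * leib i (i + n - k) (Q n)) m \<noteq> 0" by (simp add: leib_def)
  then obtain p q where pq: "m = p + q" "coeff (P i) p \<noteq> 0" "coeff (leib i (i + n - k) (Q n)) q \<noteq> 0"
    by (rule coeff_mult_nonzero)
  from pq(3) obtain r where r: "coeff (Q n) r \<noteq> 0" "weight r = weight q" "xweight r = xweight q + (i + n - k)"
    by (rule coeff_leib_nonzero_xweight)
  have "int (weight p) + xweight p - i \<ge> d" "int (weight r) + xweight r - n \<ge> e"
    using P Q pq(2) r(1) by (auto simp: filx_def)
  then show "int (weight m) + xweight m - k \<ge> d + e"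
    using r by (simp add: pq(1) weight_add xweight_add)
qed

lemma filx_evo:
  assumes g: "time_flow T ge" "time_flow T go" shows "filx 0 (evo ge go)"
  unfolding filx_def
proof (intro allI impI)
  fix n m assume "coeff (evo ge go n) m \<noteq> 0"
  from coeff_evo_nonzero[OF g this] show "int (weight m) + xweight m - n \<ge> 0"
    using xweight_nonneg[of m] by (auto simp: xweight_def simp flip: count_greater_zero_iff)
qed

lemma filx_minus: "filx d P \<Longrightarrow> filx d (\<lambda>n. - P n)"
  by (simp add: filx_def coeff_minus)

lemma filx_op_exp:
  assumes X: "filx 0 X" shows "filx 0 (op_exp X)"
proof -
  have "filx 0 (op_pow X j)" for j
  proof (induction j)
    case 0
    show ?case by (auto simp: filx_def D_pow_def coeff_one weight_def xweight_def split: if_split_asm)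
  next
    case (Suc j)
    then show ?case using filx_mult[OF X, of 0] by simp
  qed
  then show ?thesis
    unfolding filx_def op_exp_def by (auto elim!: coeff_fsum_nonzero dest!: coeff_cscale_nonzero)
qed

text \<open>Without x, and with \<xi> occurring at most once in a monomial, \<open>xweight\<close>
  is at most 1. So the modified filtration costs only a constant in the growth condition of
  \<open>Ehat\<close>.\<close>

lemma filx_Ehat:
  assumes P: "filx 0 P" and V: "\<And>n. in_vars (insert Vxi T) (P n)" and T: "Vx \<notin> T"
  shows "P \<in> Ehat T"
proof (rule EhatI)
  show "in_vars ({Vx, Vxi} \<union> T) (P n)" for n by (rule in_vars_mono[OF V]) auto
  show "fil 1 (- 1) P"
  proof (rule filI)
    fix n m assume nz: "coeff (P n) m \<noteq> 0"
    then have "valid_mono m" using coeff_invalid by blast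
    then have "count m Vxi \<le> 1" by (simp add: valid_mono_def)
    moreover have "count m Vx = 0" using in_varsD[OF V nz] T by (auto simp: not_in_iff[symmetric])
    moreover have "int (weight m) + xweight m - n \<ge> 0" using P nz by (simp add: filx_def)
    ultimately show "int 1 * int (weight m) - n \<ge> - 1" by (simp add: xweight_def)
  qed
qed

text \<open>Generic in the family A, so that the modes of C and of B share the arguments about
  exponentials and compositions. Triangularity is carried along because it makes the column sums
  finite.\<close>

definition evolves :: "(int \<Rightarrow> 'a::supercomm_algebra sser \<Rightarrow> 'a sser) \<Rightarrow> ('a sser \<Rightarrow> 'a sser) \<Rightarrow> 'a sdop \<Rightarrow> bool"
  where "evolves A \<Psi> P \<longleftrightarrow> admissible P \<and> (\<forall>k l. scalar (Xi P k l)) \<and> (\<forall>k l. l < k \<longrightarrow> Xi P k l = 0) \<and>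
    (\<forall>j f. \<Psi> (A j f) = fsum UNIV (\<lambda>l. A l (Xi P l j * \<Psi> f)))"

lemma scalar_Xi:
  assumes "\<And>n. scalar (P n)" shows "scalar (Xi P j k)"
proof -
  have "scalar ((D_pow j \<odot> P) k)"
    using assms unfolding scalar_def by (intro in_vars_op_mult in_vars_D_pow_op) auto
  then show ?thesis unfolding Xi_def by (rule scalar_kill)
qed

lemma scalar_op_exp: "(\<And>n. scalar (X n)) \<Longrightarrow> scalar (op_exp X n)"
  unfolding scalar_def by (rule in_vars_op_exp) auto

lemma Xi_op_exp_triangular:
  assumes X: "fil 3 1 X" and tri: "\<And>l k. k \<le> l \<Longrightarrow> Xi X l k = 0" and "k < l"
  shows "Xi (op_exp X) l k = 0"
proof -
  have Xa: "admissible X" by (rule fil_admissible[OF X(1)]) simp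
  show ?thesis by (simp add: Xi_op_exp[OF X] Xi_op_pow_triangular[OF Xa tri assms(3)])
qed

lemma evolves_exp:
  assumes g: "flow V ge" "flow V go" and A: "\<And>k. finitary (A k)"
    and As: "\<And>k a f. scalar a \<Longrightarrow> A k (a * f) = sign_twist (par k) a * A k f"
    and comm: "\<And>k f. current ge go (A k f) = A k (current ge go f) + fsum UNIV (\<lambda>l. A l (h l k * f))"
    and X: "fil 3 1 X" "\<And>n. scalar (X n)" "\<And>l k. Xi X l k = h l k" and tri: "\<And>l k. k \<le> l \<Longrightarrow> h l k = 0"
  shows "evolves A (cexp ge go) (op_exp X)"
  unfolding evolves_def
proof (intro conjI allI impI)
  show "admissible (op_exp X)" by (rule unipotent_admissible[OF unipotent_op_exp[OF X(1)]])
  show "scalar (Xi (op_exp X) k l)" for k l by (intro scalar_Xi scalar_op_exp X)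
  show "Xi (op_exp X) k l = 0" if "l < k" for k l
    by (rule Xi_op_exp_triangular[OF X(1) _ that]) (simp add: X(3) tri)
  show "cexp ge go (A j f) = fsum UNIV (\<lambda>l. A l (Xi (op_exp X) l j * cexp ge go f))" for j f
    by (rule cexp_mode_Xi[OF g A As _ X(1,2)]) (simp_all add: X(3) comm tri)
qed

lemma hmat_triangular: "k \<le> l \<Longrightarrow> hmat ge go l k = 0"
  by (simp add: hmat_def)

lemma evolves_cmode:
  assumes g: "time_flow T ge" "time_flow T go"
  shows "evolves cmode (cexp ge go) (op_exp (evo ge go))"
  by (rule evolves_exp[OF time_flow_flow[OF g(1)] time_flow_flow[OF g(2)] finitary_cmode cmode_scalar
        current_cmode[OF time_flow_flow[OF g(1)] time_flow_flow[OF g(2)]] fil_evo[OF g] scalar_evo[OF g]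
        Xi_evo[OF g admissible_evo[OF g]] hmat_triangular])

lemma evolves_bmode:
  assumes g: "time_flow T ge" "time_flow T go"
  shows "evolves bmode (cexp ge go) (op_exp (\<lambda>n. - op_adj (evo ge go) n))"
proof (rule evolves_exp[OF time_flow_flow[OF g(1)] time_flow_flow[OF g(2)] finitary_bmode bmode_scalar
        current_bmode[OF time_flow_flow[OF g(1)] time_flow_flow[OF g(2)]]])
  let ?X = "evo ge go"
  note X = even_op_evo[OF g] admissible_evo[OF g]
  show "fil 3 1 (\<lambda>n. - op_adj ?X n)" by (rule fil_minus[OF D_pow_op_adj(2)[OF X fil_evo[OF g]]])
  show "scalar (- op_adj ?X n)" for n
    unfolding op_adj_eq[OF X] scalar_def
    by (intro in_vars_minus in_vars_psign in_vars_op_mult in_vars_D_pow_op)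
      (rule scalar_evo[OF g, unfolded scalar_def], auto)
  show "Xi (\<lambda>n. - op_adj ?X n) l k = hmat_dual ge go l k" for l k
    unfolding Xi_def op_mult_minus_right[OF admissible_D_pow D_pow_op_adj(4)[OF X]] D_pow_op_adj(1)[OF X]
      hmat_dual_def Xi_evo[OF g X(2), symmetric] Xi_def
    by (simp add: finitary_uminus[OF finitary_kill] finitary_psign[OF finitary_kill])
  show "k \<le> l \<Longrightarrow> hmat_dual ge go l k = 0" for l k
    by (simp add: hmat_dual_def hmat_triangular)
qed

text \<open>The inner map acts first and produces the matrix of Q; the outer one then inserts the
  matrix of P to its left. Hence the order P Q agrees with the order of the maps.\<close>

lemma evolves_comp:
  assumes A: "\<And>k. finitary (A k)"
    and As: "\<And>k a f. scalar a \<Longrightarrow> A k (a * f) = sign_twist (par k) a * A k f"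
    and 1: "evolves A \<Psi> P" and 2: "evolves A \<Phi> Q"
    and \<Psi>: "finitary \<Psi>" "\<And>a f. scalar a \<Longrightarrow> \<Psi> (a * f) = a * \<Psi> f"
  shows "evolves A (\<lambda>f. \<Psi> (\<Phi> f)) (P \<odot> Q)"
proof -
  have P: "admissible P" "\<And>k l. scalar (Xi P k l)" "\<And>k l. l < k \<Longrightarrow> Xi P k l = 0"
    "\<And>j f. \<Psi> (A j f) = fsum UNIV (\<lambda>l. A l (Xi P l j * \<Psi> f))"
    and Q: "admissible Q" "\<And>k l. scalar (Xi Q k l)" "\<And>k l. l < k \<Longrightarrow> Xi Q k l = 0"
    "\<And>j f. \<Phi> (A j f) = fsum UNIV (\<lambda>l. A l (Xi Q l j * \<Phi> f))"
    using 1 2 by (simp_all add: evolves_def)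
  have PQ: "Xi (P \<odot> Q) k l = fsum UNIV (\<lambda>i. Xi P k i * Xi Q i l)" for k l
    by (rule Xi_mult[OF P(1) Q(1)])
  have sPQ: "scalar (Xi P k i * Xi Q i l)" for k i l by (intro scalar_mult P Q)
  obtain d e where d: "fil 3 d P" and e: "fil 3 e Q" using P(1) Q(1) by (auto simp: admissible_def)
  have tri: "Xi P k i * Xi Q i l = 0" if "l < k" for k i l
    using P(3)[of i k] Q(3)[of l i] that by (cases "i < k") auto
  have "\<Psi> (\<Phi> (A j f)) = fsum UNIV (\<lambda>l. A l (Xi (P \<odot> Q) l j * \<Psi> (\<Phi> f)))" for j f
  proof -
    have s1: "fsummable UNIV (\<lambda>i. Xi Q i j)"
    proof (rule fsummableI)
      fix m
      have "i \<in> {e + j - 3 * int (weight m) .. j}" if "coeff (Xi Q i j) m \<noteq> 0" for i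
        using coeff_Xi_bound[OF e that] Q(3)[of j i] that by (cases "j < i") auto
      then show "finite {i \<in> UNIV. coeff (Xi Q i j) m \<noteq> 0}"
        by - (rule finite_subset[of _ "{e + j - 3 * int (weight m) .. j}"], auto)
    qed
    have s2: "fsummable UNIV (\<lambda>(i, l). Xi P l i * Xi Q i j)"
    proof (rule fsummableI)
      fix m
      let ?w = "3 * int (weight m)"
      let ?B = "{e + j - ?w .. j} \<times> {d + e + j - ?w - ?w .. j}"
      have "(i, l) \<in> ?B" if nz: "coeff (Xi P l i * Xi Q i j) m \<noteq> 0" for i l
      proof -
        obtain p q where pq: "m = p + q" "coeff (Xi P l i) p \<noteq> 0" "coeff (Xi Q i j) q \<noteq> 0"
          using nz by (rule coeff_mult_nonzero)
        have "i \<le> j" "l \<le> i" using P(3)[of i l] Q(3)[of j i] pq by (cases "i \<le> j"; cases "l \<le> i"; simp)+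
        then show ?thesis
          using coeff_Xi_bound[OF d pq(2), simplified] coeff_Xi_bound[OF e pq(3), simplified]
            weight_le[OF pq(1)] by auto
      qed
      then show "finite {x \<in> UNIV. coeff (case x of (i, l) \<Rightarrow> Xi P l i * Xi Q i j) m \<noteq> 0}"
        by - (rule finite_subset[of _ ?B], auto)
    qed
    have s3: "fsummable UNIV (\<lambda>i. A i (Xi Q i j * \<Phi> f))"
      unfolding As[OF Q(2)] by (intro fsummable_mult_right fsummable_sign_twist s1)
    have s4: "fsummable UNIV (\<lambda>(i, l). A l (Xi P l i * Xi Q i j * \<Psi> (\<Phi> f)))"
      unfolding As[OF sPQ] split_def
      by (rule fsummable_mult_right, rule fsummable_sign_twist) (use s2 in \<open>simp add: split_def\<close>)
    have "\<Psi> (\<Phi> (A j f)) = fsum UNIV (\<lambda>i. fsum UNIV (\<lambda>l. A l (Xi P l i * Xi Q i j * \<Psi> (\<Phi> f))))"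
      unfolding Q(4) finitary_fsum[OF \<Psi>(1) s3] P(4) \<Psi>(2)[OF Q(2)] mult.assoc ..
    also have "\<dots> = fsum UNIV (\<lambda>l. fsum UNIV (\<lambda>i. A l (Xi P l i * Xi Q i j * \<Psi> (\<Phi> f))))"
      by (rule fsum_swap[OF s4])
    also have "\<dots> = fsum UNIV (\<lambda>l. A l (Xi (P \<odot> Q) l j * \<Psi> (\<Phi> f)))"
    proof (rule fsum_cong)
      fix l
      note s = fsummable_Xi_rows[OF P(1) Q(1), of l j]
      show "fsum UNIV (\<lambda>i. A l (Xi P l i * Xi Q i j * \<Psi> (\<Phi> f))) = A l (Xi (P \<odot> Q) l j * \<Psi> (\<Phi> f))"
        unfolding PQ finitary_fsum[OF finitary_mult_right s]
        by (rule finitary_fsum[OF A fsummable_mult_right[OF s], symmetric])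
    qed
    finally show ?thesis .
  qed
  moreover have "scalar (Xi (P \<odot> Q) k l)" for k l
    unfolding PQ by (intro in_vars_fsum_scalar sPQ)
  moreover have "Xi (P \<odot> Q) k l = 0" if "l < k" for k l
    unfolding PQ by (simp add: tri[OF that])
  ultimately show ?thesis
    unfolding evolves_def using admissible_mult[OF P(1) Q(1)] by blast
qed

section \<open>The three hierarchies\<close>

lemma admissible_coeff_op: "admissible (coeff_op f)"
proof -
  have "fil 3 0 (coeff_op f)" by (rule filI) (auto simp: coeff_op_def split: if_split_asm)
  then show ?thesis by (auto simp: admissible_def)
qed

lemma coeff_op_mult: "admissible Q \<Longrightarrow> coeff_op f \<odot> Q = (\<lambda>k. f * Q k)"
proof
  fix k assume Q: "admissible Q"
  have "(coeff_op f \<odot> Q) k = coeff_op f 0 * (D_pow 0 \<odot> Q) k"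
    unfolding op_mult_rows[OF admissible_coeff_op Q] by (rule fsum_single) (auto simp: coeff_op_def)
  then show "(coeff_op f \<odot> Q) k = f * Q k" by (simp add: coeff_op_def)
qed

lemma xi_op_mult: "admissible Q \<Longrightarrow> xi_op \<odot> Q = (\<lambda>k. var Vxi * Q k)"
  by (simp add: xi_op_def coeff_op_mult)

lemma admissible_xi_mult: "admissible Q \<Longrightarrow> admissible (\<lambda>k. var Vxi * Q k)"
  using admissible_mult[OF admissible_coeff_op, of Q "var Vxi"] by (simp add: coeff_op_mult)

lemma d_xi_eq: "d_xi = (\<lambda>k. D_pow 1 k - var Vxi * D_pow 2 k)"
  by (simp add: fun_eq_iff d_xi_def xi_op_mult admissible_D_pow)

lemma xi_mult_D_pow_mult:
  "admissible Q \<Longrightarrow> (\<lambda>k. var Vxi * D_pow i k) \<odot> Q = (\<lambda>k. var Vxi * (D_pow i \<odot> Q) k)"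
  using op_mult_assoc[OF admissible_coeff_op admissible_D_pow, of Q "var Vxi" i]
  by (simp add: coeff_op_mult admissible_D_pow admissible_mult)

lemma d_xi_mult:
  assumes "admissible Q"
  shows "d_xi \<odot> Q = (\<lambda>k. (D_pow 1 \<odot> Q) k - var Vxi * (D_pow 2 \<odot> Q) k)"
  unfolding d_xi_eq
  by (simp add: op_mult_diff_left admissible_D_pow admissible_xi_mult assms xi_mult_D_pow_mult)

lemma admissible_d_xi: "admissible d_xi"
  unfolding d_xi_eq by (intro admissible_diff admissible_D_pow admissible_xi_mult)

lemma d_xi_dx_pow: "d_xi \<odot> dx_pow n = (\<lambda>k. D_pow (2 * int n + 1) k - var Vxi * D_pow (2 * int n + 2) k)"
  by (simp add: dx_pow_def d_xi_mult admissible_D_pow D_pow_mult_D_pow add.commute)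

text \<open>The order-raising part of \<open>d_xi\<close> carries a factor \<xi> and dies by \<xi>^2
  = 0.\<close>

lemma xi_d_xi_dx_pow: "xi_op \<odot> d_xi \<odot> dx_pow n = (\<lambda>k. var Vxi * D_pow (2 * int n + 1) k)"
proof -
  have "xi_op \<odot> d_xi \<odot> dx_pow n = xi_op \<odot> (d_xi \<odot> dx_pow n)"
    unfolding xi_op_def dx_pow_def
    by (rule op_mult_assoc) (rule admissible_coeff_op admissible_d_xi admissible_D_pow)+
  also have "\<dots> = (\<lambda>k. var Vxi * (d_xi \<odot> dx_pow n) k)"
    by (rule xi_op_mult) (simp add: dx_pow_def admissible_mult admissible_d_xi admissible_D_pow)
  finally show ?thesis by (simp add: d_xi_dx_pow right_diff_distrib xi_square)
qed

lemma leib_xi: "leib j r (var Vxi) =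
    (if r = 0 then psign j * var Vxi else if r = 1 \<and> odd j then 1 else (0 :: 'a::supercomm_algebra sser))"
proof -
  have tw: "sign_twist k (var Vxi) = (psign k * var Vxi :: 'a sser)" for k
    using has_parity_sign_twist[of 1 "var Vxi :: 'a sser" k] odd_var_has_parity[of Vxi, where 'b = 'a]
    by simp
  consider "r < 0" | "r = 0" | "r = 1" | s where "r > 1" "nat r = Suc (Suc s)"
  proof -
    have "r > 1 \<Longrightarrow> nat r = Suc (Suc (nat (r - 2)))" by simp
    then show ?thesis using that by fastforce
  qed
  then show ?thesis
  proof cases
    case 3
    then show ?thesis
      by (simp add: leib_def leibniz_def tw finitary_psign[OF finitary_D] super_binom_def cscale_one)
  next
    case 4
    have "(D_ser ^^ Suc (Suc s)) (var Vxi) = (0 :: 'a sser)"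
      by (induction s) simp_all
    then show ?thesis using 4
      by (simp add: leib_def leibniz_def tw finitary_psign[OF finitary_funpow[OF finitary_D]]
          del: funpow.simps)
  qed (simp_all add: leib_def leibniz_def tw cscale_one)
qed

lemma d_xi_xi_dx_pow:
  "d_xi \<odot> xi_op \<odot> dx_pow n =
    (\<lambda>k. D_pow (2 * int n) k - var Vxi * D_pow (2 * int n + 1) k :: 'a::supercomm_algebra sser)"
proof -
  have "d_xi \<odot> xi_op = (\<lambda>k. D_pow 0 k - var Vxi * D_pow 1 k :: 'a sser)"
  proof
    fix k :: int
    consider "k = 0" | "k = 1" | "k = 2" | "k \<noteq> 0 \<and> k \<noteq> 1 \<and> k \<noteq> 2" by blast
    then show "(d_xi \<odot> xi_op) k = D_pow 0 k - var Vxi * D_pow 1 k"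
      unfolding xi_op_def d_xi_mult[OF admissible_coeff_op] D_pow_mult_coeff_op leib_xi
      by cases (auto simp: D_pow_def xi_square[of 1, simplified])
  qed
  then have "d_xi \<odot> xi_op \<odot> dx_pow n =
      (\<lambda>k. D_pow 0 k - var Vxi * D_pow 1 k :: 'a sser) \<odot> D_pow (2 * int n)"
    by (simp add: dx_pow_def)
  also have "\<dots> = (\<lambda>k. D_pow (2 * int n) k - var Vxi * D_pow (2 * int n + 1) k)"
    by (simp add: op_mult_diff_left admissible_D_pow admissible_xi_mult xi_mult_D_pow_mult
        D_pow_mult_D_pow add.commute)
  finally show ?thesis .
qed

lemma dx_pow_d_xi: "dx_pow n \<odot> d_xi =
  (\<lambda>k. D_pow (2 * int n + 1) k - var Vxi * D_pow (2 * int n + 2) k :: 'a::supercomm_algebra sser)"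
proof -
  have xi: "D_pow (2 * int n) \<odot> coeff_op (var Vxi) = (\<lambda>k. var Vxi * D_pow (2 * int n) k :: 'a sser)"
    unfolding fun_eq_iff D_pow_mult_coeff_op leib_xi by (auto simp: D_pow_def)
  have "dx_pow n \<odot> (\<lambda>k. var Vxi * D_pow 2 k :: 'a sser) = D_pow (2 * int n) \<odot> coeff_op (var Vxi) \<odot> D_pow 2"
    unfolding dx_pow_def coeff_op_mult[OF admissible_D_pow, symmetric]
    by (rule op_mult_assoc[symmetric]) (rule admissible_coeff_op admissible_D_pow)+
  also have "\<dots> = (\<lambda>k. var Vxi * D_pow (2 * int n + 2) k)"
    by (simp add: xi xi_mult_D_pow_mult admissible_D_pow D_pow_mult_D_pow)
  finally show ?thesis
    unfolding d_xi_eq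
    by (simp add: dx_pow_def op_mult_diff_right admissible_D_pow admissible_xi_mult D_pow_mult_D_pow)
qed

section \<open>Matching the time variables with the coefficients of currents and operators\<close>

definition select :: "(nat \<Rightarrow> bool) \<Rightarrow> (nat \<Rightarrow> svar) \<Rightarrow> nat \<Rightarrow> 'a::supercomm_algebra sser"
  where "select p v n = (if n \<ge> 1 \<and> p n then var (v n) else 0)"

lemma time_flow_signed:
  assumes T: "T \<inter> (range Vc \<union> range Vb) = {}" "Vx \<notin> T" "Vxi \<notin> T"
    and v: "\<And>n. n \<ge> 1 \<Longrightarrow> v n \<in> T" "\<And>n. var_weight (v n) = n" "\<And>n. odd_var (v n) = odd n"
    and g: "\<And>n. g n = psign (s n) * select p v n"
  shows "time_flow T g"
proof -
  have nz: "m = {#v n#} \<and> n \<ge> 1" if "coeff (g n) m \<noteq> 0" for n m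
    using that by (auto simp: g select_def psign_def coeff_minus dest!: coeff_var_nonzero split: if_split_asm)
  have w: "weight m = n" if "coeff (g n) m \<noteq> 0" for n m
    using nz[OF that] by (simp add: weight_def v)
  have "fsummable UNIV g"
  proof (rule fsummableI)
    fix m
    show "finite {n \<in> UNIV. coeff (g n) m \<noteq> 0}"
      by (rule finite_subset[of _ "{weight m}"]) (auto dest: w)
  qed
  moreover have "in_vars T (g n)" for n
    using v(1)[of n] by (auto simp: g select_def intro!: in_vars_psign)
  moreover have "has_parity (int n) (g n)" for n
  proof -
    have "has_parity (int n) (var (v n))"
      by (rule has_parity_cong[THEN iffD2, OF _ has_parity_var]) (simp add: mono_deg_single v)
    then show ?thesis by (auto simp: g select_def intro!: has_parity_psign)
  qed
  moreover have "vdeg T m \<ge> 1" if "coeff (g n) m \<noteq> 0" for n m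
    using nz[OF that] v(1)[of n] by (simp add: vdeg_def)
  moreover have "g 0 = 0" by (simp add: g select_def)
  ultimately show ?thesis using T w unfolding time_flow_def flow_def by blast
qed

lemma time_flow_select:
  assumes "T \<inter> (range Vc \<union> range Vb) = {}" "Vx \<notin> T" "Vxi \<notin> T"
    and "\<And>n. n \<ge> 1 \<Longrightarrow> v n \<in> T" "\<And>n. var_weight (v n) = n" "\<And>n. odd_var (v n) = odd n"
  shows "time_flow T (select p v)"
  using time_flow_signed[OF assms, of "select p v" "\<lambda>_. 0" p] by simp

lemma fsum_parity_split:
  fixes F :: "nat \<Rightarrow> 'a::supercomm_algebra sser"
  assumes "fsummable {1..} F"
  shows "fsum {1..} F = fsum UNIV (\<lambda>n. F (2 * n + 1)) + fsum {1..} (\<lambda>n. F (2 * n))"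
proof -
  have s: "fsummable {1..} (\<lambda>N. if P N then F N else 0)" for P
    by (rule fsummableI, rule finite_subset[OF _ fsummableD[OF assms]]) auto
  have 1: "bij_betw (\<lambda>n. 2 * n + 1) UNIV {N::nat \<in> {1..}. odd N}"
    by (rule bij_betw_byWitness[where f' = "\<lambda>n. n div 2"]) auto
  have 2: "bij_betw (\<lambda>n. 2 * n) {1..} {N::nat \<in> {1..}. even N}"
    by (rule bij_betw_byWitness[where f' = "\<lambda>n. n div 2"]) auto
  have "fsum {1..} F = fsum {1..} (\<lambda>N. (if odd N then F N else 0) + (if even N then F N else 0))"
    by (rule fsum_cong) simp
  also have "\<dots> = fsum {1..} (\<lambda>N. if odd N then F N else 0) + fsum {1..} (\<lambda>N. if even N then F N else 0)"
    by (rule fsum_add[OF s s])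
  also have "fsum {1..} (\<lambda>N. if odd N then F N else 0) = fsum {N \<in> {1..}. odd N} F"
    by (subst fsum_restrict[of "{N \<in> {1..}. odd N}" "{1..}"]) (auto intro!: fsum_cong)
  also have "\<dots> = fsum UNIV (\<lambda>n. F (2 * n + 1))" by (rule fsum_reindex[OF 1])
  also have "fsum {1..} (\<lambda>N. if even N then F N else 0) = fsum {N \<in> {1..}. even N} F"
    by (subst fsum_restrict[of "{N \<in> {1..}. even N}" "{1..}"]) (auto intro!: fsum_cong)
  also have "\<dots> = fsum {1..} (\<lambda>n. F (2 * n))" by (rule fsum_reindex[OF 2])
  finally show ?thesis .
qed

lemma current_split:
  assumes g: "flow V ge" "flow V go"
  shows "current ge go f =
    fsum UNIV (\<lambda>n. ge (2 * n + 1) * psi_plus n f + go (2 * n + 1) * psi_minus n f) +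
    fsum {1..} (\<lambda>n. ge (2 * n) * j_plus n f + go (2 * n) * j_minus n f)"
proof -
  have "int (2 * n + 1) = 2 * int n + 1" "int (2 * n) = 2 * int n" for n by simp_all
  then show ?thesis
    unfolding current_def fsum_parity_split[OF fsummable_current[OF g]]
    by (simp add: current_term_def cur_currents add.commute)
qed

lemma times_of_disjoint:
  "times_of h \<inter> (range Vc \<union> range Vb) = {}" "Vx \<notin> times_of h" "Vxi \<notin> times_of h"
  by (cases h; auto)+

lemma time_flow_select_times:
  "time_flow (times_of Maximal) (select p Vtp)" "time_flow (times_of Maximal) (select p Vtm)"
  "time_flow (times_of Maximal) (\<lambda>n. - select p Vtm n)"
  "time_flow (times_of Jacobian) (select p Vt)"
  "time_flow (times_of Manin_Radul) (select p Vt)"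
  "time_flow (times_of Manin_Radul) (\<lambda>n. psign (int n) * select p Vt n)"
proof -
  show "time_flow (times_of Maximal) (select p Vtp)"
    by (rule time_flow_select[OF times_of_disjoint]) auto
  show "time_flow (times_of Maximal) (select p Vtm)"
    by (rule time_flow_select[OF times_of_disjoint]) auto
  show "time_flow (times_of Maximal) (\<lambda>n. - select p Vtm n)"
    by (rule time_flow_signed[OF times_of_disjoint, where v = Vtm and s = "\<lambda>_. 1"]) auto
  show "time_flow (times_of Jacobian) (select p Vt)"
    by (rule time_flow_select[OF times_of_disjoint]) auto
  show "time_flow (times_of Manin_Radul) (select p Vt)"
    by (rule time_flow_select[OF times_of_disjoint]) auto
  show "time_flow (times_of Manin_Radul) (\<lambda>n. psign (int n) * select p Vt n)"
    by (rule time_flow_signed[OF times_of_disjoint, where v = Vt and s = int]) auto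
qed

text \<open>The sign patterns are those of the odd currents \<psi>^- in the three exponents: a minus
  sign for the maximal hierarchy, no such current for the Jacobian one, and a minus sign at odd
  times for Manin-Radul.\<close>

abbreviation "odd_plus \<equiv> select odd Vtp"
abbreviation "odd_minus \<equiv> \<lambda>n. - select odd Vtm n"
abbreviation "even_plus \<equiv> select even Vtp"
abbreviation "even_minus \<equiv> select even Vtm"
abbreviation "all_times \<equiv> select (\<lambda>_. True) Vt"
abbreviation "even_times \<equiv> select even Vt"
abbreviation "signed_times \<equiv> \<lambda>n. psign (int n) * select (\<lambda>_. True) Vt n"

lemma Phi_cexp:
  "Phi Maximal = (\<lambda>f. cexp odd_plus odd_minus (cexp even_plus even_minus f))"
  "Phi Jacobian = cexp all_times even_times"
  "Phi Manin_Radul = cexp all_times signed_times"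
proof -
  note f = time_flow_flow[OF time_flow_select_times(1)] time_flow_flow[OF time_flow_select_times(2)]
    time_flow_flow[OF time_flow_select_times(3)] time_flow_flow[OF time_flow_select_times(4)]
    time_flow_flow[OF time_flow_select_times(5)] time_flow_flow[OF time_flow_select_times(6)]
  show "Phi Maximal = (\<lambda>f. cexp odd_plus odd_minus (cexp even_plus even_minus f))"
    unfolding Phi.simps fun_eq_iff current_split[OF f(1,3), abs_def] current_split[OF f(1,2), abs_def]
    by (auto simp: select_def intro!: fsum_cong arg_cong2[where f = fock_exp])
  show "Phi Jacobian = cexp all_times even_times"
    unfolding Phi.simps fun_eq_iff current_split[OF f(4,4), abs_def]
    by (auto simp: select_def j_total_def distrib_left intro!: fsum_cong arg_cong2[where f = fock_exp]
        arg_cong2[where f = "(+)"])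
  show "Phi Manin_Radul = cexp all_times signed_times"
    unfolding Phi.simps fun_eq_iff current_split[OF f(5,6), abs_def]
    by (auto simp: select_def j_total_def distrib_left right_diff_distrib psign_def
        intro!: fsum_cong arg_cong2[where f = fock_exp] arg_cong2[where f = "(+)"])
qed

text \<open>For go = (-1)^n ge the two parts of the \<xi>-term in \<open>evo\<close> cancel, which
  leaves t_n D^n.\<close>

lemma H_MR_evo: "H_MR = (evo all_times signed_times :: 'a::supercomm_algebra sdop)"
proof
  fix k :: int
  show "H_MR k = evo all_times signed_times k"
  proof (cases "k \<le> 0")
    case True
    then show ?thesis by (auto simp: H_MR_def evo_def D_pow_def intro!: fsum_neutral)
  next
    case False
    have "H_MR k = var (Vt (nat k)) * D_pow (int (nat k)) k"
      unfolding H_MR_def by (rule fsum_single) (use False in \<open>auto simp: D_pow_def\<close>)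
    moreover have "psign (k - 1) * (psign (k - 1) * X) = (X :: 'a sser)" for X
      by (simp add: psign_def)
    moreover have "nat k \<ge> 1" using False by simp
    ultimately show ?thesis using False by (simp add: evo_def select_def D_pow_def)
  qed
qed

text \<open>Tailored to \<open>H_Jac\<close> and \<open>H_odd\<close>, whose n-th terms have the
  orders 2n + 1 and 2n + 2 only.\<close>

lemma fsum_two_orders:
  assumes "\<And>n. k \<noteq> 2 * int n + 1 \<Longrightarrow> k \<noteq> 2 * int n + 2 \<Longrightarrow> f n = 0"
  shows "fsum UNIV f = (if k \<le> 0 then 0 else f (nat ((k - 1) div 2)))"
proof (cases "k \<le> 0")
  case True
  have "f n = 0" for n by (rule assms) (use True in auto)
  then show ?thesis using True by (simp add: fsum_neutral)
next
  case False
  have "fsum UNIV f = f (nat ((k - 1) div 2))"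
    by (rule fsum_single) (use False in \<open>auto intro!: assms\<close>)
  then show ?thesis using False by simp
qed

lemma positive_cases:
  assumes "k > (0::int)"
  obtains n where "k = 2 * int n + 1" | n where "k = 2 * int n + 2"
proof (cases "even k")
  case True
  then have "k = 2 * int (nat (k div 2 - 1)) + 2" using assms by auto
  then show ?thesis using that by blast
next
  case False
  then have "k = 2 * (k div 2) + 1" by presburger
  then have "k = 2 * int (nat (k div 2)) + 1" using assms by simp
  then show ?thesis using that by blast
qed

text \<open>The \<xi>-part of \<open>d_xi\<close> puts -t_(2n+1) \<xi> at the order of t_(2n+2).
  This is \<open>evo\<close> with go absent at odd indices and equal to ge at even ones.\<close>

lemma H_Jac_evo: "H_Jac = (evo all_times even_times :: 'a::supercomm_algebra sdop)"
proof
  fix k :: int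
  define F :: "nat \<Rightarrow> 'a sser" where "F n = var (Vt (2 * (n + 1))) * dx_pow (n + 1) k +
    var (Vt (2 * n + 1)) * (dx_pow n \<odot> d_xi) k" for n
  have F: "F n = (if k = 2 * int n + 1 then var (Vt (nat k)) else
      if k = 2 * int n + 2 then var (Vt (nat k)) - var (Vt (nat (k - 1))) * var Vxi else 0)" for n
  proof -
    have "nat (2 * int n + 1) = 2 * n + 1" "nat (2 * int n + 2) = 2 * n + 2" by simp_all
    moreover have "nat (1 + 2 * int n) = 2 * n + 1" by simp
    ultimately show ?thesis
      unfolding F_def dx_pow_d_xi unfolding dx_pow_def by (simp add: D_pow_def)
  qed
  have "H_Jac k = (if k \<le> 0 then 0 else F (nat ((k - 1) div 2)))"
    unfolding H_Jac_def F_def[symmetric] by (rule fsum_two_orders) (simp add: F)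
  also have "\<dots> = evo all_times even_times k"
  proof (cases "k \<le> 0")
    case False
    then have "k > 0" by simp
    then show ?thesis
      by (cases rule: positive_cases)
        (auto simp: F evo_def select_def psign_def nat_add_distrib even_nat_iff)
  qed (simp add: evo_def)
  finally show "H_Jac k = (evo all_times even_times k :: 'a sser)" .
qed

lemma H_odd_evo: "H_odd = (evo odd_plus odd_minus :: 'a::supercomm_algebra sdop)"
proof
  fix k :: int
  define F :: "nat \<Rightarrow> 'a sser" where "F n = var (Vtp (2 * n + 1)) * (d_xi \<odot> dx_pow n) k +
    var (Vtm (2 * n + 1)) * (xi_op \<odot> dx_pow (n + 1)) k" for n
  have F: "F n = (if k = 2 * int n + 1 then var (Vtp (nat k)) else
      if k = 2 * int n + 2 then var (Vtm (nat (k - 1))) * var Vxi - var (Vtp (nat (k - 1))) * var Vxi else 0)" for n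
  proof -
    have "nat (2 * int n + 1) = 2 * n + 1" "nat (2 * int n + 2) = 2 * n + 2" by simp_all
    moreover have "nat (1 + 2 * int n) = 2 * n + 1" by simp
    moreover have "xi_op \<odot> dx_pow (n + 1) = (\<lambda>k. var Vxi * D_pow (2 * int n + 2) k :: 'a sser)"
      unfolding dx_pow_def xi_op_mult[OF admissible_D_pow] by (simp add: add.commute)
    ultimately show ?thesis
      unfolding F_def d_xi_dx_pow by (simp add: D_pow_def right_diff_distrib)
  qed
  have "H_odd k = (if k \<le> 0 then 0 else F (nat ((k - 1) div 2)))"
    unfolding H_odd_def F_def[symmetric] by (rule fsum_two_orders) (simp add: F)
  also have "\<dots> = evo odd_plus odd_minus k"
  proof (cases "k \<le> 0")
    case False
    then have "k > 0" by simp
    then show ?thesis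
      by (cases rule: positive_cases)
        (auto simp: F evo_def select_def psign_def nat_add_distrib even_nat_iff left_diff_distrib)
  qed (simp add: evo_def)
  finally show "H_odd k = (evo odd_plus odd_minus k :: 'a sser)" .
qed

text \<open>Here the n-th term has the orders 2n and 2n + 1, so the index is k div 2; order 1 would
  belong to n = 0, which the sum omits.\<close>

lemma H_even_evo: "H_even = (evo even_plus even_minus :: 'a::supercomm_algebra sdop)"
proof
  fix k :: int
  define F :: "nat \<Rightarrow> 'a sser" where "F n = var (Vtp (2 * n)) * (d_xi \<odot> xi_op \<odot> dx_pow n) k +
    var (Vtm (2 * n)) * (xi_op \<odot> d_xi \<odot> dx_pow n) k" for n
  have F: "F n = (if k = 2 * int n then var (Vtp (nat k)) else
      if k = 2 * int n + 1 then var (Vtm (nat (k - 1))) * var Vxi - var (Vtp (nat (k - 1))) * var Vxi else 0)" for n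
    by (auto simp: F_def d_xi_xi_dx_pow xi_d_xi_dx_pow D_pow_def nat_mult_distrib)
  have "H_even k = (if k \<le> 1 then 0 else F (nat (k div 2)))"
  proof (cases "k \<le> 1")
    case True
    then show ?thesis unfolding H_even_def F_def[symmetric] by (auto intro!: fsum_neutral simp: F)
  next
    case False
    then show ?thesis unfolding H_even_def F_def[symmetric]
      by (subst fsum_single[of "nat (k div 2)"]) (auto simp: F)
  qed
  also have "\<dots> = evo even_plus even_minus k"
  proof (cases "k \<le> 1")
    case True
    then show ?thesis by (cases "k = 1") (auto simp: evo_def select_def)
  next
    case False
    then have "k > 0" by simp
    then show ?thesis using False
      by (cases rule: positive_cases)
        (auto simp: F evo_def select_def psign_def nat_add_distrib even_nat_iff left_diff_distrib)
  qed
  finally show "H_even k = (evo even_plus even_minus k :: 'a sser)" .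
qed

text \<open>All that the rest of the proof uses about a hierarchy. V is the inverse of U, kept
  explicit because U is not in \<open>fil 1 0\<close>, so that \<open>op_inv_unipotent\<close>
  cannot supply it. The assumption \<open>initial\<close> will give \<tau> the constant term
  1.\<close>

locale evolution =
  fixes T :: "svar set" and \<Phi> :: "'a::supercomm_algebra sser \<Rightarrow> 'a sser" and U V :: "'a sdop"
  assumes times: "T \<inter> (range Vc \<union> range Vb) = {}" "Vx \<notin> T" "Vxi \<notin> T"
    and finitary: "finitary \<Phi>"
    and left: "scalar a \<Longrightarrow> \<Phi> (a * f) = a * \<Phi> f"
    and right: "scalar a \<Longrightarrow> \<Phi> (f * a) = \<Phi> f * a"
    and parity: "has_parity n f \<Longrightarrow> has_parity n (\<Phi> f)"
    and initial: "vdeg T m = 0 \<Longrightarrow> coeff (\<Phi> f) m = coeff f m"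
    and unipotent: "unipotent U"
    and inverse: "U \<odot> V = D_pow 0" "V \<odot> U = D_pow 0"
    and inverse_filx: "filx 0 V" and inverse_vars: "\<And>k. in_vars (insert Vxi T) (V k)"
    and inverse_even: "even_op V"
    and cmodes: "evolves cmode \<Phi> U" and bmodes: "evolves bmode \<Phi> (op_adj V)"
begin

lemma inverse_Ehat: "V \<in> Ehat T"
  by (rule filx_Ehat[OF inverse_filx inverse_vars times(2)])

lemma inverse_admissible: "admissible V"
  by (rule Ehat_admissible[OF inverse_Ehat])

lemma op_star_evolution: "op_star T U = op_adj V"
  unfolding op_star_def
  by (rule arg_cong[where f = op_adj])
    (rule op_inv_eqI[OF inverse_Ehat inverse unipotent_admissible[OF unipotent]])

end

lemma evolution_exp:
  assumes g: "time_flow T ge" "time_flow T go"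
  shows "evolution T (cexp ge go) (op_exp (evo ge go)) (op_exp (\<lambda>n. - evo ge go n))"
proof
  note f = time_flow_flow[OF g(1)] time_flow_flow[OF g(2)]
  let ?X = "evo ge go"
  note X = even_op_evo[OF g] fil_evo[OF g]
  show "T \<inter> (range Vc \<union> range Vb) = {}" "Vx \<notin> T" "Vxi \<notin> T"
    using g(1) by (auto simp: time_flow_def flow_def)
  show "finitary (cexp ge go)" by (rule finitary_cexp[OF f])
  show "scalar a \<Longrightarrow> cexp ge go (a * f) = a * cexp ge go f"
    "scalar a \<Longrightarrow> cexp ge go (f * a) = cexp ge go f * a" for a f
    by (rule cexp_scalar[OF f] cexp_right[OF f], assumption)+
  show "has_parity n f \<Longrightarrow> has_parity n (cexp ge go f)" for n f by (rule has_parity_cexp[OF f])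
  show "vdeg T m = 0 \<Longrightarrow> coeff (cexp ge go f) m = coeff f m" for m f by (rule coeff_cexp_vdeg_0[OF f])
  show "unipotent (op_exp ?X)" by (rule unipotent_op_exp[OF X(2)])
  show "op_exp ?X \<odot> op_exp (\<lambda>n. - ?X n) = D_pow 0" by (rule op_exp_mult_minus[OF X(2)])
  show "op_exp (\<lambda>n. - ?X n) \<odot> op_exp ?X = D_pow 0"
    using op_exp_mult_minus[OF fil_minus[OF X(2)]] by simp
  show "filx 0 (op_exp (\<lambda>n. - ?X n))" by (rule filx_op_exp[OF filx_minus[OF filx_evo[OF g]]])
  show "in_vars (insert Vxi T) (op_exp (\<lambda>n. - ?X n) k)" for k
    by (intro in_vars_op_exp in_vars_minus in_vars_evo[OF g]) simp
  show "even_op (op_exp (\<lambda>n. - ?X n))"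
    by (rule even_op_exp[OF fil_minus[OF X(2)] even_op_minus[OF X(1)]])
  show "evolves cmode (cexp ge go) (op_exp ?X)" by (rule evolves_cmode[OF g])
  have "op_adj (op_exp (\<lambda>n. - ?X n)) = op_exp (\<lambda>n. - op_adj ?X n)"
    by (simp add: op_adj_exp[OF even_op_minus[OF X(1)] fil_minus[OF X(2)]]
        op_adj_minus[OF X(1) admissible_evo[OF g]])
  then show "evolves bmode (cexp ge go) (op_adj (op_exp (\<lambda>n. - ?X n)))"
    using evolves_bmode[OF g] by simp
qed

lemma evolution_comp:
  assumes "evolution T \<Psi> P P'" "evolution T \<Phi> Q Q'"
  shows "evolution T (\<lambda>f. \<Psi> (\<Phi> f)) (P \<odot> Q) (Q' \<odot> P')"
proof -
  interpret P: evolution T \<Psi> P P' by fact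
  interpret Q: evolution T \<Phi> Q Q' by fact
  note adm = unipotent_admissible[OF P.unipotent] unipotent_admissible[OF Q.unipotent]
    P.inverse_admissible Q.inverse_admissible
  have cancel: "A \<odot> B \<odot> (B' \<odot> A') = D_pow 0"
    if "admissible A" "admissible B" "admissible A'" "admissible B'"
      "B \<odot> B' = D_pow 0" "A \<odot> A' = D_pow 0" for A B A' B' :: "'a sdop"
  proof -
    have "A \<odot> B \<odot> (B' \<odot> A') = A \<odot> (B \<odot> (B' \<odot> A'))"
      by (rule op_mult_assoc) (simp_all add: that admissible_mult)
    also have "B \<odot> (B' \<odot> A') = B \<odot> B' \<odot> A'" by (rule op_mult_assoc[symmetric]) (simp_all add: that)
    finally show ?thesis by (simp add: that)
  qed
  show ?thesis
  proof
    show "T \<inter> (range Vc \<union> range Vb) = {}" "Vx \<notin> T" "Vxi \<notin> T" by (rule P.times)+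
    show "finitary (\<lambda>f. \<Psi> (\<Phi> f))" by (rule finitary_comp[OF P.finitary Q.finitary])
    show "scalar a \<Longrightarrow> \<Psi> (\<Phi> (a * f)) = a * \<Psi> (\<Phi> f)" "scalar a \<Longrightarrow> \<Psi> (\<Phi> (f * a)) = \<Psi> (\<Phi> f) * a" for a f
      by (simp_all add: P.left Q.left P.right Q.right)
    show "has_parity n f \<Longrightarrow> has_parity n (\<Psi> (\<Phi> f))" for n f by (intro P.parity Q.parity)
    show "vdeg T m = 0 \<Longrightarrow> coeff (\<Psi> (\<Phi> f)) m = coeff f m" for m f by (simp add: P.initial Q.initial)
    show "unipotent (P \<odot> Q)" by (rule unipotent_mult[OF P.unipotent Q.unipotent])
    show "P \<odot> Q \<odot> (Q' \<odot> P') = D_pow 0" by (rule cancel) (rule adm P.inverse Q.inverse)+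
    show "Q' \<odot> P' \<odot> (P \<odot> Q) = D_pow 0" by (rule cancel) (rule adm P.inverse Q.inverse)+
    show "filx 0 (Q' \<odot> P')" using filx_mult[OF Q.inverse_filx P.inverse_filx] by simp
    show "in_vars (insert Vxi T) ((Q' \<odot> P') k)" for k
      by (intro in_vars_op_mult P.inverse_vars Q.inverse_vars) simp
    show "even_op (Q' \<odot> P')" by (intro even_op_mult P.inverse_even Q.inverse_even adm)
    show "evolves cmode (\<lambda>f. \<Psi> (\<Phi> f)) (P \<odot> Q)"
      by (rule evolves_comp[OF finitary_cmode cmode_scalar P.cmodes Q.cmodes P.finitary P.left])
    show "evolves bmode (\<lambda>f. \<Psi> (\<Phi> f)) (op_adj (Q' \<odot> P'))"
      unfolding op_adj_mult[OF Q.inverse_even adm(4) P.inverse_even adm(3)]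
      by (rule evolves_comp[OF finitary_bmode bmode_scalar P.bmodes Q.bmodes P.finitary P.left])
  qed
qed

lemma evolution_hierarchy: "\<exists>V. evolution (times_of h) (Phi h) (U_op h) V"
proof (cases h)
  case Maximal
  show ?thesis
    unfolding Maximal Phi_cexp U_op.simps H_odd_evo H_even_evo
    using evolution_comp[OF evolution_exp[OF time_flow_select_times(1,3)[of odd]]
        evolution_exp[OF time_flow_select_times(1,2)[of even]]] by blast
next
  case Jacobian
  show ?thesis
    unfolding Jacobian Phi_cexp U_op.simps H_Jac_evo
    using evolution_exp[OF time_flow_select_times(4)[of "\<lambda>_. True"] time_flow_select_times(4)[of even]]
    by blast
next
  case Manin_Radul
  show ?thesis
    unfolding Manin_Radul Phi_cexp U_op.simps H_MR_evo
    using evolution_exp[OF time_flow_select_times(5,6)[of "\<lambda>_. True"]] by blast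
qed

section \<open>Inverses of series\<close>

lemma coeff_power_nonzero:
  assumes "coeff a {#} = 0" "coeff (a ^ j) m \<noteq> 0"
  shows "j \<le> size m"
  using assms(2)
proof (induction j arbitrary: m)
  case (Suc j)
  then have "coeff (a * a ^ j) m \<noteq> 0" by simp
  then obtain p q where pq: "m = p + q" "coeff a p \<noteq> 0" "coeff (a ^ j) q \<noteq> 0"
    by (rule coeff_mult_nonzero)
  then have "p \<noteq> {#}" using assms(1) by auto
  then have "size p \<ge> 1" by (simp add: Suc_le_eq nonempty_has_size)
  then show ?case using Suc.IH[OF pq(3)] pq(1) by simp
qed simp

text \<open>The geometric series in 1 - f. As this has no constant term, its j-th power contains
  only monomials with at least j factors.\<close>

lemma sinverse:
  fixes f :: "'a::supercomm_algebra sser"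
  assumes "coeff f {#} = 1"
  shows "f * sinverse f = 1" "sinverse f * f = 1"
proof -
  define a where "a = 1 - f"
  define g where "g = fsum UNIV (\<lambda>j. a ^ j)"
  have a0: "coeff a {#} = 0" by (simp add: a_def coeff_diff coeff_one assms)
  have s: "fsummable UNIV (\<lambda>j. a ^ j)"
  proof (rule fsummableI)
    show "finite {j \<in> UNIV. coeff (a ^ j) m \<noteq> 0}" for m
      by (rule finite_subset[of _ "{..size m}"]) (auto dest: coeff_power_nonzero[OF a0])
  qed
  have "a * g = fsum UNIV (\<lambda>j. a * a ^ j)" "g * a = fsum UNIV (\<lambda>j. a ^ j * a)"
    unfolding g_def by (rule finitary_fsum[OF finitary_mult_left s] finitary_fsum[OF finitary_mult_right s])+
  moreover have "g = 1 + fsum UNIV (\<lambda>j. a * a ^ j)" unfolding g_def by (subst fsum_Suc[OF s]) simp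
  ultimately have "a * g = g - 1" "g * a = g - 1" by (simp_all add: power_commutes)
  then have g: "f * g = 1" "g * f = 1" by (auto simp: a_def algebra_simps)
  have "sinverse f = g"
    unfolding sinverse_def by (rule the_equality) (use g in \<open>auto, metis mult.assoc mult_1 mult_1_right\<close>)
  then show "f * sinverse f = 1" "sinverse f * f = 1" using g by simp_all
qed

lemma in_vars_coeff_empty: "in_vars {} f \<Longrightarrow> f = const (coeff f {#})"
  by (rule sser_eqI) (auto simp: const.rep_eq dest: in_varsD)

lemma kill_const_coeff:
  assumes "in_vars W f" shows "kill W f = const (coeff f {#})"
proof -
  have "in_vars {} (kill W f)"
    by (rule in_varsI) (use in_varsD[OF in_vars_kill'[OF assms]] in_varsD[OF in_vars_kill] in blast)
  from in_vars_coeff_empty[OF this] show ?thesis by (simp add: kill.rep_eq)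
qed

section \<open>Operators without negative powers\<close>

text \<open>For i \<ge> 0 the operator D^i f has no negative powers: beyond r = i the super-binomial
  vanishes, by parity or because the lower entry exceeds the upper one.\<close>

lemma leib_high:
  assumes "0 \<le> i" "i < r" shows "leib i r f = 0"
proof -
  have "super_binom i (nat r) = 0"
  proof (cases "odd (int (nat r) * (i - int (nat r)))")
    case False
    then have "even r \<or> even (i - r)" using assms by simp
    then have "r div 2 > i div 2" using assms by presburger
    then have "nat (i div 2) < nat r div 2" using assms by (simp add: nat_div_distrib[symmetric])
    moreover have "(of_int (i div 2) :: complex) = of_nat (nat (i div 2))" using assms by simp
    ultimately have "(of_int (i div 2) :: complex) gchoose (nat r div 2) = 0"
      by (simp only: binomial_gbinomial[symmetric]) simp
    then show ?thesis by (simp add: super_binom_def)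
  qed (simp add: super_binom_def)
  then show ?thesis by (simp add: leib_def leibniz_def)
qed

text \<open>If \<open>N\<close> is the negative part of \<open>A\<close> then \<open>N\<^sub>n = - (N (Y - 1))\<^sub>n\<close> for \<open>n < 0\<close>, and \<open>Y - 1\<close>
  raises the filtration.\<close>

lemma nonnegative_cancel:
  assumes A: "admissible A" and Y: "unipotent Y" "\<And>n. n < 0 \<Longrightarrow> Y n = 0"
    and AY: "\<And>n. n < 0 \<Longrightarrow> (A \<odot> Y) n = 0" and "n < 0"
  shows "A n = 0"
proof -
  define N where "N n = (if n < 0 then A n else 0)" for n
  obtain d where d: "fil 3 d A" using A by (rule admissibleE)
  have fN: "fil 3 d N" and fP: "fil 3 d (\<lambda>n. A n - N n)"
    by (rule filI; use filD3[OF d] in \<open>force simp: N_def split: if_split_asm\<close>)+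
  have adm: "admissible N" "admissible (\<lambda>n. A n - N n)" using fN fP by (auto simp: admissible_def)
  note Yadm = unipotent_admissible[OF Y(1)]
  define X where "X n = Y n - D_pow 0 n" for n
  have X: "fil 3 1 X" using Y(1) by (simp add: unipotent_def X_def[abs_def])
  have neg: "N n = - (N \<odot> X) n" if "n < 0" for n
  proof -
    have "((\<lambda>n. A n - N n) \<odot> Y) n = 0"
    proof -
      have "(A i - N i) * (D_pow i \<odot> Y) n = 0" for i
      proof (cases "i < 0")
        case False
        \<comment> \<open>Here i \<ge> 0 and n < 0. For m \<ge> 0 the number i + m - n of
          derivatives exceeds i, and for m < 0 the coefficient of Y is zero.\<close>
        have "leib i (i + m - n) (Y m) = 0" for m
          by (cases "m < 0") (use False that Y(2) leib_high[of i "i + m - n"] in \<open>auto simp: finitary_0[OF finitary_leib]\<close>)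
        then show ?thesis by (simp add: D_pow_mult)
      qed (simp add: N_def)
      then show ?thesis unfolding op_mult_rows[OF adm(2) Yadm] by simp
    qed
    moreover have "(A \<odot> Y) n - (N \<odot> Y) n = ((\<lambda>n. A n - N n) \<odot> Y) n"
      by (simp add: op_mult_diff_left[OF A adm(1) Yadm])
    moreover have "(N \<odot> X) n = (N \<odot> Y) n - N n"
      unfolding X_def[abs_def] by (simp add: op_mult_diff_right adm(1) Yadm admissible_D_pow)
    ultimately show ?thesis using AY[OF that] by simp
  qed
  \<comment> \<open>Each use of \<open>neg\<close> gains one step of the filtration, so N lies in
    all of its steps and must vanish.\<close>
  have "fil 3 (d + int j) N" for j
  proof (induction j)
    case (Suc j)
    have "fil 3 (d + int j + 1) (N \<odot> X)" by (rule fil_mult[OF Suc X])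
    then have "fil 3 (d + int (Suc j)) (N \<odot> X)" by (simp add: add.commute add.left_commute)
    then show ?case
      using neg by (intro filI) (force simp: N_def coeff_minus dest: filD3 split: if_split_asm)
  qed (simp add: fN)
  then have fil: "coeff (N n) m \<noteq> 0 \<Longrightarrow> d + int j \<le> 3 * int (weight m) - n" for j m
    by (rule filD3)
  have "coeff (N n) m = 0" for m
  proof (rule ccontr)
    assume "coeff (N n) m \<noteq> 0"
    from fil[OF this, of "nat (3 * int (weight m) - n - d + 1)"] show False by linarith
  qed
  then have "N n = 0" by (intro sser_eqI) simp
  then show ?thesis using \<open>n < 0\<close> by (simp add: N_def)
qed

lemma D_pow_mult_monic:
  assumes "R 0 = 1" "\<And>n. n > 0 \<Longrightarrow> R n = 0" "k \<ge> m"
  shows "(D_pow m \<odot> R) k = (if k = m then 1 else 0)"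
proof -
  have t: "leib m (m + n - k) (R n) = (if n = 0 \<and> k = m then 1 else 0)" for n
    by (cases "n > 0"; cases "n = 0")
      (use assms in \<open>auto simp: leib_const finitary_0[OF finitary_leib], auto simp: leib_def\<close>)
  have "(D_pow m \<odot> R) k = leib m (m + 0 - k) (R 0)"
    unfolding D_pow_mult by (rule fsum_single) (auto simp: t)
  also have "\<dots> = (if k = m then 1 else 0)" using t[of 0] by simp
  finally show ?thesis .
qed

text \<open>The form 1 + negative powers is encoded as \<open>fil 0 1\<close>, a condition on orders
  alone. Its stability under inversion gives the last two claims.\<close>

lemma Gamma_unipotent:
  assumes "S \<in> Gamma T"
  shows "fil 0 1 (\<lambda>n. S n - D_pow 0 n)" and "unipotent S"
    and "in_vars ({Vx, Vxi} \<union> T) (S n)" and "even_op S"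
    and "op_inv T S = op_inverse S"
    and "op_inverse S 0 = 1" and "n > 0 \<Longrightarrow> op_inverse S n = 0"
proof -
  have S: "S 0 = 1" "\<And>n. n > 0 \<Longrightarrow> S n = 0"
    "\<And>n. n < 0 \<Longrightarrow> in_vars ({Vx, Vxi} \<union> T) (S n)"
    "\<And>n. n < 0 \<Longrightarrow> if even n then is_even (S n) else is_odd (S n)"
    using assms by (auto simp: Gamma_def)
  have z: "S n - D_pow 0 n = 0" if "n \<ge> 0" for n
    using that S(1,2) by (cases "n = 0") (auto simp: D_pow_def)
  show f: "fil 0 1 (\<lambda>n. S n - D_pow 0 n)"
  proof (rule filI)
    fix n m assume "coeff (S n - D_pow 0 n) m \<noteq> 0"
    then have "n < 0" using z[of n] by force
    then show "int 0 * int (weight m) - n \<ge> 1" by simp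
  qed
  show u: "unipotent S" unfolding unipotent_def by (rule fil_mono[OF f]) auto
  show v: "in_vars ({Vx, Vxi} \<union> T) (S n)" for n
    by (rule linorder_cases[of n 0]) (use S(3)[of n] in \<open>simp_all add: S(1,2)\<close>)
  show "even_op S"
    unfolding even_op_def
  proof
    fix n :: int
    consider "n > 0" | "n = 0" | "n < 0" "even n" | "n < 0" "odd n" by linarith
    then show "has_parity n (S n)"
    proof cases
      case 3
      then show ?thesis using S(4)[of n] is_even_has_parity has_parity_cong[of n 0] by force
    next
      case 4
      then show ?thesis using S(4)[of n] is_odd_has_parity has_parity_cong[of n 1] by force
    qed (simp_all add: S(1,2))
  qed
  have "fil 1 0 (\<lambda>n. (S n - D_pow 0 n) + D_pow 0 n)"
    by (rule fil_add[OF fil_mono[OF f] fil_D_pow_0]) auto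
  then show "op_inv T S = op_inverse S" by (intro op_inv_unipotent[OF u _ v]) simp
  have i: "fil 0 1 (\<lambda>n. op_inverse S n - D_pow 0 n)" by (rule fil_op_inverse[OF u f]) simp
  have "op_inverse S n = D_pow 0 n" if "n \<ge> 0" for n
  proof -
    have "coeff (op_inverse S n - D_pow 0 n) m = 0" for m
      using filD[OF i, of n m] that by fastforce
    then have "op_inverse S n - D_pow 0 n = 0" by (intro sser_eqI) simp
    then show ?thesis by simp
  qed
  then show "op_inverse S 0 = 1" "n > 0 \<Longrightarrow> op_inverse S n = 0" by (auto simp: D_pow_def)
qed

section \<open>Uniqueness of the state\<close>

lemma const_0 [simp]: "const 0 = 0" and const_1 [simp]: "const 1 = 1"
  by (rule sser_eqI, simp add: const.rep_eq coeff_one)+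

lemma fsummable_C_modes:
  assumes "\<And>k. k > j \<Longrightarrow> f k = 0"
  shows "fsummable UNIV (\<lambda>k. C_mode k (f k))"
proof (rule fsummableI)
  fix m
  have "{k \<in> UNIV. coeff (C_mode k (f k)) m \<noteq> 0} \<subseteq> {1..j} \<union> (\<lambda>n. - int n) ` {n. Vc n \<in># m}"
  proof
    fix k assume k: "k \<in> {k \<in> UNIV. coeff (C_mode k (f k)) m \<noteq> 0}"
    show "k \<in> {1..j} \<union> (\<lambda>n. - int n) ` {n. Vc n \<in># m}"
    proof (cases "k \<le> 0")
      case True
      then have "Vc (nat (- k)) \<in># m" using k by (auto elim: coeff_C_mode_nonzero)
      then show ?thesis using True by (auto intro!: image_eqI[of _ _ "nat (- k)"])
    next
      case False
      then show ?thesis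
        using k assms[of k] by (cases "k > j") (auto simp: finitary_0[OF finitary_C_mode])
    qed
  qed
  moreover have "finite {n. Vc n \<in># m}"
    using finite_vimageI[of "set_mset m" Vc] by (simp add: inj_def vimage_def)
  ultimately show "finite {k \<in> UNIV. coeff (C_mode k (f k)) m \<noteq> 0}"
    by (meson finite_UnI finite_atLeastAtMost_int finite_imageI finite_subset)
qed

lemma vdeg_add_mset: "vdeg V (add_mset u m) = (if u \<in> V then 1 else 0) + vdeg V m"
  by (simp add: vdeg_def)

text \<open>Induction on the number of factors \<open>B\<^sub>-\<^sub>j\<close>, and for a fixed number on \<open>j\<close>: the \<open>j\<close>-th
  condition expresses \<open>C\<^sub>j w\<close> by the \<open>C\<^sub>k w\<close> with \<open>k < j\<close>.\<close>

lemma state_unique: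
  fixes w :: "'a::supercomm_algebra sser"
  assumes w: "\<And>m. vdeg B_vars m = 0 \<Longrightarrow> coeff w m = 0"
    and M: "\<And>j k. k \<ge> j \<Longrightarrow> M (- k) (- j) = (if k = j then 1 else 0)"
    and eq: "\<And>j. j > 0 \<Longrightarrow> fsum UNIV (\<lambda>k. C_mode k (const (M (- k) (- j)) * w)) = 0"
  shows "w = 0"
proof -
  have "coeff w m = 0" if "vdeg B_vars m = b" for b m
    using that
  proof (induction b arbitrary: m)
    case (Suc b)
    have step: "coeff (dvar (Vb j) w) \<mu> = 0" if "j \<ge> 1" "vdeg B_vars \<mu> = b" for j \<mu>
      using that(1)
    proof (induction j rule: less_induct)
      case (less j)
      have "coeff (C_mode k (const (M (- k) (- int j)) * w)) \<mu> = 0" if "k \<noteq> int j" for k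
      proof -
        consider "k \<le> 0" | "0 < k" "k < int j" | "k > int j" using \<open>k \<noteq> int j\<close> by linarith
        then show ?thesis
        proof cases
          case 1
          show ?thesis
          proof (rule ccontr)
            assume "\<not> ?thesis"
            then obtain p q where pq: "\<mu> = p + q" "coeff (var (Vc (nat (- k))) :: 'a sser) p \<noteq> 0"
              "coeff (const (M (- k) (- int j)) * w) q \<noteq> 0"
              using 1 by (auto simp: C_mode_def elim: coeff_mult_nonzero)
            have "p = {#Vc (nat (- k))#}" using pq(2) by (rule coeff_var_nonzero)
            \<comment> \<open>Multiplication by a creation mode of C does not change the number of
              factors B, so the outer induction hypothesis applies to the remaining factor.\<close>
            then have "vdeg B_vars q = b"
              using that(1) \<open>vdeg B_vars \<mu> = b\<close> pq(1) by (simp add: vdeg_add_mset B_vars_def image_iff)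
            then show False using Suc.IH pq(3) by (simp add: coeff_const_mult)
          qed
        next
          case 2
          then show ?thesis using less.IH[of "nat k"]
            by (simp add: C_mode_def dvar_const_mult sign_twist_const coeff_const_mult)
        next
          case 3
          then have "M (- k) (- int j) = 0" using M[of "int j" k] by simp
          then show ?thesis by (simp add: finitary_0[OF finitary_C_mode])
        qed
      qed
      then have "coeff (fsum UNIV (\<lambda>k. C_mode k (const (M (- k) (- int j)) * w))) \<mu> =
          (\<Sum>k\<in>{int j}. coeff (C_mode k (const (M (- k) (- int j)) * w)) \<mu>)"
        by (intro coeff_fsum) auto
      then show ?case
        using eq[of "int j"] M[of "int j" "int j"] less.prems by (simp add: C_mode_def)
    qed
    show ?case
    proof (cases "valid_mono m")
      case True
      from Suc.prems have "size {#u \<in># m. u \<in> B_vars#} \<noteq> 0" by (simp add: vdeg_def)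
      then obtain u where "u \<in># m" "u \<in> B_vars"
        by (metis (no_types, lifting) filter_mset_eq_conv multiset_nonemptyE nonempty_has_size not_gr_zero
            set_mset_filter mem_Collect_eq size_eq_0_iff_empty)
      then obtain j \<mu> where j: "m = add_mset (Vb j) \<mu>" "j \<ge> 1"
        by (auto simp: B_vars_def dest: multi_member_split)
      then have "vdeg B_vars \<mu> = b" using Suc.prems by (simp add: vdeg_add_mset B_vars_def)
      moreover have "valid_mono \<mu>" using True valid_mono_add[of "{#Vb j#}" \<mu>] by (simp add: j)
      ultimately show ?thesis
        using step[OF j(2)] coeff_dvar_eq_0_iff[of \<mu> "Vb j" w] by (simp add: j(1))
    qed (simp add: coeff_invalid)
  qed (rule w)
  then show ?thesis by (intro sser_eqI) simp
qed

text \<open>The entry M (-k) (-j) has parity j + k, so the j-th condition is homogeneous and the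
  grading involution maps v to another solution. The difference w is then subject to
  \<open>state_unique\<close>.\<close>

lemma state_even:
  assumes v: "is_state M v"
    and M: "\<And>j k. k \<ge> j \<Longrightarrow> M (- k) (- j) = (if k = j then 1 else 0)"
    and par: "\<And>j k. has_parity (j + k) (M j k)"
  shows "has_parity 0 (v :: 'a::supercomm_algebra sser)"
proof -
  define w where "w = v - sign_twist 1 v"
  have "w = 0"
  proof (rule state_unique[OF _ M])
    fix m assume m: "vdeg B_vars m = 0"
    show "coeff w m = 0"
    proof (cases "coeff v m = 0")
      case False
      \<comment> \<open>Equal numbers of factors C and B leave only the empty monomial here. Its
        coefficient in v is 1, which is even, so it drops out of w.\<close>
      have "{#u \<in># m. u \<in> B_vars#} = {#}" using m by (simp add: vdeg_def)
      moreover from this have "{#u \<in># m. u \<in> C_vars#} = {#}"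
        using v False unfolding is_state_def by (metis size_empty size_eq_0_iff_empty)
      moreover have "set_mset m \<subseteq> C_vars \<union> B_vars"
        using v False by (auto simp: is_state_def dest: in_varsD)
      ultimately have "m = {#}"
        by (metis (no_types, lifting) Un_iff mem_Collect_eq set_mset_empty empty_iff multiset_nonemptyE
            set_mset_filter subset_iff)
      moreover have "coeff v {#} = 1"
        using v fun_cong[OF bra10.rep_eq[of v], of "{#}"] by (simp add: is_state_def coeff_one)
      ultimately show ?thesis by (simp add: w_def coeff_diff coeff_sign_twist)
    qed (simp add: w_def coeff_diff)
  next
    fix j :: int assume j: "j > 0"
    let ?t = "\<lambda>k f. C_mode k (const (M (- k) (- j)) * f)"
    have sum: "fsummable UNIV (\<lambda>k. ?t k f)" for f :: "'a sser"
      using M[of j] by (intro fsummable_C_modes[of j]) auto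
    have tw: "sign_twist 1 (?t k f) = psign (j + 1) * ?t k (sign_twist 1 f)" for k and f :: "'a sser"
    proof -
      have C: "sign_twist 1 (C_mode k f) = psign (k + 1) * C_mode k (sign_twist 1 f)" for f :: "'a sser"
      proof (cases "k \<le> 0")
        case True
        then show ?thesis
          using has_parity_fock_var(1)[OF True, where 'a = 'a]
          by (simp add: C_mode_def sign_twist_mult has_parity_def mult.assoc)
      next
        case False
        have "psign (1 * vpar (Vb (nat k))) = (psign (k + 1) :: 'a sser)"
          by (rule psign_cong) (use False in \<open>simp add: even_nat_iff\<close>)
        then show ?thesis using False by (simp add: C_mode_def sign_twist_dvar)
      qed
      have "const (psign (- k + - j) * M (- k) (- j)) = (psign (k + j) * const (M (- k) (- j)) :: 'a sser)"
        by (rule sser_eqI) (auto simp: const.rep_eq psign_def coeff_minus)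
      then have "sign_twist 1 (const (M (- k) (- j))) = (psign (k + j) * const (M (- k) (- j)) :: 'a sser)"
        using par[of "- k" "- j"] by (simp add: sign_twist_const has_parity_def)
      then have "sign_twist 1 (?t k f) = psign (k + 1) * (psign (k + j) * ?t k (sign_twist 1 f))"
        by (simp add: C sign_twist_mult mult.assoc finitary_psign[OF finitary_C_mode])
      also have "\<dots> = psign (j + 1) * ?t k (sign_twist 1 f)"
        unfolding psign_mult' by (rule arg_cong2[where f = "(*)"]) (auto intro!: psign_cong)
      finally show ?thesis .
    qed
    have 0: "fsum UNIV (\<lambda>k. ?t k v) = 0" using v j by (simp add: is_state_def)
    have "0 = sign_twist 1 (fsum UNIV (\<lambda>k. ?t k v))" by (simp add: 0)
    also have "\<dots> = fsum UNIV (\<lambda>k. psign (j + 1) * ?t k (sign_twist 1 v))"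
      unfolding finitary_twist_fsum[OF sum] tw ..
    also have "\<dots> = psign (j + 1) * fsum UNIV (\<lambda>k. ?t k (sign_twist 1 v))"
      by (rule finitary_fsum[OF finitary_mult_left sum, symmetric])
    finally have "fsum UNIV (\<lambda>k. ?t k (sign_twist 1 v)) = 0"
      by (auto simp: psign_def split: if_split_asm)
    moreover have "?t k w = ?t k v - ?t k (sign_twist 1 v)" for k
      by (simp add: w_def right_diff_distrib finitary_diff[OF finitary_C_mode])
    ultimately show "fsum UNIV (\<lambda>k. ?t k w) = 0"
      using 0 by (simp add: fsum_diff[OF sum sum])
  qed
  then show ?thesis by (simp add: w_def has_parity_def)
qed

section \<open>Wave functions\<close>

lemma bra10_scalar: "scalar a \<Longrightarrow> bra10 (f * a) = bra10 f * a"
proof -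
  have "- (range Vc \<union> range Vb) \<inter> (C_vars \<union> B_vars) = {}" by (auto simp: C_vars_def B_vars_def)
  then show "scalar a \<Longrightarrow> bra10 (f * a) = bra10 f * a"
    using kill_id[of "- (range Vc \<union> range Vb)" a "C_vars \<union> B_vars"]
    by (simp add: bra10_kill kill_mult scalar_def)
qed

lemma translation_right: "scalar a \<Longrightarrow> translation (f * a) = translation f * a"
  unfolding translation_cexp by (rule cexp_right[OF flow_txi flow_txi])

lemma finitary_translation: "finitary translation"
  unfolding translation_cexp by (rule finitary_cexp[OF flow_txi flow_txi])

lemma cmode_right: "scalar a \<Longrightarrow> cmode k (f * a) = cmode k f * a"
  by (simp add: cmode_def C_mode_right)

lemma bmode_right: "scalar a \<Longrightarrow> bmode k (f * a) = bmode k f * a"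
  by (simp add: bmode_def B_mode_right mult.assoc)

lemma scalar_emat: "scalar (emat l k)"
  unfolding scalar_def by (rule in_vars_mono[OF in_vars_emat]) auto

lemma even_commutes: "has_parity 0 f \<Longrightarrow> a * f = f * (a :: 'a::supercomm_algebra)"
  using has_parity_commute[of 0 f a] by (simp add: sign_twist_even)

text \<open>As f is even, so are its images, and the matrix entries can be moved to their right and
  through the mode. The evolution contributes the matrix of P, the translation contributes
  \<open>emat\<close>, and \<open>eval_row_mult\<close> recombines the two.\<close>

lemma (in evolution) bra_modes:
  assumes A: "\<And>k. finitary (A k)" and Ar: "\<And>k a f. scalar a \<Longrightarrow> A k (f * a) = A k f * a"
    and ev: "evolves A \<Phi> P"
    and tr: "\<And>j f. translation (A j f) = fsum UNIV (\<lambda>l. A l (emat l j * translation f))"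
    and bra: "finitary bra" "\<And>a f. scalar a \<Longrightarrow> bra (f * a) = bra f * a"
    and f: "has_parity 0 f"
    and adm: "admissible (\<lambda>k. bra (A k (translation (\<Phi> f))))"
  shows "bra (translation (\<Phi> (A j f))) = eval_row ((\<lambda>k. bra (A k (translation (\<Phi> f)))) \<odot> P) j"
proof -
  have P: "admissible P" "\<And>k l. scalar (Xi P k l)" "\<And>k l. l < k \<Longrightarrow> Xi P k l = 0"
    using ev by (auto simp: evolves_def)
  have even: "has_parity 0 (\<Phi> f)" "has_parity 0 (translation (\<Phi> f))"
    unfolding translation_cexp by (intro has_parity_cexp[OF flow_txi flow_txi] parity f)+
  obtain d where d: "fil 3 d P" using P(1) by (rule admissibleE)
  have sXi: "fsummable UNIV (\<lambda>l. Xi P l j)"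
  proof (rule fsummableI)
    fix m
    show "finite {l \<in> UNIV. coeff (Xi P l j) m \<noteq> 0}"
    proof (rule finite_subset[of _ "{d + j - 3 * int (weight m)..j}"])
      show "{l \<in> UNIV. coeff (Xi P l j) m \<noteq> 0} \<subseteq> {d + j - 3 * int (weight m)..j}"
        using coeff_Xi_bound[OF d, of _ j m] P(3)[of j] by (force simp: not_less[symmetric])
    qed simp
  qed
  have "\<Phi> (A j f) = fsum UNIV (\<lambda>l. A l (Xi P l j * \<Phi> f))" using ev by (simp add: evolves_def)
  also have "\<dots> = fsum UNIV (\<lambda>l. A l (\<Phi> f) * Xi P l j)"
    by (rule fsum_cong) (simp add: even_commutes[OF even(1)] Ar P(2))
  finally have 1: "\<Phi> (A j f) = fsum UNIV (\<lambda>l. A l (\<Phi> f) * Xi P l j)" .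
  have 2: "bra (translation (A l (\<Phi> f))) = eval_row (\<lambda>k. bra (A k (translation (\<Phi> f)))) l" for l
  proof -
    have "translation (A l (\<Phi> f)) = fsum UNIV (\<lambda>m. A m (translation (\<Phi> f)) * emat m l)"
      unfolding tr by (rule fsum_cong) (simp add: even_commutes[OF even(2)] Ar scalar_emat)
    also have "bra \<dots> = fsum UNIV (\<lambda>m. bra (A m (translation (\<Phi> f)) * emat m l))"
      by (intro finitary_fsum bra fsummable_mult_left fsummable_emat')
    finally show ?thesis by (simp add: eval_row_def bra(2) scalar_emat)
  qed
  have "bra (translation (\<Phi> (A j f))) = fsum UNIV (\<lambda>l. bra (translation (A l (\<Phi> f) * Xi P l j)))"
    unfolding 1 by (intro finitary_fsum[OF finitary_comp[OF bra(1) finitary_translation]]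
        fsummable_mult_left sXi)
  also have "\<dots> = fsum UNIV (\<lambda>l. eval_row (\<lambda>k. bra (A k (translation (\<Phi> f)))) l * Xi P l j)"
    by (simp add: translation_right bra(2) P(2) 2)
  also have "\<dots> = eval_row ((\<lambda>k. bra (A k (translation (\<Phi> f)))) \<odot> P) j"
    by (rule eval_row_mult[OF adm P(1), symmetric])
  finally show ?thesis .
qed

locale grassmann = evolution T \<Phi> U V
  for T and \<Phi> :: "'a::supercomm_algebra sser \<Rightarrow> 'a sser" and U V +
  fixes S\<^sub>0 S :: "'a sdop" and v :: "'a sser"
  assumes S\<^sub>0: "S\<^sub>0 \<in> Gamma {}" and S: "S \<in> Gamma T"
    and equation: "\<And>n. n < 0 \<Longrightarrow> (S \<odot> U \<odot> op_inverse S\<^sub>0) n = 0"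
    and state: "is_state (Xi_matrix (op_inverse S\<^sub>0)) v"
begin

abbreviation "R\<^sub>0 \<equiv> op_inverse S\<^sub>0"
abbreviation "R \<equiv> op_inverse S"
abbreviation "G f \<equiv> translation (\<Phi> f)"
abbreviation "tau_inv \<equiv> sinverse (bra10 (G v))"

lemmas S\<^sub>0_unipotent = Gamma_unipotent[OF S\<^sub>0]
lemmas S_unipotent = Gamma_unipotent[OF S]

lemma admissibles: "admissible S" "admissible R" "admissible R\<^sub>0" "admissible U"
  using S\<^sub>0_unipotent(2) S_unipotent(2) unipotent
  by (auto intro: unipotent_admissible unipotent_op_inverse)

lemma monic: "m \<le> k \<Longrightarrow> (D_pow m \<odot> R\<^sub>0) k = (if k = m then 1 else 0)"
  "m \<le> k \<Longrightarrow> (D_pow m \<odot> R) k = (if k = m then 1 else 0)"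
  using D_pow_mult_monic[where R = R\<^sub>0] D_pow_mult_monic[where R = R]
    S\<^sub>0_unipotent(6,7) S_unipotent(6,7) by blast+

lemma v_even: "has_parity 0 v"
proof (rule state_even[OF state])
  show "Xi_matrix R\<^sub>0 (- k) (- j) = (if k = j then 1 else 0)" if "k \<ge> j" for j k
    using that monic(1)[of "- k" "- j"]
    by (auto simp: Xi_matrix_def coeff_one)
  show "has_parity (j + k) (Xi_matrix R\<^sub>0 j k)" for j k
    using has_parity_coeff[OF has_parity_D_pow_mult[OF even_op_inverse[OF S\<^sub>0_unipotent(2,4)] admissibles(3)],
        of j k "{#}"]
    by (simp add: Xi_matrix_def)
qed

text \<open>Every correction in the two exponentials contains x, \<xi> or a time, so \<tau> has the
  constant term of v, which is 1.\<close>

lemma tau_inverse: "tau_inv * bra10 (G v) = 1"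
proof (rule sinverse(2))
  have "coeff (bra10 (G v)) {#} = coeff (G v) {#}" by (simp add: bra10.rep_eq)
  also have "\<dots> = coeff v {#}"
    by (simp add: translation_cexp coeff_cexp_vdeg_0[OF flow_txi flow_txi] initial vdeg_def)
  also have "\<dots> = coeff (bra10 v) {#}" by (simp add: bra10.rep_eq)
  finally show "coeff (bra10 (G v)) {#} = 1" using state by (simp add: is_state_def coeff_one)
qed

lemma bra10_var: "u \<in> C_vars \<union> B_vars \<Longrightarrow> bra10 (var u * f) = 0"
  by (simp add: bra10_kill kill_mult kill_var)

text \<open>The coefficient, taken on the right, of the i-th creation mode of C applied to the
  vacuum, normalised by \<tau>. For i = 0 it is the functional \<open>bra00\<close> divided by
  \<tau>.\<close>

definition bra :: "nat \<Rightarrow> 'a sser \<Rightarrow> 'a sser"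
  where "bra i f = tau_inv * bra10 (dvar (Vc i) f)"

definition dual_bra :: "'a sser \<Rightarrow> 'a sser"
  where "dual_bra f = tau_inv * bra10 (C_mode 1 f)"

definition row :: "nat \<Rightarrow> 'a sdop"
  where "row i k = bra i (cmode k (G v))"

definition dual_row :: "'a sdop"
  where "dual_row k = dual_bra (bmode k (G v))"

lemma finitary_bra: "finitary (bra i)" and finitary_dual_bra: "finitary dual_bra"
  unfolding bra_def[abs_def] dual_bra_def[abs_def] bra10_kill
  by (intro finitary_comp[OF finitary_mult_left] finitary_comp[OF finitary_kill]
      finitary_dvar finitary_C_mode)+

lemma bra_right: "scalar a \<Longrightarrow> bra i (f * a) = bra i f * a"
  by (simp add: bra_def dvar_mult dvar_scalar bra10_scalar mult.assoc)

lemma dual_bra_right: "scalar a \<Longrightarrow> dual_bra (f * a) = dual_bra f * a"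
  by (simp add: dual_bra_def C_mode_right bra10_scalar mult.assoc)

text \<open>For k \<ge> 0 the mode multiplies by a creation variable. The vacuum functional kills
  the result unless the derivative of \<open>bra\<close> removes that very variable, and then \<tau>
  is left, cancelled by the normalisation.\<close>

lemma row_nonneg: "k \<ge> 0 \<Longrightarrow> row i k = (if k = int i then 1 else 0)"
proof -
  assume k: "k \<ge> 0"
  have "bra10 (swap_sign (Vc i) (Vc (nat k)) * (var (Vc (nat k)) * f)) = 0" for f :: "'a sser"
    by (simp add: bra10_kill kill_mult kill_var C_vars_def)
  moreover have "Vc i = Vc (nat k) \<longleftrightarrow> k = int i" using k by auto
  ultimately show ?thesis using k tau_inverse
    by (auto simp: row_def bra_def cmode_def C_mode_def dvar_var_mult bra10_kill
        finitary_add[OF finitary_kill])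
qed

lemma dual_row_nonneg: "k \<ge> 0 \<Longrightarrow> dual_row k = (if k = 0 then 1 else 0)"
proof -
  assume k: "k \<ge> 0"
  have "bra10 (swap_sign (Vb 1) (Vb (nat (k + 1))) * (var (Vb (nat (k + 1))) * f)) = 0" for f :: "'a sser"
    by (rule trans[OF arg_cong[where f = bra10, OF swap_sign_left_commute[symmetric]] bra10_var])
      (use k in \<open>auto simp: B_vars_def intro!: imageI\<close>)
  moreover have "Vb 1 = Vb (nat (k + 1)) \<longleftrightarrow> k = 0" using k by auto
  ultimately have "bra10 (C_mode 1 (B_mode (- k - 1) (G v))) = (if k = 0 then bra10 (G v) else 0)"
    using k by (auto simp: C_mode_def B_mode_def dvar_var_mult bra10_kill finitary_add[OF finitary_kill]
        add.commute)
  then show ?thesis using tau_inverse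
    by (auto simp: dual_row_def dual_bra_def bmode_def finitary_psign[OF finitary_C_mode] bra10_kill
        finitary_psign[OF finitary_kill])
qed

lemma admissible_row: "admissible (row i)" and admissible_dual_row: "admissible dual_row"
proof -
  have "fil 3 (- int i) (row i)"
  proof (rule filI)
    fix k m assume "coeff (row i k) m \<noteq> 0"
    then have "k \<le> int i" using row_nonneg[of k i] by (force split: if_split_asm)
    then show "int 3 * int (weight m) - k \<ge> - int i" by simp
  qed
  moreover have "fil 3 0 dual_row"
  proof (rule filI)
    fix k m assume "coeff (dual_row k) m \<noteq> 0"
    then have "k \<le> 0" using dual_row_nonneg[of k] by (force split: if_split_asm)
    then show "int 3 * int (weight m) - k \<ge> 0" by simp
  qed
  ultimately show "admissible (row i)" "admissible dual_row" by (auto simp: admissible_def)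
qed

lemma bra_cmode: "bra i (G (cmode j v)) = eval_row (row i \<odot> U) j"
  using bra_modes[OF finitary_cmode cmode_right cmodes translation_cmode finitary_bra bra_right v_even]
    admissible_row[of i]
  by (simp add: row_def[abs_def])

lemma dual_bra_bmode: "dual_bra (G (bmode j v)) = eval_row (dual_row \<odot> op_adj V) j"
  using bra_modes[OF finitary_bmode bmode_right bmodes translation_bmode finitary_dual_bra
      dual_bra_right v_even] admissible_dual_row
  by (simp add: dual_row_def[abs_def])

section \<open>The linear conditions on the row operators\<close>

lemma Xi_R\<^sub>0: "Xi R\<^sub>0 j k = const (Xi_matrix R\<^sub>0 j k)"
  unfolding Xi_def Xi_matrix_def
  by (rule kill_const_coeff, rule in_vars_op_mult, rule in_vars_D_pow_op, rule in_vars_op_inverse)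
    (use S\<^sub>0_unipotent(3) in auto)

text \<open>It suffices to test on the exponential. The coefficient of \<zeta>^k with k < 0 is the
  bra vector applied to G of the defining sum of v with j = - k, which is zero.\<close>

lemma row_equation:
  assumes "n < 0" shows "(row i \<odot> U \<odot> R\<^sub>0) n = 0"
proof (rule eval_row_negative[OF _ assms])
  fix k :: int assume k: "k < 0"
  let ?M = "Xi_matrix R\<^sub>0"
  have sc: "scalar (const a)" for a :: 'a by (simp add: scalar_def)
  define f where "f l = const (?M (- l) k) * v" for l
  have "f l = 0" if "l > - k" for l
    using monic(1)[of "- l" k] that by (simp add: f_def Xi_matrix_def)
  then have "fsummable UNIV (\<lambda>l. C_mode l (f l))" by (rule fsummable_C_modes)
  then have s: "fsummable UNIV (\<lambda>l. cmode l (f (- l)))"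
    using fsummable_uminus[of "\<lambda>l. C_mode l (f l)"] by (simp add: cmode_def)
  have "eval_row (row i \<odot> U \<odot> R\<^sub>0) k = fsum UNIV (\<lambda>l. eval_row (row i \<odot> U) l * Xi R\<^sub>0 l k)"
    by (intro eval_row_mult admissible_mult admissible_row admissibles)
  also have "\<dots> = fsum UNIV (\<lambda>l. bra i (G (cmode l (f (- l)))))"
    by (simp add: Xi_R\<^sub>0 bra_cmode[symmetric] f_def even_commutes[OF v_even] cmode_right right
        translation_right bra_right sc)
  also have "\<dots> = bra i (G (fsum UNIV (\<lambda>l. cmode l (f (- l)))))"
    by (intro finitary_fsum[OF finitary_comp[OF finitary_bra finitary_comp[OF finitary_translation finitary]],
          symmetric] s)
  also have "fsum UNIV (\<lambda>l. cmode l (f (- l))) = fsum UNIV (\<lambda>l. C_mode l (f l))"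
    using fsum_uminus[of "\<lambda>l. C_mode l (f l)"] by (simp add: cmode_def)
  also have "\<dots> = 0"
  proof -
    have "\<forall>j>0. fsum UNIV (\<lambda>l. C_mode l (const (?M (- l) (- j)) * v)) = 0"
      using state by (simp add: is_state_def)
    from this[rule_format, of "- k"] k show ?thesis by (simp add: f_def)
  qed
  finally show "eval_row (row i \<odot> U \<odot> R\<^sub>0) k = 0"
    by (simp add: finitary_0[OF finitary] finitary_0[OF finitary_translation] finitary_0[OF finitary_bra])
qed

lemma row_inverse:
  assumes "n < 0" shows "(row i \<odot> R) n = 0"
proof (rule nonnegative_cancel[OF _ _ equation _ assms])
  show "admissible (row i \<odot> R)" by (intro admissible_mult admissible_row admissibles)
  show "unipotent (S \<odot> U \<odot> R\<^sub>0)"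
    by (intro unipotent_mult unipotent_op_inverse S\<^sub>0_unipotent S_unipotent unipotent)
  fix n :: int assume n: "n < 0"
  \<comment> \<open>Inserting R S = 1 introduces the factor S U \<open>R\<^sub>0\<close>, which has
    no negative powers and can be cancelled on the right.\<close>
  have "row i \<odot> R \<odot> (S \<odot> U \<odot> R\<^sub>0) = row i \<odot> U \<odot> R\<^sub>0"
  proof -
    have "row i \<odot> R \<odot> (S \<odot> U \<odot> R\<^sub>0) = row i \<odot> R \<odot> (S \<odot> U) \<odot> R\<^sub>0"
      by (rule op_mult_assoc[symmetric]) (intro admissible_mult admissible_row admissibles)+
    also have "row i \<odot> R \<odot> (S \<odot> U) = row i \<odot> (R \<odot> (S \<odot> U))"
      by (rule op_mult_assoc) (intro admissible_mult admissible_row admissibles)+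
    also have "R \<odot> (S \<odot> U) = R \<odot> S \<odot> U"
      by (rule op_mult_assoc[symmetric]) (intro admissible_mult admissible_row admissibles)+
    finally show ?thesis by (simp add: op_inverse_left[OF S_unipotent(2)])
  qed
  then show "(row i \<odot> R \<odot> (S \<odot> U \<odot> R\<^sub>0)) n = 0" using row_equation[OF n] by simp
qed

text \<open>In orders n \<ge> -1 only two terms of the row are felt: D^i, and the D^(-1) term, which
  meets the leading coefficient 1 of D^(-1) R. Terms with l < -1 have too low an order.\<close>

lemma row_inverse_eq:
  assumes "n \<ge> - 1"
  shows "(row i \<odot> R) n = (D_pow (int i) \<odot> R) n + (if n = - 1 then row i (- 1) else 0)"
proof -
  have 0: "row i l * (D_pow l \<odot> R) n = 0" if "l \<noteq> int i" "l \<noteq> - 1" for l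
  proof (cases "l \<ge> 0")
    case True then show ?thesis using that row_nonneg[of l i] by simp
  next
    case False
    then show ?thesis using that assms monic(2)[of l n] by simp
  qed
  have "(row i \<odot> R) n = fsum UNIV (\<lambda>l. row i l * (D_pow l \<odot> R) n)"
    by (rule op_mult_rows[OF admissible_row admissibles(2)])
  also have "\<dots> = fsum {int i, - 1} (\<lambda>l. row i l * (D_pow l \<odot> R) n)"
    by (rule fsum_neutral_superset) (use 0 in auto)
  also have "\<dots> = (D_pow (int i) \<odot> R) n + row i (- 1) * (D_pow (- 1) \<odot> R) n"
    by (simp add: fsum_finite row_nonneg)
  finally show ?thesis using monic(2)[OF assms] by simp
qed

lemma row_0: "row 0 = S"
proof -
  have "row 0 \<odot> R = D_pow 0"
  proof
    fix n :: int
    show "(row 0 \<odot> R) n = D_pow 0 n"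
      using row_inverse[of n 0] row_inverse_eq[of n 0] monic(2)[of 0 n]
      by (cases "n < 0") (auto simp: D_pow_def)
  qed
  moreover have "row 0 = row 0 \<odot> (R \<odot> S)"
    by (simp add: op_inverse_left[OF S_unipotent(2)] admissible_row)
  moreover have "row 0 \<odot> (R \<odot> S) = row 0 \<odot> R \<odot> S"
    by (rule op_mult_assoc[symmetric]) (rule admissible_row admissibles)+
  ultimately show ?thesis by simp
qed

text \<open>For these indices the mode of B is, up to sign, the derivative by the i-th creation
  variable of C. It commutes with C_1, which is the derivative by an even variable, so both rows
  evaluate the same double derivative of G v.\<close>

lemma dual_row_negative:
  "dual_row (- int i - 1) = - (psign (eps (- int i - 1)) * row i (- 1))"
proof -
  let ?k = "- int i - 1"
  have "B_mode (int i) f = psign (int i) * dvar (Vc i) f" for f :: "'a sser"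
    by (simp add: B_mode_def psign_def)
  then have "bmode ?k (G v) = psign (?k * (?k - 1) div 2 + int i) * dvar (Vc i) (G v)"
    by (simp add: bmode_def)
  moreover have "C_mode 1 (dvar (Vc i) f) = dvar (Vc i) (C_mode 1 f)" for f :: "'a sser"
    using dvar_dvar[of "Vb 1" "Vc i" f] by (simp add: C_mode_def swap_sign_def)
  ultimately have "dual_row ?k = psign (?k * (?k - 1) div 2 + int i) * row i (- 1)"
    by (simp add: dual_row_def dual_bra_def row_def bra_def cmode_def finitary_psign[OF finitary_C_mode]
        bra10_kill finitary_psign[OF finitary_kill] psign_left_commute[of "sinverse _"])
  moreover have "even (?k * (?k - 1) div 2 + int i) \<longleftrightarrow> odd (eps ?k)"
  proof -
    have "?k * (?k - 1) = 2 * (int i + 1) + ?k * (?k + 1)" by (simp add: algebra_simps)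
    then have "?k * (?k - 1) div 2 = (int i + 1) + eps ?k" by (simp only: div_mult_self4)
    then show ?thesis by simp
  qed
  ultimately show ?thesis by (auto simp: psign_def)
qed

text \<open>For k \<ge> 0 both sides are determined by leading coefficients. For k < 0 the residue
  formula gives the coefficient of D^(-1) in D^i R, which the vanishing of (row i R) at order -1
  ties to the row coefficient at -1.\<close>

lemma dual_row_eq: "dual_row = op_star T S"
proof
  fix k :: int
  note E = op_adj_eq[OF even_op_inverse[OF S_unipotent(2,4)] admissibles(2)]
  show "dual_row k = op_star T S k"
  proof (cases "k \<ge> 0")
    case True
    then show ?thesis
      using monic(2)[of "- k - 1" "- 1"]
      by (auto simp: op_star_def S_unipotent(5) E dual_row_nonneg)
  next
    case False
    define i where "i = nat (- k - 1)"
    have k: "k = - int i - 1" using False by (simp add: i_def)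
    have "(D_pow (int i) \<odot> R) (- 1) = - row i (- 1)"
      using row_inverse[of "- 1" i] row_inverse_eq[of "- 1" i] by (simp add: eq_neg_iff_add_eq_0)
    then show ?thesis
      unfolding op_star_def S_unipotent(5) E k dual_row_negative by simp
  qed
qed

lemma theta: "scalar (var Vtheta)" "var Vtheta * v = v * var Vtheta"
  unfolding scalar_def by (rule in_vars_var, auto, rule even_commutes[OF v_even])

lemma wave_eq: "op_apply_exp 1 (S \<odot> U) k = tau_inv * bra00 (G (C_field k v))"
proof -
  have "C_field k v = cmode (2 * k) v + cmode (2 * k + 1) v * var Vtheta"
    by (simp add: C_field_def theta cmode_right[OF theta(1), symmetric]) (simp add: cmode_def)
  then have "bra 0 (G (C_field k v)) =
      bra 0 (G (cmode (2 * k) v)) + bra 0 (G (cmode (2 * k + 1) v)) * var Vtheta"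
    by (simp add: finitary_add[OF finitary] finitary_add[OF finitary_translation] finitary_add[OF finitary_bra]
        right theta translation_right bra_right)
  then show ?thesis
    by (simp add: bra_cmode row_0 op_apply_exp_eval cscale_one) (simp add: bra_def bra00_def)
qed

lemma dual_wave_eq:
  "op_apply_exp (- 1) (op_star T S \<odot> op_star T U) k = tau_inv * bra10 (C_mode 1 (G (B_field k v)))"
proof -
  \<comment> \<open>The sign (-1)^k comes from the normalisation of \<open>bmode\<close> at 2k and
    2k + 1 and matches (-z)^k. The minus sign arises from moving \<theta> past an odd vector and
    matches -\<theta> in the exponential.\<close>
  have "B_field k v = psign k * (bmode (2 * k) v - bmode (2 * k + 1) v * var Vtheta)"
  proof -
    have B: "bmode (2 * k) v = psign k * B_mode (- 2 * k - 1) v"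
      "bmode (2 * k + 1) v = psign k * B_mode (- 2 * k - 2) v"
    proof -
      have "2 * k * (2 * k - 1) div 2 = k * (2 * k - 1)" "(2 * k + 1) * (2 * k + 1 - 1) div 2 = (2 * k + 1) * k"
        by simp_all
      moreover have "psign (k * (2 * k - 1)) = (psign k :: 'a sser)" "psign ((2 * k + 1) * k) = (psign k :: 'a sser)"
        by (intro psign_cong; simp)+
      ultimately show "bmode (2 * k) v = psign k * B_mode (- 2 * k - 1) v"
        "bmode (2 * k + 1) v = psign k * B_mode (- 2 * k - 2) v"
        unfolding bmode_def
        by (simp_all only: arg_cong[where f = "\<lambda>m. B_mode m v", of "- (2 * k + 1) - 1" "- 2 * k - 2"])
          simp_all
    qed
    have "has_parity 1 (B_mode (- 2 * k - 2) v)"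
      using has_parity_B_mode[OF v_even, of "- 2 * k - 2"] has_parity_cong[of "0 + (- 2 * k - 2) + 1" 1] by auto
    moreover have "sign_twist 1 (var Vtheta) = (- var Vtheta :: 'a sser)"
      using odd_var_has_parity[of Vtheta, where 'b = 'a] by (simp add: has_parity_def)
    ultimately have "var Vtheta * B_mode (- 2 * k - 2) v = - (B_mode (- 2 * k - 2) v * var Vtheta)"
      using has_parity_commute[of 1 "B_mode (- 2 * k - 2) v" "var Vtheta"] by simp
    then show ?thesis by (simp add: B_field_def B mult.assoc right_diff_distrib)
  qed
  then have "dual_bra (G (B_field k v)) =
      psign k * (dual_bra (G (bmode (2 * k) v)) - dual_bra (G (bmode (2 * k + 1) v)) * var Vtheta)"
    by (simp add: finitary_diff[OF finitary] finitary_diff[OF finitary_translation]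
        finitary_diff[OF finitary_dual_bra] right theta translation_right dual_bra_right
        finitary_psign[OF finitary] finitary_psign[OF finitary_translation] finitary_psign[OF finitary_dual_bra])
  moreover have "(- 1) powi k = (psign k :: complex)"
    by (simp add: psign_def power_int_minus_one_minus)
  ultimately show ?thesis
    unfolding dual_bra_bmode dual_row_eq
    by (simp add: op_star_evolution op_apply_exp_eval cscale_neg_one dual_bra_def
        psign_cscale[where 'a = "'a sser"])
qed

end

theorem mainTheorem3:
  fixes S\<^sub>0 S :: "'a::supercomm_algebra sdop" and v :: "'a sser" and h :: hierarchy
  assumes "S\<^sub>0 \<in> Gamma {}"
    and "S \<in> Gamma (times_of h)"
    and "\<forall>n<0. (S \<odot> U_op h \<odot> op_inv {} S\<^sub>0) n = 0"
    and "is_state (Xi_matrix (op_inv {} S\<^sub>0)) v"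
  shows "(\<forall>k. wave h S k = sinverse (tau h v) * bra00 (translation (Phi h (C_field k v)))) \<and>
    (\<forall>k. dual_wave h S k =
      sinverse (tau h v) * bra10 (C_mode 1 (translation (Phi h (B_field k v)))))"
proof -
  obtain V where "evolution (times_of h) (Phi h) (U_op h :: 'a sdop) V"
    using evolution_hierarchy by blast
  then interpret evolution "times_of h" "Phi h" "U_op h" V .
  interpret grassmann "times_of h" "Phi h" "U_op h" V S\<^sub>0 S v
    using assms Gamma_unipotent(5)[OF assms(1)] by unfold_locales simp_all
  show ?thesis
    by (simp add: wave_def dual_wave_def tau_def wave_eq dual_wave_eq)
qed

end
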